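(* Let $A$ be a finite dimensional algebra over a field $k$ which is $g$-finite, $n:=|A|$, and $(h_0,\ldots,h_n)$ the $h$-vector of $\Delta(A)$. Then \[{\rm Ehr}_A(x)=\frac{\sum_{i=0}^nh_ix^i}{(1-x)^{n+1}};\] equivalently, for each $\ell\ge0$, $\#\mathrm{2\text{-}psilt}_\oplus^{\le\ell}A=\sum_{j=0}^n\binom{n+\ell-j}{n}h_j$.
   Context: $|X|$: number of isomorphism classes of indecomposable direct summands. A 2-term presilting complex is $T\in\mathsf{K}^{\rm b}(\operatorname{proj}A)$ concentrated in degrees $-1,0$ with $\operatorname{Hom}(T,T[\ell])=0$ for $\ell>0$; it is silting if also its thick closure is the whole category. $A$ is $g$-finite if there are finitely many isomorphism classes of basic 2-term silting complexes. $\mathrm{2\text{-}psilt}^jA$: isomorphism classes of basic 2-term presilting $T$ with $|T|=j$. $\Delta(A)$ is the simplicial complex whose $(j-1)$-simplices are the elements of $\mathrm{2\text{-}psilt}^jA$; $f_{-1}=1$, $f_{j-1}=\#\mathrm{2\text{-}psilt}^jA$, $h_j=\sum_{i=0}^j(-1)^{j-i}\binom{n-i}{j-i}f_{i-1}$. $\mathrm{2\text{-}psilt}_\oplus^{\le\ell}A$ is the set of isomorphism classes of (not necessarily basic) 2-term presilting complexes having at most $\ell$ indecomposable direct summands counted with multiplicity, and ${\rm Ehr}_A(x):=1+\sum_{\ell\ge1}\#(\mathrm{2\text{-}psilt}_\oplus^{\le\ell}A)x^\ell$. *)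

theory Defs
  imports "Jordan_Normal_Form.Matrix"
begin

text \<open>The algebra A is the ambient type 'a (a unital ring), made into a k-algebra
  by a scalar multiplication scale; finite dimensionality = finite spanning set.\<close>

definition fd_algebra :: "('k::field \<Rightarrow> 'a::ring_1 \<Rightarrow> 'a) \<Rightarrow> bool" where
  "fd_algebra scale \<longleftrightarrow>
     (\<forall>c x y. scale c (x + y) = scale c x + scale c y) \<and>
     (\<forall>c d x. scale (c + d) x = scale c x + scale d x) \<and>
     (\<forall>c d x. scale (c * d) x = scale c (scale d x)) \<and>
     (\<forall>x. scale 1 x = x) \<and>
     (\<forall>c x y. scale c (x * y) = scale c x * y) \<and>
     (\<forall>c x y. scale c (x * y) = x * scale c y) \<and>
     (\<exists>B. finite B \<and> (\<forall>x. \<exists>c. x = (\<Sum>b\<in>B. scale (c b) b)))"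

text \<open>A projective object is a pair (m, e) with e an idempotent m x m matrix over A;
  it stands for the module e A^m. Morphisms (m,e) -> (m',e') are matrices f with f = e' f e.\<close>

type_synonym 'a pobj = "nat \<times> 'a mat"

definition proj_obj :: "'a::ring_1 pobj \<Rightarrow> bool" where
  "proj_obj P \<longleftrightarrow> snd P \<in> carrier_mat (fst P) (fst P) \<and> snd P * snd P = snd P"

definition phom :: "'a::ring_1 pobj \<Rightarrow> 'a pobj \<Rightarrow> 'a mat set" where
  "phom P Q = {f. f \<in> carrier_mat (fst Q) (fst P) \<and> snd Q * f * snd P = f}"

type_synonym 'a cplx = "(int \<Rightarrow> 'a pobj) \<times> (int \<Rightarrow> 'a mat)"

definition cobj :: "'a cplx \<Rightarrow> int \<Rightarrow> 'a pobj" where "cobj X = fst X"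
definition cdif :: "'a cplx \<Rightarrow> int \<Rightarrow> 'a mat" where "cdif X = snd X"

definition is_complex :: "'a::ring_1 cplx \<Rightarrow> bool" where
  "is_complex X \<longleftrightarrow>
     (\<forall>i. proj_obj (cobj X i)) \<and>
     (\<forall>i. cdif X i \<in> phom (cobj X i) (cobj X (i + 1))) \<and>
     (\<forall>i. cdif X (i + 1) * cdif X i = 0\<^sub>m (fst (cobj X (i + 2))) (fst (cobj X i))) \<and>
     (\<exists>N::nat. \<forall>i. \<bar>i\<bar> > int N \<longrightarrow> snd (cobj X i) = 0\<^sub>m (fst (cobj X i)) (fst (cobj X i)))"

definition chain_map :: "'a::ring_1 cplx \<Rightarrow> 'a cplx \<Rightarrow> (int \<Rightarrow> 'a mat) \<Rightarrow> bool" where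
  "chain_map X Y f \<longleftrightarrow>
     (\<forall>i. f i \<in> phom (cobj X i) (cobj Y i)) \<and>
     (\<forall>i. cdif Y i * f i = f (i + 1) * cdif X i)"

definition null_homotopic :: "'a::ring_1 cplx \<Rightarrow> 'a cplx \<Rightarrow> (int \<Rightarrow> 'a mat) \<Rightarrow> bool" where
  "null_homotopic X Y f \<longleftrightarrow>
     (\<exists>h. (\<forall>i. h i \<in> phom (cobj X i) (cobj Y (i - 1))) \<and>
          (\<forall>i. f i = cdif Y (i - 1) * h i + h (i + 1) * cdif X i))"

definition id_cmap :: "'a::ring_1 cplx \<Rightarrow> int \<Rightarrow> 'a mat" where
  "id_cmap X i = snd (cobj X i)"

text \<open>Isomorphism in K^b(proj A) = homotopy equivalence.\<close>

definition htpy_equiv :: "'a::ring_1 cplx \<Rightarrow> 'a cplx \<Rightarrow> bool" (infix \<open>\<simeq>\<^sub>K\<close> 50) where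
  "X \<simeq>\<^sub>K Y \<longleftrightarrow> is_complex X \<and> is_complex Y \<and>
     (\<exists>f g. chain_map X Y f \<and> chain_map Y X g \<and>
        null_homotopic X X (\<lambda>i. g i * f i - id_cmap X i) \<and>
        null_homotopic Y Y (\<lambda>i. f i * g i - id_cmap Y i))"

definition zero_cplx :: "'a::ring_1 cplx" where
  "zero_cplx = ((\<lambda>i. (0, 0\<^sub>m 0 0)), (\<lambda>i. 0\<^sub>m 0 0))"

definition pobj_sum :: "'a::ring_1 pobj \<Rightarrow> 'a pobj \<Rightarrow> 'a pobj" where
  "pobj_sum P Q = (fst P + fst Q,
     four_block_mat (snd P) (0\<^sub>m (fst P) (fst Q)) (0\<^sub>m (fst Q) (fst P)) (snd Q))"

definition dsum :: "'a::ring_1 cplx \<Rightarrow> 'a cplx \<Rightarrow> 'a cplx" (infixr \<open>\<oplus>\<^sub>K\<close> 65) where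
  "X \<oplus>\<^sub>K Y = ((\<lambda>i. pobj_sum (cobj X i) (cobj Y i)),
     (\<lambda>i. four_block_mat (cdif X i) (0\<^sub>m (fst (cobj X (i + 1))) (fst (cobj Y i)))
                         (0\<^sub>m (fst (cobj Y (i + 1))) (fst (cobj X i))) (cdif Y i)))"

fun dsum_list :: "'a::ring_1 cplx list \<Rightarrow> 'a cplx" where
  "dsum_list [] = zero_cplx"
| "dsum_list (X # Xs) = X \<oplus>\<^sub>K dsum_list Xs"

definition shift :: "int \<Rightarrow> 'a::ring_1 cplx \<Rightarrow> 'a cplx" where
  "shift k X = ((\<lambda>i. cobj X (i + k)),
     (\<lambda>i. if even k then cdif X (i + k) else - cdif X (i + k)))"

definition cone :: "'a::ring_1 cplx \<Rightarrow> 'a cplx \<Rightarrow> (int \<Rightarrow> 'a mat) \<Rightarrow> 'a cplx" where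
  "cone X Y f = ((\<lambda>i. pobj_sum (cobj X (i + 1)) (cobj Y i)),
     (\<lambda>i. four_block_mat (- cdif X (i + 1)) (0\<^sub>m (fst (cobj X (i + 2))) (fst (cobj Y i)))
                         (f (i + 1)) (cdif Y i)))"

inductive_set thick :: "'a::ring_1 cplx set \<Rightarrow> 'a cplx set" for S where
  base: "X \<in> S \<Longrightarrow> is_complex X \<Longrightarrow> X \<in> thick S"
| zero: "zero_cplx \<in> thick S"
| iso: "X \<in> thick S \<Longrightarrow> X \<simeq>\<^sub>K Y \<Longrightarrow> Y \<in> thick S"
| shft: "X \<in> thick S \<Longrightarrow> shift k X \<in> thick S"
| cne: "X \<in> thick S \<Longrightarrow> Y \<in> thick S \<Longrightarrow> chain_map X Y f \<Longrightarrow> cone X Y f \<in> thick S"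
| summand: "X \<oplus>\<^sub>K Y \<in> thick S \<Longrightarrow> is_complex X \<Longrightarrow> is_complex Y \<Longrightarrow> X \<in> thick S"

definition indec :: "'a::ring_1 cplx \<Rightarrow> bool" where
  "indec X \<longleftrightarrow> is_complex X \<and> \<not> X \<simeq>\<^sub>K zero_cplx \<and>
     (\<forall>Y Z. is_complex Y \<longrightarrow> is_complex Z \<longrightarrow> X \<simeq>\<^sub>K Y \<oplus>\<^sub>K Z \<longrightarrow>
        Y \<simeq>\<^sub>K zero_cplx \<or> Z \<simeq>\<^sub>K zero_cplx)"

definition iso_class :: "'a::ring_1 cplx \<Rightarrow> 'a cplx set" where
  "iso_class X = {Y. Y \<simeq>\<^sub>K X}"

definition num_summands :: "'a::ring_1 cplx \<Rightarrow> nat" where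
  "num_summands X = card (iso_class ` {Y. indec Y \<and> (\<exists>Z. is_complex Z \<and> X \<simeq>\<^sub>K Y \<oplus>\<^sub>K Z)})"

definition basic :: "'a::ring_1 cplx \<Rightarrow> bool" where
  "basic X \<longleftrightarrow> (\<exists>Ts. X \<simeq>\<^sub>K dsum_list Ts \<and> (\<forall>Y\<in>set Ts. indec Y) \<and>
      (\<forall>i j. i < j \<longrightarrow> j < length Ts \<longrightarrow> \<not> Ts ! i \<simeq>\<^sub>K Ts ! j))"

definition two_term :: "'a::ring_1 cplx \<Rightarrow> bool" where
  "two_term X \<longleftrightarrow> is_complex X \<and>
     (\<forall>i. i \<noteq> -1 \<and> i \<noteq> 0 \<longrightarrow> snd (cobj X i) = 0\<^sub>m (fst (cobj X i)) (fst (cobj X i)))"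

definition presilting :: "'a::ring_1 cplx \<Rightarrow> bool" where
  "presilting T \<longleftrightarrow> is_complex T \<and>
     (\<forall>l::nat. l > 0 \<longrightarrow> (\<forall>f. chain_map T (shift (int l) T) f \<longrightarrow>
                               null_homotopic T (shift (int l) T) f))"

definition silting :: "'a::ring_1 cplx \<Rightarrow> bool" where
  "silting T \<longleftrightarrow> presilting T \<and> (\<forall>X. is_complex X \<longrightarrow> X \<in> thick {T})"

definition alg_cplx :: "'a::ring_1 cplx" where
  "alg_cplx = ((\<lambda>i. if i = 0 then (1, 1\<^sub>m 1) else (0, 0\<^sub>m 0 0)),
               (\<lambda>i. if i = 0 then 0\<^sub>m 0 1 else if i = -1 then 0\<^sub>m 1 0 else 0\<^sub>m 0 0))"

definition g_finite :: "'a::ring_1 itself \<Rightarrow> bool" where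
  "g_finite _ \<longleftrightarrow> finite (iso_class ` {T :: 'a cplx. two_term T \<and> silting T \<and> basic T})"

definition psilt_count :: "'a::ring_1 itself \<Rightarrow> nat \<Rightarrow> nat" where
  "psilt_count _ j = card (iso_class `
      {T :: 'a cplx. two_term T \<and> presilting T \<and> basic T \<and> num_summands T = j})"

text \<open>f_(i-1) of Delta(A), with f_(-1) = 1.\<close>

definition fvec :: "'a::ring_1 itself \<Rightarrow> nat \<Rightarrow> int" where
  "fvec a i = (if i = 0 then 1 else int (psilt_count a i))"

definition hvec :: "'a::ring_1 itself \<Rightarrow> nat \<Rightarrow> nat \<Rightarrow> int" where
  "hvec a n j = (\<Sum>i = 0..j. (-1) ^ (j - i) * int ((n - i) choose (j - i)) * fvec a i)"

definition psilt_oplus_le_count :: "'a::ring_1 itself \<Rightarrow> nat \<Rightarrow> nat" where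
  "psilt_oplus_le_count _ l = card (iso_class `
      {T :: 'a cplx. two_term T \<and> presilting T \<and>
         (\<exists>Ts. length Ts \<le> l \<and> (\<forall>Y\<in>set Ts. indec Y) \<and> T \<simeq>\<^sub>K dsum_list Ts)})"

end

theory Submission
  imports Defs "HOL-Library.Multiset"
begin

text \<open>
  By the Krull-Schmidt theorem in the homotopy category, two-term presilting complexes correspond to
  multisets of indecomposable two-term classes whose support is a face of \<open>\<Delta>(A)\<close>. A face with \<open>i\<close>
  vertices supports \<open>l choose i\<close> multisets of size at most \<open>l\<close>, so the counting function is
  \<open>\<Sum>i. f_(i-1) * (l choose i)\<close>, and repeated differences turn the \<open>f\<close>-vector into the \<open>h\<close>-vector.

  Two facts make the sum meaningful. There are finitely many vertices, since the Bongartz completion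
  places every presilting complex inside one of the finitely many silting ones. A face has at most
  \<open>n = |A|\<close> vertices: otherwise there is a linear relation between their \<open>g\<close>-vectors, that is, there
  are \<open>X\<close> and \<open>Y\<close> without common summands whose terms agree after adding contractible complexes, so
  that they are maps \<open>d, d' : P \<rightarrow> Q\<close>. Vanishing of extensions says that \<open>Hom(P, Q)\<close> is
  \<open>End(Q) d + d' End(P)\<close> and its three variants; comparing dimensions, \<open>coker d\<close> is generated by its
  image under endomorphisms of \<open>X\<close> factoring through \<open>Y\<close>. These are radical, hence \<open>d\<close> is a split
  surjection by Nakayama's lemma; likewise \<open>d'\<close>, and cancellation gives \<open>X \<simeq> Y\<close>.
\<close>

section \<open>Matrices with finite support\<close>

text \<open>The terms of a complex are projectives given by idempotent matrices, of sizes that vary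
  with the degree. Putting all degrees into one ring turns a complex into a pair of ring elements,
  and statements about sums, shifts, cones and homotopies into identities for rewriting. It also
  makes strict idempotent chain maps split at once: the idempotent itself is the new object. The
  obstacle is that decompositions in the homotopy category are idempotent only up to homotopy.
  Fitting's lemma, applied to the finite dimensional algebra of strict chain endomorphisms, replaces
  such a map by a strict idempotent. Krull-Schmidt is therefore proved for a category with a
  distinguished ideal of morphisms. The \<open>g\<close>-vector of a two-term complex is kept as two
  multisets of summands of \<open>A\<close>, one for each term, obtained by applying Krull-Schmidt
  to complexes concentrated in degree 0. A linear relation among \<open>g\<close>-vectors becomes an
  equality of multisets once its negative coefficients are moved to the other side.\<close>

text \<open>Rows and columns of all matrices occurring in a complex are indexed by pairs of a degree
  and a position. A separate datatype keeps quantifiers over indices from being split.\<close>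

datatype idx = Ix int nat

typedef (overloaded) 'a fm =
  "{f :: idx \<Rightarrow> idx \<Rightarrow> 'a::zero. finite {p. f (fst p) (snd p) \<noteq> 0}}"
  morphisms ent Abs_fm
  by (rule exI[of _ "\<lambda>_ _. 0"]) simp

lemma fm_eqI: "(\<And>u v. ent x u v = ent y u v) \<Longrightarrow> x = y"
  by (simp add: ent_inject[symmetric] fun_eq_iff)

definition fin_ent :: "(idx \<Rightarrow> idx \<Rightarrow> 'a::zero) \<Rightarrow> bool" where
  "fin_ent f \<longleftrightarrow> (\<exists>I. finite I \<and> (\<forall>u v. f u v \<noteq> 0 \<longrightarrow> u \<in> I \<and> v \<in> I))"

lemma fin_ent_iff: "fin_ent f \<longleftrightarrow> finite {p. f (fst p) (snd p) \<noteq> 0}"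
proof
  assume "fin_ent f"
  then obtain I where I: "finite I" "\<And>u v. f u v \<noteq> 0 \<Longrightarrow> u \<in> I \<and> v \<in> I"
    unfolding fin_ent_def by metis
  have "{p. f (fst p) (snd p) \<noteq> 0} \<subseteq> I \<times> I"
  proof
    fix p assume "p \<in> {p. f (fst p) (snd p) \<noteq> 0}"
    then have "f (fst p) (snd p) \<noteq> 0" by simp
    from I(2)[OF this] show "p \<in> I \<times> I" by (simp add: mem_Times_iff)
  qed
  then show "finite {p. f (fst p) (snd p) \<noteq> 0}"
    using I(1) finite_subset by blast
next
  assume *: "finite {p. f (fst p) (snd p) \<noteq> 0}"
  let ?P = "{p. f (fst p) (snd p) \<noteq> 0}"
  show "fin_ent f" unfolding fin_ent_def
  proof (intro exI[of _ "fst ` ?P \<union> snd ` ?P"] conjI allI impI)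
    show "finite (fst ` ?P \<union> snd ` ?P)" using * by simp
    fix u v assume "f u v \<noteq> 0"
    then have uv: "(u, v) \<in> ?P" by simp
    from uv show "u \<in> fst ` ?P \<union> snd ` ?P"
      by (intro UnI1 rev_image_eqI[of "(u, v)"]) simp_all
    from uv show "v \<in> fst ` ?P \<union> snd ` ?P"
      by (intro UnI2 rev_image_eqI[of "(u, v)"]) simp_all
  qed
qed

lemma ent_Abs_fm: "fin_ent f \<Longrightarrow> ent (Abs_fm f) = f"
  by (simp add: Abs_fm_inverse fin_ent_iff)

lemma fin_ent_ent: "fin_ent (ent x)"
  using ent[of x] by (simp add: fin_ent_iff)

lemma fin_entI: "finite I \<Longrightarrow> (\<And>u v. u \<notin> I \<or> v \<notin> I \<Longrightarrow> f u v = 0) \<Longrightarrow> fin_ent f"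
  unfolding fin_ent_def by blast

definition fm_in :: "idx set \<Rightarrow> 'a::zero fm \<Rightarrow> bool" where
  "fm_in I x \<longleftrightarrow> (\<forall>u v. u \<notin> I \<or> v \<notin> I \<longrightarrow> ent x u v = 0)"

lemma fm_inD: "fm_in I x \<Longrightarrow> u \<notin> I \<or> v \<notin> I \<Longrightarrow> ent x u v = 0"
  unfolding fm_in_def by blast

lemma fm_in_mono: "fm_in I x \<Longrightarrow> I \<subseteq> J \<Longrightarrow> fm_in J x"
  unfolding fm_in_def by blast

lemma ex_fm_in: "\<exists>I. finite I \<and> fm_in I x"
  using fin_ent_ent[of x] unfolding fin_ent_def fm_in_def by blast

lemma ex_fm_in2: "\<exists>I. finite I \<and> fm_in I x \<and> fm_in I y"
proof -
  obtain I J where "finite I" "fm_in I x" "finite J" "fm_in J y"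
    using ex_fm_in[of x] ex_fm_in[of y] by blast
  then show ?thesis
    by (intro exI[of _ "I \<union> J"]) (auto intro: fm_in_mono)
qed

lemma ex_fm_in3: "\<exists>I. finite I \<and> fm_in I x \<and> fm_in I y \<and> fm_in I z"
proof -
  obtain I J where "finite I" "fm_in I x" "finite J" "fm_in J y" "fm_in J z"
    using ex_fm_in[of x] ex_fm_in2[of y z] by blast
  then show ?thesis
    by (intro exI[of _ "I \<union> J"]) (auto intro: fm_in_mono)
qed

text \<open>The index set is infinite, so the identity matrix lacks finite support and the ring has
  no unit. Its idempotents serve as identities of objects: a morphism is an element absorbed by one
  idempotent on each side.\<close>

instantiation fm :: (ring) ring
begin

definition "0 = Abs_fm (\<lambda>_ _. 0 :: 'a)"
definition "x + y = Abs_fm (\<lambda>u v. ent x u v + ent y u v :: 'a)"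
definition "- x = Abs_fm (\<lambda>u v. - ent x u v :: 'a)"
definition "x - y = Abs_fm (\<lambda>u v. ent x u v - ent y u v :: 'a)"
definition "x * y = Abs_fm (\<lambda>u v. \<Sum>w | ent x u w \<noteq> 0. ent x u w * ent y w v :: 'a)"

lemma ent_zero [simp]: "ent (0 :: 'a fm) u v = 0"
  unfolding zero_fm_def by (simp add: ent_Abs_fm fin_entI[of "{}"])

lemma ent_add [simp]: "ent (x + y :: 'a fm) u v = ent x u v + ent y u v"
proof -
  obtain I where I: "finite I" "fm_in I x" "fm_in I y" using ex_fm_in2 by blast
  have "fin_ent (\<lambda>u v. ent x u v + ent y u v)"
    by (rule fin_entI[OF I(1)]) (simp add: fm_inD[OF I(2)] fm_inD[OF I(3)])
  then show ?thesis unfolding plus_fm_def by (simp add: ent_Abs_fm)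
qed

lemma ent_uminus [simp]: "ent (- x :: 'a fm) u v = - ent x u v"
proof -
  obtain I where I: "finite I" "fm_in I x" using ex_fm_in by blast
  have "fin_ent (\<lambda>u v. - ent x u v)"
    by (rule fin_entI[OF I(1)]) (simp add: fm_inD[OF I(2)])
  then show ?thesis unfolding uminus_fm_def by (simp add: ent_Abs_fm)
qed

lemma ent_diff [simp]: "ent (x - y :: 'a fm) u v = ent x u v - ent y u v"
proof -
  obtain I where I: "finite I" "fm_in I x" "fm_in I y" using ex_fm_in2 by blast
  have "fin_ent (\<lambda>u v. ent x u v - ent y u v)"
    by (rule fin_entI[OF I(1)]) (simp add: fm_inD[OF I(2)] fm_inD[OF I(3)])
  then show ?thesis unfolding minus_fm_def by (simp add: ent_Abs_fm)
qed

lemma ent_mult':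
  "ent (x * y :: 'a fm) u v = (\<Sum>w | ent x u w \<noteq> 0. ent x u w * ent y w v)"
proof -
  obtain I where I: "finite I" "fm_in I x" "fm_in I y" using ex_fm_in2 by blast
  have *: "(\<Sum>w | ent x u w \<noteq> 0. ent x u w * ent y w v) = 0" if "u \<notin> I \<or> v \<notin> I" for u v
    using that
  proof
    assume "u \<notin> I"
    then show ?thesis by (simp add: fm_inD[OF I(2)])
  next
    assume "v \<notin> I"
    then show ?thesis by (simp add: fm_inD[OF I(3)])
  qed
  have "fin_ent (\<lambda>u v. \<Sum>w | ent x u w \<noteq> 0. ent x u w * ent y w v)"
    by (rule fin_entI[OF I(1)]) (rule *)
  then show ?thesis unfolding times_fm_def by (simp add: ent_Abs_fm)
qed

lemma ent_mult:
  assumes "finite I" "\<And>w. w \<notin> I \<Longrightarrow> ent x u w = 0 \<or> ent y w v = 0"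
  shows "ent (x * y :: 'a fm) u v = (\<Sum>w\<in>I. ent x u w * ent y w v)"
proof -
  obtain J where J: "finite J" "fm_in J x" using ex_fm_in by blast
  have "{w. ent x u w \<noteq> 0} \<subseteq> J" using fm_inD[OF J(2)] by blast
  then have f: "finite {w. ent x u w \<noteq> 0}" using J(1) finite_subset by blast
  have "(\<Sum>w | ent x u w \<noteq> 0. ent x u w * ent y w v)
      = (\<Sum>w\<in>{w. ent x u w \<noteq> 0} \<union> I. ent x u w * ent y w v)"
    by (rule sum.mono_neutral_left) (use f assms in auto)
  also have "\<dots> = (\<Sum>w\<in>I. ent x u w * ent y w v)"
  proof (rule sum.mono_neutral_right)
    show "\<forall>w\<in>{w. ent x u w \<noteq> 0} \<union> I - I. ent x u w * ent y w v = 0"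
      using assms(2) by fastforce
  qed (use f assms(1) in auto)
  finally show ?thesis unfolding ent_mult' .
qed

lemma ent_mult_in:
  "finite I \<Longrightarrow> fm_in I x \<Longrightarrow> ent (x * y :: 'a fm) u v = (\<Sum>w\<in>I. ent x u w * ent y w v)"
  by (rule ent_mult) (auto simp: fm_in_def)

lemma fm_in_mult:
  assumes "fm_in I x" "fm_in I y" shows "fm_in I (x * y :: 'a fm)"
proof -
  obtain J where J: "finite J" "fm_in J x" using ex_fm_in by blast
  have "ent (x * y) u v = 0" if "u \<notin> I \<or> v \<notin> I" for u v
    using that by (auto simp: ent_mult_in[OF J] fm_inD[OF assms(1)] fm_inD[OF assms(2)])
  then show ?thesis unfolding fm_in_def by blast
qed

instance
proof
  fix x y z :: "'a fm"
  show "x + y + z = x + (y + z)" "x + y = y + x" "0 + x = x" "- x + x = 0" "x - y = x + - y"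
    by (rule fm_eqI, simp add: algebra_simps)+
  obtain I where I: "finite I" "fm_in I x" "fm_in I y" "fm_in I z"
    using ex_fm_in3 by blast
  have xy: "fm_in I (x + y)"
    unfolding fm_in_def by (simp add: fm_inD[OF I(2)] fm_inD[OF I(3)])
  have mxy: "fm_in I (x * y)" using I by (intro fm_in_mult)
  show "(x + y) * z = x * z + y * z"
    by (rule fm_eqI) (simp add: ent_mult_in[OF I(1)] I xy distrib_right sum.distrib)
  show "x * (y + z) = x * y + x * z"
    by (rule fm_eqI) (simp add: ent_mult_in[OF I(1)] I xy distrib_left sum.distrib)
  show "x * y * z = x * (y * z)"
  proof (rule fm_eqI)
    fix u v
    have "ent (x * y * z) u v = (\<Sum>w\<in>I. \<Sum>w'\<in>I. ent x u w' * ent y w' w * ent z w v)"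
      by (simp add: ent_mult_in[OF I(1)] I mxy sum_distrib_right)
    also have "\<dots> = (\<Sum>w'\<in>I. \<Sum>w\<in>I. ent x u w' * ent y w' w * ent z w v)"
      by (rule sum.swap)
    also have "\<dots> = ent (x * (y * z)) u v"
      by (simp add: ent_mult_in[OF I(1)] I sum_distrib_left mult.assoc)
    finally show "ent (x * y * z) u v = ent (x * (y * z)) u v" .
  qed
qed

end

text \<open>Rows index the target, so a homogeneous matrix of degree \<open>k\<close> maps degree
  \<open>j\<close> to degree \<open>j + k\<close>. Chain maps have degree 0, differentials degree 1
  and homotopies degree -1.\<close>

definition dg :: "int \<Rightarrow> 'a::zero fm \<Rightarrow> bool" where
  "dg k x \<longleftrightarrow> (\<forall>i a j b. ent x (Ix i a) (Ix j b) \<noteq> 0 \<longrightarrow> i = j + k)"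

lemma dgD: "dg k x \<Longrightarrow> i \<noteq> j + k \<Longrightarrow> ent x (Ix i a) (Ix j b) = 0"
  unfolding dg_def by blast

lemma dg_zero [simp]: "dg k (0 :: 'a::ring fm)"
  by (simp add: dg_def)

lemma dg_add: "dg k x \<Longrightarrow> dg k y \<Longrightarrow> dg k (x + y :: 'a::ring fm)"
  unfolding dg_def by (metis add.right_neutral ent_add)

lemma dg_uminus: "dg k x \<Longrightarrow> dg k (- x :: 'a::ring fm)"
  unfolding dg_def by simp

lemma dg_diff: "dg k x \<Longrightarrow> dg k y \<Longrightarrow> dg k (x - y :: 'a::ring fm)"
  using dg_add[of k x "- y"] dg_uminus[of k y] by simp

lemma dg_mult:
  assumes "dg k x" "dg l y" shows "dg (k + l) (x * y :: 'a::ring fm)"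
  unfolding dg_def
proof (intro allI impI)
  fix i a j b assume nz: "ent (x * y) (Ix i a) (Ix j b) \<noteq> 0"
  obtain I where I: "finite I" "fm_in I x" using ex_fm_in by blast
  from nz obtain w where "ent x (Ix i a) w * ent y w (Ix j b) \<noteq> 0"
    unfolding ent_mult_in[OF I] by (metis (no_types, lifting) sum.neutral)
  then have "ent x (Ix i a) w \<noteq> 0" "ent y w (Ix j b) \<noteq> 0" by auto
  then show "i = j + (k + l)"
    using assms unfolding dg_def by (cases w) (metis add.assoc add.commute)
qed

lemma dg_mult_0l: "dg 0 x \<Longrightarrow> dg l y \<Longrightarrow> dg l (x * y :: 'a::ring fm)"
  and dg_mult_0r: "dg l x \<Longrightarrow> dg 0 y \<Longrightarrow> dg l (x * y :: 'a::ring fm)"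
  using dg_mult[of 0 x l y] dg_mult[of l x 0 y] by auto

text \<open>The Koszul sign: multiplication by the \<open>k\<close>-th power of -1.\<close>

definition sg :: "int \<Rightarrow> 'b::ring \<Rightarrow> 'b" where
  "sg k x = (if even k then x else - x)"

lemma sg_add: "sg k (x + y) = sg k x + sg k y"
  and sg_uminus: "sg k (- x) = - sg k x"
  and sg_mult_left: "sg k x * y = sg k (x * y)"
  and sg_mult_right: "x * sg k y = sg k (x * y)"
  and sg_sg: "sg k (sg l x) = sg (k + l) x"
  and sg_0 [simp]: "sg 0 x = x"
  and sg_1 [simp]: "sg 1 x = - x"
  and sg_zero [simp]: "sg k 0 = 0"
  and dg_sg: "dg l z \<Longrightarrow> dg l (sg k z)"
  for z :: "'a::ring fm"
  unfolding sg_def by (auto simp: dg_uminus)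

section \<open>Finite dimensional algebras\<close>

context vector_space
begin

text \<open>A basis of \<open>S\<close> extends to one of \<open>T\<close> by at least one vector.
  The ambient space is infinite dimensional, so the finite spanning set \<open>B\<close> is what
  makes \<open>dim\<close> count.\<close>

lemma dim_psubspace:
  assumes "subspace S" "subspace T" "S \<subseteq> T" "S \<noteq> T" "T \<subseteq> span B" "finite B"
  shows "dim S < dim T"
proof -
  obtain C where C: "C \<subseteq> S" "independent C" "S \<subseteq> span C"
    by (rule basis_exists[of S])
  obtain C' where C': "C \<subseteq> C'" "C' \<subseteq> T" "independent C'" "T \<subseteq> span C'"
    by (rule maximal_independent_subset_extend[of C T]) (use C assms(3) in blast)+
  have "finite C'" using independent_span_bound[OF assms(6) C'(3)] C'(2) assms(5) by blast
  moreover have "C \<noteq> C'"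
  proof
    assume "C = C'"
    then have "T \<subseteq> span C" using C' by simp
    also have "\<dots> \<subseteq> S" using C(1) assms(1) by (simp add: span_minimal)
    finally show False using assms by blast
  qed
  ultimately have "card C < card C'" using C'(1) by (meson psubsetI psubset_card_mono)
  then show ?thesis
    using basis_card_eq_dim[OF C(1,3,2)] basis_card_eq_dim[OF C'(2,4,3)] by simp
qed

lemma dim_le_finite:
  assumes "T \<subseteq> span B" "finite B" shows "dim T \<le> card B"
  using dim_le_card assms by blast

lemma ascending_chain_stable:
  assumes "\<And>n. subspace (K n)" "\<And>n. K n \<subseteq> K (Suc n)" "\<And>n. K n \<subseteq> span B" "finite B"
  shows "\<exists>n::nat. K (Suc n) = K n"
proof (rule ccontr)
  assume "\<not> ?thesis"
  then have "dim (K n) < dim (K (Suc n))" for n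
    using dim_psubspace[OF assms(1,1,2) _ assms(3,4), of n] by metis
  then have "strict_mono (\<lambda>n. dim (K n))" by (simp add: strict_mono_Suc_iff)
  then have "n \<le> dim (K n)" for n by (rule strict_mono_imp_increasing)
  from this[of "Suc (card B)"] dim_le_finite[OF assms(3,4), of "Suc (card B)"] show False by linarith
qed

lemma descending_chain_stable:
  assumes "\<And>n. subspace (K n)" "\<And>n. K (Suc n) \<subseteq> K n" "K 0 \<subseteq> span B" "finite B"
  shows "\<exists>n::nat. K (Suc n) = K n"
proof (rule ccontr)
  assume neg: "\<not> ?thesis"
  have "K n \<subseteq> K 0" for n by (induction n) (use assms(2) in auto)
  then have sub: "K n \<subseteq> span B" for n using assms(3) by blast
  have less: "dim (K (Suc n)) < dim (K n)" for n
    using dim_psubspace[OF assms(1,1,2) _ sub assms(4), of n] neg by metis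
  have "dim (K n) + n \<le> dim (K 0)" for n
  proof (induction n)
    case (Suc n) then show ?case using less[of n] by linarith
  qed simp
  from this[of "Suc (dim (K 0))"] show False by linarith
qed

text \<open>Both maps induce surjections of quotients from \<open>V1/W1\<close> to \<open>V2/W2\<close>; if one of them is
  injective then the dimensions agree, so the other one is injective as well.\<close>

lemma quotient_surj_inj:
  assumes sub: "subspace V1" "subspace W1" "subspace W2" "W1 \<subseteq> V1"
    and fin: "V1 \<subseteq> span B" "finite B"
    and lin: "\<And>x y. f (x + y) = f x + f y" "\<And>c x. f (scale c x) = scale c (f x)"
      "\<And>x y. g (x + y) = g x + g y" "\<And>c x. g (scale c x) = scale c (g x)"
    and W: "\<And>x. x \<in> W1 \<Longrightarrow> f x \<in> W2" "\<And>x. x \<in> W1 \<Longrightarrow> g x \<in> W2"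
    and V: "\<And>x. x \<in> V1 \<Longrightarrow> f x \<in> V2" "\<And>x. x \<in> V1 \<Longrightarrow> g x \<in> V2"
    and surj: "\<And>y. y \<in> V2 \<Longrightarrow> \<exists>x\<in>V1. y - f x \<in> W2"
    and inj: "\<And>x. x \<in> V1 \<Longrightarrow> g x \<in> W2 \<Longrightarrow> x \<in> W1"
    and x: "x \<in> V1" "f x \<in> W2"
  shows "x \<in> W1"
proof -
  have f0: "f 0 = 0" using lin(1)[of 0 0] by simp
  have g0: "g 0 = 0" using lin(3)[of 0 0] by simp
  have fm: "f (- x) = - f x" for x using lin(1)[of x "- x"] f0 by (simp add: eq_neg_iff_add_eq_0 add.commute)
  have gm: "g (- x) = - g x" for x using lin(3)[of x "- x"] g0 by (simp add: eq_neg_iff_add_eq_0 add.commute)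
  have fd: "f (x - y) = f x - f y" for x y using lin(1)[of x "- y"] fm by simp
  have gd: "g (x - y) = g x - g y" for x y using lin(3)[of x "- y"] gm by simp
  \<comment> \<open>Quotient spaces are avoided by a chain argument. \<open>K n\<close> holds the
    elements that reach \<open>W1\<close> after \<open>n\<close> steps along the relation
    "\<open>f x\<close> equals \<open>g y\<close> modulo \<open>W2\<close>". The chain increases
    inside a finite dimensional space, so it stops growing.\<close>
  define K where "K = rec_nat W1 (\<lambda>_ K. {x \<in> V1. \<exists>y\<in>K. f x - g y \<in> W2})"
  have K0: "K 0 = W1" and KS: "K (Suc n) = {x \<in> V1. \<exists>y\<in>K n. f x - g y \<in> W2}" for n
    by (simp_all add: K_def)
  have subK: "subspace (K n)" for n
  proof (induction n)
    case 0 then show ?case using sub K0 by simp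
  next
    case (Suc n)
    show ?case unfolding KS
    proof (rule subspaceI)
      show "0 \<in> {x \<in> V1. \<exists>y\<in>K n. f x - g y \<in> W2}"
        using sub Suc by (auto simp: subspace_0 f0 g0 intro!: bexI[of _ 0])
    next
      fix x y assume "x \<in> {x \<in> V1. \<exists>y\<in>K n. f x - g y \<in> W2}" "y \<in> {x \<in> V1. \<exists>y\<in>K n. f x - g y \<in> W2}"
      then obtain a b where ab: "x \<in> V1" "y \<in> V1" "a \<in> K n" "b \<in> K n" "f x - g a \<in> W2" "f y - g b \<in> W2"
        by blast
      have "f (x + y) - g (a + b) = (f x - g a) + (f y - g b)" by (simp add: lin algebra_simps)
      then have "f (x + y) - g (a + b) \<in> W2" using subspace_add[OF sub(3) ab(5,6)] by simp
      then show "x + y \<in> {x \<in> V1. \<exists>y\<in>K n. f x - g y \<in> W2}"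
        using ab subspace_add[OF sub(1)] subspace_add[OF Suc] by blast
    next
      fix c x assume "x \<in> {x \<in> V1. \<exists>y\<in>K n. f x - g y \<in> W2}"
      then obtain a where ab: "x \<in> V1" "a \<in> K n" "f x - g a \<in> W2" by blast
      have "f (scale c x) - g (scale c a) = scale c (f x - g a)" by (simp add: lin scale_right_diff_distrib)
      then have "f (scale c x) - g (scale c a) \<in> W2" using subspace_scale[OF sub(3) ab(3)] by simp
      then show "scale c x \<in> {x \<in> V1. \<exists>y\<in>K n. f x - g y \<in> W2}"
        using ab subspace_scale[OF sub(1)] subspace_scale[OF Suc] by blast
    qed
  qed
  have inc: "K n \<subseteq> K (Suc n)" for n
  proof (induction n)
    case 0
    show ?case unfolding KS K0
      using sub W by (auto simp: subspace_0 g0 intro!: bexI[of _ 0])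
  next
    case (Suc n)
    then show ?case unfolding KS[of "Suc n"] KS[of n] by blast
  qed
  have KV: "K n \<subseteq> V1" for n by (cases n) (use K0 KS sub in auto)
  have W1K: "W1 \<subseteq> K n" for n by (induction n) (use K0 inc in auto)
  have "\<exists>n. K (Suc n) = K n"
  proof (rule ascending_chain_stable[OF _ _ _ fin(2)])
    fix n show "subspace (K n)" "K n \<subseteq> K (Suc n)" "K n \<subseteq> span B"
      using subK inc KV fin(1) by blast+
  qed
  then obtain n where n: "K (Suc n) = K n" by blast
  have up: "\<exists>y\<in>V1. f y - g x \<in> W2" if xV: "x \<in> V1" for x
  proof -
    obtain y where "y \<in> V1" "g x - f y \<in> W2" using surj[OF V(2)[OF xV]] by blast
    then show ?thesis using subspace_neg[OF sub(3), of "g x - f y"] by auto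
  qed
  \<comment> \<open>Surjectivity of \<open>f\<close> continues the relation backwards from
    \<open>x\<close>: \<open>f (s (Suc m))\<close> equals \<open>g (s m)\<close> modulo
    \<open>W2\<close>. As \<open>f x\<close> lies in \<open>W2\<close>, the element
    \<open>s m\<close> reaches \<open>W1\<close> in \<open>m + 1\<close> steps.\<close>
  define s where "s = rec_nat x (\<lambda>_ x. SOME y. y \<in> V1 \<and> f y - g x \<in> W2)"
  have s0: "s 0 = x" and sS: "s (Suc m) = (SOME y. y \<in> V1 \<and> f y - g (s m) \<in> W2)" for m
    by (simp_all add: s_def)
  have s: "s m \<in> V1 \<and> s m \<in> K (Suc m)" for m
  proof (induction m)
    case 0
    then show ?case using x s0 KS[of 0] K0 sub(2) by (auto simp: g0 subspace_0 intro!: bexI[of _ 0])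
  next
    case (Suc m)
    have "s (Suc m) \<in> V1 \<and> f (s (Suc m)) - g (s m) \<in> W2"
      unfolding sS using someI_ex[of "\<lambda>y. y \<in> V1 \<and> f y - g (s m) \<in> W2"] up[of "s m"] Suc by blast
    then show ?case using Suc KS[of "Suc m"] by blast
  qed
  have sr: "f (s (Suc m)) - g (s m) \<in> W2" for m
    unfolding sS using someI_ex[of "\<lambda>y. y \<in> V1 \<and> f y - g (s m) \<in> W2"] up[of "s m"] s[of m] by blast
  \<comment> \<open>Where the chain is stable one step is saved, and injectivity of \<open>g\<close>
    carries the saving down to \<open>s 0 = x\<close>, which then needs no step at all.\<close>
  have down: "s m \<in> K m" if "m \<le> n" for m
    using that
  proof (induction rule: inc_induct)
    case base then show ?case using s[of n] n by simp
  next
    case (step m)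
    then obtain y where y: "y \<in> K m" "f (s (Suc m)) - g y \<in> W2" using KS[of m] by blast
    have "g (s m - y) = (f (s (Suc m)) - g y) - (f (s (Suc m)) - g (s m))"
      by (simp add: gd)
    then have "g (s m - y) \<in> W2" using subspace_diff[OF sub(3) y(2) sr[of m]] by simp
    moreover have "s m - y \<in> V1" using s[of m] y KV subspace_diff[OF sub(1)] by blast
    ultimately have "s m - y \<in> K m" using inj W1K by blast
    then show ?case using subspace_add[OF subK _ y(1), of "s m - y"] by simp
  qed
  show ?thesis using down[of 0] s0 K0 by simp
qed

end

locale fdalg =
  fixes scale :: "'k::field \<Rightarrow> 'a::ring_1 \<Rightarrow> 'a"
  assumes fd: "fd_algebra scale"
begin

lemma scale_simps:
  "scale c (x + y) = scale c x + scale c y" "scale (c + d) x = scale c x + scale d x"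
  "scale (c * d) x = scale c (scale d x)" "scale 1 x = x"
  "scale c (x * y) = scale c x * y" "scale c x * y = x * scale c y"
  using fd unfolding fd_algebra_def by simp_all (metis)

lemma scale_zero [simp]: "scale c 0 = 0"
  using scale_simps(1)[of c 0 0] by simp

definition fs :: "'k \<Rightarrow> 'a fm \<Rightarrow> 'a fm" where
  "fs c x = Abs_fm (\<lambda>u v. scale c (ent x u v))"

lemma ent_fs [simp]: "ent (fs c x) u v = scale c (ent x u v)"
proof -
  obtain I where I: "finite I" "fm_in I x" using ex_fm_in by blast
  have "fin_ent (\<lambda>u v. scale c (ent x u v))"
    by (rule fin_entI[OF I(1)]) (simp add: fm_inD[OF I(2)])
  then show ?thesis unfolding fs_def by (simp add: ent_Abs_fm)
qed

sublocale vs: vector_space fs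
  by unfold_locales (rule fm_eqI, simp add: scale_simps)+

lemma scale_sum: "scale c (sum f A) = (\<Sum>i\<in>A. scale c (f i))"
  by (induction A rule: infinite_finite_induct) (auto simp: scale_simps)

lemma fs_mult_left: "fs c x * y = fs c (x * y)"
proof (rule fm_eqI)
  fix u v
  obtain I where I: "finite I" "fm_in I x" using ex_fm_in by blast
  have I': "fm_in I (fs c x)" using I(2) unfolding fm_in_def by simp
  show "ent (fs c x * y) u v = ent (fs c (x * y)) u v"
    by (simp add: ent_mult_in[OF I] ent_mult_in[OF I(1) I'] scale_sum scale_simps(5))
qed

lemma fs_mult_right: "x * fs c y = fs c (x * y)"
proof (rule fm_eqI)
  fix u v
  obtain I where I: "finite I" "fm_in I x" using ex_fm_in by blast
  show "ent (x * fs c y) u v = ent (fs c (x * y)) u v"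
    by (simp add: ent_mult_in[OF I] scale_sum scale_simps(5,6))
qed

lemma dg_fs: "dg k x \<Longrightarrow> dg k (fs c x)"
  unfolding dg_def using ent_fs scale_zero by metis

lemma finite_span_fm_in:
  assumes "finite I" shows "\<exists>B. finite B \<and> {x. fm_in I x} \<subseteq> vs.span B"
proof -
  obtain B0 where B0: "finite B0" "\<And>x. \<exists>c. x = (\<Sum>b\<in>B0. scale (c b) b)"
    using fd unfolding fd_algebra_def by auto
  define E where "E = (\<lambda>u v b. Abs_fm (\<lambda>u' v'. if u' = u \<and> v' = v then b else 0 :: 'a))"
  have entE: "ent (E u v b) u' v' = (if u' = u \<and> v' = v then b else 0)" for u v b u' v'
  proof -
    have "fin_ent (\<lambda>u' v'. if u' = u \<and> v' = v then b else 0 :: 'a)"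
      by (rule fin_entI[of "{u, v}"]) auto
    then show ?thesis unfolding E_def by (simp add: ent_Abs_fm)
  qed
  have ent_sum: "ent (sum F A) u v = (\<Sum>i\<in>A. ent (F i) u v)" for F :: "'c \<Rightarrow> 'a fm" and A u v
    by (induction A rule: infinite_finite_induct) auto
  let ?B = "(\<lambda>(u, v, b). E u v b) ` (I \<times> I \<times> B0)"
  have EB: "E u v a \<in> vs.span ?B" if "u \<in> I" "v \<in> I" for u v a
  proof -
    obtain c where c: "a = (\<Sum>b\<in>B0. scale (c b) b)" using B0(2) by blast
    have "E u v a = (\<Sum>b\<in>B0. fs (c b) (E u v b))"
      by (rule fm_eqI) (auto simp: entE ent_sum c)
    also have "\<dots> \<in> vs.span ?B"
      using that by (intro vs.span_sum vs.span_scale vs.span_base) force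
    finally show ?thesis .
  qed
  have "x \<in> vs.span ?B" if "fm_in I x" for x
  proof -
    have "x = (\<Sum>u\<in>I. \<Sum>v\<in>I. E u v (ent x u v))"
    proof (rule fm_eqI)
      fix u v
      have "(\<Sum>u'\<in>I. \<Sum>v'\<in>I. if u = u' \<and> v = v' then ent x u' v' else 0)
          = (\<Sum>u'\<in>I. if u = u' then (\<Sum>v'\<in>I. if v = v' then ent x u v' else 0) else 0)"
        by (intro sum.cong refl) auto
      also have "\<dots> = ent x u v" using assms fm_inD[OF that, of u v] by simp
      finally show "ent x u v = ent (\<Sum>u\<in>I. \<Sum>v\<in>I. E u v (ent x u v)) u v"
        by (simp add: ent_sum entE)
    qed
    also have "\<dots> \<in> vs.span ?B" by (intro vs.span_sum EB)
    finally show ?thesis .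
  qed
  then show ?thesis using assms B0(1) by (intro exI[of _ ?B]) auto
qed

text \<open>The two equations confine the rows of \<open>x\<close> to the support of
  \<open>e\<close> and its columns to that of \<open>f\<close>. So spaces of morphisms between two
  objects are finite dimensional; all later dimension arguments rest on this.\<close>

lemma finite_span_corner:
  "\<exists>B. finite B \<and> {x. e * x = x \<and> x * f = x} \<subseteq> vs.span B"
proof -
  obtain I where I: "finite I" "fm_in I e" "fm_in I f" using ex_fm_in2 by blast
  have "fm_in I x" if "e * x = x" "x * f = x" for x
  proof -
    obtain J where J: "finite J" "fm_in J x" using ex_fm_in by blast
    have "ent (e * x) u v = 0" if "u \<notin> I" for u v
      unfolding ent_mult_in[OF I(1,2)] using that fm_inD[OF I(2)] by simp
    moreover have "ent (x * f) u v = 0" if "v \<notin> I" for u v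
      unfolding ent_mult_in[OF J] using that fm_inD[OF I(3)] by simp
    ultimately show ?thesis unfolding fm_in_def using \<open>e * x = x\<close> \<open>x * f = x\<close> by metis
  qed
  then show ?thesis using finite_span_fm_in[OF I(1)] by blast
qed

text \<open>Fitting's lemma, in the form of the exchange property: \<open>g\<close> is an idempotent on whose image
  \<open>f\<close> is invertible, and on the complement \<open>e - f\<close> is invertible.\<close>

lemma fitting:
  assumes e: "e * e = e" "e * f = f" "f * e = f"
    and S: "vs.subspace S" "\<And>x y. x \<in> S \<Longrightarrow> y \<in> S \<Longrightarrow> x * y \<in> S" "e \<in> S" "f \<in> S"
  obtains g u v where "g \<in> S" "u \<in> S" "v \<in> S" "g * g = g" "f * u = g" "u * f = g"
    "(e - f) * v = e - g" "v * (e - f) = e - g" "e * g = g" "g * e = g" 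
proof -
  define p where "p = rec_nat e (\<lambda>_ x. f * x)"
  have p0: "p 0 = e" and pS: "p (Suc n) = f * p n" for n by (simp_all add: p_def)
  have ep: "e * p n = p n" for n by (cases n) (simp_all add: p0 pS e mult.assoc[symmetric])
  have padd: "p (m + n) = p m * p n" for m n
    by (induction m) (simp_all add: p0 pS ep mult.assoc)
  have pe: "p n * e = p n" for n using padd[of n 0] p0 by simp
  have p1: "p 1 = f" using pS[of 0] p0 e by simp
  \<comment> \<open>Everything is constructed inside the commutative algebra \<open>P\<close> of
    polynomials in \<open>f\<close> with unit \<open>e\<close>. \<open>K n\<close> is its ideal
    generated by the \<open>n\<close>-th power of \<open>f\<close>, and this descending chain
    stabilises.\<close>
  define K where "K = (\<lambda>n. vs.span (p ` {n..}))"
  define P where "P = K 0"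
  have PS: "P \<subseteq> S" unfolding P_def K_def
  proof (rule vs.span_minimal[OF _ S(1)])
    have "p n \<in> S" for n by (induction n) (use S p0 pS in auto)
    then show "p ` {0..} \<subseteq> S" by blast
  qed
  have pP: "p n \<in> P" for n unfolding P_def K_def by (rule vs.span_base) auto
  have Pmult: "x * y \<in> P \<and> x * y = y * x" if "x \<in> P" "y \<in> P" for x y
  proof -
    have 1: "p n * y \<in> P \<and> p n * y = y * p n" if "y \<in> P" for n y
      using that unfolding P_def K_def
    proof (induction rule: vs.span_induct_alt)
      case base then show ?case by (simp add: vs.span_zero)
    next
      case (step c x y)
      then obtain m where "x = p m" by blast
      moreover have "p n * p m = p m * p n" using padd[of n m] padd[of m n] by (simp add: add.commute)
      moreover have "p n * p m \<in> vs.span (p ` {0..})" using pP[of "n + m"] padd by (simp add: P_def K_def)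
      ultimately show ?case using step
        by (elim conjE) (simp add: distrib_left distrib_right fs_mult_left fs_mult_right vs.span_add vs.span_scale)
    qed
    show ?thesis
      using that(1) unfolding P_def K_def
    proof (induction rule: vs.span_induct_alt)
      case base then show ?case by (simp add: vs.span_zero)
    next
      case (step c x z)
      then obtain m where "x = p m" by blast
      then show ?case using step 1[OF that(2), of m] unfolding P_def K_def
        by (elim conjE) (simp add: distrib_left distrib_right fs_mult_left fs_mult_right vs.span_add vs.span_scale)
    qed
  qed
  have comm: "x * y = y * x" if "x \<in> P" "y \<in> P" for x y using Pmult that by blast
  have Pe: "e * x = x" "x * e = x" if "x \<in> P" for x
  proof -
    show "e * x = x" using that unfolding P_def K_def
      by (induction rule: vs.span_induct_alt) (auto simp: distrib_left fs_mult_right ep)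
    then show "x * e = x" using comm[OF that pP[of 0]] p0 by simp
  qed
  obtain B where B: "finite B" "{x. e * x = x \<and> x * e = x} \<subseteq> vs.span B"
    using finite_span_corner by blast
  have "P \<subseteq> vs.span B" using Pe B(2) by blast
  then have "\<exists>n. K (Suc n) = K n"
    by (intro vs.descending_chain_stable[OF _ _ _ B(1)])
       (auto simp: K_def P_def intro!: vs.span_mono image_mono)
  then obtain n0 where n0: "K (Suc n0) = K n0" by blast
  have fac: "\<exists>w\<in>P. x = p n * w" if "x \<in> K n" for x n
    using that unfolding K_def
  proof (induction rule: vs.span_induct_alt)
    case base then show ?case using vs.span_zero P_def K_def by (intro bexI[of _ 0]) auto
  next
    case (step c x z)
    then obtain m w where "x = p m" "m \<ge> n" "w \<in> P" "z = p n * w" by auto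
    then have "fs c x + z = p n * (fs c (p (m - n)) + w)"
      using padd[of n "m - n"] by (simp add: distrib_left fs_mult_right)
    moreover have "fs c (p (m - n)) + w \<in> P"
      using pP \<open>w \<in> P\<close> unfolding P_def K_def by (simp add: vs.span_add vs.span_scale)
    ultimately show ?case by blast
  qed
  have "p n0 \<in> K n0" unfolding K_def by (rule vs.span_base) auto
  then obtain w0 where w0: "w0 \<in> P" "p n0 = p (Suc n0) * w0" using fac n0 by metis
  \<comment> \<open>One more than the stable index, so that the power \<open>p n\<close> is visibly
    a multiple of \<open>f\<close>; this yields \<open>f * u = g\<close> for
    \<open>u = p n0 * y\<close>.\<close>
  define n where "n = Suc n0"
  have w: "p n = p (Suc n) * w0" unfolding n_def using w0(2) pS by (metis mult.assoc)
  define q where "q = rec_nat e (\<lambda>_ x. w0 * x)"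
  have q0: "q 0 = e" and qS: "q (Suc m) = w0 * q m" for m by (simp_all add: q_def)
  have qP: "q m \<in> P" for m by (induction m) (use q0 p0 pP[of 0] qS Pmult w0 in auto)
  have pq: "p n = p (n + m) * q m" for m
  proof (induction m)
    case 0 then show ?case by (simp add: q0 pe)
  next
    case (Suc m)
    have "p (n + Suc m) * q (Suc m) = p m * (p (Suc n) * w0) * q m"
      using padd[of m "Suc n"] by (simp add: qS mult.assoc add.commute)
    also have "\<dots> = p (n + m) * q m" using w padd[of m n] by (simp add: add.commute)
    finally show ?case using Suc by simp
  qed
  define y where "y = q n"
  have yP: "y \<in> P" using qP y_def by simp
  have py: "p n * p n * y = p n" using pq[of n] padd[of n n] y_def by simp
  \<comment> \<open>From \<open>p n * p n * y = p n\<close> it follows that \<open>g\<close> is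
    idempotent and acts as a unit on \<open>p n\<close>.\<close>
  define g where "g = p n * y"
  define u where "u = p n0 * y"
  \<comment> \<open>The geometric sum inverts \<open>e - f\<close> up to the error
    \<open>p n\<close>, and the factor \<open>e - g\<close> annihilates this error.\<close>
  define r where "r = (\<Sum>i<n. p i)"
  define v where "v = (e - g) * r"
  have eP: "e \<in> P" using pP[of 0] p0 by simp
  have fP: "f \<in> P" using pP[of 1] p1 by simp
  have subP: "vs.subspace P" unfolding P_def K_def by simp
  have gP: "g \<in> P" and uP: "u \<in> P" using Pmult pP yP g_def u_def by auto
  have egP: "e - g \<in> P" "e - f \<in> P" using subP eP gP fP by (auto intro: vs.subspace_diff)
  have rP: "r \<in> P" unfolding r_def by (intro vs.subspace_sum[OF subP] pP)
  have vP: "v \<in> P" unfolding v_def using Pmult egP rP by blast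
  have gp: "g * p n = p n" using py comm[OF yP pP[of n]] by (simp add: g_def mult.assoc)
  have gg: "g * g = g" using gp by (metis g_def mult.assoc)
  have fu: "f * u = g" unfolding u_def g_def n_def pS by (simp add: mult.assoc)
  have tele: "r * (e - f) = e - p n"
  proof -
    have "(\<Sum>i<m. p i) * (e - f) = e - p m" for m
    proof (induction m)
      case 0 then show ?case by (simp add: p0)
    next
      case (Suc m)
      have "p m * f = p (Suc m)" using padd[of m 1] p1 by simp
      then have "p m * (e - f) = p m - p (Suc m)" by (simp add: right_diff_distrib pe)
      then show ?case using Suc by (simp only: sum.lessThan_Suc distrib_right) simp
    qed
    then show ?thesis unfolding r_def .
  qed
  have ve: "v * (e - f) = e - g"
  proof -
    have "v * (e - f) = (e - g) * (e - p n)" unfolding v_def using tele by (simp add: mult.assoc)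
    also have "\<dots> = e - g" using Pe[OF gP] gp ep[of n] e
      by (simp add: left_diff_distrib right_diff_distrib)
    finally show ?thesis .
  qed
  show thesis
    using that[of g u v] PS gP uP vP gg fu ve comm[OF fP uP] comm[OF vP egP(2)] Pe[OF gP] by auto
qed

end

section \<open>Complexes as pairs of matrices\<close>

text \<open>The first component is the idempotent cutting out all terms at once, the second one the total
  differential; the degree is recorded in the indices.\<close>

type_synonym 'a ac = "'a fm \<times> 'a fm"

definition acx :: "'a::ring ac \<Rightarrow> bool" where
  "acx X \<longleftrightarrow> dg 0 (fst X) \<and> dg 1 (snd X) \<and> fst X * fst X = fst X \<and>
     fst X * snd X = snd X \<and> snd X * fst X = snd X \<and> snd X * snd X = 0"

definition hm :: "int \<Rightarrow> 'a::ring ac \<Rightarrow> 'a ac \<Rightarrow> 'a fm set" where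
  "hm k X Y = {f. dg k f \<and> fst Y * f = f \<and> f * fst X = f}"

text \<open>Cocycles and coboundaries of degree \<open>k\<close>: with these signs
  \<open>Zc k X Y\<close> is the set of chain maps from \<open>X\<close> to the \<open>k\<close>-th
  shift of \<open>Y\<close>, and \<open>Bc k X Y\<close> the set of null-homotopic ones.\<close>

definition Zc :: "int \<Rightarrow> 'a::ring ac \<Rightarrow> 'a ac \<Rightarrow> 'a fm set" where
  "Zc k X Y = {f \<in> hm k X Y. sg k (snd Y * f) = f * snd X}"

definition Bc :: "int \<Rightarrow> 'a::ring ac \<Rightarrow> 'a ac \<Rightarrow> 'a fm set" where
  "Bc k X Y = {sg k (snd Y * h) + h * snd X | h. h \<in> hm (k - 1) X Y}"

lemma hmD: "f \<in> hm k X Y \<Longrightarrow> dg k f" "f \<in> hm k X Y \<Longrightarrow> fst Y * f = f" "f \<in> hm k X Y \<Longrightarrow> f * fst X = f"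
  unfolding hm_def by auto

lemma ZcD: "f \<in> Zc k X Y \<Longrightarrow> f \<in> hm k X Y" "f \<in> Zc k X Y \<Longrightarrow> sg k (snd Y * f) = f * snd X"
  unfolding Zc_def by auto

lemma hm_zero [simp]: "0 \<in> hm k X Y" and Zc_zero [simp]: "0 \<in> Zc k X Y"
  unfolding hm_def Zc_def by auto

lemma Bc_zero [simp]: "0 \<in> Bc k X Y"
  unfolding Bc_def by (auto intro!: exI[of _ 0])

lemma hm_add: "f \<in> hm k X Y \<Longrightarrow> g \<in> hm k X Y \<Longrightarrow> f + g \<in> hm k X Y"
  and hm_uminus: "f \<in> hm k X Y \<Longrightarrow> - f \<in> hm k X Y"
  unfolding hm_def by (auto simp: dg_add dg_uminus distrib_left distrib_right)

lemma hm_sg: "f \<in> hm k X Y \<Longrightarrow> sg l f \<in> hm k X Y"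
  by (simp add: sg_def hm_uminus)

lemma hm_mult: "g \<in> hm l Y W \<Longrightarrow> f \<in> hm k X Y \<Longrightarrow> g * f \<in> hm (k + l) X W"
  unfolding hm_def using dg_mult[of l g k f] by (auto simp: mult.assoc add.commute) (simp add: mult.assoc[symmetric])

lemma Zc_add: "f \<in> Zc k X Y \<Longrightarrow> g \<in> Zc k X Y \<Longrightarrow> f + g \<in> Zc k X Y"
  and Zc_uminus: "f \<in> Zc k X Y \<Longrightarrow> - f \<in> Zc k X Y"
  unfolding Zc_def by (auto simp: hm_add hm_uminus distrib_left distrib_right sg_add sg_uminus)

lemma Zc_diff: "f \<in> Zc k X Y \<Longrightarrow> g \<in> Zc k X Y \<Longrightarrow> f - g \<in> Zc k X Y"
  using Zc_add[of f k X Y "- g"] Zc_uminus[of g k X Y] by simp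

lemma Bc_add: "f \<in> Bc k X Y \<Longrightarrow> g \<in> Bc k X Y \<Longrightarrow> f + g \<in> Bc k X Y"
proof -
  assume "f \<in> Bc k X Y" "g \<in> Bc k X Y"
  then obtain h h' where "h \<in> hm (k - 1) X Y" "f = sg k (snd Y * h) + h * snd X"
    "h' \<in> hm (k - 1) X Y" "g = sg k (snd Y * h') + h' * snd X"
    unfolding Bc_def by auto
  then show ?thesis
    unfolding Bc_def by (auto intro!: exI[of _ "h + h'"] simp: hm_add algebra_simps sg_add)
qed

lemma Bc_uminus: "f \<in> Bc k X Y \<Longrightarrow> - f \<in> Bc k X Y"
proof -
  assume "f \<in> Bc k X Y"
  then obtain h where h: "h \<in> hm (k - 1) X Y" "f = sg k (snd Y * h) + h * snd X"
    unfolding Bc_def by auto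
  then have "- f = sg k (snd Y * - h) + - h * snd X" by (simp add: sg_uminus)
  then show ?thesis using hm_uminus[OF h(1)] unfolding Bc_def by blast
qed

lemma Bc_diff: "f \<in> Bc k X Y \<Longrightarrow> g \<in> Bc k X Y \<Longrightarrow> f - g \<in> Bc k X Y"
  using Bc_add[of f k X Y "- g"] Bc_uminus[of g k X Y] by simp

lemma Zc_mult:
  assumes "g \<in> Zc l Y W" "f \<in> Zc k X Y" shows "g * f \<in> Zc (k + l) X W"
proof -
  have "sg (k + l) (snd W * (g * f)) = sg k (sg l (snd W * g) * f)"
    by (simp add: sg_sg sg_mult_left mult.assoc)
  also have "\<dots> = g * sg k (snd Y * f)"
    using assms ZcD(2)[of g l Y W] by (simp add: sg_mult_right mult.assoc)
  also have "\<dots> = g * f * snd X" using ZcD(2)[OF assms(2)] by (simp add: mult.assoc)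
  finally show ?thesis using assms ZcD(1) hm_mult unfolding Zc_def by blast
qed

lemma Bc_mult_left:
  assumes "g \<in> Zc l Y W" "f \<in> Bc k X Y" shows "g * f \<in> Bc (k + l) X W"
proof -
  obtain h where h: "h \<in> hm (k - 1) X Y" "f = sg k (snd Y * h) + h * snd X"
    using assms(2) unfolding Bc_def by auto
  have "g * f = sg k (g * snd Y * h) + g * h * snd X"
    by (simp add: h distrib_left sg_mult_right mult.assoc)
  also have "g * snd Y = sg l (snd W * g)" using ZcD(2)[OF assms(1)] by simp
  also have "sg k (sg l (snd W * g) * h) = sg (k + l) (snd W * (g * h))"
    by (simp add: sg_sg sg_mult_left mult.assoc)
  finally show ?thesis
    using hm_mult[OF ZcD(1)[OF assms(1)] h(1)] unfolding Bc_def
    by (auto intro!: exI[of _ "g * h"] simp: algebra_simps)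
qed

text \<open>The homotopy \<open>h\<close> of \<open>g\<close> becomes \<open>h * f\<close>, up to
  the sign that arises when the differential is moved past \<open>f\<close>, an element of degree
  \<open>k\<close>.\<close>

lemma Bc_mult_right:
  assumes "g \<in> Bc l Y W" "f \<in> Zc k X Y" shows "g * f \<in> Bc (k + l) X W"
proof -
  obtain h where h: "h \<in> hm (l - 1) Y W" "g = sg l (snd W * h) + h * snd Y"
    using assms(1) unfolding Bc_def by auto
  have "g * f = sg l (snd W * h * f) + h * (snd Y * f)"
    by (simp add: h distrib_right sg_mult_left mult.assoc)
  also have "snd Y * f = sg k (f * snd X)" using ZcD(2)[OF assms(2), symmetric] by (simp add: sg_sg) (simp add: sg_def)
  also have "sg l (snd W * h * f) + h * sg k (f * snd X) =
    sg (k + l) (snd W * sg k (h * f)) + sg k (h * f) * snd X"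
    by (simp add: sg_def mult.assoc)
  finally show ?thesis
    using hm_sg[OF hm_mult[OF h(1) ZcD(1)[OF assms(2)]], of k] unfolding Bc_def
    by (auto intro!: exI[of _ "sg k (h * f)"] simp: algebra_simps)
qed

lemma acx_unit: "acx X \<Longrightarrow> fst X \<in> Zc 0 X X"
  unfolding acx_def Zc_def hm_def by simp

section \<open>Encoding graded families of matrices as finite matrices\<close>

definition bounded_mats :: "int \<Rightarrow> (int \<Rightarrow> nat) \<Rightarrow> (int \<Rightarrow> nat) \<Rightarrow> (int \<Rightarrow> 'a::zero mat) \<Rightarrow> bool" where
  "bounded_mats k v u f \<longleftrightarrow> (\<forall>i. f i \<in> carrier_mat (v (i + k)) (u i)) \<and>
     (\<exists>N. \<forall>i. \<bar>i\<bar> > N \<longrightarrow> f i = 0\<^sub>m (v (i + k)) (u i))"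

definition encf :: "int \<Rightarrow> (int \<Rightarrow> nat) \<Rightarrow> (int \<Rightarrow> nat) \<Rightarrow> (int \<Rightarrow> 'a::zero mat) \<Rightarrow> 'a fm" where
  "encf k v u f = Abs_fm (\<lambda>x y. case x of Ix i a \<Rightarrow> (case y of Ix j b \<Rightarrow>
     if i = j + k \<and> a < v i \<and> b < u j then f j $$ (a, b) else 0))"

lemma bounded_matsD: "bounded_mats k v u f \<Longrightarrow> f i \<in> carrier_mat (v (i + k)) (u i)"
  unfolding bounded_mats_def by blast

lemma ent_encf:
  assumes "bounded_mats k v u f"
  shows "ent (encf k v u f) (Ix i a) (Ix j b) =
    (if i = j + k \<and> a < v i \<and> b < u j then f j $$ (a, b) else 0)"
proof -
  obtain N where N: "\<And>i. \<bar>i\<bar> > N \<Longrightarrow> f i = 0\<^sub>m (v (i + k)) (u i)"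
    using assms unfolding bounded_mats_def by blast
  define R where "R = \<bar>N\<bar> + \<bar>k\<bar>"
  define I where "I = (\<lambda>(i, a). Ix i a) ` (SIGMA i:{-R..R}. {..<v i + u i})"
  have "finite I" unfolding I_def by auto
  then have "fin_ent (\<lambda>x y. case x of Ix i a \<Rightarrow> (case y of Ix j b \<Rightarrow>
     if i = j + k \<and> a < v i \<and> b < u j then f j $$ (a, b) else 0))"
  proof (rule fin_entI)
    fix x y assume *: "x \<notin> I \<or> y \<notin> I"
    obtain i a j b where [simp]: "x = Ix i a" "y = Ix j b" by (metis idx.exhaust)
    have "f j $$ (a, b) = 0" if c: "i = j + k" "a < v i" "b < u j"
    proof (cases "\<bar>j\<bar> > N")
      case True
      then show ?thesis using N[OF True] c by simp
    next
      case False
      then have "\<bar>j\<bar> \<le> R" "\<bar>i\<bar> \<le> R" using c unfolding R_def by linarith+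
      then have "(i, a) \<in> (SIGMA i:{-R..R}. {..<v i + u i})" "(j, b) \<in> (SIGMA i:{-R..R}. {..<v i + u i})"
        using c by auto
      then have "x \<in> I" "y \<in> I" unfolding I_def by force+
      then show ?thesis using * by blast
    qed
    then show "(case x of Ix i a \<Rightarrow> (case y of Ix j b \<Rightarrow>
     if i = j + k \<and> a < v i \<and> b < u j then f j $$ (a, b) else 0)) = 0" by auto
  qed
  then show ?thesis unfolding encf_def by (simp add: ent_Abs_fm)
qed

lemma fm_eqI': "(\<And>i a j b. ent x (Ix i a) (Ix j b) = ent y (Ix i a) (Ix j b)) \<Longrightarrow> x = y"
  by (rule fm_eqI) (metis idx.exhaust)

lemma encf_mult:
  assumes g: "bounded_mats l w v g" and f: "bounded_mats k v u f"
  shows "bounded_mats (k + l) w u (\<lambda>i. g (i + k) * f i)"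
    and "encf l w v g * encf k v u f = encf (k + l) w u (\<lambda>i. g (i + k) * f i :: 'a::ring_1 mat)"
proof -
  note cg = bounded_matsD[OF g] and cf = bounded_matsD[OF f]
  have c: "g (i + k) * f i \<in> carrier_mat (w (i + (k + l))) (u i)" for i
    using cg[of "i + k"] cf[of i] by (simp add: add.assoc)
  obtain N where N: "\<And>i. \<bar>i\<bar> > N \<Longrightarrow> f i = 0\<^sub>m (v (i + k)) (u i)"
    using f unfolding bounded_mats_def by blast
  have "g (i + k) * f i = 0\<^sub>m (w (i + (k + l))) (u i)" if "\<bar>i\<bar> > N" for i
    using N[OF that] cg[of "i + k"] by (simp add: add.assoc)
  then show b: "bounded_mats (k + l) w u (\<lambda>i. g (i + k) * f i)"
    unfolding bounded_mats_def using c by blast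
  show "encf l w v g * encf k v u f = encf (k + l) w u (\<lambda>i. g (i + k) * f i)"
  proof (rule fm_eqI')
    fix i a j b
    have "ent (encf l w v g * encf k v u f) (Ix i a) (Ix j b) =
      (\<Sum>x\<in>Ix (j + k) ` {0..<v (j + k)}. ent (encf l w v g) (Ix i a) x * ent (encf k v u f) x (Ix j b))"
    proof (rule ent_mult)
      fix x assume "x \<notin> Ix (j + k) ` {0..<v (j + k)}"
      then show "ent (encf l w v g) (Ix i a) x = 0 \<or> ent (encf k v u f) x (Ix j b) = 0"
        by (cases x) (auto simp: ent_encf[OF f])
    qed simp
    also have "\<dots> = (\<Sum>c = 0..<v (j + k). ent (encf l w v g) (Ix i a) (Ix (j + k) c) *
        ent (encf k v u f) (Ix (j + k) c) (Ix j b))"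
      by (subst sum.reindex) (auto simp: inj_on_def)
    also have "\<dots> = ent (encf (k + l) w u (\<lambda>i. g (i + k) * f i)) (Ix i a) (Ix j b)"
    proof (cases "i = j + (k + l) \<and> a < w i \<and> b < u j")
      case True
      then have "(g (j + k) * f j) $$ (a, b) = (\<Sum>c = 0..<v (j + k). g (j + k) $$ (a, c) * f j $$ (c, b))"
        using cg[of "j + k"] cf[of j] by (auto simp: scalar_prod_def add.assoc intro!: sum.cong)
      then show ?thesis using True
        by (simp add: ent_encf[OF f] ent_encf[OF g] ent_encf[OF b] add.assoc)
    next
      case False
      then show ?thesis
        by (auto simp: ent_encf[OF f] ent_encf[OF g] ent_encf[OF b] add.assoc intro!: sum.neutral)
    qed
    finally show "ent (encf l w v g * encf k v u f) (Ix i a) (Ix j b) =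
      ent (encf (k + l) w u (\<lambda>i. g (i + k) * f i)) (Ix i a) (Ix j b)" .
  qed
qed

lemma encf_add:
  assumes g: "bounded_mats k v u g" and f: "bounded_mats k v u f"
  shows "bounded_mats k v u (\<lambda>i. f i + g i)"
    and "encf k v u (\<lambda>i. f i + g i) = encf k v u f + (encf k v u g :: 'a::ring_1 fm)"
proof -
  obtain N N' where N: "\<And>i. \<bar>i\<bar> > N \<Longrightarrow> f i = 0\<^sub>m (v (i + k)) (u i)" "\<And>i. \<bar>i\<bar> > N' \<Longrightarrow> g i = 0\<^sub>m (v (i + k)) (u i)"
    using f g unfolding bounded_mats_def by blast
  have "\<forall>i. \<bar>i\<bar> > max N N' \<longrightarrow> f i + g i = 0\<^sub>m (v (i + k)) (u i)" using N by auto
  then show b: "bounded_mats k v u (\<lambda>i. f i + g i)"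
    unfolding bounded_mats_def using bounded_matsD[OF f] bounded_matsD[OF g] by (meson add_carrier_mat)
  show "encf k v u (\<lambda>i. f i + g i) = encf k v u f + encf k v u g"
  proof -
    have "(f j + g j) $$ (a, b) = f j $$ (a, b) + g j $$ (a, b)" if "a < v (j + k)" "b < u j" for a j b
      using bounded_matsD[OF f, of j] bounded_matsD[OF g, of j] that by simp
    then show ?thesis
      by (intro fm_eqI') (auto simp: ent_encf[OF b] ent_encf[OF f] ent_encf[OF g])
  qed
qed

lemma encf_uminus:
  assumes f: "bounded_mats k v u f"
  shows "bounded_mats k v u (\<lambda>i. - f i)"
    and "encf k v u (\<lambda>i. - f i) = - (encf k v u f :: 'a::ring_1 fm)"
proof -
  obtain N where N: "\<And>i. \<bar>i\<bar> > N \<Longrightarrow> f i = 0\<^sub>m (v (i + k)) (u i)"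
    using f unfolding bounded_mats_def by blast
  have "\<forall>i. \<bar>i\<bar> > N \<longrightarrow> - f i = 0\<^sub>m (v (i + k)) (u i)" using N by auto
  then show b: "bounded_mats k v u (\<lambda>i. - f i)"
    unfolding bounded_mats_def using bounded_matsD[OF f] by (meson uminus_carrier_mat)
  have "(- f j) $$ (a, b) = - f j $$ (a, b)" if "a < v (j + k)" "b < u j" for a j b
    using bounded_matsD[OF f, of j] that by simp
  then show "encf k v u (\<lambda>i. - f i) = - encf k v u f"
    by (intro fm_eqI') (auto simp: ent_encf[OF b] ent_encf[OF f])
qed

lemma encf_diff:
  assumes g: "bounded_mats k v u g" and f: "bounded_mats k v u f"
  shows "bounded_mats k v u (\<lambda>i. f i - g i)"
    and "encf k v u (\<lambda>i. f i - g i) = encf k v u f - (encf k v u g :: 'a::ring_1 fm)"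
proof -
  have *: "(\<lambda>i. f i - g i) = (\<lambda>i. f i + - g i)"
    using bounded_matsD[OF f] bounded_matsD[OF g] by (auto simp: fun_eq_iff minus_add_uminus_mat)
  show "bounded_mats k v u (\<lambda>i. f i - g i)" unfolding *
    by (rule encf_add[OF encf_uminus(1)[OF g] f])
  show "encf k v u (\<lambda>i. f i - g i) = encf k v u f - encf k v u g" unfolding *
    by (simp add: encf_add(2)[OF encf_uminus(1)[OF g] f] encf_uminus[OF g])
qed

lemma encf_inj:
  assumes g: "bounded_mats k v u g" and f: "bounded_mats k v u f"
    and eq: "encf k v u f = encf k v u g"
  shows "f i = g i"
proof (rule eq_matI)
  fix a b assume "a < dim_row (g i)" "b < dim_col (g i)"
  then have "a < v (i + k)" "b < u i" using bounded_matsD[OF g, of i] by auto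
  then show "f i $$ (a, b) = g i $$ (a, b)"
    using arg_cong[OF eq, of "\<lambda>x. ent x (Ix (i + k) a) (Ix i b)"] by (simp add: ent_encf[OF f] ent_encf[OF g])
qed (use bounded_matsD[OF f, of i] bounded_matsD[OF g, of i] in auto)

lemma dg_encf: "bounded_mats k v u f \<Longrightarrow> dg k (encf k v u f)"
  unfolding dg_def by (auto simp: ent_encf split: if_splits)

lemma bounded_mats_zero: "bounded_mats k v u (\<lambda>i. 0\<^sub>m (v (i + k)) (u i))"
  unfolding bounded_mats_def by auto

lemma encf_zero: "encf k v u (\<lambda>i. 0\<^sub>m (v (i + k)) (u i)) = (0 :: 'a::ring_1 fm)"
  by (rule fm_eqI') (auto simp: ent_encf[OF bounded_mats_zero])

lemma encf_surj:
  assumes dg: "dg k F" and z: "\<And>i a j b. a \<ge> v i \<or> b \<ge> u j \<Longrightarrow> ent F (Ix i a) (Ix j b) = 0"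
  defines "f \<equiv> \<lambda>i. mat (v (i + k)) (u i) (\<lambda>(a, b). ent F (Ix (i + k) a) (Ix i b))"
  shows "bounded_mats k v u f" "encf k v u f = (F :: 'a::ring_1 fm)"
proof -
  obtain I where I: "finite I" "fm_in I F" using ex_fm_in by blast
  define dgr where "dgr = (\<lambda>x. case x of Ix i a \<Rightarrow> i)"
  define N where "N = Max (insert 0 ((\<lambda>x. \<bar>dgr x\<bar>) ` I))"
  have "f i = 0\<^sub>m (v (i + k)) (u i)" if "\<bar>i\<bar> > N" for i
  proof -
    have "Ix i b \<notin> I" for b
    proof
      assume "Ix i b \<in> I"
      then have "\<bar>dgr (Ix i b)\<bar> \<in> insert 0 ((\<lambda>x. \<bar>dgr x\<bar>) ` I)" by blast
      then have "\<bar>dgr (Ix i b)\<bar> \<le> N" unfolding N_def using I(1) by (intro Max_ge) auto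
      then show False using that unfolding dgr_def by simp
    qed
    then show ?thesis unfolding f_def by (intro eq_matI) (auto simp: fm_inD[OF I(2)])
  qed
  then show b: "bounded_mats k v u f" unfolding bounded_mats_def f_def by auto
  show "encf k v u f = F"
  proof (rule fm_eqI')
    fix i a j b
    show "ent (encf k v u f) (Ix i a) (Ix j b) = ent F (Ix i a) (Ix j b)"
    proof (cases "i = j + k \<and> a < v i \<and> b < u j")
      case True
      then show ?thesis unfolding ent_encf[OF b] by (auto simp: f_def)
    next
      case False
      then have "ent F (Ix i a) (Ix j b) = 0" using dgD[OF dg] z by (meson not_less)
      then show ?thesis unfolding ent_encf[OF b] using False by auto
    qed
  qed
qed

section \<open>Translating complexes, chain maps and homotopies\<close>

definition dm :: "'a cplx \<Rightarrow> int \<Rightarrow> nat" where "dm X i = fst (cobj X i)"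

definition ac :: "'a::ring_1 cplx \<Rightarrow> 'a ac" where
  "ac X = (encf 0 (dm X) (dm X) (id_cmap X), encf 1 (dm X) (dm X) (cdif X))"

definition homs :: "int \<Rightarrow> 'a::ring_1 cplx \<Rightarrow> 'a cplx \<Rightarrow> (int \<Rightarrow> 'a mat) set" where
  "homs k X Y = {f. \<forall>i. f i \<in> phom (cobj X i) (cobj Y (i + k))}"

definition enc :: "int \<Rightarrow> 'a::ring_1 cplx \<Rightarrow> 'a cplx \<Rightarrow> (int \<Rightarrow> 'a mat) \<Rightarrow> 'a fm" where
  "enc k X Y f = encf k (dm Y) (dm X) f"

lemma is_complexD:
  assumes "is_complex X"
  shows "snd (cobj X i) \<in> carrier_mat (dm X i) (dm X i)" "snd (cobj X i) * snd (cobj X i) = snd (cobj X i)"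
    "cdif X i \<in> phom (cobj X i) (cobj X (i + 1))" "cdif X i \<in> carrier_mat (dm X (i + 1)) (dm X i)"
    "cdif X (i + 1) * cdif X i = 0\<^sub>m (dm X (i + 2)) (dm X i)"
  using assms unfolding is_complex_def proj_obj_def dm_def phom_def by auto

lemma homs_carrier: "f \<in> homs k X Y \<Longrightarrow> f i \<in> carrier_mat (dm Y (i + k)) (dm X i)"
  unfolding homs_def phom_def dm_def by auto

text \<open>The sizes \<open>dm X i\<close> may be positive in every degree; only the idempotents
  vanish far out. A morphism absorbs these idempotents and so vanishes with them.\<close>

lemma bounded_homs:
  assumes X: "is_complex X" and Y: "is_complex Y" and f: "f \<in> homs k X Y"
  shows "bounded_mats k (dm Y) (dm X) f"
proof -
  obtain N where N: "\<And>i. \<bar>i\<bar> > int N \<Longrightarrow> snd (cobj X i) = 0\<^sub>m (dm X i) (dm X i)"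
    using X unfolding is_complex_def dm_def by blast
  have "f i = 0\<^sub>m (dm Y (i + k)) (dm X i)" if "\<bar>i\<bar> > int N" for i
  proof -
    have c: "snd (cobj Y (i + k)) * f i \<in> carrier_mat (dm Y (i + k)) (dm X i)"
      using is_complexD(1)[OF Y, of "i + k"] homs_carrier[OF f, of i] by simp
    have "f i = snd (cobj Y (i + k)) * f i * snd (cobj X i)"
      using f unfolding homs_def phom_def by auto
    also have "\<dots> = 0\<^sub>m (dm Y (i + k)) (dm X i)"
      unfolding N[OF that] using right_mult_zero_mat[OF c] by simp
    finally show ?thesis .
  qed
  then show ?thesis unfolding bounded_mats_def using homs_carrier[OF f] by blast
qed

lemma id_homs: "is_complex X \<Longrightarrow> id_cmap X \<in> homs 0 X X"
  and cdif_homs: "is_complex X \<Longrightarrow> cdif X \<in> homs 1 X X"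
  unfolding homs_def id_cmap_def using is_complexD[of X] by (auto simp: phom_def dm_def)

lemma ac_bounded:
  assumes "is_complex X"
  shows "bounded_mats 0 (dm X) (dm X) (id_cmap X)" "bounded_mats 1 (dm X) (dm X) (cdif X)"
  using bounded_homs[OF assms assms] id_homs[OF assms] cdif_homs[OF assms] by auto

lemma acx_ac:
  assumes X: "is_complex X" shows "acx (ac X)"
proof -
  note b = ac_bounded[OF X]
  have 1: "(\<lambda>i. id_cmap X (i + 0) * id_cmap X i) = id_cmap X"
    using is_complexD(2)[OF X] by (simp add: id_cmap_def fun_eq_iff)
  have ph: "snd (cobj X (i + 1)) * cdif X i * snd (cobj X i) = cdif X i" for i
    using is_complexD(3)[OF X, of i] unfolding phom_def by auto
  have 2: "(\<lambda>i. id_cmap X (i + 1) * cdif X i) = cdif X"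
  proof
    fix i
    note c = is_complexD(1)[OF X, of "i + 1"] is_complexD(4)[OF X, of i] is_complexD(1)[OF X, of i]
    have "snd (cobj X (i + 1)) * cdif X i = snd (cobj X (i + 1)) * (snd (cobj X (i + 1)) * cdif X i * snd (cobj X i))"
      using ph by simp
    also have "\<dots> = (snd (cobj X (i + 1)) * snd (cobj X (i + 1))) * cdif X i * snd (cobj X i)"
      using c by (simp add: assoc_mult_mat[of _ "dm X (i + 1)" "dm X (i + 1)" _ "dm X i" _ "dm X i"]
          assoc_mult_mat[of _ "dm X (i + 1)" "dm X (i + 1)" _ "dm X (i + 1)" _ "dm X i"])
    also have "\<dots> = cdif X i" using is_complexD(2)[OF X] ph by simp
    finally show "id_cmap X (i + 1) * cdif X i = cdif X i" by (simp add: id_cmap_def)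
  qed
  have 3: "(\<lambda>i. cdif X (i + 0) * id_cmap X i) = cdif X"
  proof
    fix i
    note c = is_complexD(1)[OF X, of "i + 1"] is_complexD(4)[OF X, of i] is_complexD(1)[OF X, of i]
    have "cdif X i * snd (cobj X i) = (snd (cobj X (i + 1)) * cdif X i * snd (cobj X i)) * snd (cobj X i)"
      using ph by simp
    also have "\<dots> = snd (cobj X (i + 1)) * cdif X i * (snd (cobj X i) * snd (cobj X i))"
      using c by (intro assoc_mult_mat[of _ "dm X (i + 1)" "dm X i" _ "dm X i" _ "dm X i"]) auto
    also have "\<dots> = cdif X i" using is_complexD(2)[OF X] ph by simp
    finally show "cdif X (i + 0) * id_cmap X i = cdif X i" by (simp add: id_cmap_def)
  qed
  have 4: "(\<lambda>i. cdif X (i + 1) * cdif X i) = (\<lambda>i. 0\<^sub>m (dm X (i + (1 + 1))) (dm X i))"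
    using is_complexD(5)[OF X] by (simp add: fun_eq_iff)
  show ?thesis unfolding acx_def ac_def fst_conv snd_conv
    using encf_mult(2)[OF b(1) b(1)] encf_mult(2)[OF b(1) b(2)] encf_mult(2)[OF b(2) b(1)]
      encf_mult(2)[OF b(2) b(2)] dg_encf[OF b(1)] dg_encf[OF b(2)]
    unfolding 1 2 3 4 encf_zero by simp
qed

text \<open>Since the encoding is injective on bounded families, ring identities between encodings
  can be read degree by degree. Sums, cones and shifts are recognised as complexes in this
  way.\<close>

lemma is_complexI:
  assumes b: "bounded_mats 0 (dm X) (dm X) (id_cmap X)" "bounded_mats 1 (dm X) (dm X) (cdif X)"
    and a: "acx (ac X)"
  shows "is_complex X"
proof -
  note m = a[unfolded acx_def ac_def fst_conv snd_conv]
  have 1: "id_cmap X i * id_cmap X i = id_cmap X i" for i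
    using encf_inj[OF b(1) encf_mult(1)[OF b(1) b(1), simplified], of i]
      encf_mult(2)[OF b(1) b(1)] m by simp
  have 2: "id_cmap X (i + 1) * cdif X i = cdif X i" for i
    using encf_inj[OF b(2) encf_mult(1)[OF b(1) b(2), simplified], of i]
      encf_mult(2)[OF b(1) b(2)] m by simp
  have 3: "cdif X i * id_cmap X i = cdif X i" for i
    using encf_inj[OF b(2) encf_mult(1)[OF b(2) b(1), simplified], of i]
      encf_mult(2)[OF b(2) b(1)] m by simp
  have 4: "cdif X (i + 1) * cdif X i = 0\<^sub>m (dm X (i + (1 + 1))) (dm X i)" for i
    using encf_inj[OF bounded_mats_zero encf_mult(1)[OF b(2) b(2)], of i]
      encf_mult(2)[OF b(2) b(2)] m by (simp add: encf_zero)
  obtain N where N: "\<And>i. \<bar>i\<bar> > N \<Longrightarrow> id_cmap X i = 0\<^sub>m (dm X i) (dm X i)"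
    using b(1) unfolding bounded_mats_def by auto
  have "\<forall>i. \<bar>i\<bar> > int (nat N) \<longrightarrow> snd (cobj X i) = 0\<^sub>m (fst (cobj X i)) (fst (cobj X i))"
    using N unfolding id_cmap_def dm_def by auto
  then have N': "\<exists>N::nat. \<forall>i. \<bar>i\<bar> > int N \<longrightarrow> snd (cobj X i) = 0\<^sub>m (fst (cobj X i)) (fst (cobj X i))"
    by blast
  show ?thesis unfolding is_complex_def proj_obj_def phom_def
    using bounded_matsD[OF b(1)] bounded_matsD[OF b(2)] 1 2 3 4 N'
    unfolding id_cmap_def dm_def by auto
qed

lemma phom_iff:
  assumes X: "is_complex X" and Y: "is_complex Y" and b: "bounded_mats k (dm Y) (dm X) f"
  shows "f \<in> homs k X Y \<longleftrightarrow> enc k X Y f \<in> hm k (ac X) (ac Y)"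
proof -
  note bx = ac_bounded(1)[OF X] and bY = ac_bounded(1)[OF Y]
  have cf: "f i \<in> carrier_mat (dm Y (i + k)) (dm X i)" for i using bounded_matsD[OF b] .
  note l = encf_mult[OF bY b, simplified] and r = encf_mult[OF b bx, simplified]
  show ?thesis
  proof
    assume f: "f \<in> homs k X Y"
    have ph: "snd (cobj Y (i + k)) * f i * snd (cobj X i) = f i" for i
      using f unfolding homs_def phom_def by auto
    have 1: "snd (cobj Y (i + k)) * f i = f i" for i
    proof -
      note c = is_complexD(1)[OF Y, of "i + k"] cf[of i] is_complexD(1)[OF X, of i]
      have "snd (cobj Y (i + k)) * f i = snd (cobj Y (i + k)) * (snd (cobj Y (i + k)) * f i * snd (cobj X i))"
        using ph by simp
      also have "\<dots> = (snd (cobj Y (i + k)) * snd (cobj Y (i + k))) * f i * snd (cobj X i)"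
        using c by (simp add: assoc_mult_mat[of _ "dm Y (i + k)" "dm Y (i + k)" _ "dm X i" _ "dm X i"]
          assoc_mult_mat[of _ "dm Y (i + k)" "dm Y (i + k)" _ "dm Y (i + k)" _ "dm X i"])
      also have "\<dots> = f i" using is_complexD(2)[OF Y] ph by simp
      finally show ?thesis .
    qed
    have 2: "f i * snd (cobj X i) = f i" for i using ph[of i] 1[of i] by simp
    show "enc k X Y f \<in> hm k (ac X) (ac Y)"
      unfolding hm_def enc_def ac_def using dg_encf[OF b] l(2) r(2) 1 2 by (simp add: id_cmap_def)
  next
    assume "enc k X Y f \<in> hm k (ac X) (ac Y)"
    then have *: "encf k (dm Y) (dm X) (\<lambda>i. id_cmap Y (i + k) * f i) = encf k (dm Y) (dm X) f"
      "encf k (dm Y) (dm X) (\<lambda>i. f i * id_cmap X i) = encf k (dm Y) (dm X) f"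
      unfolding hm_def enc_def ac_def using l(2) r(2) by auto
    have "snd (cobj Y (i + k)) * f i = f i" "f i * snd (cobj X i) = f i" for i
      using encf_inj[OF b l(1) *(1), of i] encf_inj[OF b r(1) *(2), of i] by (simp_all add: id_cmap_def)
    then show "f \<in> homs k X Y" unfolding homs_def phom_def using cf by (auto simp: dm_def)
  qed
qed

lemma enc_hm:
  "is_complex X \<Longrightarrow> is_complex Y \<Longrightarrow> f \<in> homs k X Y \<Longrightarrow> enc k X Y f \<in> hm k (ac X) (ac Y)"
  using phom_iff bounded_homs by blast

lemma ent_ac_zero:
  assumes "is_complex X" "a \<ge> dm X i \<or> b \<ge> dm X j"
  shows "ent (fst (ac X)) (Ix i a) (Ix j b) = 0"
  using assms(2) unfolding ac_def by (auto simp: ent_encf[OF ac_bounded(1)[OF assms(1)]])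

text \<open>The idempotents of \<open>X\<close> and \<open>Y\<close> have no entries at positions
  beyond the sizes of the terms, and \<open>F\<close> absorbs them; so \<open>F\<close> fits into
  matrices of the prescribed format.\<close>

lemma enc_surj:
  assumes X: "is_complex X" and Y: "is_complex Y" and F: "F \<in> hm k (ac X) (ac Y)"
  obtains f where "f \<in> homs k X Y" "enc k X Y f = F"
proof -
  have z: "ent F (Ix i a) (Ix j b) = 0" if "a \<ge> dm Y i \<or> b \<ge> dm X j" for i a j b
    using that
  proof
    assume *: "a \<ge> dm Y i"
    obtain I where I: "finite I" "fm_in I (fst (ac Y))" using ex_fm_in by blast
    have "ent (fst (ac Y)) (Ix i a) w = 0" for w
      using ent_ac_zero[OF Y, of i a] * by (cases w) auto
    then have "ent (fst (ac Y) * F) (Ix i a) (Ix j b) = 0" by (simp add: ent_mult_in[OF I])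
    then show ?thesis using hmD(2)[OF F] by simp
  next
    assume *: "b \<ge> dm X j"
    obtain I where I: "finite I" "fm_in I F" using ex_fm_in by blast
    have "ent (fst (ac X)) w (Ix j b) = 0" for w
      using ent_ac_zero[OF X, of _ _ j b] * by (cases w) auto
    then have "ent (F * fst (ac X)) (Ix i a) (Ix j b) = 0" by (simp add: ent_mult_in[OF I])
    then show ?thesis using hmD(3)[OF F] by simp
  qed
  have "\<exists>f. bounded_mats k (dm Y) (dm X) f \<and> encf k (dm Y) (dm X) f = F"
    using encf_surj[of k F "dm Y" "dm X", OF hmD(1)[OF F]] z by blast
  then obtain f where s: "bounded_mats k (dm Y) (dm X) f" "encf k (dm Y) (dm X) f = F" by blast
  show thesis
    using that[of f] phom_iff[OF X Y s(1)] F s(2) unfolding enc_def by simp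
qed

lemma shift_simps: "cobj (shift k X) i = cobj X (i + k)"
  "cdif (shift k X) i = (if even k then cdif X (i + k) else - cdif X (i + k))"
  unfolding shift_def cobj_def cdif_def by auto

text \<open>The alternating sign in the differential of a shift is exactly the sign
  \<open>sg l\<close> in the cocycle condition.\<close>

lemma chain_map_iff:
  assumes X: "is_complex X" and Y: "is_complex Y"
  shows "chain_map X (shift l Y) f \<longleftrightarrow> f \<in> homs l X Y \<and> enc l X Y f \<in> Zc l (ac X) (ac Y)"
proof (cases "f \<in> homs l X Y")
  case True
  note b = bounded_homs[OF X Y True]
  note bD = encf_mult[OF ac_bounded(2)[OF Y] b] and Db = encf_mult[OF b ac_bounded(2)[OF X]]
  have Db': "bounded_mats (l + 1) (dm Y) (dm X) (\<lambda>i. f (i + 1) * cdif X i)"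
    "enc l X Y f * snd (ac X) = encf (l + 1) (dm Y) (dm X) (\<lambda>i. f (i + 1) * cdif X i)"
    using Db by (simp_all add: add.commute ac_def enc_def)
  have c: "cdif Y (i + l) \<in> carrier_mat (dm Y (i + l + 1)) (dm Y (i + l))" "f i \<in> carrier_mat (dm Y (i + l)) (dm X i)" for i
    using is_complexD(4)[OF Y] bounded_matsD[OF b] by auto
  have sD: "bounded_mats (l + 1) (dm Y) (dm X) (\<lambda>i. cdif (shift l Y) i * f i) \<and>
    sg l (snd (ac Y) * enc l X Y f) = encf (l + 1) (dm Y) (dm X) (\<lambda>i. cdif (shift l Y) i * f i)"
  proof (cases "even l")
    case True
    then show ?thesis using bD by (simp add: sg_def shift_simps ac_def enc_def)
  next
    case False
    have "- cdif Y (i + l) * f i = - (cdif Y (i + l) * f i)" for i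
      using c[of i] by (intro uminus_mult_left_mat) auto
    then show ?thesis
      using bD False encf_uminus[OF bD(1)] by (simp add: sg_def shift_simps ac_def enc_def)
  qed
  have "chain_map X (shift l Y) f \<longleftrightarrow> (\<forall>i. cdif (shift l Y) i * f i = f (i + 1) * cdif X i)"
    using True unfolding chain_map_def homs_def by (simp add: shift_simps)
  also have "\<dots> \<longleftrightarrow> sg l (snd (ac Y) * enc l X Y f) = enc l X Y f * snd (ac X)"
  proof
    assume "\<forall>i. cdif (shift l Y) i * f i = f (i + 1) * cdif X i"
    then have "(\<lambda>i. cdif (shift l Y) i * f i) = (\<lambda>i. f (i + 1) * cdif X i)" by blast
    then show "sg l (snd (ac Y) * enc l X Y f) = enc l X Y f * snd (ac X)" using sD Db' by simp
  next
    assume "sg l (snd (ac Y) * enc l X Y f) = enc l X Y f * snd (ac X)"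
    then show "\<forall>i. cdif (shift l Y) i * f i = f (i + 1) * cdif X i"
      using sD Db' encf_inj[OF Db'(1) conjunct1[OF sD]] by simp
  qed
  finally show ?thesis using True enc_hm[OF X Y True] unfolding Zc_def by auto
next
  case False
  then show ?thesis unfolding chain_map_def homs_def by (auto simp: shift_simps)
qed

lemma null_homotopic_iff:
  assumes X: "is_complex X" and Y: "is_complex Y" and b: "bounded_mats l (dm Y) (dm X) f"
  shows "null_homotopic X (shift l Y) f \<longleftrightarrow> enc l X Y f \<in> Bc l (ac X) (ac Y)"
proof -
  have key: "(\<forall>i. f i = cdif (shift l Y) (i - 1) * h i + h (i + 1) * cdif X i) \<longleftrightarrow>
      enc l X Y f = sg l (snd (ac Y) * enc (l - 1) X Y h) + enc (l - 1) X Y h * snd (ac X)"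
    if h: "h \<in> homs (l - 1) X Y" for h
  proof -
    note bh = bounded_homs[OF X Y h]
    note bD = encf_mult[OF ac_bounded(2)[OF Y] bh, simplified] 
    note Db = encf_mult[OF bh ac_bounded(2)[OF X], simplified]
    have c: "cdif Y (i + (l - 1)) \<in> carrier_mat (dm Y (i + (l - 1) + 1)) (dm Y (i + (l - 1)))"
      "h i \<in> carrier_mat (dm Y (i + (l - 1))) (dm X i)" for i
      by (rule is_complexD(4)[OF Y], rule bounded_matsD[OF bh])
    have idx: "i - 1 + l = i + (l - 1)" for i :: int by simp
    have sD: "bounded_mats l (dm Y) (dm X) (\<lambda>i. cdif (shift l Y) (i - 1) * h i) \<and>
      sg l (snd (ac Y) * enc (l - 1) X Y h) = encf l (dm Y) (dm X) (\<lambda>i. cdif (shift l Y) (i - 1) * h i)"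
    proof (cases "even l")
      case True
      then show ?thesis using bD by (simp add: sg_def shift_simps ac_def enc_def idx)
    next
      case False
      have "- cdif Y (i + (l - 1)) * h i = - (cdif Y (i + (l - 1)) * h i)" for i
        using c[of i] by (intro uminus_mult_left_mat) auto
      then show ?thesis
        using bD False encf_uminus[OF bD(1)] by (simp add: sg_def shift_simps ac_def enc_def idx)
    qed
    note add = encf_add[OF Db(1) conjunct1[OF sD]]
    have eq: "encf l (dm Y) (dm X) (\<lambda>i. cdif (shift l Y) (i - 1) * h i + h (i + 1) * cdif X i)
        = sg l (snd (ac Y) * enc (l - 1) X Y h) + enc (l - 1) X Y h * snd (ac X)"
      using add(2) sD Db(2) by (simp add: enc_def ac_def)
    show ?thesis
    proof
      assume "\<forall>i. f i = cdif (shift l Y) (i - 1) * h i + h (i + 1) * cdif X i"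
      then have "f = (\<lambda>i. cdif (shift l Y) (i - 1) * h i + h (i + 1) * cdif X i)" by blast
      then show "enc l X Y f = sg l (snd (ac Y) * enc (l - 1) X Y h) + enc (l - 1) X Y h * snd (ac X)"
        using eq by (simp add: enc_def)
    next
      assume "enc l X Y f = sg l (snd (ac Y) * enc (l - 1) X Y h) + enc (l - 1) X Y h * snd (ac X)"
      then show "\<forall>i. f i = cdif (shift l Y) (i - 1) * h i + h (i + 1) * cdif X i"
        using encf_inj[OF add(1) b] eq by (simp add: enc_def)
    qed
  qed
  have idx: "i - 1 + l = i + (l - 1)" for i :: int by simp
  have "null_homotopic X (shift l Y) f \<longleftrightarrow>
    (\<exists>h\<in>homs (l - 1) X Y. \<forall>i. f i = cdif (shift l Y) (i - 1) * h i + h (i + 1) * cdif X i)"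
    unfolding null_homotopic_def homs_def by (simp add: shift_simps(1) idx)
  also have "\<dots> \<longleftrightarrow> (\<exists>h\<in>homs (l - 1) X Y.
      enc l X Y f = sg l (snd (ac Y) * enc (l - 1) X Y h) + enc (l - 1) X Y h * snd (ac X))"
    using key by blast
  also have "\<dots> \<longleftrightarrow> enc l X Y f \<in> Bc l (ac X) (ac Y)"
  proof
    assume "enc l X Y f \<in> Bc l (ac X) (ac Y)"
    then obtain H where H: "H \<in> hm (l - 1) (ac X) (ac Y)"
      "enc l X Y f = sg l (snd (ac Y) * H) + H * snd (ac X)" unfolding Bc_def by blast
    from enc_surj[OF X Y H(1)] H(2)
    show "\<exists>h\<in>homs (l - 1) X Y. enc l X Y f = sg l (snd (ac Y) * enc (l - 1) X Y h) + enc (l - 1) X Y h * snd (ac X)"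
      by metis
  next
    assume "\<exists>h\<in>homs (l - 1) X Y. enc l X Y f = sg l (snd (ac Y) * enc (l - 1) X Y h) + enc (l - 1) X Y h * snd (ac X)"
    then show "enc l X Y f \<in> Bc l (ac X) (ac Y)" unfolding Bc_def using enc_hm[OF X Y] by blast
  qed
  finally show ?thesis .
qed

lemma shift_0 [simp]: "shift 0 X = X"
  unfolding shift_def cobj_def cdif_def by simp

definition hiso :: "'a::ring ac \<Rightarrow> 'a ac \<Rightarrow> bool" where
  "hiso X Y \<longleftrightarrow> (\<exists>f\<in>Zc 0 X Y. \<exists>g\<in>Zc 0 Y X. g * f - fst X \<in> Bc 0 X X \<and> f * g - fst Y \<in> Bc 0 Y Y)"

lemma htpy_equiv_iff:
  "X \<simeq>\<^sub>K Y \<longleftrightarrow> is_complex X \<and> is_complex Y \<and> hiso (ac X) (ac Y)"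
proof -
  have "(\<exists>f g. chain_map X Y f \<and> chain_map Y X g \<and>
        null_homotopic X X (\<lambda>i. g i * f i - id_cmap X i) \<and>
        null_homotopic Y Y (\<lambda>i. f i * g i - id_cmap Y i)) \<longleftrightarrow> hiso (ac X) (ac Y)"
    if X: "is_complex X" and Y: "is_complex Y"
  proof -
    have nh: "null_homotopic X X (\<lambda>i. g i * f i - id_cmap X i) \<longleftrightarrow>
        enc 0 Y X g * enc 0 X Y f - fst (ac X) \<in> Bc 0 (ac X) (ac X)"
      if X: "is_complex X" and Y: "is_complex Y" and f: "f \<in> homs 0 X Y" and g: "g \<in> homs 0 Y X" for X Y f g
    proof -
      note m = encf_mult[OF bounded_homs[OF Y X g] bounded_homs[OF X Y f], simplified]
      note d = encf_diff[OF ac_bounded(1)[OF X] m(1)]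
      show ?thesis using null_homotopic_iff[OF X X d(1)] d(2) m(2) by (simp add: enc_def ac_def)
    qed
    have cm: "chain_map X Y f \<longleftrightarrow> f \<in> homs 0 X Y \<and> enc 0 X Y f \<in> Zc 0 (ac X) (ac Y)"
      if "is_complex X" "is_complex Y" for X Y and f :: "int \<Rightarrow> 'a mat"
      using chain_map_iff[OF that, of 0] by simp
    show ?thesis
    proof
      assume "\<exists>f g. chain_map X Y f \<and> chain_map Y X g \<and>
        null_homotopic X X (\<lambda>i. g i * f i - id_cmap X i) \<and>
        null_homotopic Y Y (\<lambda>i. f i * g i - id_cmap Y i)"
      then obtain f g where fg: "chain_map X Y f" "chain_map Y X g"
        "null_homotopic X X (\<lambda>i. g i * f i - id_cmap X i)"
        "null_homotopic Y Y (\<lambda>i. f i * g i - id_cmap Y i)" by blast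
      have h: "f \<in> homs 0 X Y" "enc 0 X Y f \<in> Zc 0 (ac X) (ac Y)"
        "g \<in> homs 0 Y X" "enc 0 Y X g \<in> Zc 0 (ac Y) (ac X)"
        using fg cm[OF X Y] cm[OF Y X] by blast+
      then show "hiso (ac X) (ac Y)" unfolding hiso_def
        using nh[OF X Y h(1,3)] nh[OF Y X h(3,1)] fg by blast
    next
      assume "hiso (ac X) (ac Y)"
      then obtain F G where FG: "F \<in> Zc 0 (ac X) (ac Y)" "G \<in> Zc 0 (ac Y) (ac X)"
        "G * F - fst (ac X) \<in> Bc 0 (ac X) (ac X)" "F * G - fst (ac Y) \<in> Bc 0 (ac Y) (ac Y)"
        unfolding hiso_def by blast
      obtain f where f: "f \<in> homs 0 X Y" "enc 0 X Y f = F" using enc_surj[OF X Y ZcD(1)[OF FG(1)]] .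
      obtain g where g: "g \<in> homs 0 Y X" "enc 0 Y X g = G" using enc_surj[OF Y X ZcD(1)[OF FG(2)]] .
      show "\<exists>f g. chain_map X Y f \<and> chain_map Y X g \<and>
        null_homotopic X X (\<lambda>i. g i * f i - id_cmap X i) \<and>
        null_homotopic Y Y (\<lambda>i. f i * g i - id_cmap Y i)"
        using FG f g cm[OF X Y, of f] cm[OF Y X, of g] nh[OF X Y f(1) g(1)] nh[OF Y X g(1) f(1)]
        by (intro exI[of _ f] exI[of _ g]) simp
    qed
  qed
  then show ?thesis unfolding htpy_equiv_def by blast
qed

definition ext_vanish :: "int \<Rightarrow> 'a::ring ac \<Rightarrow> 'a ac \<Rightarrow> bool" where
  "ext_vanish l X Y \<longleftrightarrow> Zc l X Y \<subseteq> Bc l X Y"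

lemma presilting_iff:
  "presilting T \<longleftrightarrow> is_complex T \<and> (\<forall>l>0. ext_vanish (int l) (ac T) (ac T))"
proof -
  have "(\<forall>f. chain_map T (shift l T) f \<longrightarrow> null_homotopic T (shift l T) f) \<longleftrightarrow> ext_vanish l (ac T) (ac T)"
    if T: "is_complex T" for l
  proof
    assume *: "\<forall>f. chain_map T (shift l T) f \<longrightarrow> null_homotopic T (shift l T) f"
    show "ext_vanish l (ac T) (ac T)" unfolding ext_vanish_def
    proof
      fix F assume F: "F \<in> Zc l (ac T) (ac T)"
      obtain f where f: "f \<in> homs l T T" "enc l T T f = F" using enc_surj[OF T T ZcD(1)[OF F]] .
      then show "F \<in> Bc l (ac T) (ac T)"
        using * F chain_map_iff[OF T T] null_homotopic_iff[OF T T bounded_homs[OF T T f(1)]] by blast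
    qed
  next
    assume "ext_vanish l (ac T) (ac T)"
    then show "\<forall>f. chain_map T (shift l T) f \<longrightarrow> null_homotopic T (shift l T) f"
      unfolding ext_vanish_def
      using chain_map_iff[OF T T] null_homotopic_iff[OF T T bounded_homs[OF T T]] by blast
  qed
  then show ?thesis unfolding presilting_def by blast
qed

text \<open>All terms get the same size \<open>n\<close>, larger than every position in use, and the
  idempotent \<open>e\<close> cuts out the actual term in each degree. Images of strict idempotents
  thereby become genuine complexes.\<close>

lemma realize:
  assumes "acx (e, d)" shows "\<exists>X. is_complex X \<and> ac X = (e, d :: 'a::ring_1 fm)"
proof -
  obtain I where I: "finite I" "fm_in I e" "fm_in I d" using ex_fm_in2 by blast
  define ps where "ps = (\<lambda>x. case x of Ix i a \<Rightarrow> a)"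
  define n where "n = Suc (Max (insert 0 (ps ` I)))"
  have out: "Ix i a \<notin> I" if "a \<ge> n" for i a
  proof
    assume "Ix i a \<in> I"
    then have "ps (Ix i a) \<in> insert 0 (ps ` I)" by blast
    then have "ps (Ix i a) \<le> Max (insert 0 (ps ` I))" using I(1) by (intro Max_ge) auto
    then show False using that unfolding n_def ps_def by simp
  qed
  have z: "ent x (Ix i a) (Ix j b) = 0" if "fm_in I x" "a \<ge> n \<or> b \<ge> n" for x :: "'a fm" and i a j b
    using that out fm_inD[OF that(1)] by blast
  define X where "X = ((\<lambda>i. (n, mat n n (\<lambda>(a, b). ent e (Ix (i + 0) a) (Ix i b)))),
     (\<lambda>i. mat n n (\<lambda>(a, b). ent d (Ix (i + 1) a) (Ix i b))))"
  have dX: "dm X = (\<lambda>_. n)" and idX: "id_cmap X = (\<lambda>i. mat n n (\<lambda>(a, b). ent e (Ix (i + 0) a) (Ix i b)))"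
    and cX: "cdif X = (\<lambda>i. mat n n (\<lambda>(a, b). ent d (Ix (i + 1) a) (Ix i b)))"
    by (simp_all add: X_def dm_def fun_eq_iff cobj_def id_cmap_def cdif_def)
  have dgs: "dg 0 e" "dg 1 d" using assms unfolding acx_def by auto
  have se: "bounded_mats 0 (\<lambda>_. n) (\<lambda>_. n) (\<lambda>i. mat n n (\<lambda>(a, b). ent e (Ix (i + 0) a) (Ix i b)))"
    "encf 0 (\<lambda>_. n) (\<lambda>_. n) (\<lambda>i. mat n n (\<lambda>(a, b). ent e (Ix (i + 0) a) (Ix i b))) = e"
    using encf_surj[of 0 e "\<lambda>_. n" "\<lambda>_. n", OF dgs(1)] z[OF I(2)] by blast+
  have sd: "bounded_mats 1 (\<lambda>_. n) (\<lambda>_. n) (\<lambda>i. mat n n (\<lambda>(a, b). ent d (Ix (i + 1) a) (Ix i b)))"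
    "encf 1 (\<lambda>_. n) (\<lambda>_. n) (\<lambda>i. mat n n (\<lambda>(a, b). ent d (Ix (i + 1) a) (Ix i b))) = d"
    using encf_surj[of 1 d "\<lambda>_. n" "\<lambda>_. n", OF dgs(2)] z[OF I(3)] by blast+
  have "ac X = (e, d)" unfolding ac_def dX idX cX using se(2) sd(2) by simp
  moreover have "is_complex X"
    using is_complexI[of X] se(1) sd(1) assms \<open>ac X = (e, d)\<close> unfolding dX idX cX by simp
  ultimately show ?thesis by blast
qed

lemma two_term_iff:
  "two_term X \<longleftrightarrow> is_complex X \<and> (\<forall>i a j b. i \<noteq> -1 \<longrightarrow> i \<noteq> 0 \<longrightarrow> ent (fst (ac X)) (Ix i a) (Ix j b) = 0)"
proof -
  have "(\<forall>i. i \<noteq> -1 \<and> i \<noteq> 0 \<longrightarrow> snd (cobj X i) = 0\<^sub>m (fst (cobj X i)) (fst (cobj X i))) \<longleftrightarrow>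
    (\<forall>i a j b. i \<noteq> -1 \<longrightarrow> i \<noteq> 0 \<longrightarrow> ent (fst (ac X)) (Ix i a) (Ix j b) = 0)" if X: "is_complex X"
  proof -
    note e = ent_encf[OF ac_bounded(1)[OF X]]
    have "snd (cobj X i) = 0\<^sub>m (dm X i) (dm X i) \<longleftrightarrow> (\<forall>a j b. ent (fst (ac X)) (Ix i a) (Ix j b) = 0)" for i
    proof
      assume "snd (cobj X i) = 0\<^sub>m (dm X i) (dm X i)"
      then show "\<forall>a j b. ent (fst (ac X)) (Ix i a) (Ix j b) = 0"
        unfolding ac_def fst_conv e by (auto simp: id_cmap_def)
    next
      assume *: "\<forall>a j b. ent (fst (ac X)) (Ix i a) (Ix j b) = 0"
      show "snd (cobj X i) = 0\<^sub>m (dm X i) (dm X i)"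
      proof (rule eq_matI)
        fix a b assume "a < dim_row (0\<^sub>m (dm X i) (dm X i))" "b < dim_col (0\<^sub>m (dm X i) (dm X i))"
        then show "snd (cobj X i) $$ (a, b) = 0\<^sub>m (dm X i) (dm X i) $$ (a, b)"
          using spec[OF spec[OF spec[OF *, of a], of i], of b] unfolding ac_def fst_conv e
          by (simp add: id_cmap_def)
      qed (use is_complexD(1)[OF X, of i] in auto)
    qed
    then show ?thesis unfolding dm_def by blast
  qed
  then show ?thesis unfolding two_term_def by blast
qed

section \<open>The Krull-Schmidt theorem\<close>

text \<open>An additive category given by hom groups \<open>H\<close> inside a ring of morphisms, an ideal \<open>N\<close>
  of morphisms to be regarded as zero, and units \<open>un\<close>. The assumption \<open>exchange\<close> says that
  endomorphism rings modulo \<open>N\<close> are exchange rings; \<open>mu\<close> bounds the number of summands.\<close>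

locale ks_cat =
  fixes ob :: "'o \<Rightarrow> bool" and H N :: "'o \<Rightarrow> 'o \<Rightarrow> 'm::ring set" and un :: "'o \<Rightarrow> 'm"
    and sm :: "'o \<Rightarrow> 'o \<Rightarrow> 'o" and zr :: 'o and mu :: "'o \<Rightarrow> nat"
  assumes H_zero: "0 \<in> H X Y"
    and H_add: "f \<in> H X Y \<Longrightarrow> g \<in> H X Y \<Longrightarrow> f + g \<in> H X Y"
    and H_uminus: "f \<in> H X Y \<Longrightarrow> - f \<in> H X Y"
    and H_mult: "g \<in> H Y W \<Longrightarrow> f \<in> H X Y \<Longrightarrow> g * f \<in> H X W"
    and un_H: "ob X \<Longrightarrow> un X \<in> H X X"
    and un_left: "f \<in> H X Y \<Longrightarrow> un Y * f = f"
    and un_right: "f \<in> H X Y \<Longrightarrow> f * un X = f"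
    and N_zero: "0 \<in> N X Y"
    and N_add: "f \<in> N X Y \<Longrightarrow> g \<in> N X Y \<Longrightarrow> f + g \<in> N X Y"
    and N_uminus: "f \<in> N X Y \<Longrightarrow> - f \<in> N X Y"
    and N_left: "g \<in> H Y W \<Longrightarrow> f \<in> N X Y \<Longrightarrow> g * f \<in> N X W"
    and N_right: "g \<in> N Y W \<Longrightarrow> f \<in> H X Y \<Longrightarrow> g * f \<in> N X W"
    and ob_zr: "ob zr" and un_zr: "un zr = 0"
    and ob_sm: "ob X \<Longrightarrow> ob Y \<Longrightarrow> ob (sm X Y)"
    and biproduct: "ob X \<Longrightarrow> ob Y \<Longrightarrow> \<exists>i1 i2 p1 p2. i1 \<in> H X (sm X Y) \<and> i2 \<in> H Y (sm X Y) \<and>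
      p1 \<in> H (sm X Y) X \<and> p2 \<in> H (sm X Y) Y \<and> p1 * i1 = un X \<and> p2 * i2 = un Y \<and>
      p1 * i2 = 0 \<and> p2 * i1 = 0 \<and> i1 * p1 + i2 * p2 = un (sm X Y)"
    and exchange: "ob X \<Longrightarrow> f \<in> H X X \<Longrightarrow> \<exists>e\<in>H X X. \<exists>u\<in>H X X. \<exists>v\<in>H X X. e * e - e \<in> N X X \<and>
      f * u - e \<in> N X X \<and> u * f - e \<in> N X X \<and>
      (un X - f) * v - (un X - e) \<in> N X X \<and> v * (un X - f) - (un X - e) \<in> N X X"
    and splitting: "ob X \<Longrightarrow> f \<in> H X X \<Longrightarrow> f * f - f \<in> N X X \<Longrightarrow> \<exists>Y Z i1 i2 p1 p2. ob Y \<and> ob Z \<and>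
      i1 \<in> H Y X \<and> i2 \<in> H Z X \<and> p1 \<in> H X Y \<and> p2 \<in> H X Z \<and> p1 * i1 = un Y \<and> p2 * i2 = un Z \<and>
      p1 * i2 = 0 \<and> p2 * i1 = 0 \<and> i1 * p1 + i2 * p2 = un X \<and> i1 * p1 - f \<in> N X X \<and>
      (f \<notin> N X X \<longrightarrow> un X - f \<notin> N X X \<longrightarrow> mu Y < mu X \<and> mu Z < mu X)"
begin

lemma H_diff: "f \<in> H X Y \<Longrightarrow> g \<in> H X Y \<Longrightarrow> f - g \<in> H X Y"
  using H_add[of f X Y "- g"] H_uminus[of g X Y] by simp

lemma N_diff: "f \<in> N X Y \<Longrightarrow> g \<in> N X Y \<Longrightarrow> f - g \<in> N X Y"
  using N_add[of f X Y "- g"] N_uminus[of g X Y] by simp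

lemma N_mid: "x \<in> N A B \<Longrightarrow> g \<in> H B C \<Longrightarrow> f \<in> H D A \<Longrightarrow> g * x * f \<in> N D C"
  using N_left N_right by blast

lemma N_cong: "f - g \<in> N X Y \<Longrightarrow> g \<in> N X Y \<Longrightarrow> f \<in> N X Y"
  using N_add[of "f - g" X Y g] by simp

lemma N_trans: "f - g \<in> N X Y \<Longrightarrow> g - h \<in> N X Y \<Longrightarrow> f - h \<in> N X Y"
  using N_add[of "f - g" X Y "g - h"] by simp

lemma N_sym: "f - g \<in> N X Y \<Longrightarrow> g - f \<in> N X Y"
  using N_uminus[of "f - g" X Y] by simp

definition iso :: "'o \<Rightarrow> 'o \<Rightarrow> bool" where
  "iso X Y \<longleftrightarrow> ob X \<and> ob Y \<and>
     (\<exists>f\<in>H X Y. \<exists>g\<in>H Y X. g * f - un X \<in> N X X \<and> f * g - un Y \<in> N Y Y)"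

lemma iso_ob: "iso X Y \<Longrightarrow> ob X" "iso X Y \<Longrightarrow> ob Y"
  unfolding iso_def by auto

lemma iso_refl: "ob X \<Longrightarrow> iso X X"
  unfolding iso_def using un_H[of X] un_left[of "un X" X X]
  by (auto intro!: bexI[of _ "un X"] simp: N_zero)

lemma iso_sym: "iso X Y \<Longrightarrow> iso Y X"
  unfolding iso_def by blast

lemma iso_trans:
  assumes "iso X Y" "iso Y W" shows "iso X W"
proof -
  obtain f g where f: "f \<in> H X Y" "g \<in> H Y X" "g * f - un X \<in> N X X" "f * g - un Y \<in> N Y Y"
    using assms(1) unfolding iso_def by blast
  obtain f' g' where f': "f' \<in> H Y W" "g' \<in> H W Y" "g' * f' - un Y \<in> N Y Y" "f' * g' - un W \<in> N W W"
    using assms(2) unfolding iso_def by blast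
  have "(g * g') * (f' * f) - un X = g * (g' * f' - un Y) * f + (g * f - un X)"
    using un_left[OF f(1)] by (simp add: algebra_simps)
  also have "\<dots> \<in> N X X" using f f' by (intro N_add N_mid[of _ Y Y])
  finally have 1: "(g * g') * (f' * f) - un X \<in> N X X" .
  have "(f' * f) * (g * g') - un W = f' * (f * g - un Y) * g' + (f' * g' - un W)"
    using un_left[OF f'(2)] by (simp add: algebra_simps)
  also have "\<dots> \<in> N W W" using f f' by (intro N_add N_mid[of _ Y Y])
  finally have 2: "(f' * f) * (g * g') - un W \<in> N W W" .
  show ?thesis
    unfolding iso_def using iso_ob[OF assms(1)] iso_ob[OF assms(2)] H_mult[OF f'(1) f(1)] H_mult[OF f(2) f'(2)] 1 2
    by blast
qed

text \<open>The biproduct equations hold only modulo \<open>N\<close>, so that the notion is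
  invariant under isomorphism of \<open>B\<close>, \<open>Y\<close> and \<open>Z\<close>.\<close>

definition bip :: "'o \<Rightarrow> 'o \<Rightarrow> 'o \<Rightarrow> 'm \<Rightarrow> 'm \<Rightarrow> 'm \<Rightarrow> 'm \<Rightarrow> bool" where
  "bip B Y Z i1 i2 p1 p2 \<longleftrightarrow> ob B \<and> ob Y \<and> ob Z \<and>
     i1 \<in> H Y B \<and> i2 \<in> H Z B \<and> p1 \<in> H B Y \<and> p2 \<in> H B Z \<and>
     p1 * i1 - un Y \<in> N Y Y \<and> p2 * i2 - un Z \<in> N Z Z \<and> p1 * i2 \<in> N Z Y \<and> p2 * i1 \<in> N Y Z \<and>
     i1 * p1 + i2 * p2 - un B \<in> N B B"

lemma bipD:
  assumes "bip B Y Z i1 i2 p1 p2"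
  shows "ob B" "ob Y" "ob Z" "i1 \<in> H Y B" "i2 \<in> H Z B" "p1 \<in> H B Y" "p2 \<in> H B Z"
     "p1 * i1 - un Y \<in> N Y Y" "p2 * i2 - un Z \<in> N Z Z" "p1 * i2 \<in> N Z Y" "p2 * i1 \<in> N Y Z"
     "i1 * p1 + i2 * p2 - un B \<in> N B B"
  using assms unfolding bip_def by auto

lemma bip_swap: "bip B Y Z i1 i2 p1 p2 \<Longrightarrow> bip B Z Y i2 i1 p2 p1"
  unfolding bip_def by (auto simp: add.commute)

lemma bip_sm:
  assumes "ob X" "ob Y" obtains i1 i2 p1 p2 where "bip (sm X Y) X Y i1 i2 p1 p2"
  using biproduct[OF assms] ob_sm[OF assms] assms unfolding bip_def by (metis N_zero diff_self)

lemma bip_iso_half: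
  assumes b: "bip B Y Z i1 i2 p1 p2" and c: "bip B' Y' Z' j1 j2 q1 q2"
    and a: "a \<in> H Y Y'" "a' \<in> H Y' Y" "a' * a - un Y \<in> N Y Y"
    and d: "d \<in> H Z Z'" "d' \<in> H Z' Z" "d' * d - un Z \<in> N Z Z"
  shows "(i1 * a' * q1 + i2 * d' * q2) * (j1 * a * p1 + j2 * d * p2) - un B \<in> N B B"
proof -
  note bD = bipD[OF b] and cD = bipD[OF c]
  have "(i1 * a' * q1 + i2 * d' * q2) * (j1 * a * p1 + j2 * d * p2) - un B
    = (i1 * a') * (q1 * j1 - un Y') * (a * p1) + (i1 * a') * (q1 * j2) * (d * p2)
      + (i2 * d') * (q2 * j1) * (a * p1) + (i2 * d') * (q2 * j2 - un Z') * (d * p2)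
      + i1 * (a' * a - un Y) * p1 + i2 * (d' * d - un Z) * p2 + (i1 * p1 + i2 * p2 - un B)"
    using un_left[OF a(1)] un_left[OF d(1)] un_left[OF bD(6)] un_left[OF bD(7)]
      un_right[OF a(2)] un_right[OF d(2)] un_left[OF H_mult[OF a(1) bD(6)]] un_left[OF H_mult[OF d(1) bD(7)]]
    by (simp add: algebra_simps)
  also have "\<dots> \<in> N B B"
    by (intro N_add bD(12) N_mid[OF cD(8) H_mult[OF bD(4) a(2)] H_mult[OF a(1) bD(6)]]
        N_mid[OF cD(10) H_mult[OF bD(4) a(2)] H_mult[OF d(1) bD(7)]]
        N_mid[OF cD(11) H_mult[OF bD(5) d(2)] H_mult[OF a(1) bD(6)]]
        N_mid[OF cD(9) H_mult[OF bD(5) d(2)] H_mult[OF d(1) bD(7)]]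
        N_mid[OF a(3) bD(4,6)] N_mid[OF d(3) bD(5,7)])
  finally show ?thesis .
qed

lemma bip_iso:
  assumes b: "bip B Y Z i1 i2 p1 p2" and c: "bip B' Y' Z' j1 j2 q1 q2" and "iso Y Y'" "iso Z Z'"
  shows "iso B B'"
proof -
  obtain a a' where a: "a \<in> H Y Y'" "a' \<in> H Y' Y" "a' * a - un Y \<in> N Y Y" "a * a' - un Y' \<in> N Y' Y'"
    using assms(3) unfolding iso_def by blast
  obtain d d' where d: "d \<in> H Z Z'" "d' \<in> H Z' Z" "d' * d - un Z \<in> N Z Z" "d * d' - un Z' \<in> N Z' Z'"
    using assms(4) unfolding iso_def by blast
  note bD = bipD[OF b] and cD = bipD[OF c]
  show ?thesis unfolding iso_def
    using bip_iso_half[OF b c a(1,2,3) d(1,2,3)] bip_iso_half[OF c b a(2,1,4) d(2,1,4)] bD cD a d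
    by (intro conjI bexI[of _ "j1 * a * p1 + j2 * d * p2"] bexI[of _ "i1 * a' * q1 + i2 * d' * q2"])
       (auto intro!: H_add H_mult)
qed

lemma bip_imp_iso: "bip B Y Z i1 i2 p1 p2 \<Longrightarrow> iso B (sm Y Z)"
  using bip_sm[of Y Z] bip_iso iso_refl bipD(2,3) by metis

lemma sm_cong: "iso X X' \<Longrightarrow> iso Y Y' \<Longrightarrow> iso (sm X Y) (sm X' Y')"
  using bip_sm[of X Y] bip_sm[of X' Y'] bip_iso iso_ob by metis

lemma sm_comm: "ob X \<Longrightarrow> ob Y \<Longrightarrow> iso (sm X Y) (sm Y X)"
  using bip_sm[of X Y] bip_swap bip_imp_iso by metis

lemma iso_imp_bip:
  assumes "iso B (sm Y Z)" "ob Y" "ob Z" obtains i1 i2 p1 p2 where "bip B Y Z i1 i2 p1 p2"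
proof -
  obtain f g where f: "f \<in> H B (sm Y Z)" "g \<in> H (sm Y Z) B" "g * f - un B \<in> N B B"
    "f * g - un (sm Y Z) \<in> N (sm Y Z) (sm Y Z)" and B: "ob B"
    using assms(1) unfolding iso_def by blast
  obtain j1 j2 q1 q2 where c: "bip (sm Y Z) Y Z j1 j2 q1 q2" using bip_sm[OF assms(2,3)] .
  note cD = bipD[OF c]
  have m: "q * f * (g * j) - q * j \<in> N A C" if "q \<in> H (sm Y Z) C" "j \<in> H A (sm Y Z)" for q j A C
  proof -
    have "q * f * (g * j) - q * j = q * (f * g - un (sm Y Z)) * j"
      using un_left[OF that(2)] by (simp add: algebra_simps)
    then show ?thesis using N_mid[OF f(4) that] by simp
  qed
  have "g * j1 * (q1 * f) + g * j2 * (q2 * f) - un B =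
    g * (j1 * q1 + j2 * q2 - un (sm Y Z)) * f + (g * f - un B)"
    using un_left[OF f(1)] by (simp add: algebra_simps)
  also have "\<dots> \<in> N B B" by (intro N_add f(3) N_mid[OF cD(12) f(2,1)])
  finally have 5: "g * j1 * (q1 * f) + g * j2 * (q2 * f) - un B \<in> N B B" .
  have "bip B Y Z (g * j1) (g * j2) (q1 * f) (q2 * f)"
    unfolding bip_def
    by (intro conjI B cD(2,3) H_mult[OF f(2) cD(4)] H_mult[OF f(2) cD(5)] H_mult[OF cD(6) f(1)]
        H_mult[OF cD(7) f(1)] N_trans[OF m[OF cD(6,4)] cD(8)] N_trans[OF m[OF cD(7,5)] cD(9)]
        N_cong[OF m[OF cD(6,5)] cD(10)] N_cong[OF m[OF cD(7,4)] cD(11)] 5)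
  then show thesis using that by blast
qed

lemma iso_zr_iff: "ob X \<Longrightarrow> iso X zr \<longleftrightarrow> un X \<in> N X X"
proof
  assume "ob X" "un X \<in> N X X"
  then show "iso X zr"
    unfolding iso_def using ob_zr H_zero un_zr N_uminus N_zero by (auto intro!: bexI[of _ 0])
next
  assume "iso X zr"
  then obtain f g where f: "f \<in> H X zr" "g \<in> H zr X" "g * f - un X \<in> N X X" unfolding iso_def by blast
  have "f = 0" using un_left[OF f(1)] un_zr by simp
  then show "un X \<in> N X X" using N_uminus[OF f(3)] by simp
qed

lemma sm_zr: assumes "ob X" shows "iso (sm X zr) X"
proof -
  have "bip X X zr (un X) 0 (un X) 0"
    unfolding bip_def using assms un_H[OF assms] un_left[OF un_H[OF assms]] ob_zr H_zero N_zero un_zr by auto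
  then show ?thesis using bip_imp_iso iso_sym by blast
qed

text \<open>Regroups \<open>X + (Y + W')\<close> as \<open>Y + (X + W')\<close>. It serves both for
  the symmetry of iterated sums and for moving a summand to the front in the exchange
  argument.\<close>

lemma bip_assoc_swap:
  assumes b: "bip B X W j1 j2 q1 q2" and w: "bip W Y W' f i g p" and v: "bip V X W' k1 k2 r1 r2"
  shows "bip B Y V (j2 * f) (j1 * r1 + j2 * i * r2) (g * q2) (k1 * q1 + k2 * p * q2)"
proof -
  note bD = bipD[OF b] and wD = bipD[OF w] and vD = bipD[OF v]
  have 1: "g * q2 * (j2 * f) - un Y \<in> N Y Y"
  proof -
    have "g * q2 * (j2 * f) - un Y = g * (q2 * j2 - un W) * f + (g * f - un Y)"
      using un_left[OF wD(4)] by (simp add: algebra_simps)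
    also have "\<dots> \<in> N Y Y" using bD wD by (intro N_add N_mid[of _ W W])
    finally show ?thesis .
  qed
  have 2: "(k1 * q1 + k2 * p * q2) * (j1 * r1 + j2 * i * r2) - un V \<in> N V V"
  proof -
    have "(k1 * q1 + k2 * p * q2) * (j1 * r1 + j2 * i * r2) - un V =
      k1 * (q1 * j1 - un X) * r1 + k1 * (q1 * j2) * (i * r2) + (k2 * p) * (q2 * j1) * r1
      + (k2 * p) * (q2 * j2 - un W) * (i * r2) + k2 * (p * i - un W') * r2 + (k1 * r1 + k2 * r2 - un V)"
      using un_left[OF wD(5)] un_left[OF vD(6)] un_left[OF vD(7)] un_left[OF H_mult[OF wD(5) vD(7)]]
      by (simp add: algebra_simps)
    also have "\<dots> \<in> N V V"
      by (intro N_add vD(12) N_mid[OF bD(8) vD(4,6)] N_mid[OF bD(10) vD(4) H_mult[OF wD(5) vD(7)]]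
          N_mid[OF bD(11) H_mult[OF vD(5) wD(7)] vD(6)]
          N_mid[OF bD(9) H_mult[OF vD(5) wD(7)] H_mult[OF wD(5) vD(7)]] N_mid[OF wD(9) vD(5,7)])
    finally show ?thesis .
  qed
  have 3: "g * q2 * (j1 * r1 + j2 * i * r2) \<in> N V Y"
  proof -
    have "g * q2 * (j1 * r1 + j2 * i * r2) = g * (q2 * j1) * r1 + g * (q2 * j2 - un W) * (i * r2) + (g * i) * r2"
      using un_left[OF wD(5)] un_left[OF H_mult[OF wD(5) vD(7)]] by (simp add: algebra_simps)
    also have "\<dots> \<in> N V Y"
      by (intro N_add N_mid[OF bD(11) wD(6) vD(6)] N_mid[OF bD(9) wD(6) H_mult[OF wD(5) vD(7)]]
          N_right[OF wD(10) vD(7)])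
    finally show ?thesis .
  qed
  have 4: "(k1 * q1 + k2 * p * q2) * (j2 * f) \<in> N Y V"
  proof -
    have "(k1 * q1 + k2 * p * q2) * (j2 * f) = k1 * (q1 * j2) * f + (k2 * p) * (q2 * j2 - un W) * f + k2 * (p * f)"
      using un_left[OF wD(4)] by (simp add: algebra_simps)
    also have "\<dots> \<in> N Y V"
      by (intro N_add N_mid[OF bD(10) vD(4) wD(4)] N_mid[OF bD(9) H_mult[OF vD(5) wD(7)] wD(4)]
          N_left[OF vD(5) wD(11)])
    finally show ?thesis .
  qed
  have 5: "j2 * f * (g * q2) + (j1 * r1 + j2 * i * r2) * (k1 * q1 + k2 * p * q2) - un B \<in> N B B"
  proof -
    have "j2 * f * (g * q2) + (j1 * r1 + j2 * i * r2) * (k1 * q1 + k2 * p * q2) - un B =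
      j1 * (r1 * k1 - un X) * q1 + j1 * (r1 * k2) * (p * q2) + (j2 * i) * (r2 * k1) * q1
      + (j2 * i) * (r2 * k2 - un W') * (p * q2) + j2 * (f * g + i * p - un W) * q2 + (j1 * q1 + j2 * q2 - un B)"
      using un_left[OF wD(7)] un_left[OF bD(6)] un_left[OF bD(7)] un_left[OF H_mult[OF wD(7) bD(7)]]
      by (simp add: algebra_simps)
    also have "\<dots> \<in> N B B"
      by (intro N_add bD(12) N_mid[OF vD(8) bD(4,6)] N_mid[OF vD(10) bD(4) H_mult[OF wD(7) bD(7)]]
          N_mid[OF vD(11) H_mult[OF bD(5) wD(5)] bD(6)]
          N_mid[OF vD(9) H_mult[OF bD(5) wD(5)] H_mult[OF wD(7) bD(7)]] N_mid[OF wD(12) bD(5,7)])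
    finally show ?thesis .
  qed
  show ?thesis unfolding bip_def using 1 2 3 4 5 bD wD vD by (auto intro!: H_add H_mult)
qed

lemma sm_left_comm: "ob X \<Longrightarrow> ob Y \<Longrightarrow> ob Z \<Longrightarrow> iso (sm X (sm Y Z)) (sm Y (sm X Z))"
  using bip_sm[of X "sm Y Z"] bip_sm[of Y Z] bip_sm[of X Z] bip_assoc_swap bip_imp_iso ob_sm by metis

lemma sm_assoc:
  assumes "ob X" "ob Y" "ob Z" shows "iso (sm (sm X Y) Z) (sm X (sm Y Z))"
proof -
  have "iso (sm (sm X Y) Z) (sm Z (sm X Y))" using assms by (intro sm_comm ob_sm)
  moreover have "iso (sm Z (sm X Y)) (sm X (sm Z Y))" using assms by (intro sm_left_comm)
  moreover have "iso (sm X (sm Z Y)) (sm X (sm Y Z))" using assms by (intro sm_cong iso_refl sm_comm)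
  ultimately show ?thesis using iso_trans by blast
qed

text \<open>The identity of \<open>B\<close>, written from \<open>Y + Z\<close> to
  \<open>X + W\<close>, is an invertible two by two matrix with corner \<open>q1 * i1\<close>. If
  \<open>a\<close> inverts the corner, the Schur complement
  \<open>q2 * i2 - q2 * i1 * a * q1 * i2\<close> is invertible, and its inverse is the block
  \<open>p2 * j2\<close> of the inverse matrix.\<close>

lemma schur_half:
  assumes b: "bip B Y Z i1 i2 p1 p2" and c: "bip B X W j1 j2 q1 q2"
    and a: "a \<in> H X Y" "q1 * i1 * a - un X \<in> N X X"
  shows "(p2 * j2) * (q2 * i2 - q2 * i1 * a * q1 * i2) - un Z \<in> N Z Z"
proof -
  note bD = bipD[OF b] and cD = bipD[OF c]
  have "(p2 * j2) * (q2 * i2 - q2 * i1 * a * q1 * i2) - un Z =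
    (p2 * i2 - un Z) + p2 * (j1 * q1 + j2 * q2 - un B) * i2 - (p2 * i1) * (a * q1 * i2)
    - p2 * (j1 * q1 + j2 * q2 - un B) * (i1 * a * q1 * i2) + (p2 * j1) * (q1 * i1 * a - un X) * (q1 * i2)"
    using un_left[OF bD(5)] un_left[OF bD(4)] un_left[OF cD(6)] un_left[OF H_mult[OF cD(6) bD(5)]]
      un_left[OF H_mult[OF bD(4) H_mult[OF a(1) H_mult[OF cD(6) bD(5)]]]]
    by (simp add: algebra_simps)
  also have "\<dots> \<in> N Z Z"
    by (intro N_add N_diff bD(9) N_mid[OF cD(12) bD(7,5)]
        N_right[OF bD(11) H_mult[OF H_mult[OF a(1) cD(6)] bD(5)]]
        N_mid[OF cD(12) bD(7) H_mult[OF H_mult[OF H_mult[OF bD(4) a(1)] cD(6)] bD(5)]]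
        N_mid[OF a(2) H_mult[OF bD(7) cD(4)] H_mult[OF cD(6) bD(5)]])
  finally show ?thesis .
qed

lemma schur_half':
  assumes b: "bip B Y Z i1 i2 p1 p2" and c: "bip B X W j1 j2 q1 q2"
    and a: "a \<in> H X Y" "a * (q1 * i1) - un Y \<in> N Y Y"
  shows "(q2 * i2 - q2 * i1 * a * q1 * i2) * (p2 * j2) - un W \<in> N W W"
proof -
  note bD = bipD[OF b] and cD = bipD[OF c]
  have "(q2 * i2 - q2 * i1 * a * q1 * i2) * (p2 * j2) - un W =
    (q2 * j2 - un W) + q2 * (i1 * p1 + i2 * p2 - un B) * j2 - (q2 * i1 * a) * (q1 * j2)
    - (q2 * i1 * a * q1) * (i1 * p1 + i2 * p2 - un B) * j2 + (q2 * i1) * (a * (q1 * i1) - un Y) * (p1 * j2)"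
    using un_left[OF bD(6)] un_left[OF cD(5)] un_left[OF H_mult[OF bD(6) cD(5)]]
    by (simp add: algebra_simps)
  also have "\<dots> \<in> N W W"
    by (intro N_add N_diff cD(9) N_mid[OF bD(12) cD(7,5)]
        N_left[OF H_mult[OF H_mult[OF cD(7) bD(4)] a(1)] cD(10)]
        N_mid[OF bD(12) H_mult[OF H_mult[OF H_mult[OF cD(7) bD(4)] a(1)] cD(6)] cD(5)]
        N_mid[OF a(2) H_mult[OF cD(7) bD(4)] H_mult[OF bD(6) cD(5)]])
  finally show ?thesis .
qed

lemma schur:
  assumes b: "bip B Y Z i1 i2 p1 p2" and c: "bip B X W j1 j2 q1 q2"
    and a: "a \<in> H X Y" "a * (q1 * i1) - un Y \<in> N Y Y" "q1 * i1 * a - un X \<in> N X X"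
  shows "iso Z W"
proof -
  note bD = bipD[OF b] and cD = bipD[OF c]
  show ?thesis unfolding iso_def
    using schur_half[OF b c a(1,3)] schur_half'[OF b c a(1,2)] bD cD a(1)
    by (intro conjI bexI[of _ "q2 * i2 - q2 * i1 * a * q1 * i2"] bexI[of _ "p2 * j2"])
       (auto intro!: H_diff H_mult)
qed

definition indec :: "'o \<Rightarrow> bool" where
  "indec X \<longleftrightarrow> ob X \<and> \<not> iso X zr \<and>
     (\<forall>Y Z. ob Y \<longrightarrow> ob Z \<longrightarrow> iso X (sm Y Z) \<longrightarrow> iso Y zr \<or> iso Z zr)"

lemma indec_ob: "indec X \<Longrightarrow> ob X" and indec_nz: "indec X \<Longrightarrow> un X \<notin> N X X"
  unfolding indec_def using iso_zr_iff by blast+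

lemma zero_factor: "un Y \<in> N Y Y \<Longrightarrow> i \<in> H Y X \<Longrightarrow> p \<in> H W Y \<Longrightarrow> i * p \<in> N W X"
  using N_mid[of "un Y" Y Y i X p W] un_right by simp

text \<open>The idempotent \<open>e\<close> supplied by \<open>exchange\<close> splits
  \<open>X\<close>, so indecomposability makes it 0 or the unit modulo \<open>N\<close>. Then
  \<open>un X - f\<close> or \<open>f\<close> is invertible: the endomorphism ring is local.\<close>

lemma indec_local:
  assumes X: "indec X" and f: "f \<in> H X X"
  shows "(\<exists>u\<in>H X X. f * u - un X \<in> N X X \<and> u * f - un X \<in> N X X) \<or>
    (\<exists>v\<in>H X X. (un X - f) * v - un X \<in> N X X \<and> v * (un X - f) - un X \<in> N X X)"
proof -
  note oX = indec_ob[OF X]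
  obtain e u v where e: "e \<in> H X X" "u \<in> H X X" "v \<in> H X X" "e * e - e \<in> N X X"
    "f * u - e \<in> N X X" "u * f - e \<in> N X X"
    "(un X - f) * v - (un X - e) \<in> N X X" "v * (un X - f) - (un X - e) \<in> N X X"
    using exchange[OF oX f] by blast
  obtain Y Z i1 i2 p1 p2 where s: "ob Y" "ob Z" "i1 \<in> H Y X" "i2 \<in> H Z X" "p1 \<in> H X Y" "p2 \<in> H X Z"
    "p1 * i1 = un Y" "p2 * i2 = un Z" "p1 * i2 = 0" "p2 * i1 = 0" "i1 * p1 + i2 * p2 = un X"
    "i1 * p1 - e \<in> N X X"
    using splitting[OF oX e(1,4)] by blast
  have "bip X Y Z i1 i2 p1 p2" unfolding bip_def using s oX N_zero by auto
  then have "iso X (sm Y Z)" by (rule bip_imp_iso)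
  then have "iso Y zr \<or> iso Z zr" using X s(1,2) unfolding indec_def by blast
  then show ?thesis
  proof
    assume "iso Y zr"
    then have "un Y \<in> N Y Y" using iso_zr_iff s(1) by blast
    then have "i1 * p1 \<in> N X X" using zero_factor s by blast
    then have "e \<in> N X X" using N_diff[OF _ s(12)] by fastforce
    then have "(un X - f) * v - un X \<in> N X X" "v * (un X - f) - un X \<in> N X X"
      using N_diff[OF e(7)] N_diff[OF e(8)] by fastforce+
    then show ?thesis using e by blast
  next
    assume "iso Z zr"
    then have "un Z \<in> N Z Z" using iso_zr_iff s(2) by blast
    then have "i2 * p2 \<in> N X X" using zero_factor s by blast
    then have "e - un X \<in> N X X"
      using N_sym[OF s(12)] s(11) N_diff[of "e - i1 * p1" X X "i2 * p2"] by (simp add: algebra_simps)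
    then have "f * u - un X \<in> N X X" "u * f - un X \<in> N X X"
      using N_trans e(5,6) by blast+
    then show ?thesis using e by blast
  qed
qed

text \<open>\<open>f * g\<close> is idempotent modulo \<open>N\<close> in a local ring. If it is
  invertible it is the unit; if its complement is invertible, then \<open>Y\<close> is zero, which
  is excluded.\<close>

lemma retract_indec:
  assumes X: "indec X" and Y: "un Y \<notin> N Y Y" and f: "f \<in> H Y X" "g \<in> H X Y" "g * f - un Y \<in> N Y Y"
  shows "f * g - un X \<in> N X X"
proof -
  have oX: "ob X" using X indec_ob by blast
  have idem: "f * g * (f * g) - f * g \<in> N X X"
  proof -
    have "f * g * (f * g) - f * g = f * (g * f - un Y) * g"
      using un_left[OF f(2)] by (simp add: algebra_simps)
    then show ?thesis using N_mid[OF f(3) f(1) f(2)] by simp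
  qed
  have fg: "f * g \<in> H X X" using H_mult f by blast
  from indec_local[OF X fg] show ?thesis
  proof (elim disjE bexE conjE)
    fix u assume u: "u \<in> H X X" "f * g * u - un X \<in> N X X" "u * (f * g) - un X \<in> N X X"
    have "f * g - un X = - ((u * (f * g) - un X) * (f * g)) + u * (f * g * (f * g) - f * g) + (u * (f * g) - un X)"
      using un_left[OF fg] by (simp add: algebra_simps)
    also have "\<dots> \<in> N X X" using u idem fg by (intro N_add N_uminus N_right[OF u(3)] N_left[OF u(1)])
    finally show ?thesis .
  next
    fix v assume v: "v \<in> H X X" "(un X - f * g) * v - un X \<in> N X X" "v * (un X - f * g) - un X \<in> N X X"
    have "un Y = - (g * f - un Y) + (- (g * (v * (un X - f * g) - un X) * f) - g * v * f * (g * f - un Y))"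
      using un_right[OF f(1)] un_left[OF f(1)] by (simp add: algebra_simps)
    also have "\<dots> \<in> N Y Y"
      by (intro N_add N_uminus N_diff f(3) N_mid[OF v(3) f(2,1)] N_left[OF H_mult[OF H_mult[OF f(2) v(1)] f(1)] f(3)])
    finally show ?thesis using Y by blast
  qed
qed

text \<open>The idempotent \<open>f * g\<close> of \<open>W\<close> splits, and its image is
  replaced by \<open>Y\<close>, using \<open>f\<close> and \<open>g\<close> themselves as inclusion
  and projection.\<close>

lemma split_retract:
  assumes f: "f \<in> H Y W" "g \<in> H W Y" "g * f - un Y \<in> N Y Y" and o: "ob Y" "ob W"
  obtains W' i p where "bip W Y W' f i g p"
proof -
  have "f * g * (f * g) - f * g = f * (g * f - un Y) * g"
    using un_left[OF f(2)] by (simp add: algebra_simps)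
  then have "f * g * (f * g) - f * g \<in> N W W" using N_mid[OF f(3) f(1) f(2)] by simp
  from splitting[OF o(2) H_mult[OF f(1,2)] this]
  obtain Y' Z i1 i2 p1 p2 where s: "ob Y'" "ob Z" "i1 \<in> H Y' W" "i2 \<in> H Z W" "p1 \<in> H W Y'" "p2 \<in> H W Z"
    "p1 * i1 = un Y'" "p2 * i2 = un Z" "p1 * i2 = 0" "p2 * i1 = 0" "i1 * p1 + i2 * p2 = un W"
    "i1 * p1 - f * g \<in> N W W"
    by blast
  have "p2 * f = - (p2 * (i1 * p1 - f * g) * f) - (p2 * f) * (g * f - un Y) + (p2 * i1) * (p1 * f)"
    using un_right[OF f(1)] by (simp add: algebra_simps)
  also have "\<dots> \<in> N Y Z" unfolding s(10)
    by (simp only: mult_zero_left, intro N_add N_uminus N_diff N_zero N_mid[OF s(12,6) f(1)] N_left[OF H_mult[OF s(6) f(1)] f(3)])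
  finally have 1: "p2 * f \<in> N Y Z" .
  have "g * i2 = - (g * (i1 * p1 - f * g) * i2) - (g * f - un Y) * (g * i2) + (g * i1) * (p1 * i2)"
    using un_left[OF f(2)] un_left[OF H_mult[OF f(2) s(4)]] by (simp add: algebra_simps)
  also have "\<dots> \<in> N Z Y" unfolding s(9)
    by (simp only: mult_zero_right, intro N_add N_uminus N_diff N_zero N_mid[OF s(12) f(2) s(4)] N_right[OF f(3) H_mult[OF f(2) s(4)]])
  finally have 2: "g * i2 \<in> N Z Y" .
  have 3: "f * g + i2 * p2 - un W \<in> N W W"
    using N_sym[OF s(12)] unfolding s(11)[symmetric] by simp
  have "bip W Y Z f i2 g p2" unfolding bip_def using f s o 1 2 3 N_zero by auto
  then show thesis using that by blast
qed

definition slist :: "'o list \<Rightarrow> 'o" where "slist Xs = foldr sm Xs zr"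

lemma slist_simps [simp]: "slist [] = zr" "slist (X # Xs) = sm X (slist Xs)"
  unfolding slist_def by auto

lemma ob_slist: "(\<forall>X\<in>set Xs. ob X) \<Longrightarrow> ob (slist Xs)"
  by (induction Xs) (auto simp: ob_zr ob_sm)

lemma slist_remove:
  "\<forall>Y\<in>set (as @ X # bs). ob Y \<Longrightarrow> iso (slist (as @ X # bs)) (sm X (slist (as @ bs)))"
proof (induction as)
  case Nil
  then show ?case using ob_slist[of "X # bs"] by (auto intro!: iso_refl)
next
  case (Cons a as)
  then have 1: "iso (slist ((a # as) @ X # bs)) (sm a (sm X (slist (as @ bs))))"
    by (auto intro!: sm_cong iso_refl)
  have 2: "iso (sm a (sm X (slist (as @ bs)))) (sm X (sm a (slist (as @ bs))))"
    using Cons.prems ob_slist[of "as @ bs"] by (intro sm_left_comm) auto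
  show ?case using iso_trans[OF 1 2] by simp
qed

lemma slist_append:
  "\<forall>Y\<in>set (xs @ ys). ob Y \<Longrightarrow> iso (slist (xs @ ys)) (sm (slist xs) (slist ys))"
proof (induction xs)
  case Nil
  then have "ob (slist ys)" using ob_slist by auto
  then show ?case using iso_trans[OF iso_sym[OF sm_zr] sm_comm[OF _ ob_zr], of "slist ys"] by simp
next
  case (Cons x xs)
  have o: "ob x" "ob (slist xs)" "ob (slist ys)" using Cons.prems ob_slist by auto
  have "iso (slist ((x # xs) @ ys)) (sm x (sm (slist xs) (slist ys)))"
    using Cons o by (auto intro!: sm_cong iso_refl)
  moreover have "iso (sm x (sm (slist xs) (slist ys))) (sm (slist (x # xs)) (slist ys))"
    using iso_sym[OF sm_assoc[OF o]] by simp
  ultimately show ?case by (rule iso_trans)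
qed

definition cls :: "'o \<Rightarrow> 'o set" where "cls X = {Y. iso Y X}"

lemma cls_eq_iff:
  assumes "ob X" shows "cls X = cls Y \<longleftrightarrow> iso X Y"
proof
  assume "cls X = cls Y"
  then show "iso X Y" using iso_refl[OF assms] unfolding cls_def by blast
next
  assume *: "iso X Y"
  show "cls X = cls Y"
    unfolding cls_def using iso_trans[OF _ *] iso_trans[OF _ iso_sym[OF *]] by blast
qed

lemma slist_cong:
  "mset (map cls Xs) = mset (map cls Ys) \<Longrightarrow> \<forall>X\<in>set Xs. ob X \<Longrightarrow> \<forall>X\<in>set Ys. ob X \<Longrightarrow> iso (slist Xs) (slist Ys)"
proof (induction Xs arbitrary: Ys)
  case Nil
  then show ?case using iso_refl[OF ob_zr] by simp
next
  case (Cons X Xs)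
  have "cls X \<in># mset (map cls Ys)" using Cons.prems(1) by (metis list.simps(9) list.set_intros(1) set_mset_mset)
  then obtain Y where "Y \<in> set Ys" "cls Y = cls X" by auto
  then obtain as bs where Ys: "Ys = as @ Y # bs" by (meson split_list)
  have i: "iso X Y" using \<open>cls Y = cls X\<close> cls_eq_iff[of X Y] Cons.prems by auto
  have "mset (map cls Xs) = mset (map cls (as @ bs))"
    using Cons.prems(1) \<open>cls Y = cls X\<close> unfolding Ys by simp
  then have "iso (slist Xs) (slist (as @ bs))" using Cons.IH[of "as @ bs"] Cons.prems Ys by auto
  then have "iso (slist (X # Xs)) (sm Y (slist (as @ bs)))" using i by (simp add: sm_cong)
  moreover have "iso (sm Y (slist (as @ bs))) (slist Ys)"
    using slist_remove[of as Y bs] Cons.prems(3) Ys iso_sym by blast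
  ultimately show ?case by (rule iso_trans)
qed

lemma bip_zero: "bip B Y Z i1 i2 p1 p2 \<Longrightarrow> iso B zr \<Longrightarrow> iso Y zr"
proof -
  assume b: "bip B Y Z i1 i2 p1 p2" and z: "iso B zr"
  note bD = bipD[OF b]
  have "un B \<in> N B B" using z iso_zr_iff bD(1) by blast
  then have "p1 * i1 \<in> N Y Y" using zero_factor bD by blast
  then have "un Y \<in> N Y Y" using N_diff[OF _ bD(8)] by fastforce
  then show ?thesis using iso_zr_iff bD by blast
qed

lemma sm_nonzero: "ob Y \<Longrightarrow> ob Z \<Longrightarrow> iso (sm Y Z) zr \<Longrightarrow> iso Y zr"
  using bip_sm bip_zero by metis

text \<open>The identity of \<open>Y\<close> is the sum modulo \<open>N\<close> of
  \<open>g1\<close>, which factors through \<open>X\<close>, and \<open>g2\<close>, which factors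
  through the remaining summands. By locality one of them is invertible. If it is \<open>g1\<close>,
  then \<open>Y\<close> is isomorphic to \<open>X\<close> and the complements agree by the Schur
  complement; if it is \<open>g2\<close>, then \<open>Y\<close> is a retract of the rest and
  induction applies there.\<close>

lemma indec_exchange:
  "\<forall>X\<in>set Xs. indec X \<Longrightarrow> indec Y \<Longrightarrow> ob Z \<Longrightarrow> iso (sm Y Z) (slist Xs) \<Longrightarrow>
   \<exists>as X bs. Xs = as @ X # bs \<and> iso Y X \<and> iso Z (slist (as @ bs))"
proof (induction Xs arbitrary: Z)
  case Nil
  then show ?case using sm_nonzero[of Y Z] unfolding indec_def by auto
next
  case (Cons X Xs)
  define W where "W = slist Xs"
  have oX: "ob X" "ob W" "ob Y" using Cons.prems ob_slist[of Xs] indec_ob W_def by auto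
  obtain i1 i2 p1 p2 where b: "bip (sm Y Z) Y Z i1 i2 p1 p2" using bip_sm[OF oX(3) Cons.prems(3)] .
  have "iso (sm Y Z) (sm X W)" using Cons.prems(4) W_def by simp
  then obtain j1 j2 q1 q2 where c: "bip (sm Y Z) X W j1 j2 q1 q2" using iso_imp_bip oX by metis
  note bD = bipD[OF b] and cD = bipD[OF c]
  define g1 where "g1 = p1 * j1 * (q1 * i1)"
  define g2 where "g2 = p1 * j2 * (q2 * i1)"
  have g1H: "g1 \<in> H Y Y" unfolding g1_def using bD cD by (intro H_mult[of _ X] H_mult[of _ "sm Y Z"])
  have g12: "g2 - (un Y - g1) \<in> N Y Y"
  proof -
    have "g2 - (un Y - g1) = p1 * (j1 * q1 + j2 * q2 - un (sm Y Z)) * i1 + (p1 * i1 - un Y)"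
      unfolding g1_def g2_def using un_left[OF bD(4)] by (simp add: algebra_simps)
    also have "\<dots> \<in> N Y Y" by (intro N_add bD(8) N_mid[OF cD(12) bD(6,4)])
    finally show ?thesis .
  qed
  from indec_local[OF Cons.prems(2) g1H] show ?case
  proof (elim disjE bexE conjE)
    fix u assume u: "u \<in> H Y Y" "u * g1 - un Y \<in> N Y Y"
    define g where "g = u * (p1 * j1)"
    have gH: "g \<in> H X Y" unfolding g_def using u bD cD by (intro H_mult)
    have fH: "q1 * i1 \<in> H Y X" using bD cD by (intro H_mult)
    have gf: "g * (q1 * i1) - un Y \<in> N Y Y" using u(2) unfolding g_def g1_def by (simp add: mult.assoc)
    have fg: "q1 * i1 * g - un X \<in> N X X"
      using retract_indec[OF _ _ fH gH gf] Cons.prems indec_nz by simp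
    have "iso Z W" by (rule schur[OF b c gH gf fg])
    moreover have "iso Y X" unfolding iso_def using oX fH gH gf fg by blast
    ultimately show ?thesis unfolding W_def by (intro exI[of _ "[]"] exI[of _ X] exI[of _ Xs]) simp
  next
    fix v assume v: "v \<in> H Y Y" "v * (un Y - g1) - un Y \<in> N Y Y"
    have "v * g2 - v * (un Y - g1) \<in> N Y Y" using N_left[OF v(1) g12] by (simp add: algebra_simps)
    then have vg: "v * g2 - un Y \<in> N Y Y" using v(2) N_trans by blast
    define g where "g = v * (p1 * j2)"
    have gH: "g \<in> H W Y" unfolding g_def using v bD cD by (intro H_mult)
    have fH: "q2 * i1 \<in> H Y W" using bD cD by (intro H_mult)
    have gf: "g * (q2 * i1) - un Y \<in> N Y Y" using vg unfolding g_def g2_def by (simp add: mult.assoc)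
    obtain W' i p where w: "bip W Y W' (q2 * i1) i g p" using split_retract[OF fH gH gf oX(3,2)] .
    have oW': "ob W'" using bipD[OF w] by blast
    have "iso (sm Y W') (slist Xs)" using bip_imp_iso[OF w] iso_sym unfolding W_def by blast
    then obtain as X' bs where IH: "Xs = as @ X' # bs" "iso Y X'" "iso W' (slist (as @ bs))"
      using Cons.IH[of W'] Cons.prems oW' by auto
    obtain k1 k2 r1 r2 where k: "bip (sm X W') X W' k1 k2 r1 r2" using bip_sm[OF oX(1) oW'] .
    have "iso Z (sm X W')"
    proof (rule schur[OF b bip_assoc_swap[OF c w k]])
      show "un Y \<in> H Y Y" using un_H oX by blast
      show "un Y * (g * q2 * i1) - un Y \<in> N Y Y" "g * q2 * i1 * un Y - un Y \<in> N Y Y"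
        using gf un_left[OF H_mult[OF gH fH]] un_right[OF H_mult[OF gH fH]] by (simp_all add: mult.assoc)
    qed
    moreover have "iso (sm X W') (slist ((X # as) @ bs))" using IH(3) oX by (simp add: sm_cong iso_refl)
    ultimately have "iso Z (slist ((X # as) @ bs))" by (rule iso_trans)
    then show ?thesis using IH by (intro exI[of _ "X # as"] exI[of _ X'] exI[of _ bs]) simp
  qed
qed

theorem krull_schmidt:
  "\<forall>X\<in>set Xs. indec X \<Longrightarrow> \<forall>X\<in>set Ys. indec X \<Longrightarrow> iso (slist Xs) (slist Ys) \<Longrightarrow>
   mset (map cls Xs) = mset (map cls Ys)"
proof (induction Xs arbitrary: Ys)
  case Nil
  show ?case
  proof (cases Ys)
    case (Cons Y Ys')
    then have "iso (sm Y (slist Ys')) zr" using Nil iso_sym by auto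
    then have "iso Y zr" using sm_nonzero[of Y "slist Ys'"] Nil Cons ob_slist[of Ys'] indec_ob by auto
    then show ?thesis using Nil Cons unfolding indec_def by auto
  qed simp
next
  case (Cons X Xs)
  have o: "ob (slist Xs)" using Cons.prems ob_slist indec_ob by auto
  obtain as Y bs where Y: "Ys = as @ Y # bs" "iso X Y" "iso (slist Xs) (slist (as @ bs))"
    using indec_exchange[of Ys X "slist Xs"] Cons.prems o by auto
  have "mset (map cls Xs) = mset (map cls (as @ bs))" using Cons.IH[of "as @ bs"] Cons.prems Y by auto
  moreover have "cls X = cls Y" using Y(2) cls_eq_iff iso_ob by blast
  ultimately show ?case using Y(1) by simp
qed

lemma decompose: "ob X \<Longrightarrow> \<exists>Xs. (\<forall>Y\<in>set Xs. indec Y) \<and> iso X (slist Xs)"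
proof (induction "mu X" arbitrary: X rule: less_induct)
  case less
  show ?case
  proof (cases "iso X zr \<or> indec X")
    case True
    then show ?thesis
    proof
      assume "iso X zr" then show ?thesis by (intro exI[of _ "[]"]) simp
    next
      assume "indec X" then show ?thesis using iso_sym[OF sm_zr[OF less.prems]] by (intro exI[of _ "[X]"]) simp
    qed
  next
    case False
    then obtain Y Z where YZ: "ob Y" "ob Z" "iso X (sm Y Z)" "\<not> iso Y zr" "\<not> iso Z zr"
      using less.prems unfolding indec_def by blast
    obtain i1 i2 p1 p2 where b: "bip X Y Z i1 i2 p1 p2" using iso_imp_bip YZ by metis
    note bD = bipD[OF b]
    have fH: "i1 * p1 \<in> H X X" using bD by (intro H_mult)
    have "i1 * p1 * (i1 * p1) - i1 * p1 = i1 * (p1 * i1 - un Y) * p1"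
      using un_left[OF bD(6)] by (simp add: algebra_simps)
    then have idem: "i1 * p1 * (i1 * p1) - i1 * p1 \<in> N X X" using N_mid[OF bD(8,4,6)] by simp
    have n1: "i1 * p1 \<notin> N X X"
    proof
      assume *: "i1 * p1 \<in> N X X"
      have "un Y = p1 * (i1 * p1) * i1 - (p1 * i1) * (p1 * i1 - un Y) - (p1 * i1 - un Y)"
        using un_right[OF bD(4)] by (simp add: algebra_simps)
      also have "\<dots> \<in> N Y Y" by (intro N_diff bD(8) N_mid[OF * bD(6,4)] N_left[OF H_mult[OF bD(6,4)] bD(8)])
      finally show False using YZ iso_zr_iff by blast
    qed
    have n2: "un X - i1 * p1 \<notin> N X X"
    proof
      assume "un X - i1 * p1 \<in> N X X"
      from N_add[OF bD(12) this] have *: "i2 * p2 \<in> N X X" by (simp add: algebra_simps)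
      have "un Z = p2 * (i2 * p2) * i2 - (p2 * i2) * (p2 * i2 - un Z) - (p2 * i2 - un Z)"
        using un_right[OF bD(5)] by (simp add: algebra_simps)
      also have "\<dots> \<in> N Z Z" by (intro N_diff bD(9) N_mid[OF * bD(7,5)] N_left[OF H_mult[OF bD(7,5)] bD(9)])
      finally show False using YZ iso_zr_iff by blast
    qed
    \<comment> \<open>\<open>mu\<close> is not invariant under isomorphism, so \<open>Y\<close> and
      \<open>Z\<close> themselves need not be smaller than \<open>X\<close>. The idempotent that
      they define is split again, now inside \<open>X\<close>, where \<open>mu\<close>
      decreases.\<close>
    obtain Y' Z' j1 j2 q1 q2 where s: "ob Y'" "ob Z'" "j1 \<in> H Y' X" "j2 \<in> H Z' X" "q1 \<in> H X Y'" "q2 \<in> H X Z'"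
      "q1 * j1 = un Y'" "q2 * j2 = un Z'" "q1 * j2 = 0" "q2 * j1 = 0" "j1 * q1 + j2 * q2 = un X"
      "mu Y' < mu X" "mu Z' < mu X"
      using splitting[OF less.prems fH idem] n1 n2 by blast
    have "bip X Y' Z' j1 j2 q1 q2" unfolding bip_def using s less.prems N_zero by auto
    then have i: "iso X (sm Y' Z')" by (rule bip_imp_iso)
    obtain Ys Zs where "\<forall>Y\<in>set Ys. indec Y" "iso Y' (slist Ys)" "\<forall>Y\<in>set Zs. indec Y" "iso Z' (slist Zs)"
      using less.hyps[OF s(12,1)] less.hyps[OF s(13,2)] by blast
    then have d: "\<forall>Y\<in>set (Ys @ Zs). indec Y" "iso (sm Y' Z') (sm (slist Ys) (slist Zs))"
      using sm_cong by auto
    have "iso (sm (slist Ys) (slist Zs)) (slist (Ys @ Zs))"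
      by (rule iso_sym, rule slist_append) (use d(1) indec_ob in blast)
    from iso_trans[OF i iso_trans[OF d(2) this]] show ?thesis using d(1) by blast
  qed
qed

text \<open>The multiset of isomorphism classes of indecomposable summands.\<close>

definition kms :: "'o \<Rightarrow> 'o set multiset" where
  "kms X = (SOME M. \<exists>Xs. (\<forall>Y\<in>set Xs. indec Y) \<and> iso X (slist Xs) \<and> M = mset (map cls Xs))"

lemma kms_eqI:
  assumes "\<forall>Y\<in>set Xs. indec Y" "iso X (slist Xs)" shows "kms X = mset (map cls Xs)"
proof -
  have "\<exists>M. \<exists>Xs. (\<forall>Y\<in>set Xs. indec Y) \<and> iso X (slist Xs) \<and> M = mset (map cls Xs)" using assms by blast
  from someI_ex[OF this] obtain Ys where "\<forall>Y\<in>set Ys. indec Y" "iso X (slist Ys)" "kms X = mset (map cls Ys)"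
    unfolding kms_def by blast
  then show ?thesis using krull_schmidt[OF assms(1) _ iso_trans[OF iso_sym[OF assms(2)]], of Ys] by simp
qed

lemma kms_decompose:
  assumes "ob X"
  obtains Xs where "\<forall>Y\<in>set Xs. indec Y" "iso X (slist Xs)" "kms X = mset (map cls Xs)"
  using decompose[OF assms] kms_eqI by blast

lemma kms_sm:
  assumes "ob X" "ob Y" shows "kms (sm X Y) = kms X + kms Y"
proof -
  obtain Xs where X: "\<forall>Y\<in>set Xs. indec Y" "iso X (slist Xs)" "kms X = mset (map cls Xs)"
    using kms_decompose[OF assms(1)] .
  obtain Ys where Y: "\<forall>Y\<in>set Ys. indec Y" "iso Y (slist Ys)" "kms Y = mset (map cls Ys)"
    using kms_decompose[OF assms(2)] .
  have "iso (sm (slist Xs) (slist Ys)) (slist (Xs @ Ys))"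
    by (rule iso_sym, rule slist_append) (use X(1) Y(1) indec_ob in auto)
  from iso_trans[OF sm_cong[OF X(2) Y(2)] this] have "iso (sm X Y) (slist (Xs @ Ys))" .
  then show ?thesis using kms_eqI[of "Xs @ Ys"] X Y by auto
qed

lemma kms_iso: "iso X Y \<Longrightarrow> kms X = kms Y"
  using kms_decompose[OF iso_ob(2)] kms_eqI[OF _ iso_trans] by metis

lemma iso_iff_kms: "ob X \<Longrightarrow> ob Y \<Longrightarrow> iso X Y \<longleftrightarrow> kms X = kms Y"
proof
  assume o: "ob X" "ob Y" and eq: "kms X = kms Y"
  obtain Xs where X: "\<forall>Y\<in>set Xs. indec Y" "iso X (slist Xs)" "kms X = mset (map cls Xs)"
    using kms_decompose[OF o(1)] .
  obtain Ys where Y: "\<forall>Y\<in>set Ys. indec Y" "iso Y (slist Ys)" "kms Y = mset (map cls Ys)"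
    using kms_decompose[OF o(2)] .
  have "iso (slist Xs) (slist Ys)" using slist_cong[of Xs Ys] X Y eq indec_ob by auto
  then show "iso X Y" by (rule iso_trans[OF X(2) iso_trans[OF _ iso_sym[OF Y(2)]]])
qed (rule kms_iso)

lemma kms_zr: "kms zr = {#}"
  using kms_eqI[of "[]" zr] iso_refl[OF ob_zr] by simp

lemma kms_indec: "indec X \<Longrightarrow> kms X = {#cls X#}"
  using kms_eqI[of "[X]" X] iso_sym[OF sm_zr] indec_ob by simp

lemma kms_mem:
  assumes "ob X" "c \<in># kms X" shows "\<exists>Y. indec Y \<and> c = cls Y"
proof -
  obtain Xs where "\<forall>Y\<in>set Xs. indec Y" "kms X = mset (map cls Xs)" using kms_decompose[OF assms(1)] .
  then show ?thesis using assms(2) by auto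
qed

lemma kms_ex: "(\<forall>c\<in>#M. \<exists>Y. indec Y \<and> c = cls Y) \<Longrightarrow> \<exists>X. ob X \<and> kms X = M"
proof (induction M)
  case empty
  then show ?case using ob_zr kms_zr by blast
next
  case (add c M)
  then obtain Y X where "indec Y" "c = cls Y" "ob X" "kms X = M" by auto
  then show ?case using kms_sm[of Y X] kms_indec ob_sm indec_ob by (intro exI[of _ "sm Y X"]) auto
qed

lemma kms_empty_iff: "ob X \<Longrightarrow> kms X = {#} \<longleftrightarrow> iso X zr"
  using iso_iff_kms[OF _ ob_zr] kms_zr by simp

lemma kms_mem_summand:
  assumes "ob X" "indec Y" shows "cls Y \<in># kms X \<longleftrightarrow> (\<exists>Z. ob Z \<and> iso X (sm Y Z))"
proof
  assume "cls Y \<in># kms X"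
  have "\<forall>c\<in>#kms X - {#cls Y#}. \<exists>Y. indec Y \<and> c = cls Y"
    using kms_mem[OF assms(1)] in_diffD by metis
  from kms_ex[OF this] obtain Z where "ob Z" "kms Z = kms X - {#cls Y#}" by blast
  then have "kms (sm Y Z) = kms X" using kms_sm[of Y Z] kms_indec[OF assms(2)] indec_ob[OF assms(2)] \<open>cls Y \<in># kms X\<close> by simp
  then show "\<exists>Z. ob Z \<and> iso X (sm Y Z)"
    using iso_iff_kms[OF assms(1)] ob_sm indec_ob[OF assms(2)] \<open>ob Z\<close> by metis
next
  assume "\<exists>Z. ob Z \<and> iso X (sm Y Z)"
  then obtain Z where "ob Z" "iso X (sm Y Z)" by blast
  then have "kms X = {#cls Y#} + kms Z" using kms_iso kms_sm kms_indec assms indec_ob by metis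
  then show "cls Y \<in># kms X" by simp
qed

end

section \<open>Direct sums, cones and shifts\<close>

text \<open>Inclusion of a graded object with sizes \<open>n\<close> as the summand that starts at
  position \<open>m\<close>, shifted by \<open>c\<close> degrees; \<open>prj\<close> is its
  transpose. The cutoff \<open>N\<close> on the degree keeps the support finite.\<close>

definition emb :: "int \<Rightarrow> (int \<Rightarrow> nat) \<Rightarrow> (int \<Rightarrow> nat) \<Rightarrow> int \<Rightarrow> 'a::ring_1 fm" where
  "emb c m n N = Abs_fm (\<lambda>x y. case x of Ix i a \<Rightarrow> (case y of Ix j b \<Rightarrow>
     if j = i + c \<and> a = b + m j \<and> b < n j \<and> \<bar>j\<bar> \<le> N then 1 else 0))"

definition prj :: "int \<Rightarrow> (int \<Rightarrow> nat) \<Rightarrow> (int \<Rightarrow> nat) \<Rightarrow> int \<Rightarrow> 'a::ring_1 fm" where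
  "prj c m n N = Abs_fm (\<lambda>x y. case x of Ix j b \<Rightarrow> (case y of Ix i a \<Rightarrow>
     if j = i + c \<and> a = b + m j \<and> b < n j \<and> \<bar>j\<bar> \<le> N then 1 else 0))"

lemma ent_emb: "ent (emb c m n N :: 'a::ring_1 fm) (Ix i a) (Ix j b) =
     (if j = i + c \<and> a = b + m j \<and> b < n j \<and> \<bar>j\<bar> \<le> N then 1 else 0)"
  and ent_prj: "ent (prj c m n N :: 'a::ring_1 fm) (Ix j b) (Ix i a) =
     (if j = i + c \<and> a = b + m j \<and> b < n j \<and> \<bar>j\<bar> \<le> N then 1 else 0)"
proof -
  define R where "R = \<bar>N\<bar> + \<bar>c\<bar>"
  define J where "J = (SIGMA i:{-R..R}. {..<n i + n (i + c) + m i + m (i + c)})"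
  define I where "I = (\<lambda>(i, a). Ix i a) ` J"
  have fin: "finite I" unfolding I_def J_def by auto
  have mem: "Ix i a \<in> I \<and> Ix j b \<in> I" if "j = i + c \<and> a = b + m j \<and> b < n j \<and> \<bar>j\<bar> \<le> N" for i a j b
  proof -
    have "\<bar>j\<bar> \<le> R" "\<bar>i\<bar> \<le> R" using that unfolding R_def by linarith+
    then have "(i, a) \<in> J" "(j, b) \<in> J" unfolding J_def using that by auto
    then show ?thesis unfolding I_def by force
  qed
  have "fin_ent (\<lambda>x y. case x of Ix i a \<Rightarrow> (case y of Ix j b \<Rightarrow>
     if j = i + c \<and> a = b + m j \<and> b < n j \<and> \<bar>j\<bar> \<le> N then (1::'a) else 0))"
  proof (rule fin_entI[OF fin])
    fix x y assume *: "x \<notin> I \<or> y \<notin> I"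
    obtain i a j b where "x = Ix i a" "y = Ix j b" by (metis idx.exhaust)
    then show "(case x of Ix i a \<Rightarrow> (case y of Ix j b \<Rightarrow>
     if j = i + c \<and> a = b + m j \<and> b < n j \<and> \<bar>j\<bar> \<le> N then (1::'a) else 0)) = 0"
      using * mem[of j i a b] by auto
  qed
  then show "ent (emb c m n N :: 'a fm) (Ix i a) (Ix j b) =
     (if j = i + c \<and> a = b + m j \<and> b < n j \<and> \<bar>j\<bar> \<le> N then 1 else 0)"
    unfolding emb_def by (simp add: ent_Abs_fm)
  have "fin_ent (\<lambda>x y. case x of Ix j b \<Rightarrow> (case y of Ix i a \<Rightarrow>
     if j = i + c \<and> a = b + m j \<and> b < n j \<and> \<bar>j\<bar> \<le> N then (1::'a) else 0))"
  proof (rule fin_entI[OF fin])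
    fix y x assume *: "y \<notin> I \<or> x \<notin> I"
    obtain i a j b where "x = Ix i a" "y = Ix j b" by (metis idx.exhaust)
    then show "(case y of Ix j b \<Rightarrow> (case x of Ix i a \<Rightarrow>
     if j = i + c \<and> a = b + m j \<and> b < n j \<and> \<bar>j\<bar> \<le> N then (1::'a) else 0)) = 0"
      using * mem[of j i a b] by auto
  qed
  then show "ent (prj c m n N :: 'a fm) (Ix j b) (Ix i a) =
     (if j = i + c \<and> a = b + m j \<and> b < n j \<and> \<bar>j\<bar> \<le> N then 1 else 0)"
    unfolding prj_def by (simp add: ent_Abs_fm)
qed

lemma dg_emb: "dg (- c) (emb c m n N)" and dg_prj: "dg c (prj c m n N)"
  unfolding dg_def ent_emb ent_prj by (auto split: if_splits)

lemma ent_emb_mult: "ent (emb c m n N * y) (Ix i a) v =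
    (if m (i + c) \<le> a \<and> a < m (i + c) + n (i + c) \<and> \<bar>i + c\<bar> \<le> N
     then ent y (Ix (i + c) (a - m (i + c))) v else 0)"
proof -
  have "ent (emb c m n N * y) (Ix i a) v =
    (\<Sum>w\<in>{Ix (i + c) (a - m (i + c))}. ent (emb c m n N) (Ix i a) w * ent y w v)"
  proof (rule ent_mult)
    fix w assume "w \<notin> {Ix (i + c) (a - m (i + c))}"
    then show "ent (emb c m n N) (Ix i a) w = 0 \<or> ent y w v = 0"
      by (cases w) (auto simp: ent_emb)
  qed simp
  then show ?thesis by (auto simp: ent_emb)
qed

lemma ent_mult_prj: "ent (y * prj c m n N) v (Ix i a) =
    (if m (i + c) \<le> a \<and> a < m (i + c) + n (i + c) \<and> \<bar>i + c\<bar> \<le> N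
     then ent y v (Ix (i + c) (a - m (i + c))) else 0)"
proof -
  have "ent (y * prj c m n N) v (Ix i a) =
    (\<Sum>w\<in>{Ix (i + c) (a - m (i + c))}. ent y v w * ent (prj c m n N) w (Ix i a))"
  proof (rule ent_mult)
    fix w assume "w \<notin> {Ix (i + c) (a - m (i + c))}"
    then show "ent y v w = 0 \<or> ent (prj c m n N) w (Ix i a) = 0"
      by (cases w) (auto simp: ent_prj)
  qed simp
  then show ?thesis by (auto simp: ent_prj)
qed

definition sized :: "int \<Rightarrow> (int \<Rightarrow> nat) \<Rightarrow> (int \<Rightarrow> nat) \<Rightarrow> 'a::zero fm \<Rightarrow> bool" where
  "sized N v u x \<longleftrightarrow> (\<forall>i a j b. \<bar>i\<bar> > N \<or> \<bar>j\<bar> > N \<or> a \<ge> v i \<or> b \<ge> u j \<longrightarrow> ent x (Ix i a) (Ix j b) = 0)"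

lemma sizedD: "sized N v u x \<Longrightarrow> \<bar>i\<bar> > N \<or> \<bar>j\<bar> > N \<or> a \<ge> v i \<or> b \<ge> u j \<Longrightarrow> ent x (Ix i a) (Ix j b) = 0"
  unfolding sized_def by blast

lemma sized_mono: "sized N v u x \<Longrightarrow> N \<le> M \<Longrightarrow> sized M v u x"
  unfolding sized_def by (meson order_le_less_trans)

lemma ex_sized:
  assumes "bounded_mats k v u f" shows "\<exists>N. sized N v u (encf k v u f)"
proof -
  obtain N where N: "\<And>i. \<bar>i\<bar> > N \<Longrightarrow> f i = 0\<^sub>m (v (i + k)) (u i)"
    using assms unfolding bounded_mats_def by blast
  have "ent (encf k v u f) (Ix i a) (Ix j b) = 0"
    if *: "\<bar>i\<bar> > \<bar>N\<bar> + \<bar>k\<bar> \<or> \<bar>j\<bar> > \<bar>N\<bar> + \<bar>k\<bar> \<or> a \<ge> v i \<or> b \<ge> u j" for i a j b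
  proof (cases "i = j + k \<and> a < v i \<and> b < u j")
    case True
    then have "\<bar>j\<bar> > N" using * by linarith
    then show ?thesis using True N by (simp add: ent_encf[OF assms])
  next
    case False
    then show ?thesis by (auto simp: ent_encf[OF assms])
  qed
  then show ?thesis unfolding sized_def by blast
qed

lemma ent_emb_prj:
  assumes "sized N v u x"
  shows "ent (emb c m v N * x * prj c' m' u N) (Ix i a) (Ix j b) =
    (if m (i + c) \<le> a \<and> m' (j + c') \<le> b then ent x (Ix (i + c) (a - m (i + c))) (Ix (j + c') (b - m' (j + c'))) else 0)"
  unfolding ent_mult_prj ent_emb_mult
  using sizedD[OF assms, of "i + c" "j + c'" "a - m (i + c)" "b - m' (j + c')"]
  by (cases "m (i + c) \<le> a"; cases "m' (j + c') \<le> b") (auto simp: le_diff_conv2 not_less add.commute)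

lemma prj_emb:
  assumes "sized N v u x" shows "prj c m v N * (emb c m v N * x) = x"
proof (rule fm_eqI')
  fix i a j b
  have "ent (prj c m v N * (emb c m v N * x)) (Ix i a) (Ix j b) =
    (\<Sum>w\<in>{Ix (i - c) (a + m i)}. ent (prj c m v N) (Ix i a) w * ent (emb c m v N * x) w (Ix j b))"
  proof (rule ent_mult)
    fix w assume "w \<notin> {Ix (i - c) (a + m i)}"
    then show "ent (prj c m v N) (Ix i a) w = 0 \<or> ent (emb c m v N * x) w (Ix j b) = 0"
      by (cases w) (auto simp: ent_prj)
  qed simp
  then show "ent (prj c m v N * (emb c m v N * x)) (Ix i a) (Ix j b) = ent x (Ix i a) (Ix j b)"
    using sizedD[OF assms, of i j a b] by (auto simp: ent_prj ent_emb_mult not_less not_le)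
qed

lemma prj_emb_orth:
  shows "prj c (\<lambda>_. 0) u N * emb 0 (\<lambda>i. u (i + c)) w N = (0 :: 'a::ring_1 fm)"
    and "prj 0 (\<lambda>i. u (i + c)) w N * emb c (\<lambda>_. 0) u N = (0 :: 'a::ring_1 fm)"
proof -
  show "prj c (\<lambda>_. 0) u N * emb 0 (\<lambda>i. u (i + c)) w N = (0 :: 'a::ring_1 fm)"
  proof (rule fm_eqI')
    fix i a j b
    have "ent (prj c (\<lambda>_. 0) u N * emb 0 (\<lambda>i. u (i + c)) w N :: 'a fm) (Ix i a) (Ix j b) =
      (\<Sum>x\<in>{}. ent (prj c (\<lambda>_. 0) u N) (Ix i a) x * ent (emb 0 (\<lambda>i. u (i + c)) w N) x (Ix j b))"
    proof (rule ent_mult)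
      fix x show "ent (prj c (\<lambda>_. 0) u N :: 'a fm) (Ix i a) x = 0 \<or> ent (emb 0 (\<lambda>i. u (i + c)) w N :: 'a fm) x (Ix j b) = 0"
        by (cases x) (auto simp: ent_prj ent_emb)
    qed simp
    then show "ent (prj c (\<lambda>_. 0) u N * emb 0 (\<lambda>i. u (i + c)) w N :: 'a fm) (Ix i a) (Ix j b) = ent 0 (Ix i a) (Ix j b)"
      by simp
  qed
  show "prj 0 (\<lambda>i. u (i + c)) w N * emb c (\<lambda>_. 0) u N = (0 :: 'a::ring_1 fm)"
  proof (rule fm_eqI')
    fix i a j b
    have "ent (prj 0 (\<lambda>i. u (i + c)) w N * emb c (\<lambda>_. 0) u N :: 'a fm) (Ix i a) (Ix j b) =
      (\<Sum>x\<in>{}. ent (prj 0 (\<lambda>i. u (i + c)) w N) (Ix i a) x * ent (emb c (\<lambda>_. 0) u N) x (Ix j b))"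
    proof (rule ent_mult)
      fix x show "ent (prj 0 (\<lambda>i. u (i + c)) w N :: 'a fm) (Ix i a) x = 0 \<or> ent (emb c (\<lambda>_. 0) u N :: 'a fm) x (Ix j b) = 0"
        by (cases x) (auto simp: ent_prj ent_emb)
    qed simp
    then show "ent (prj 0 (\<lambda>i. u (i + c)) w N * emb c (\<lambda>_. 0) u N :: 'a fm) (Ix i a) (Ix j b) = ent 0 (Ix i a) (Ix j b)"
      by simp
  qed
qed

text \<open>A single formula for block lower triangular families in which the first block column is
  read \<open>c\<close> degrees further on. Direct sums and extensions have \<open>c = 0\<close>,
  cones have \<open>c = 1\<close>.\<close>

lemma encf_four_block:
  fixes A C D :: "int \<Rightarrow> 'a::ring_1 mat"
  assumes A: "bounded_mats k v1 u1 A" and C: "bounded_mats (k - c) v2 u1 C" and D: "bounded_mats k v2 u2 D"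
  defines "F \<equiv> \<lambda>i. four_block_mat (A (i + c)) (0\<^sub>m (v1 (i + c + k)) (u2 i)) (C (i + c)) (D i)"
  defines "V \<equiv> \<lambda>i. v1 (i + c) + v2 i" and "U \<equiv> \<lambda>i. u1 (i + c) + u2 i"
  assumes s: "sized N v1 u1 (encf k v1 u1 A)" "sized N v2 u1 (encf (k - c) v2 u1 C)" "sized N v2 u2 (encf k v2 u2 D)"
  shows "bounded_mats k V U F" "encf k V U F =
    emb c (\<lambda>_. 0) v1 N * encf k v1 u1 A * prj c (\<lambda>_. 0) u1 N
    + emb 0 (\<lambda>i. v1 (i + c)) v2 N * encf (k - c) v2 u1 C * prj c (\<lambda>_. 0) u1 N
    + emb 0 (\<lambda>i. v1 (i + c)) v2 N * encf k v2 u2 D * prj 0 (\<lambda>i. u1 (i + c)) u2 N"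
proof -
  have cA: "A (i + c) \<in> carrier_mat (v1 (i + c + k)) (u1 (i + c))" for i using bounded_matsD[OF A] by blast
  have cC: "C (i + c) \<in> carrier_mat (v2 (i + k)) (u1 (i + c))" for i
    using bounded_matsD[OF C, of "i + c"] by (simp add: algebra_simps)
  have cD: "D i \<in> carrier_mat (v2 (i + k)) (u2 i)" for i using bounded_matsD[OF D] by blast
  have ik: "i + c + k = i + k + c" for i by simp
  have cF: "F i \<in> carrier_mat (V (i + k)) (U i)" for i
    unfolding F_def V_def U_def using four_block_carrier_mat[OF cA[of i] cD[of i]] by (simp add: ik)
  obtain N1 N2 N3 where Ns: "\<And>i. \<bar>i\<bar> > N1 \<Longrightarrow> A i = 0\<^sub>m (v1 (i + k)) (u1 i)"
    "\<And>i. \<bar>i\<bar> > N2 \<Longrightarrow> C i = 0\<^sub>m (v2 (i + (k - c))) (u1 i)" "\<And>i. \<bar>i\<bar> > N3 \<Longrightarrow> D i = 0\<^sub>m (v2 (i + k)) (u2 i)"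
    using A C D unfolding bounded_mats_def by meson
  have "F i = 0\<^sub>m (V (i + k)) (U i)" if "\<bar>i\<bar> > \<bar>N1\<bar> + \<bar>N2\<bar> + \<bar>N3\<bar> + \<bar>c\<bar>" for i
  proof -
    have "\<bar>i + c\<bar> > N1" "\<bar>i + c\<bar> > N2" "\<bar>i\<bar> > N3" using that by linarith+
    then show ?thesis unfolding F_def V_def U_def using Ns by (intro eq_matI) (auto simp: algebra_simps)
  qed
  then show b: "bounded_mats k V U F" unfolding bounded_mats_def using cF by blast
  show "encf k V U F =
    emb c (\<lambda>_. 0) v1 N * encf k v1 u1 A * prj c (\<lambda>_. 0) u1 N
    + emb 0 (\<lambda>i. v1 (i + c)) v2 N * encf (k - c) v2 u1 C * prj c (\<lambda>_. 0) u1 N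
    + emb 0 (\<lambda>i. v1 (i + c)) v2 N * encf k v2 u2 D * prj 0 (\<lambda>i. u1 (i + c)) u2 N"
  proof (rule fm_eqI')
    fix i a j b
    have fb: "F j $$ (a, b) = (if a < v1 (j + k + c) then if b < u1 (j + c) then A (j + c) $$ (a, b) else 0
      else if b < u1 (j + c) then C (j + c) $$ (a - v1 (j + k + c), b) else D j $$ (a - v1 (j + k + c), b - u1 (j + c)))"
      if "a < V (j + k)" "b < U j"
      unfolding F_def using that cA[of j] cC[of j] cD[of j] unfolding V_def U_def by (auto simp: ik)
    show "ent (encf k V U F) (Ix i a) (Ix j b) = ent (emb c (\<lambda>_. 0) v1 N * encf k v1 u1 A * prj c (\<lambda>_. 0) u1 N
    + emb 0 (\<lambda>i. v1 (i + c)) v2 N * encf (k - c) v2 u1 C * prj c (\<lambda>_. 0) u1 N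
    + emb 0 (\<lambda>i. v1 (i + c)) v2 N * encf k v2 u2 D * prj 0 (\<lambda>i. u1 (i + c)) u2 N) (Ix i a) (Ix j b)"
    proof (cases "i = j + k")
      case True
      have r: "ent (encf k v1 u1 A) (Ix (j + k + c) a) (Ix (j + c) b) = (if a < v1 (j + k + c) \<and> b < u1 (j + c) then A (j + c) $$ (a, b) else 0)"
        "ent (encf (k - c) v2 u1 C) (Ix (j + k) (a - v1 (j + k + c))) (Ix (j + c) b) =
          (if a - v1 (j + k + c) < v2 (j + k) \<and> b < u1 (j + c) then C (j + c) $$ (a - v1 (j + k + c), b) else 0)"
        "ent (encf k v2 u2 D) (Ix (j + k) (a - v1 (j + k + c))) (Ix j (b - u1 (j + c))) =
          (if a - v1 (j + k + c) < v2 (j + k) \<and> b - u1 (j + c) < u2 j then D j $$ (a - v1 (j + k + c), b - u1 (j + c)) else 0)"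
        by (auto simp: ent_encf[OF A] ent_encf[OF C] ent_encf[OF D] algebra_simps)
      have l: "ent (encf k V U F) (Ix i a) (Ix j b) = (if a < V (j + k) \<and> b < U j then F j $$ (a, b) else 0)"
        using True by (simp add: ent_encf[OF b])
      show ?thesis
        unfolding ent_add ent_emb_prj[OF s(1)] ent_emb_prj[OF s(2)] ent_emb_prj[OF s(3)] l
        using True fb by (auto simp: r V_def U_def)
    next
      case False
      have r: "ent (encf k v1 u1 A) (Ix (i + c) a) (Ix (j + c) b) = 0"
        "ent (encf (k - c) v2 u1 C) (Ix i a') (Ix (j + c) b) = 0"
        "ent (encf k v2 u2 D) (Ix i a') (Ix j b') = 0" for a' b'
        using False by (auto simp: ent_encf[OF A] ent_encf[OF C] ent_encf[OF D])
      show ?thesis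
        unfolding ent_add ent_emb_prj[OF s(1)] ent_emb_prj[OF s(2)] ent_emb_prj[OF s(3)]
        using False r by (auto simp: ent_encf[OF b])
    qed
  qed
qed

section \<open>Complexes with a triangular differential\<close>

text \<open>As a graded object \<open>B\<close> is the sum of the shift of \<open>X\<close> by
  \<open>c\<close> and of \<open>Y\<close>; the differential acts as \<open>a\<close> on the first
  part, as \<open>snd Y\<close> on the second, and maps the first to the second by \<open>f\<close>.
  The cases are the direct sum (\<open>c = 0\<close>, \<open>f = 0\<close>), the extension
  (\<open>c = 0\<close>, \<open>f\<close> a cocycle of degree 1) and the cone (\<open>c = 1\<close>,
  \<open>a\<close> minus the differential of \<open>X\<close>).\<close>

definition glued :: "int \<Rightarrow> 'a::ring ac \<Rightarrow> 'a ac \<Rightarrow> 'a ac \<Rightarrow> 'a fm \<Rightarrow> 'a fm \<Rightarrow> 'a fm \<Rightarrow> 'a fm \<Rightarrow> 'a fm \<Rightarrow> 'a fm \<Rightarrow> bool" where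
  "glued c B X Y a f i1 i2 p1 p2 \<longleftrightarrow> dg (- c) i1 \<and> dg c p1 \<and> dg 0 i2 \<and> dg 0 p2 \<and>
     i1 * fst X = i1 \<and> fst X * p1 = p1 \<and> i2 * fst Y = i2 \<and> fst Y * p2 = p2 \<and>
     p1 * i1 = fst X \<and> p2 * i2 = fst Y \<and> p1 * i2 = 0 \<and> p2 * i1 = 0 \<and>
     fst B = i1 * p1 + i2 * p2 \<and> snd B = i1 * a * p1 + i2 * f * p1 + i2 * snd Y * p2"

lemma gluedD:
  assumes "glued c B X Y a f i1 i2 p1 p2"
  shows "dg (- c) i1" "dg c p1" "dg 0 i2" "dg 0 p2"
     "i1 * fst X = i1" "fst X * p1 = p1" "i2 * fst Y = i2" "fst Y * p2 = p2"
     "p1 * i1 = fst X" "p2 * i2 = fst Y" "p1 * i2 = 0" "p2 * i1 = 0"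
     "fst B = i1 * p1 + i2 * p2" "snd B = i1 * a * p1 + i2 * f * p1 + i2 * snd Y * p2"
  using assms unfolding glued_def by auto

lemma glued_simps:
  assumes "glued c B X Y a f i1 i2 p1 p2"
  shows "i1 * (fst X * y) = i1 * y" "fst X * (p1 * y) = p1 * y" "i2 * (fst Y * y) = i2 * y" "fst Y * (p2 * y) = p2 * y"
     "p1 * (i1 * y) = fst X * y" "p2 * (i2 * y) = fst Y * y" "p1 * (i2 * y) = 0" "p2 * (i1 * y) = 0"
  using gluedD[OF assms] by (simp_all add: mult.assoc[symmetric])

text \<open>The square of the triangular differential has the single critical block
  \<open>snd Y * f + f * a\<close>.\<close>

lemma acx_glued:
  assumes g: "glued c B X Y a f i1 i2 p1 p2" and X: "acx X" and Y: "acx Y"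
    and a: "dg 1 a" "fst X * a = a" "a * fst X = a" "a * a = 0"
    and f: "dg (1 - c) f" "fst Y * f = f" "f * fst X = f" "snd Y * f + f * a = 0"
  shows "acx B"
proof -
  note gD = gluedD[OF g] and gs = glued_simps[OF g]
  have xs: "fst X * (fst X * y) = fst X * y" "fst Y * (fst Y * y) = fst Y * y" "fst Y * (snd Y * y) = snd Y * y"
    "snd Y * (fst Y * y) = snd Y * y" "snd Y * (snd Y * y) = 0" for y
    using X Y unfolding acx_def by (simp_all add: mult.assoc[symmetric])
  have as: "fst X * (a * y) = a * y" "a * (fst X * y) = a * y" "a * (a * y) = 0"
    "fst Y * (f * y) = f * y" "f * (fst X * y) = f * y" for y
    using a f by (simp_all add: mult.assoc[symmetric])
  have ff: "snd Y * (f * y) + f * (a * y) = 0" for y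
    using f(4) by (simp add: mult.assoc[symmetric] distrib_right[symmetric])
  have e: "dg 0 (fst B)"
    using dg_mult[OF gD(1,2)] dg_mult[OF gD(3,4)] unfolding gD(13) by (auto intro: dg_add)
  have d: "dg 1 (snd B)"
    unfolding gD(14) using dg_mult[OF dg_mult[OF gD(1) a(1)] gD(2)] dg_mult[OF dg_mult[OF gD(3) f(1)] gD(2)]
      dg_mult[OF dg_mult[OF gD(3), of 1 "snd Y"] gD(4)] Y unfolding acx_def by (auto intro!: dg_add)
  have 1: "fst B * fst B = fst B"
    unfolding gD(13) using gD gs xs by (simp add: distrib_left distrib_right mult.assoc)
  have 2: "fst B * snd B = snd B"
    unfolding gD(13,14) using gD gs xs as by (simp add: distrib_left distrib_right mult.assoc)
  have 3: "snd B * fst B = snd B"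
    unfolding gD(13,14) using gD gs xs as by (simp add: distrib_left distrib_right mult.assoc)
  have "snd B * snd B = i2 * (snd Y * (f * p1) + f * (a * p1))"
    unfolding gD(14) using gD gs xs as by (simp add: distrib_left distrib_right mult.assoc add.commute)
  then have 4: "snd B * snd B = 0" using ff by simp
  show ?thesis unfolding acx_def using e d 1 2 3 4 by blast
qed

lemma block_cplx:
  fixes X Y B :: "'a::ring_1 cplx"
  assumes X: "is_complex X" and Y: "is_complex Y"
    and A: "bounded_mats 1 (dm X) (dm X) A" and C: "bounded_mats (1 - c) (dm Y) (dm X) C"
  defines "a \<equiv> encf 1 (dm X) (dm X) A" and "f \<equiv> encf (1 - c) (dm Y) (dm X) C"
  assumes a: "fst (ac X) * a = a" "a * fst (ac X) = a" "a * a = 0"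
    and f: "fst (ac Y) * f = f" "f * fst (ac X) = f" "snd (ac Y) * f + f * a = 0"
    and B: "\<And>i. cobj B i = pobj_sum (cobj X (i + c)) (cobj Y i)"
      "\<And>i. cdif B i = four_block_mat (A (i + c)) (0\<^sub>m (dm X (i + c + 1)) (dm Y i)) (C (i + c)) (cdif Y i)"
  shows "is_complex B" "\<exists>i1 i2 p1 p2. glued c (ac B) (ac X) (ac Y) a f i1 i2 p1 p2"
proof -
  note bX = ac_bounded[OF X] and bY = ac_bounded[OF Y]
  have dB: "dm B = (\<lambda>i. dm X (i + c) + dm Y i)" by (simp add: fun_eq_iff dm_def B pobj_sum_def)
  define Z where "Z = (\<lambda>i. 0\<^sub>m (dm Y (i + (0 - c))) (dm X i) :: 'a mat)"
  have bZ: "bounded_mats (0 - c) (dm Y) (dm X) Z" unfolding Z_def by (rule bounded_mats_zero)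
  have eZ: "encf (0 - c) (dm Y) (dm X) Z = 0" unfolding Z_def by (rule encf_zero)
  obtain N1 N2 N3 N4 N5 where Ns: "sized N1 (dm X) (dm X) (fst (ac X))" "sized N2 (dm Y) (dm Y) (fst (ac Y))"
    "sized N3 (dm X) (dm X) a" "sized N4 (dm Y) (dm X) f" "sized N5 (dm Y) (dm Y) (snd (ac Y))"
    using ex_sized[OF bX(1)] ex_sized[OF bY(1)] ex_sized[OF A] ex_sized[OF C] ex_sized[OF bY(2)]
    unfolding a_def f_def ac_def by auto
  define N where "N = max (max N1 N2) (max N3 (max N4 N5))"
  have s: "sized N (dm X) (dm X) (fst (ac X))" "sized N (dm Y) (dm Y) (fst (ac Y))"
    "sized N (dm X) (dm X) a" "sized N (dm Y) (dm X) f" "sized N (dm Y) (dm Y) (snd (ac Y))"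
    using Ns[THEN sized_mono] unfolding N_def by auto
  have s0: "sized N (dm Y) (dm X) (0 :: 'a fm)" unfolding sized_def by simp
  define s1 where "s1 = (emb c (\<lambda>_. 0) (dm X) N :: 'a fm)"
  define t1 where "t1 = (prj c (\<lambda>_. 0) (dm X) N :: 'a fm)"
  define s2 where "s2 = (emb 0 (\<lambda>i. dm X (i + c)) (dm Y) N :: 'a fm)"
  define t2 where "t2 = (prj 0 (\<lambda>i. dm X (i + c)) (dm Y) N :: 'a fm)"
  have idB: "id_cmap B = (\<lambda>i. four_block_mat (id_cmap X (i + c)) (0\<^sub>m (dm X (i + c + 0)) (dm Y i)) (Z (i + c)) (id_cmap Y i))"
    by (simp add: fun_eq_iff id_cmap_def B pobj_sum_def Z_def dm_def)
  have cB: "cdif B = (\<lambda>i. four_block_mat (A (i + c)) (0\<^sub>m (dm X (i + c + 1)) (dm Y i)) (C (i + c)) (cdif Y i))"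
    using B(2) by blast
  have E: "bounded_mats 0 (dm B) (dm B) (id_cmap B)"
    "fst (ac B) = s1 * fst (ac X) * t1 + s2 * fst (ac Y) * t2"
    using encf_four_block[OF bX(1) bZ bY(1), of N] s(1,2) s0 unfolding eZ dB idB ac_def s1_def s2_def t1_def t2_def
    by simp_all
  have D: "bounded_mats 1 (dm B) (dm B) (cdif B)"
    "snd (ac B) = s1 * a * t1 + s2 * f * t1 + s2 * snd (ac Y) * t2"
    using encf_four_block[OF A C bY(2), of N] s(3,4,5) unfolding dB cB ac_def s1_def s2_def t1_def t2_def a_def f_def
    by simp_all
  have aX: "acx (ac X)" and aY: "acx (ac Y)" using acx_ac[OF X] acx_ac[OF Y] by auto
  note ax = aX[unfolded acx_def] and ay = aY[unfolded acx_def]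
  have 11: "t1 * (s1 * fst (ac X)) = fst (ac X)" and 22: "t2 * (s2 * fst (ac Y)) = fst (ac Y)"
    unfolding s1_def s2_def t1_def t2_def using prj_emb[OF s(1)] prj_emb[OF s(2)] by auto
  have 12: "t1 * s2 = 0" "t2 * s1 = 0" unfolding s1_def s2_def t1_def t2_def by (rule prj_emb_orth)+
  have orth: "t1 * (s2 * y) = 0" "t2 * (s1 * y) = 0" for y using 12 by (simp_all add: mult.assoc[symmetric])
  have ee: "fst (ac X) * (fst (ac X) * y) = fst (ac X) * y" "fst (ac Y) * (fst (ac Y) * y) = fst (ac Y) * y"
    "fst (ac X) * (a * y) = a * y" "a * (fst (ac X) * y) = a * y" "fst (ac Y) * (f * y) = f * y" "f * (fst (ac X) * y) = f * y"
    "fst (ac Y) * (snd (ac Y) * y) = snd (ac Y) * y" "snd (ac Y) * (fst (ac Y) * y) = snd (ac Y) * y" for y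
    using ax ay a f by (simp_all add: mult.assoc[symmetric])
  have g: "glued c (ac B) (ac X) (ac Y) a f (s1 * fst (ac X)) (s2 * fst (ac Y)) (fst (ac X) * t1) (fst (ac Y) * t2)"
    unfolding glued_def E(2) D(2)
  proof (intro conjI)
    show "dg (- c) (s1 * fst (ac X))" "dg c (fst (ac X) * t1)" "dg 0 (s2 * fst (ac Y))" "dg 0 (fst (ac Y) * t2)"
      using ax ay dg_emb[of c "\<lambda>_. 0" "dm X" N] dg_prj[of c "\<lambda>_. 0" "dm X" N]
        dg_emb[of 0 "\<lambda>i. dm X (i + c)" "dm Y" N] dg_prj[of 0 "\<lambda>i. dm X (i + c)" "dm Y" N]
      unfolding s1_def s2_def t1_def t2_def by (auto intro: dg_mult_0l dg_mult_0r)
  qed (use ax ay 11 22 12 orth ee in \<open>simp_all add: mult.assoc\<close>)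
  then show "\<exists>i1 i2 p1 p2. glued c (ac B) (ac X) (ac Y) a f i1 i2 p1 p2" by blast
  have "acx (ac B)"
    using acx_glued[OF g aX aY _ a _ f] dg_encf[OF A] dg_encf[OF C] unfolding a_def f_def by simp
  then show "is_complex B" by (rule is_complexI[OF E(1) D(1)])
qed

lemma dsum_glued:
  fixes X Y :: "'a::ring_1 cplx"
  assumes X: "is_complex X" and Y: "is_complex Y"
  shows "is_complex (X \<oplus>\<^sub>K Y)" "\<exists>i1 i2 p1 p2. glued 0 (ac (X \<oplus>\<^sub>K Y)) (ac X) (ac Y) (snd (ac X)) 0 i1 i2 p1 p2"
proof -
  define Z where "Z = (\<lambda>i. 0\<^sub>m (dm Y (i + (1 - 0))) (dm X i) :: 'a mat)"
  have C: "bounded_mats (1 - 0) (dm Y) (dm X) Z" unfolding Z_def by (rule bounded_mats_zero)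
  have e: "encf (1 - 0) (dm Y) (dm X) Z = 0" unfolding Z_def by (rule encf_zero)
  have a: "encf 1 (dm X) (dm X) (cdif X) = snd (ac X)" by (simp add: ac_def)
  note ax = acx_ac[OF X, unfolded acx_def]
  have c1: "cobj (X \<oplus>\<^sub>K Y) i = pobj_sum (cobj X (i + 0)) (cobj Y i)" for i
    by (simp add: dsum_def cobj_def)
  have c2: "cdif (X \<oplus>\<^sub>K Y) i = four_block_mat (cdif X (i + 0)) (0\<^sub>m (dm X (i + 0 + 1)) (dm Y i)) (Z (i + 0)) (cdif Y i)" for i
    by (simp add: dsum_def cdif_def dm_def Z_def)
  note b = block_cplx[OF X Y ac_bounded(2)[OF X] C _ _ _ _ _ _ c1 c2, unfolded e a]
  show "is_complex (X \<oplus>\<^sub>K Y)" by (rule b(1)) (use ax in simp_all)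
  show "\<exists>i1 i2 p1 p2. glued 0 (ac (X \<oplus>\<^sub>K Y)) (ac X) (ac Y) (snd (ac X)) 0 i1 i2 p1 p2"
    by (rule b(2)) (use ax in simp_all)
qed

lemma cone_glued:
  assumes X: "is_complex X" and Y: "is_complex Y" and f: "chain_map X Y f"
  shows "is_complex (cone X Y f)"
    "\<exists>i1 i2 p1 p2. glued 1 (ac (cone X Y f)) (ac X) (ac Y) (- snd (ac X)) (enc 0 X Y f) i1 i2 p1 p2"
proof -
  have f': "f \<in> homs 0 X Y" "enc 0 X Y f \<in> Zc 0 (ac X) (ac Y)" using chain_map_iff[OF X Y, of 0 f] f by auto
  note F = ZcD[OF f'(2)] and Fh = hmD[OF ZcD(1)[OF f'(2)]]
  note bm = encf_uminus[OF ac_bounded(2)[OF X]]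
  have C: "bounded_mats (1 - 1) (dm Y) (dm X) f" using bounded_homs[OF X Y f'(1)] by simp
  note ax = acx_ac[OF X, unfolded acx_def]
  have a: "encf 1 (dm X) (dm X) (\<lambda>i. - cdif X i) = - snd (ac X)" by (simp add: bm(2) ac_def)
  have e: "encf (1 - 1) (dm Y) (dm X) f = enc 0 X Y f" by (simp add: enc_def)
  have c1: "cobj (cone X Y f) i = pobj_sum (cobj X (i + 1)) (cobj Y i)" for i
    by (simp add: cone_def cobj_def)
  have i2: "i + 1 + 1 = i + 2" for i :: int by simp
  have c2: "cdif (cone X Y f) i = four_block_mat (- cdif X (i + 1)) (0\<^sub>m (dm X (i + 1 + 1)) (dm Y i)) (f (i + 1)) (cdif Y i)" for i
    unfolding i2 by (simp add: cone_def cdif_def dm_def)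
  note b = block_cplx[OF X Y bm(1) C _ _ _ _ _ _ c1 c2, unfolded e a]
  show "is_complex (cone X Y f)" by (rule b(1)) (use ax F(2) Fh in simp_all)
  show "\<exists>i1 i2 p1 p2. glued 1 (ac (cone X Y f)) (ac X) (ac Y) (- snd (ac X)) (enc 0 X Y f) i1 i2 p1 p2"
    by (rule b(2)) (use ax F(2) Fh in simp_all)
qed

lemma encf_shift:
  fixes F :: "int \<Rightarrow> 'a::ring_1 mat"
  assumes F: "bounded_mats k v u F" and s: "sized N v u (encf k v u F)"
  shows "bounded_mats k (\<lambda>i. v (i + c)) (\<lambda>i. u (i + c)) (\<lambda>i. F (i + c))"
    "encf k (\<lambda>i. v (i + c)) (\<lambda>i. u (i + c)) (\<lambda>i. F (i + c)) =
      emb c (\<lambda>_. 0) v N * encf k v u F * prj c (\<lambda>_. 0) u N"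
proof -
  have ik: "i + k + c = i + c + k" for i by simp
  obtain N0 where N0: "\<And>i. \<bar>i\<bar> > N0 \<Longrightarrow> F i = 0\<^sub>m (v (i + k)) (u i)"
    using F unfolding bounded_mats_def by blast
  have "F (i + c) = 0\<^sub>m (v (i + k + c)) (u (i + c))" if "\<bar>i\<bar> > N0 + \<bar>c\<bar>" for i
    unfolding ik by (rule N0) (use that in linarith)
  then show b: "bounded_mats k (\<lambda>i. v (i + c)) (\<lambda>i. u (i + c)) (\<lambda>i. F (i + c))"
    unfolding bounded_mats_def using bounded_matsD[OF F] by (metis ik)
  show "encf k (\<lambda>i. v (i + c)) (\<lambda>i. u (i + c)) (\<lambda>i. F (i + c)) =
      emb c (\<lambda>_. 0) v N * encf k v u F * prj c (\<lambda>_. 0) u N"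
    by (rule fm_eqI', unfold ent_emb_prj[OF s] ent_encf[OF b]) (auto simp: ent_encf[OF F] ik)
qed

definition shifted :: "int \<Rightarrow> 'a::ring ac \<Rightarrow> 'a ac \<Rightarrow> 'a fm \<Rightarrow> 'a fm \<Rightarrow> bool" where
  "shifted c B X i p \<longleftrightarrow> dg (- c) i \<and> dg c p \<and> i * fst X = i \<and> fst X * p = p \<and> p * i = fst X \<and>
     fst B = i * p \<and> snd B = sg c (i * snd X * p)"

lemma acx_shifted: "shifted c B X i p \<Longrightarrow> acx X \<Longrightarrow> acx B"
proof -
  assume s: "shifted c B X i p" and X: "acx X"
  note sD = s[unfolded shifted_def] and aX = X[unfolded acx_def]
  have r: "p * (i * y) = fst X * y" "fst X * (p * y) = p * y" "i * (fst X * y) = i * y"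
    "fst X * (snd X * y) = snd X * y" "snd X * (snd X * y) = 0" "snd X * (fst X * y) = snd X * y" for y
    using sD aX by (simp_all add: mult.assoc[symmetric])
  have "dg 0 (i * p)" "dg 1 (i * snd X * p)"
    using dg_mult[of "- c" i c p] dg_mult[OF dg_mult[of "- c" i 1 "snd X"], of c p] sD aX by auto
  then show ?thesis
    unfolding acx_def using sD aX r by (simp add: sg_mult_left sg_mult_right dg_sg mult.assoc)
qed

lemma shift_shifted:
  assumes X: "is_complex X"
  shows "is_complex (shift c X)" "\<exists>i p. shifted c (ac (shift c X)) (ac X) i p"
proof -
  note bX = ac_bounded[OF X]
  note ax = acx_ac[OF X, unfolded acx_def]
  obtain N1 N2 where Ns: "sized N1 (dm X) (dm X) (fst (ac X))" "sized N2 (dm X) (dm X) (snd (ac X))"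
    using ex_sized[OF bX(1)] ex_sized[OF bX(2)] unfolding ac_def by auto
  define N where "N = max N1 N2"
  have s: "sized N (dm X) (dm X) (fst (ac X))" "sized N (dm X) (dm X) (snd (ac X))"
    using Ns[THEN sized_mono] unfolding N_def by auto
  define s1 where "s1 = (emb c (\<lambda>_. 0) (dm X) N :: 'a fm)"
  define t1 where "t1 = (prj c (\<lambda>_. 0) (dm X) N :: 'a fm)"
  have dB: "dm (shift c X) = (\<lambda>i. dm X (i + c))" by (simp add: fun_eq_iff dm_def shift_simps)
  have idB: "id_cmap (shift c X) = (\<lambda>i. id_cmap X (i + c))" by (simp add: fun_eq_iff id_cmap_def shift_simps)
  have cB: "cdif (shift c X) = (\<lambda>i. if even c then cdif X (i + c) else - cdif X (i + c))"
    by (simp add: fun_eq_iff shift_simps)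
  note sh = encf_shift[OF bX(1), of N c] encf_shift[OF bX(2), of N c]
  have E: "bounded_mats 0 (dm (shift c X)) (dm (shift c X)) (id_cmap (shift c X))"
    "fst (ac (shift c X)) = s1 * fst (ac X) * t1"
    using sh s unfolding dB idB ac_def s1_def t1_def by simp_all
  have D: "bounded_mats 1 (dm (shift c X)) (dm (shift c X)) (cdif (shift c X)) \<and>
    snd (ac (shift c X)) = sg c (s1 * snd (ac X) * t1)"
  proof (cases "even c")
    case True
    then show ?thesis using sh s unfolding dB cB ac_def s1_def t1_def by (simp add: sg_def)
  next
    case False
    have s2: "sized N (dm X) (dm X) (encf 1 (dm X) (dm X) (cdif X))" using s(2) by (simp add: ac_def)
    note u = encf_uminus[OF sh(3)[OF s2]]
    show ?thesis using False u sh(4)[OF s2] unfolding dB cB ac_def s1_def t1_def by (simp add: sg_def)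
  qed
  have 11: "t1 * (s1 * fst (ac X)) = fst (ac X)" unfolding s1_def t1_def using prj_emb[OF s(1)] by auto
  have ee: "fst (ac X) * (fst (ac X) * y) = fst (ac X) * y"
    "fst (ac X) * (snd (ac X) * y) = snd (ac X) * y" "snd (ac X) * (fst (ac X) * y) = snd (ac X) * y" for y
    using ax by (simp_all add: mult.assoc[symmetric])
  have g: "shifted c (ac (shift c X)) (ac X) (s1 * fst (ac X)) (fst (ac X) * t1)"
    unfolding shifted_def E(2) conjunct2[OF D]
  proof (intro conjI)
    show "dg (- c) (s1 * fst (ac X))" "dg c (fst (ac X) * t1)"
      using ax dg_emb[of c "\<lambda>_. 0" "dm X" N] dg_prj[of c "\<lambda>_. 0" "dm X" N]
      unfolding s1_def t1_def by (auto intro: dg_mult_0l dg_mult_0r)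
  qed (use ax 11 ee in \<open>simp_all add: mult.assoc\<close>)
  then show "\<exists>i p. shifted c (ac (shift c X)) (ac X) i p" by blast
  show "is_complex (shift c X)"
    by (rule is_complexI[OF E(1) conjunct1[OF D] acx_shifted[OF g acx_ac[OF X]]])
qed

lemma zero_cplx_ac: "is_complex (zero_cplx :: 'a::ring_1 cplx)" "fst (ac (zero_cplx :: 'a cplx)) = 0"
proof -
  show "is_complex (zero_cplx :: 'a cplx)"
    unfolding is_complex_def zero_cplx_def proj_obj_def phom_def cobj_def cdif_def by auto
  have d: "dm (zero_cplx :: 'a cplx) = (\<lambda>_. 0)" "id_cmap (zero_cplx :: 'a cplx) = (\<lambda>i. 0\<^sub>m ((\<lambda>_. 0) (i + 0)) ((\<lambda>_. 0) i))"
    by (simp_all add: fun_eq_iff zero_cplx_def dm_def cobj_def id_cmap_def)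
  show "fst (ac (zero_cplx :: 'a cplx)) = 0" unfolding ac_def d fst_conv by (rule encf_zero)
qed

section \<open>Krull-Schmidt for complexes\<close>

lemma glued_biproduct:
  assumes g: "glued 0 B X Y (snd X) 0 i1 i2 p1 p2" and X: "acx X" and Y: "acx Y"
  shows "i1 \<in> Zc 0 X B" "i2 \<in> Zc 0 Y B" "p1 \<in> Zc 0 B X" "p2 \<in> Zc 0 B Y"
proof -
  note gD = gluedD[OF g] and gs = glued_simps[OF g]
  have xs: "fst X * (snd X * y) = snd X * y" "snd X * (fst X * y) = snd X * y"
    "fst Y * (snd Y * y) = snd Y * y" "snd Y * (fst Y * y) = snd Y * y"
    "fst X * snd X = snd X" "snd X * fst X = snd X" "fst Y * snd Y = snd Y" "snd Y * fst Y = snd Y" for y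
    using X Y unfolding acx_def by (simp_all add: mult.assoc[symmetric])
  show "i1 \<in> Zc 0 X B" "i2 \<in> Zc 0 Y B" "p1 \<in> Zc 0 B X" "p2 \<in> Zc 0 B Y"
    unfolding Zc_def hm_def using gD gs xs by (simp_all add: distrib_left distrib_right mult.assoc)
qed

context fdalg
begin

lemma subspace_Zc: "vs.subspace (Zc k X Y)"
proof (rule vs.subspaceI)
  fix c f assume f: "f \<in> Zc k X Y"
  have "sg k (fs c x) = fs c (sg k x)" for x unfolding sg_def by simp
  then show "fs c f \<in> Zc k X Y"
    using f unfolding Zc_def hm_def by (simp add: fs_mult_left fs_mult_right dg_fs)
qed (auto intro: Zc_add)

definition corner :: "'a fm \<Rightarrow> 'a fm set" where
  "corner e = {x. e * x = x \<and> x * e = x}"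

lemma subspace_corner: "vs.subspace (corner e)"
  unfolding corner_def
  by (rule vs.subspaceI) (auto simp: distrib_left distrib_right fs_mult_left fs_mult_right)

text \<open>Dimension of the graded, possibly inhomogeneous, endomorphisms. It depends on the
  complex and not just on its homotopy type, and it drops for the image of every strict idempotent
  other than the unit.\<close>

definition mu :: "'a cplx \<Rightarrow> nat" where "mu X = vs.dim (corner (fst (ac X)))"

lemma dim_corner_less:
  assumes "g * g = g" "e * g = g" "g * e = g" "e * e = e" "g \<noteq> e"
  shows "vs.dim (corner g) < vs.dim (corner e)"
proof -
  obtain B where B: "finite B" "corner e \<subseteq> vs.span B"
    using finite_span_corner[of e e] unfolding corner_def by blast
  have "corner g \<subseteq> corner e"
  proof
    fix x assume x: "x \<in> corner g"
    then have "g * x = x" "x * g = x" unfolding corner_def by simp_all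
    then have "e * x = x" "x * e = x" using assms(2,3) by (metis mult.assoc)+
    then show "x \<in> corner e" unfolding corner_def by simp
  qed
  moreover have "e \<in> corner e" "e \<notin> corner g" using assms unfolding corner_def by auto
  ultimately show ?thesis
    using vs.dim_psubspace[OF subspace_corner subspace_corner _ _ B(2,1), of g] by blast
qed

lemma fitting_Zc:
  fixes X :: "'a ac"
  assumes X: "acx X" and f: "f \<in> Zc 0 X X"
  obtains g u v where "g \<in> Zc 0 X X" "u \<in> Zc 0 X X" "v \<in> Zc 0 X X" "g * g = g" "f * u = g" "u * f = g"
    "(fst X - f) * v = fst X - g" "v * (fst X - f) = fst X - g" "fst X * g = g" "g * fst X = g"
proof (rule fitting[of "fst X" f "Zc 0 X X"])
  show "fst X * fst X = fst X" "fst X * f = f" "f * fst X = f"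
    using X hmD[OF ZcD(1)[OF f]] unfolding acx_def by auto
  show "x * y \<in> Zc 0 X X" if "x \<in> Zc 0 X X" "y \<in> Zc 0 X X" for x y using Zc_mult[OF that] by simp
  show "fst X \<in> Zc 0 X X" by (rule acx_unit[OF X])
qed (use subspace_Zc f that in auto)

text \<open>Fitting's idempotent \<open>g\<close> is close to \<open>f\<close>: both
  \<open>f - f * g\<close> and \<open>f * g - g\<close> are multiples of \<open>f * f - f\<close>,
  hence null-homotopic.\<close>

lemma strict_idempotent:
  fixes X :: "'a ac"
  assumes X: "acx X" and f: "f \<in> Zc 0 X X" "f * f - f \<in> Bc 0 X X"
  obtains g where "g \<in> Zc 0 X X" "g * g = g" "fst X * g = g" "g * fst X = g" "g - f \<in> Bc 0 X X"
proof -
  obtain g u v where g: "g \<in> Zc 0 X X" "u \<in> Zc 0 X X" "v \<in> Zc 0 X X" "g * g = g" "f * u = g" "u * f = g"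
    "(fst X - f) * v = fst X - g" "v * (fst X - f) = fst X - g" "fst X * g = g" "g * fst X = g"
    using fitting_Zc[OF X f(1)] .
  have fe: "f * fst X = f" using hmD[OF ZcD(1)[OF f(1)]] by blast
  have "f * (fst X - g) = f * (fst X - f) * v" using g(7) by (simp add: mult.assoc)
  also have "\<dots> = - ((f * f - f) * v)" using fe by (simp add: algebra_simps)
  finally have 1: "f - f * g = - ((f * f - f) * v)" using fe by (simp add: right_diff_distrib)
  have 2: "f * g - g = (f * f - f) * u" using g(5) by (simp add: left_diff_distrib mult.assoc)
  have "g - f = - (f - f * g) - (f * g - g)" by simp
  also have "\<dots> = (f * f - f) * v - (f * f - f) * u" unfolding 1 2 by simp
  finally have "g - f = (f * f - f) * v - (f * f - f) * u" .
  moreover have "(f * f - f) * v \<in> Bc 0 X X" "(f * f - f) * u \<in> Bc 0 X X"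
    using Bc_mult_right[OF f(2) g(3)] Bc_mult_right[OF f(2) g(2)] by auto
  ultimately have "g - f \<in> Bc 0 X X" using Bc_diff by simp
  then show thesis using that g by blast
qed

lemma acx_image:
  fixes X :: "'a ac"
  assumes X: "acx X" and g: "g \<in> Zc 0 X X" "g * g = g"
  shows "acx (g, g * snd X)" "g \<in> Zc 0 (g, g * snd X) X" "g \<in> Zc 0 X (g, g * snd X)"
proof -
  note aX = X[unfolded acx_def] and gh = hmD[OF ZcD(1)[OF g(1)]]
  have c: "snd X * g = g * snd X" using ZcD(2)[OF g(1)] by simp
  have c': "snd X * (g * y) = g * (snd X * y)" for y using c by (simp add: mult.assoc[symmetric])
  have g': "g * (g * y) = g * y" for y using g(2) by (simp add: mult.assoc[symmetric])
  have d: "snd X * (snd X * y) = 0" for y using aX by (simp add: mult.assoc[symmetric])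
  have "dg 1 (g * snd X)" using dg_mult[OF gh(1), of 1 "snd X"] aX by simp
  then show "acx (g, g * snd X)"
    unfolding acx_def using gh aX c c' g' g(2) d by (simp add: mult.assoc)
  show "g \<in> Zc 0 (g, g * snd X) X" "g \<in> Zc 0 X (g, g * snd X)"
    unfolding Zc_def hm_def using gh aX c c' g' g(2) d by (simp_all add: mult.assoc)
qed

text \<open>The images of \<open>g\<close> and of its complement, with the restricted differential,
  are complexes; inclusions and projections are the idempotents themselves.\<close>

lemma split_idempotent:
  fixes X :: "'a cplx"
  assumes X: "is_complex X" and g: "g \<in> Zc 0 (ac X) (ac X)" "g * g = g" "fst (ac X) * g = g" "g * fst (ac X) = g"
  obtains Y Z i1 i2 p1 p2 where "is_complex Y" "is_complex Z" "fst (ac Y) = g" "fst (ac Z) = fst (ac X) - g"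
    "i1 \<in> Zc 0 (ac Y) (ac X)" "i2 \<in> Zc 0 (ac Z) (ac X)" "p1 \<in> Zc 0 (ac X) (ac Y)" "p2 \<in> Zc 0 (ac X) (ac Z)"
    "p1 * i1 = fst (ac Y)" "p2 * i2 = fst (ac Z)" "p1 * i2 = 0" "p2 * i1 = 0" "i1 * p1 + i2 * p2 = fst (ac X)" "i1 * p1 = g"
proof -
  note aX = acx_ac[OF X]
  let ?e = "fst (ac X)"
  have g': "?e - g \<in> Zc 0 (ac X) (ac X)" "(?e - g) * (?e - g) = ?e - g"
    using Zc_diff[OF acx_unit[OF aX] g(1)] aX[unfolded acx_def] g by (auto simp: algebra_simps)
  note 1 = acx_image[OF aX g(1,2)] and 2 = acx_image[OF aX g']
  obtain Y where Y: "is_complex Y" "ac Y = (g, g * snd (ac X))" using realize[OF 1(1)] by blast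
  obtain Z where Z: "is_complex Z" "ac Z = (?e - g, (?e - g) * snd (ac X))" using realize[OF 2(1)] by blast
  show thesis
    by (rule that[OF Y(1) Z(1), of g "?e - g" g "?e - g"])
       (use 1 2 Y(2) Z(2) g g' in \<open>auto simp: left_diff_distrib right_diff_distrib\<close>)
qed

sublocale ks: ks_cat is_complex "\<lambda>X Y. Zc 0 (ac X) (ac Y)" "\<lambda>X Y. Bc 0 (ac X) (ac Y)"
  "\<lambda>X. fst (ac X)" "(\<oplus>\<^sub>K)" zero_cplx mu
proof
  fix X Y W :: "'a cplx" and f g :: "'a fm"
  show "0 \<in> Zc 0 (ac X) (ac Y)" "0 \<in> Bc 0 (ac X) (ac Y)" by auto
  show "f + g \<in> Zc 0 (ac X) (ac Y)" if "f \<in> Zc 0 (ac X) (ac Y)" "g \<in> Zc 0 (ac X) (ac Y)"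
    using that by (rule Zc_add)
  show "- f \<in> Zc 0 (ac X) (ac Y)" if "f \<in> Zc 0 (ac X) (ac Y)" using that by (rule Zc_uminus)
  show "g * f \<in> Zc 0 (ac X) (ac W)" if "g \<in> Zc 0 (ac Y) (ac W)" "f \<in> Zc 0 (ac X) (ac Y)"
    using Zc_mult[OF that] by simp
  show "fst (ac X) \<in> Zc 0 (ac X) (ac X)" if "is_complex X" using acx_unit acx_ac that by blast
  show "fst (ac Y) * f = f" "f * fst (ac X) = f" if "f \<in> Zc 0 (ac X) (ac Y)"
    using hmD[OF ZcD(1)[OF that]] by auto
  show "f + g \<in> Bc 0 (ac X) (ac Y)" if "f \<in> Bc 0 (ac X) (ac Y)" "g \<in> Bc 0 (ac X) (ac Y)"
    using that by (rule Bc_add)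
  show "- f \<in> Bc 0 (ac X) (ac Y)" if "f \<in> Bc 0 (ac X) (ac Y)" using that by (rule Bc_uminus)
  show "g * f \<in> Bc 0 (ac X) (ac W)" if "g \<in> Zc 0 (ac Y) (ac W)" "f \<in> Bc 0 (ac X) (ac Y)"
    using Bc_mult_left[OF that] by simp
  show "g * f \<in> Bc 0 (ac X) (ac W)" if "g \<in> Bc 0 (ac Y) (ac W)" "f \<in> Zc 0 (ac X) (ac Y)"
    using Bc_mult_right[OF that] by simp
  show "is_complex (zero_cplx :: 'a cplx)" "fst (ac (zero_cplx :: 'a cplx)) = 0" by (rule zero_cplx_ac)+
  show "is_complex (X \<oplus>\<^sub>K Y)" if "is_complex X" "is_complex Y" by (rule dsum_glued(1)[OF that])
  show "\<exists>i1 i2 p1 p2. i1 \<in> Zc 0 (ac X) (ac (X \<oplus>\<^sub>K Y)) \<and> i2 \<in> Zc 0 (ac Y) (ac (X \<oplus>\<^sub>K Y)) \<and>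
      p1 \<in> Zc 0 (ac (X \<oplus>\<^sub>K Y)) (ac X) \<and> p2 \<in> Zc 0 (ac (X \<oplus>\<^sub>K Y)) (ac Y) \<and> p1 * i1 = fst (ac X) \<and> p2 * i2 = fst (ac Y) \<and>
      p1 * i2 = 0 \<and> p2 * i1 = 0 \<and> i1 * p1 + i2 * p2 = fst (ac (X \<oplus>\<^sub>K Y))" if XY: "is_complex X" "is_complex Y"
  proof -
    obtain i1 i2 p1 p2 where g: "glued 0 (ac (X \<oplus>\<^sub>K Y)) (ac X) (ac Y) (snd (ac X)) 0 i1 i2 p1 p2"
      using dsum_glued(2)[OF XY] by blast
    show ?thesis
      using glued_biproduct[OF g acx_ac[OF XY(1)] acx_ac[OF XY(2)]] gluedD[OF g]
      by (intro exI[of _ i1] exI[of _ i2] exI[of _ p1] exI[of _ p2]) simp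
  qed
  show "\<exists>e\<in>Zc 0 (ac X) (ac X). \<exists>u\<in>Zc 0 (ac X) (ac X). \<exists>v\<in>Zc 0 (ac X) (ac X). e * e - e \<in> Bc 0 (ac X) (ac X) \<and>
      f * u - e \<in> Bc 0 (ac X) (ac X) \<and> u * f - e \<in> Bc 0 (ac X) (ac X) \<and>
      (fst (ac X) - f) * v - (fst (ac X) - e) \<in> Bc 0 (ac X) (ac X) \<and>
      v * (fst (ac X) - f) - (fst (ac X) - e) \<in> Bc 0 (ac X) (ac X)"
    if X: "is_complex X" and f: "f \<in> Zc 0 (ac X) (ac X)"
  proof -
    obtain g u v where "g \<in> Zc 0 (ac X) (ac X)" "u \<in> Zc 0 (ac X) (ac X)" "v \<in> Zc 0 (ac X) (ac X)"
      "g * g = g" "f * u = g" "u * f = g"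
      "(fst (ac X) - f) * v = fst (ac X) - g" "v * (fst (ac X) - f) = fst (ac X) - g"
      using fitting_Zc[OF acx_ac[OF X] f] .
    then show ?thesis by (intro bexI[of _ g] bexI[of _ u] bexI[of _ v]) simp_all
  qed
  show "\<exists>Y Z i1 i2 p1 p2. is_complex Y \<and> is_complex Z \<and>
      i1 \<in> Zc 0 (ac Y) (ac X) \<and> i2 \<in> Zc 0 (ac Z) (ac X) \<and> p1 \<in> Zc 0 (ac X) (ac Y) \<and> p2 \<in> Zc 0 (ac X) (ac Z) \<and>
      p1 * i1 = fst (ac Y) \<and> p2 * i2 = fst (ac Z) \<and>
      p1 * i2 = 0 \<and> p2 * i1 = 0 \<and> i1 * p1 + i2 * p2 = fst (ac X) \<and> i1 * p1 - f \<in> Bc 0 (ac X) (ac X) \<and>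
      (f \<notin> Bc 0 (ac X) (ac X) \<longrightarrow> fst (ac X) - f \<notin> Bc 0 (ac X) (ac X) \<longrightarrow> mu Y < mu X \<and> mu Z < mu X)"
    if X: "is_complex X" and f: "f \<in> Zc 0 (ac X) (ac X)" "f * f - f \<in> Bc 0 (ac X) (ac X)"
  proof -
    note aX = acx_ac[OF X, unfolded acx_def]
    obtain g where g: "g \<in> Zc 0 (ac X) (ac X)" "g * g = g" "fst (ac X) * g = g" "g * fst (ac X) = g"
      "g - f \<in> Bc 0 (ac X) (ac X)"
      using strict_idempotent[OF acx_ac[OF X] f] .
    obtain Y Z i1 i2 p1 p2 where s: "is_complex Y" "is_complex Z" "fst (ac Y) = g" "fst (ac Z) = fst (ac X) - g"
      "i1 \<in> Zc 0 (ac Y) (ac X)" "i2 \<in> Zc 0 (ac Z) (ac X)" "p1 \<in> Zc 0 (ac X) (ac Y)" "p2 \<in> Zc 0 (ac X) (ac Z)"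
      "p1 * i1 = fst (ac Y)" "p2 * i2 = fst (ac Z)" "p1 * i2 = 0" "p2 * i1 = 0" "i1 * p1 + i2 * p2 = fst (ac X)" "i1 * p1 = g"
      using split_idempotent[OF X g(1-4)] .
    have "mu Y < mu X \<and> mu Z < mu X"
      if n: "f \<notin> Bc 0 (ac X) (ac X)" "fst (ac X) - f \<notin> Bc 0 (ac X) (ac X)"
    proof -
      have g0: "g \<noteq> 0" using g(5) n(1) Bc_uminus[of "g - f" 0 "ac X" "ac X"] by auto
      have g1: "g \<noteq> fst (ac X)" using g(5) n(2) by auto
      show ?thesis unfolding mu_def s(3,4)
        using dim_corner_less[of g "fst (ac X)"] dim_corner_less[of "fst (ac X) - g" "fst (ac X)"] g g0 g1 aX
        by (auto simp: left_diff_distrib right_diff_distrib)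
    qed
    then show ?thesis using s g(5)
      by (intro exI[of _ Y] exI[of _ Z] exI[of _ i1] exI[of _ i2] exI[of _ p1] exI[of _ p2]) simp
  qed
qed

lemma iso_iff: "X \<simeq>\<^sub>K Y \<longleftrightarrow> ks.iso X Y"
  unfolding htpy_equiv_iff hiso_def ks.iso_def ..

lemma iso_class_eq: "iso_class X = ks.cls X"
  unfolding iso_class_def ks.cls_def iso_iff ..

lemma indec_iff: "indec X \<longleftrightarrow> ks.indec X"
  unfolding indec_def ks.indec_def iso_iff ..

lemma dsum_list_eq: "dsum_list Xs = ks.slist Xs"
  by (induction Xs) auto

lemma num_summands_eq:
  assumes "is_complex X" shows "num_summands X = card (set_mset (ks.kms X))"
proof -
  have "iso_class ` {Y. indec Y \<and> (\<exists>Z. is_complex Z \<and> X \<simeq>\<^sub>K Y \<oplus>\<^sub>K Z)} = set_mset (ks.kms X)"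
  proof (intro equalityI subsetI)
    fix c assume "c \<in> iso_class ` {Y. indec Y \<and> (\<exists>Z. is_complex Z \<and> X \<simeq>\<^sub>K Y \<oplus>\<^sub>K Z)}"
    then obtain Y where Y: "c = ks.cls Y" "ks.indec Y" "\<exists>Z. is_complex Z \<and> ks.iso X (Y \<oplus>\<^sub>K Z)"
      unfolding indec_iff iso_iff iso_class_eq by blast
    then show "c \<in># ks.kms X" using ks.kms_mem_summand[OF assms Y(2)] by simp
  next
    fix c assume c: "c \<in># ks.kms X"
    obtain Y where Y: "ks.indec Y" "c = ks.cls Y" using ks.kms_mem[OF assms c] by blast
    have "\<exists>Z. is_complex Z \<and> ks.iso X (Y \<oplus>\<^sub>K Z)" using ks.kms_mem_summand[OF assms Y(1)] c Y(2) by simp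
    then show "c \<in> iso_class ` {Y. indec Y \<and> (\<exists>Z. is_complex Z \<and> X \<simeq>\<^sub>K Y \<oplus>\<^sub>K Z)}"
      unfolding indec_iff iso_iff iso_class_eq using Y by (intro image_eqI[of _ _ Y]) simp_all
  qed
  then show ?thesis unfolding num_summands_def by simp
qed

lemma basic_iff: "basic X \<longleftrightarrow> is_complex X \<and> (\<forall>c. count (ks.kms X) c \<le> 1)"
proof
  assume "basic X"
  then obtain Ts where Ts: "X \<simeq>\<^sub>K dsum_list Ts" "\<forall>Y\<in>set Ts. indec Y"
    "\<And>i j. i < j \<Longrightarrow> j < length Ts \<Longrightarrow> \<not> Ts ! i \<simeq>\<^sub>K Ts ! j" unfolding basic_def by blast
  have iX: "ks.iso X (ks.slist Ts)" using Ts(1) iso_iff dsum_list_eq by simp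
  have k: "ks.kms X = mset (map ks.cls Ts)" using ks.kms_eqI[OF _ iX] Ts(2) indec_iff by blast
  have "distinct (map ks.cls Ts)"
    unfolding distinct_conv_nth
  proof (intro allI impI)
    fix i j assume ij: "i < length (map ks.cls Ts)" "j < length (map ks.cls Ts)" "i \<noteq> j"
    have ne: "ks.cls (Ts ! a) \<noteq> ks.cls (Ts ! b)" if "a < b" "b < length Ts" for a b
    proof
      assume eq: "ks.cls (Ts ! a) = ks.cls (Ts ! b)"
      have "is_complex (Ts ! a)" using Ts(2) that indec_def by (metis nth_mem order_less_trans)
      then have "Ts ! a \<simeq>\<^sub>K Ts ! b" using eq ks.cls_eq_iff iso_iff by blast
      then show False using Ts(3)[OF that] by blast
    qed
    show "map ks.cls Ts ! i \<noteq> map ks.cls Ts ! j"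
      using ij ne[of i j] ne[of j i] by (cases "i < j") auto
  qed
  then show "is_complex X \<and> (\<forall>c. count (ks.kms X) c \<le> 1)"
    using ks.iso_ob(1)[OF iX] k by (simp add: distinct_count_atmost_1)
next
  assume a: "is_complex X \<and> (\<forall>c. count (ks.kms X) c \<le> 1)"
  then obtain Ts where Ts: "\<forall>Y\<in>set Ts. ks.indec Y" "ks.iso X (ks.slist Ts)" "ks.kms X = mset (map ks.cls Ts)"
    using ks.kms_decompose by blast
  have "distinct (map ks.cls Ts)"
    unfolding distinct_count_atmost_1
  proof
    fix c
    show "count (mset (map ks.cls Ts)) c = (if c \<in> set (map ks.cls Ts) then 1 else 0)"
    proof (cases "c \<in> set (map ks.cls Ts)")
      case True
      then have "c \<in># ks.kms X" using Ts(3) by simp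
      then have "count (ks.kms X) c = 1" using a by (metis One_nat_def Suc_leI count_greater_zero_iff le_antisym)
      then show ?thesis using True Ts(3) by simp
    next
      case False
      then show ?thesis by (simp add: count_eq_zero_iff)
    qed
  qed
  then have "\<not> Ts ! i \<simeq>\<^sub>K Ts ! j" if "i < j" "j < length Ts" for i j
    using that ks.cls_eq_iff[of "Ts ! i" "Ts ! j"] Ts(1) iso_iff ks.indec_ob
    by (auto simp: distinct_conv_nth)
  then show "basic X" unfolding basic_def using Ts indec_iff iso_iff dsum_list_eq by metis
qed

end

section \<open>Two-term complexes and the Bongartz completion\<close>

text \<open>The presilting condition in two variables: no nonzero maps from \<open>X\<close> to a
  positive shift of \<open>Y\<close> in the homotopy category.\<close>

definition aev :: "'a::ring ac \<Rightarrow> 'a ac \<Rightarrow> bool" where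
  "aev X Y \<longleftrightarrow> (\<forall>l::nat. l > 0 \<longrightarrow> ext_vanish (int l) X Y)"

lemma presilting_iff_aev: "presilting T \<longleftrightarrow> is_complex T \<and> aev (ac T) (ac T)"
  unfolding presilting_iff aev_def ..

lemma aev_retract:
  assumes f: "f \<in> Zc 0 X X'" "g \<in> Zc 0 X' X" "f * g - fst X' \<in> Bc 0 X' X'"
    and a: "a \<in> Zc 0 Y Y'" "b \<in> Zc 0 Y' Y" "a * b - fst Y' \<in> Bc 0 Y' Y'"
    and e: "aev X Y"
  shows "aev X' Y'"
  unfolding aev_def ext_vanish_def
proof (intro allI impI subsetI)
  fix l :: nat and F assume l: "l > 0" and F: "F \<in> Zc (int l) X' Y'"
  have "b * F * f \<in> Zc (int l) X Y" using Zc_mult[OF Zc_mult[OF a(2) F] f(1)] by simp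
  then have "b * F * f \<in> Bc (int l) X Y" using e l unfolding aev_def ext_vanish_def by blast
  then have 1: "a * (b * F * f) * g \<in> Bc (int l) X' Y'"
    using Bc_mult_right[OF Bc_mult_left[OF a(1)] f(2)] by simp
  have 2: "(a * b - fst Y') * (F * (f * g)) \<in> Bc (int l) X' Y'"
    using Bc_mult_right[OF a(3) Zc_mult[OF F Zc_mult[OF f(1,2)]]] by simp
  have 3: "F * (f * g - fst X') \<in> Bc (int l) X' Y'" using Bc_mult_left[OF F f(3)] by simp
  have "F = a * (b * F * f) * g - (a * b - fst Y') * (F * (f * g)) - F * (f * g - fst X')"
  proof -
    have "fst Y' * (F * (f * g)) = F * (f * g)" using hmD(2)[OF ZcD(1)[OF F]] by (simp add: mult.assoc[symmetric])
    moreover have "F * fst X' = F" using hmD(3)[OF ZcD(1)[OF F]] .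
    ultimately show ?thesis by (simp add: left_diff_distrib right_diff_distrib mult.assoc)
  qed
  then show "F \<in> Bc (int l) X' Y'" using Bc_diff[OF Bc_diff[OF 1 2] 3] by simp
qed

lemma aev_sum_left:
  assumes i: "i1 \<in> Zc 0 X B" "i2 \<in> Zc 0 Y B" "p1 \<in> Zc 0 B X" "p2 \<in> Zc 0 B Y" "i1 * p1 + i2 * p2 = fst B"
    and e: "aev X Z" "aev Y Z"
  shows "aev B Z"
  unfolding aev_def ext_vanish_def
proof (intro allI impI subsetI)
  fix l :: nat and F assume l: "l > 0" and F: "F \<in> Zc (int l) B Z"
  have F12: "F * i1 \<in> Bc (int l) X Z" "F * i2 \<in> Bc (int l) Y Z"
    using Zc_mult[OF F i(1)] Zc_mult[OF F i(2)] e l unfolding aev_def ext_vanish_def by auto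
  have "F * i1 * p1 \<in> Bc (int l) B Z" "F * i2 * p2 \<in> Bc (int l) B Z"
    using Bc_mult_right[OF F12(1) i(3)] Bc_mult_right[OF F12(2) i(4)] by simp_all
  then have "F * i1 * p1 + F * i2 * p2 \<in> Bc (int l) B Z" by (rule Bc_add)
  moreover have "F * i1 * p1 + F * i2 * p2 = F * fst B"
    using i(5)[symmetric] by (simp add: distrib_left mult.assoc)
  ultimately show "F \<in> Bc (int l) B Z" using hmD(3)[OF ZcD(1)[OF F]] by simp
qed

lemma aev_sum_right:
  assumes i: "i1 \<in> Zc 0 X B" "i2 \<in> Zc 0 Y B" "p1 \<in> Zc 0 B X" "p2 \<in> Zc 0 B Y" "i1 * p1 + i2 * p2 = fst B"
    and e: "aev Z X" "aev Z Y"
  shows "aev Z B"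
  unfolding aev_def ext_vanish_def
proof (intro allI impI subsetI)
  fix l :: nat and F assume l: "l > 0" and F: "F \<in> Zc (int l) Z B"
  have F12: "p1 * F \<in> Bc (int l) Z X" "p2 * F \<in> Bc (int l) Z Y"
    using Zc_mult[OF i(3) F] Zc_mult[OF i(4) F] e l unfolding aev_def ext_vanish_def by auto
  have "i1 * (p1 * F) \<in> Bc (int l) Z B" "i2 * (p2 * F) \<in> Bc (int l) Z B"
    using Bc_mult_left[OF i(1) F12(1)] Bc_mult_left[OF i(2) F12(2)] by simp_all
  then have "i1 * (p1 * F) + i2 * (p2 * F) \<in> Bc (int l) Z B" by (rule Bc_add)
  moreover have "i1 * (p1 * F) + i2 * (p2 * F) = fst B * F"
    using i(5)[symmetric] by (simp add: distrib_right mult.assoc)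
  ultimately show "F \<in> Bc (int l) Z B" using hmD(2)[OF ZcD(1)[OF F]] by simp
qed

section \<open>Extensions of degree one between two-term complexes\<close>

definition tt :: "'a::ring ac \<Rightarrow> bool" where
  "tt X \<longleftrightarrow> (\<forall>i a j b. i \<noteq> -1 \<longrightarrow> i \<noteq> 0 \<longrightarrow> ent (fst X) (Ix i a) (Ix j b) = 0)"

lemma two_term_iff_tt: "two_term X \<longleftrightarrow> is_complex X \<and> tt (ac X)"
  unfolding two_term_iff tt_def ..

lemma ent_mult_nonzero:
  assumes "ent (x * y) u v \<noteq> (0 :: 'a::ring)" shows "\<exists>w. ent x u w \<noteq> 0 \<and> ent y w v \<noteq> 0"
proof -
  obtain I where I: "finite I" "fm_in I x" using ex_fm_in by blast
  obtain w where "ent x u w * ent y w v \<noteq> 0"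
    using assms unfolding ent_mult_in[OF I] by (meson sum.neutral)
  then show ?thesis by (intro exI[of _ w]) auto
qed

lemma tt_support:
  assumes "acx X" "acx Y" "tt X" "tt Y" "f \<in> hm k X Y" "ent f (Ix i a) (Ix j b) \<noteq> 0"
  shows "i = -1 \<or> i = 0" "j = -1 \<or> j = 0" "i = j + k"
proof -
  show "i = j + k" using hmD(1)[OF assms(5)] assms(6) unfolding dg_def by blast
  have "ent (fst Y * f) (Ix i a) (Ix j b) \<noteq> 0" using assms(6) hmD(2)[OF assms(5)] by simp
  from ent_mult_nonzero[OF this] obtain w where w: "ent (fst Y) (Ix i a) w \<noteq> 0" by blast
  obtain i' a' where "w = Ix i' a'" by (cases w)
  then show "i = -1 \<or> i = 0" using w assms(4) unfolding tt_def by blast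
  have "ent (f * fst X) (Ix i a) (Ix j b) \<noteq> 0" using assms(6) hmD(3)[OF assms(5)] by simp
  from ent_mult_nonzero[OF this] obtain w where w: "ent (fst X) w (Ix j b) \<noteq> 0" by blast
  obtain j' b' where w': "w = Ix j' b'" by (cases w)
  have "j' = j" using w w' assms(1) unfolding acx_def dg_def by force
  then show "j = -1 \<or> j = 0" using w w' assms(3) unfolding tt_def by blast
qed

lemma tt_hm_zero:
  assumes "acx X" "acx Y" "tt X" "tt Y" "f \<in> hm k X Y" "\<bar>k\<bar> \<ge> 2"
  shows "f = 0"
proof (rule fm_eqI')
  fix i a j b
  show "ent f (Ix i a) (Ix j b) = ent 0 (Ix i a) (Ix j b)"
  proof (rule ccontr)
    assume "ent f (Ix i a) (Ix j b) \<noteq> ent 0 (Ix i a) (Ix j b)"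
    then have "ent f (Ix i a) (Ix j b) \<noteq> 0" by simp
    from tt_support[OF assms(1-5) this] assms(6) show False by auto
  qed
qed

text \<open>For two-term complexes every map of degree 1 is a cocycle and there are no maps of
  larger degree, so this condition on degree 1 is the whole of \<open>aev\<close>.\<close>

definition e1 :: "'a::ring ac \<Rightarrow> 'a ac \<Rightarrow> bool" where
  "e1 X Y \<longleftrightarrow> (\<forall>F\<in>hm 1 X Y. \<exists>h\<in>hm 0 X Y. F = h * snd X - snd Y * h)"

lemma hm_snd_left: "acx Y \<Longrightarrow> f \<in> hm k X Y \<Longrightarrow> snd Y * f \<in> hm (k + 1) X Y"
  using dg_mult[of 1 "snd Y" k f] unfolding hm_def acx_def by (auto simp: add.commute mult.assoc) (simp add: mult.assoc[symmetric])

lemma hm_snd_right: "acx X \<Longrightarrow> f \<in> hm k X Y \<Longrightarrow> f * snd X \<in> hm (k + 1) X Y"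
  using dg_mult[of k f 1 "snd X"] unfolding hm_def acx_def by (auto simp: mult.assoc) (simp add: mult.assoc[symmetric])

text \<open>Both sides of the cocycle condition have degree 2 and hence vanish.\<close>

lemma tt_Zc1:
  assumes "acx X" "acx Y" "tt X" "tt Y" shows "Zc 1 X Y = hm 1 X Y"
proof -
  have "f \<in> Zc 1 X Y" if f: "f \<in> hm 1 X Y" for f
  proof -
    have "snd Y * f \<in> hm 2 X Y" "f * snd X \<in> hm 2 X Y"
      using hm_snd_left[OF assms(2) f] hm_snd_right[OF assms(1) f] by simp_all
    then have "snd Y * f = 0" "f * snd X = 0" using tt_hm_zero[OF assms] by force+
    then show ?thesis using f unfolding Zc_def by simp
  qed
  then show ?thesis using ZcD(1) by blast
qed

lemma aev_iff_e1:
  assumes "acx X" "acx Y" "tt X" "tt Y" shows "aev X Y \<longleftrightarrow> e1 X Y"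
proof -
  have B: "F \<in> Bc 1 X Y \<longleftrightarrow> (\<exists>h\<in>hm 0 X Y. F = h * snd X - snd Y * h)" for F
    unfolding Bc_def by auto
  have 2: "ext_vanish (int l) X Y" if "l \<ge> 2" for l
  proof -
    have "f = 0" if "f \<in> Zc (int l) X Y" for f
      using tt_hm_zero[OF assms ZcD(1)[OF that]] \<open>l \<ge> 2\<close> by simp
    then show ?thesis unfolding ext_vanish_def using Bc_zero by (metis subsetI)
  qed
  have 1: "ext_vanish 1 X Y \<longleftrightarrow> e1 X Y"
    unfolding ext_vanish_def tt_Zc1[OF assms] e1_def subset_eq B ..
  show ?thesis
  proof
    assume "aev X Y"
    from this[unfolded aev_def, rule_format, of 1] show "e1 X Y" using 1 by simp
  next
    assume e: "e1 X Y"
    show "aev X Y" unfolding aev_def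
    proof (intro allI impI)
      fix l :: nat assume "l > 0"
      show "ext_vanish (int l) X Y"
      proof (cases "l = 1")
        case True
        then show ?thesis using e 1 by simp
      next
        case False
        then show ?thesis using \<open>l > 0\<close> by (intro 2) simp
      qed
    qed
  qed
qed

text \<open>A map of degree 1 on \<open>U\<close> vanishes on the subcomplex \<open>A\<close>, which
  admits no such map to \<open>Z\<close>, and is a coboundary on \<open>T'\<close>. The homotopy on
  \<open>T'\<close>, pulled back along the projection \<open>P1\<close>, works on
  \<open>U\<close>.\<close>

lemma e1_extension:
  assumes g: "glued 0 U T' A (snd T') F I1 I2 P1 P2" and acx: "acx T'" "acx A" "acx U" "acx Z"
    and A: "snd A = 0" "hm 1 A Z = {0}" and F: "F * fst T' = F" "fst A * F = F"
    and e: "e1 T' Z"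
  shows "e1 U Z"
  unfolding e1_def
proof
  note gD = gluedD[OF g] and gs = glued_simps[OF g]
  fix G assume G: "G \<in> hm 1 U Z"
  note Gh = hmD[OF G]
  have UI: "fst U * I1 = I1" "fst U * I2 = I2" "P1 * fst U = P1"
    unfolding gD(13) using gD gs by (simp_all add: distrib_left distrib_right mult.assoc)
  have "G * I1 \<in> hm 1 T' Z"
    using Gh gD UI dg_mult[OF Gh(1) gD(1)] unfolding hm_def by (simp add: mult.assoc) (simp add: mult.assoc[symmetric])
  then obtain h where h: "h \<in> hm 0 T' Z" "G * I1 = h * snd T' - snd Z * h" using e unfolding e1_def by blast
  have "G * I2 \<in> hm 1 A Z"
    using Gh gD UI dg_mult[OF Gh(1) gD(3)] unfolding hm_def by (simp add: mult.assoc) (simp add: mult.assoc[symmetric])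
  then have GI2: "G * I2 = 0" using A(2) by blast
  have aT: "fst T' * (snd T' * y) = snd T' * y" for y using acx(1) unfolding acx_def by (simp add: mult.assoc[symmetric])
  have PD: "P1 * snd U = snd T' * P1"
    unfolding gD(14) A(1) using gs aT by (simp add: distrib_left mult.assoc)
  have "G = G * (I1 * P1 + I2 * P2)" using Gh(3) gD(13) by simp
  also have "\<dots> = G * I1 * P1 + G * I2 * P2" by (simp add: distrib_left mult.assoc)
  also have "\<dots> = h * (snd T' * P1) - snd Z * (h * P1)" unfolding h(2) GI2 by (simp add: left_diff_distrib mult.assoc)
  also have "\<dots> = (h * P1) * snd U - snd Z * (h * P1)" unfolding PD[symmetric] by (simp add: mult.assoc)
  finally have "G = (h * P1) * snd U - snd Z * (h * P1)" .
  moreover have "h * P1 \<in> hm 0 U Z"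
    using hmD[OF h(1)] UI gD dg_mult[OF hmD(1)[OF h(1)] gD(2)] unfolding hm_def
    by (simp add: mult.assoc) (simp add: mult.assoc[symmetric])
  ultimately show "\<exists>h\<in>hm 0 U Z. G = h * snd U - snd Z * h" by blast
qed

text \<open>The component of \<open>G\<close> in \<open>T'\<close> is a coboundary. What is left in
  \<open>A\<close> equals \<open>F * c\<close> for a chain map \<open>c\<close> to
  \<open>T'\<close>, and this becomes a coboundary in \<open>U\<close>, because \<open>F\<close> is
  part of the differential of \<open>U\<close>.\<close>

lemma e1_bongartz:
  assumes g: "glued 0 U T' A (snd T') F I1 I2 P1 P2" and acx: "acx T" "acx T'" "acx A" "acx U"
    and A: "snd A = 0" and F: "F \<in> hm 1 T' A"
    and univ: "\<And>G. G \<in> hm 1 T A \<Longrightarrow> \<exists>c\<in>Zc 0 T T'. G = F * c"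
    and e: "e1 T T'"
  shows "e1 T U"
  unfolding e1_def
proof
  note gD = gluedD[OF g] and gs = glued_simps[OF g] and Fh = hmD[OF F]
  fix G assume G: "G \<in> hm 1 T U"
  note Gh = hmD[OF G]
  have UI: "fst U * I1 = I1" "P1 * fst U = P1" "P2 * fst U = P2"
    unfolding gD(13) using gD gs by (simp_all add: distrib_left distrib_right mult.assoc)
  have aT: "snd T' * (fst T' * y) = snd T' * y" for y using acx(2) unfolding acx_def by (simp add: mult.assoc[symmetric])
  have aT': "snd T' * fst T' = snd T'" using acx(2) unfolding acx_def by simp
  have DI: "snd U * I1 = I1 * snd T' + I2 * F"
    unfolding gD(14) A using gD gs aT aT' Fh(3) by (simp add: distrib_right mult.assoc)
  have "P1 * G \<in> hm 1 T T'"
    using Gh gD UI dg_mult[OF gD(2) Gh(1)] unfolding hm_def by (simp add: mult.assoc) (simp add: mult.assoc[symmetric])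
  then obtain h where h: "h \<in> hm 0 T T'" "P1 * G = h * snd T - snd T' * h" using e unfolding e1_def by blast
  have PG: "P2 * G \<in> hm 1 T A"
    using Gh gD UI dg_mult[OF gD(4) Gh(1)] unfolding hm_def by (simp add: mult.assoc) (simp add: mult.assoc[symmetric])
  have "F * h \<in> hm 1 T A" using hm_mult[OF F h(1)] by simp
  then obtain c where c: "c \<in> Zc 0 T T'" "P2 * G + F * h = F * c" using univ hm_add[OF PG] by blast
  have ch: "c \<in> hm 0 T T'" "snd T' * c = c * snd T" using ZcD[OF c(1)] by auto
  \<comment> \<open>\<open>snd U * I1\<close> is \<open>I1 * snd T' + I2 * F\<close>; so
    \<open>h\<close> accounts for the part in \<open>T'\<close> while \<open>c\<close> produces the
    part \<open>F * c\<close> in \<open>A\<close>.\<close>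
  define k where "k = I1 * h - I1 * c"
  have "G = I1 * (P1 * G) + I2 * (P2 * G)" using Gh(2) gD(13) by (simp add: distrib_right mult.assoc)
  also have "P2 * G = F * c - F * h" using c(2) by (simp add: algebra_simps)
  also have "I1 * (P1 * G) + I2 * (F * c - F * h) = k * snd T - snd U * k"
  proof -
    have "snd U * k = (snd U * I1) * h - (snd U * I1) * c" unfolding k_def by (simp add: right_diff_distrib mult.assoc)
    also have "\<dots> = I1 * (snd T' * h) + I2 * (F * h) - I1 * (c * snd T) - I2 * (F * c)"
      unfolding DI by (simp add: distrib_right mult.assoc ch(2))
    finally show ?thesis unfolding h(2) k_def by (simp add: algebra_simps)
  qed
  finally have "G = k * snd T - snd U * k" .
  moreover have "k \<in> hm 0 T U"
    unfolding k_def hm_def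
    using hmD[OF h(1)] hmD[OF ch(1)] UI(1) dg_mult[OF gD(1) hmD(1)[OF h(1)]] dg_mult[OF gD(1) hmD(1)[OF ch(1)]]
    by (simp add: dg_diff left_diff_distrib right_diff_distrib mult.assoc) (simp add: mult.assoc[symmetric])
  ultimately show "\<exists>h\<in>hm 0 T U. G = h * snd T - snd U * h" by blast
qed

lemma alg_cplx_ac:
  "is_complex (alg_cplx :: 'a::ring_1 cplx)" "snd (ac (alg_cplx :: 'a cplx)) = 0"
  "ent (fst (ac (alg_cplx :: 'a cplx))) (Ix i a) (Ix j b) = (if i = 0 \<and> j = 0 \<and> a = 0 \<and> b = 0 then 1 else 0)"
proof -
  show A: "is_complex (alg_cplx :: 'a cplx)"
    unfolding is_complex_def alg_cplx_def proj_obj_def phom_def cobj_def cdif_def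
    by (auto intro!: exI[of _ 0])
  have dm: "dm (alg_cplx :: 'a cplx) i = (if i = 0 then 1 else 0)" for i
    by (simp add: dm_def alg_cplx_def cobj_def)
  show "snd (ac (alg_cplx :: 'a cplx)) = 0"
  proof (rule fm_eqI')
    fix i a j b
    show "ent (snd (ac (alg_cplx :: 'a cplx))) (Ix i a) (Ix j b) = ent 0 (Ix i a) (Ix j b)"
      unfolding ac_def snd_conv ent_encf[OF ac_bounded(2)[OF A]] dm by auto
  qed
  show "ent (fst (ac (alg_cplx :: 'a cplx))) (Ix i a) (Ix j b) = (if i = 0 \<and> j = 0 \<and> a = 0 \<and> b = 0 then 1 else 0)"
    unfolding ac_def fst_conv ent_encf[OF ac_bounded(1)[OF A]] dm
    by (auto simp: id_cmap_def alg_cplx_def cobj_def)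
qed

lemma tt_alg: "tt (ac (alg_cplx :: 'a::ring_1 cplx))"
  unfolding tt_def alg_cplx_ac(3) by auto

lemma hm_alg_zero:
  assumes "acx Z" "tt Z" shows "hm 1 (ac (alg_cplx :: 'a::ring_1 cplx)) Z = {0}"
proof -
  let ?A = "ac (alg_cplx :: 'a cplx)"
  note aA = acx_ac[OF alg_cplx_ac(1)]
  have "f = 0" if f: "f \<in> hm 1 ?A Z" for f
  proof (rule fm_eqI')
    fix i a j b
    show "ent f (Ix i a) (Ix j b) = ent 0 (Ix i a) (Ix j b)"
    proof (rule ccontr)
      assume "ent f (Ix i a) (Ix j b) \<noteq> ent 0 (Ix i a) (Ix j b)"
      then have nz: "ent f (Ix i a) (Ix j b) \<noteq> 0" by simp
      have "ent (f * fst ?A) (Ix i a) (Ix j b) \<noteq> 0" using nz hmD(3)[OF f] by simp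
      from ent_mult_nonzero[OF this] obtain w where w: "ent (fst ?A) w (Ix j b) \<noteq> 0" by blast
      obtain j' b' where "w = Ix j' b'" by (cases w)
      then have "ent (fst ?A) (Ix j' b') (Ix j b) \<noteq> 0" using w by simp
      then have "j = 0" by (auto simp: alg_cplx_ac(3) split: if_splits)
      with tt_support[OF aA assms(1) tt_alg assms(2) f nz] show False by auto
    qed
  qed
  then show ?thesis by auto
qed

definition ext_cplx :: "'a::ring_1 cplx \<Rightarrow> 'a cplx \<Rightarrow> (int \<Rightarrow> 'a mat) \<Rightarrow> 'a cplx" where
  "ext_cplx X Y C = ((\<lambda>i. pobj_sum (cobj X i) (cobj Y i)),
     (\<lambda>i. four_block_mat (cdif X i) (0\<^sub>m (dm X (i + 1)) (dm Y i)) (C i) (cdif Y i)))"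

text \<open>The cocycle \<open>F\<close> is used as the off-diagonal block of the differential,
  which gives the middle term of the triangle from \<open>Y\<close> over \<open>U\<close> to
  \<open>X\<close> with connecting map \<open>F\<close>.\<close>

lemma extension_exists:
  assumes X: "is_complex X" and Y: "is_complex Y" and F: "F \<in> Zc 1 (ac X) (ac Y)"
  obtains U i1 i2 p1 p2 where "is_complex U" "glued 0 (ac U) (ac X) (ac Y) (snd (ac X)) F i1 i2 p1 p2"
    "two_term X \<longrightarrow> two_term Y \<longrightarrow> two_term U"
proof -
  obtain C where C: "C \<in> homs 1 X Y" "enc 1 X Y C = F" using enc_surj[OF X Y ZcD(1)[OF F]] .
  have bC: "bounded_mats (1 - 0) (dm Y) (dm X) C" using bounded_homs[OF X Y C(1)] by simp
  have e: "encf (1 - 0) (dm Y) (dm X) C = F" using C(2) by (simp add: enc_def)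
  have a: "encf 1 (dm X) (dm X) (cdif X) = snd (ac X)" by (simp add: ac_def)
  note ax = acx_ac[OF X, unfolded acx_def] and Fh = hmD[OF ZcD(1)[OF F]]
  have F2: "snd (ac Y) * F + F * snd (ac X) = 0" using ZcD(2)[OF F] by (simp add: add_eq_0_iff)
  have c1: "cobj (ext_cplx X Y C) i = pobj_sum (cobj X (i + 0)) (cobj Y i)" for i
    by (simp add: ext_cplx_def cobj_def)
  have c2: "cdif (ext_cplx X Y C) i = four_block_mat (cdif X (i + 0)) (0\<^sub>m (dm X (i + 0 + 1)) (dm Y i)) (C (i + 0)) (cdif Y i)" for i
    by (simp add: ext_cplx_def cdif_def)
  note b = block_cplx[OF X Y ac_bounded(2)[OF X] bC _ _ _ _ _ _ c1 c2, unfolded e a]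
  have U: "is_complex (ext_cplx X Y C)" by (rule b(1)) (use ax Fh F2 in simp_all)
  have g: "\<exists>i1 i2 p1 p2. glued 0 (ac (ext_cplx X Y C)) (ac X) (ac Y) (snd (ac X)) F i1 i2 p1 p2"
    by (rule b(2)) (use ax Fh F2 in simp_all)
  have "two_term (ext_cplx X Y C)" if "two_term X" "two_term Y"
    unfolding two_term_def
  proof (intro conjI allI impI U)
    fix i :: int assume i: "i \<noteq> - 1 \<and> i \<noteq> 0"
    have "snd (cobj X i) = 0\<^sub>m (dm X i) (dm X i)" "snd (cobj Y i) = 0\<^sub>m (dm Y i) (dm Y i)"
      using that i unfolding two_term_def dm_def by blast+
    then show "snd (cobj (ext_cplx X Y C) i) = 0\<^sub>m (fst (cobj (ext_cplx X Y C) i)) (fst (cobj (ext_cplx X Y C) i))"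
      unfolding c1 pobj_sum_def by (intro eq_matI) (auto simp: dm_def)
  qed
  then show thesis using that[OF U] g by blast
qed

lemma two_term_dsum:
  assumes "two_term X" "two_term Y" shows "two_term (X \<oplus>\<^sub>K Y)"
proof -
  have XY: "is_complex X" "is_complex Y" using assms unfolding two_term_def by blast+
  have c1: "cobj (X \<oplus>\<^sub>K Y) i = pobj_sum (cobj X i) (cobj Y i)" for i by (simp add: dsum_def cobj_def)
  show ?thesis unfolding two_term_def
  proof (intro conjI allI impI dsum_glued(1)[OF XY])
    fix i :: int assume i: "i \<noteq> - 1 \<and> i \<noteq> 0"
    have "snd (cobj X i) = 0\<^sub>m (dm X i) (dm X i)" "snd (cobj Y i) = 0\<^sub>m (dm Y i) (dm Y i)"
      using assms i unfolding two_term_def dm_def by blast+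
    then show "snd (cobj (X \<oplus>\<^sub>K Y) i) = 0\<^sub>m (fst (cobj (X \<oplus>\<^sub>K Y) i)) (fst (cobj (X \<oplus>\<^sub>K Y) i))"
      unfolding c1 pobj_sum_def by (intro eq_matI) (auto simp: dm_def)
  qed
qed

lemma two_term_zero: "two_term (zero_cplx :: 'a::ring_1 cplx)"
  unfolding two_term_def using zero_cplx_ac(1) by (simp add: zero_cplx_def cobj_def)

lemma aev_dsum:
  assumes XY: "is_complex X" "is_complex Y" and Z: "acx Z"
  shows "aev (ac (X \<oplus>\<^sub>K Y)) Z \<longleftrightarrow> aev (ac X) Z \<and> aev (ac Y) Z"
    and "aev Z (ac (X \<oplus>\<^sub>K Y)) \<longleftrightarrow> aev Z (ac X) \<and> aev Z (ac Y)"
proof -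
  obtain i1 i2 p1 p2 where g: "glued 0 (ac (X \<oplus>\<^sub>K Y)) (ac X) (ac Y) (snd (ac X)) 0 i1 i2 p1 p2"
    using dsum_glued(2)[OF XY] by blast
  note gb = glued_biproduct[OF g acx_ac[OF XY(1)] acx_ac[OF XY(2)]] and gD = gluedD[OF g]
  have u: "fst Z \<in> Zc 0 Z Z" "fst Z * fst Z - fst Z \<in> Bc 0 Z Z"
    using acx_unit[OF Z] Z unfolding acx_def by auto
  have p: "p1 * i1 - fst (ac X) \<in> Bc 0 (ac X) (ac X)" "p2 * i2 - fst (ac Y) \<in> Bc 0 (ac Y) (ac Y)"
    using gD(9,10) by simp_all
  show "aev (ac (X \<oplus>\<^sub>K Y)) Z \<longleftrightarrow> aev (ac X) Z \<and> aev (ac Y) Z"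
    using aev_retract[OF gb(3,1) p(1) u(1,1,2)] aev_retract[OF gb(4,2) p(2) u(1,1,2)]
      aev_sum_left[OF gb gD(13)[symmetric]] by blast
  show "aev Z (ac (X \<oplus>\<^sub>K Y)) \<longleftrightarrow> aev Z (ac X) \<and> aev Z (ac Y)"
    using aev_retract[OF u(1,1,2) gb(3,1) p(1)] aev_retract[OF u(1,1,2) gb(4,2) p(2)]
      aev_sum_right[OF gb gD(13)[symmetric]] by blast
qed

lemma aev_zero: "aev (ac (zero_cplx :: 'a::ring_1 cplx)) Z" "aev Z (ac (zero_cplx :: 'a cplx))"
proof -
  let ?O = "ac (zero_cplx :: 'a cplx)"
  have "f = 0" if "f \<in> Zc k ?O Z" for f k using hmD(3)[OF ZcD(1)[OF that]] by (simp add: zero_cplx_ac(2))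
  then show "aev ?O Z" unfolding aev_def ext_vanish_def by (metis Bc_zero subsetI)
  have "f = 0" if "f \<in> Zc k Z ?O" for f k using hmD(2)[OF ZcD(1)[OF that]] by (simp add: zero_cplx_ac(2))
  then show "aev Z ?O" unfolding aev_def ext_vanish_def by (metis Bc_zero subsetI)
qed

context fdalg
begin

lemma aev_slist:
  assumes Z: "acx Z"
  shows "\<forall>X\<in>set Xs. is_complex X \<Longrightarrow> aev (ac (ks.slist Xs)) Z \<longleftrightarrow> (\<forall>X\<in>set Xs. aev (ac X) Z)"
    and "\<forall>X\<in>set Xs. is_complex X \<Longrightarrow> aev Z (ac (ks.slist Xs)) \<longleftrightarrow> (\<forall>X\<in>set Xs. aev Z (ac X))"
proof (induction Xs)
  case Nil
  case 1 then show ?case using aev_zero by simp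
  case 2 then show ?case using aev_zero by simp
next
  case (Cons X Xs)
  have *: "is_complex X" "is_complex (ks.slist Xs)" if "\<forall>X\<in>set (X # Xs). is_complex X"
    using that ks.ob_slist[of Xs] by auto
  case 1 then show ?case using Cons.IH(1) aev_dsum(1)[OF *[OF 1] Z] by simp
  case 2 then show ?case using Cons.IH(2) aev_dsum(2)[OF *[OF 2] Z] by simp
qed

lemma aev_iso:
  assumes "ks.iso X X'" "ks.iso Y Y'" "aev (ac X) (ac Y)" shows "aev (ac X') (ac Y')"
proof -
  obtain f g where f: "f \<in> Zc 0 (ac X) (ac X')" "g \<in> Zc 0 (ac X') (ac X)" "f * g - fst (ac X') \<in> Bc 0 (ac X') (ac X')"
    using assms(1) unfolding ks.iso_def by blast
  obtain a b where a: "a \<in> Zc 0 (ac Y) (ac Y')" "b \<in> Zc 0 (ac Y') (ac Y)" "a * b - fst (ac Y') \<in> Bc 0 (ac Y') (ac Y')"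
    using assms(2) unfolding ks.iso_def by blast
  show ?thesis by (rule aev_retract[OF f a assms(3)])
qed

text \<open>\<open>aev\<close> on isomorphism classes. The choice of representatives is immaterial
  by homotopy invariance.\<close>

definition pev :: "'a cplx set \<Rightarrow> 'a cplx set \<Rightarrow> bool" where
  "pev c d \<longleftrightarrow> (\<exists>X\<in>c. \<exists>Y\<in>d. aev (ac X) (ac Y))"

lemma pev_cls:
  assumes "is_complex X" "is_complex Y" shows "pev (ks.cls X) (ks.cls Y) \<longleftrightarrow> aev (ac X) (ac Y)"
proof
  assume "pev (ks.cls X) (ks.cls Y)"
  then obtain X' Y' where "ks.iso X' X" "ks.iso Y' Y" "aev (ac X') (ac Y')"
    unfolding pev_def ks.cls_def by blast
  then show "aev (ac X) (ac Y)" by (rule aev_iso)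
next
  assume "aev (ac X) (ac Y)"
  then show "pev (ks.cls X) (ks.cls Y)"
    unfolding pev_def ks.cls_def using ks.iso_refl[OF assms(1)] ks.iso_refl[OF assms(2)] by blast
qed

text \<open>\<open>aev\<close> is additive in both arguments, so it is a pairwise condition on
  indecomposable summands. Hence being presilting depends only on the support of the multiset and
  passes to subsets of it.\<close>

lemma aev_kms:
  assumes "is_complex X" "is_complex Y"
  shows "aev (ac X) (ac Y) \<longleftrightarrow> (\<forall>c\<in>#ks.kms X. \<forall>d\<in>#ks.kms Y. pev c d)"
proof -
  obtain Xs where X: "\<forall>Y\<in>set Xs. ks.indec Y" "ks.iso X (ks.slist Xs)" "ks.kms X = mset (map ks.cls Xs)"
    using ks.kms_decompose[OF assms(1)] .
  obtain Ys where Y: "\<forall>Y\<in>set Ys. ks.indec Y" "ks.iso Y (ks.slist Ys)" "ks.kms Y = mset (map ks.cls Ys)"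
    using ks.kms_decompose[OF assms(2)] .
  have obX: "\<forall>X\<in>set Xs. is_complex X" and obY: "\<forall>X\<in>set Ys. is_complex X" using X(1) Y(1) ks.indec_ob by blast+
  have "aev (ac X) (ac Y) \<longleftrightarrow> aev (ac (ks.slist Xs)) (ac (ks.slist Ys))"
    using aev_iso[OF X(2) Y(2)] aev_iso[OF ks.iso_sym[OF X(2)] ks.iso_sym[OF Y(2)]] by blast
  also have "\<dots> \<longleftrightarrow> (\<forall>X\<in>set Xs. aev (ac X) (ac (ks.slist Ys)))"
    by (rule aev_slist(1)[OF acx_ac[OF ks.ob_slist[OF obY]] obX])
  also have "\<dots> \<longleftrightarrow> (\<forall>X\<in>set Xs. \<forall>Y\<in>set Ys. aev (ac X) (ac Y))"
    by (rule ball_cong[OF refl]) (use aev_slist(2)[OF acx_ac obY] obX in blast)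
  also have "\<dots> \<longleftrightarrow> (\<forall>X\<in>set Xs. \<forall>Y\<in>set Ys. pev (ks.cls X) (ks.cls Y))"
    by (intro ball_cong refl) (use pev_cls obX obY in blast)
  also have "\<dots> \<longleftrightarrow> (\<forall>c\<in>#ks.kms X. \<forall>d\<in>#ks.kms Y. pev c d)"
    unfolding X(3) Y(3) by simp
  finally show ?thesis .
qed

definition ttc :: "'a cplx set \<Rightarrow> bool" where "ttc c \<longleftrightarrow> (\<exists>X\<in>c. two_term X)"

text \<open>The idempotent of \<open>T\<close> belonging to \<open>Y\<close> is made strict and
  split inside \<open>T\<close>. Its image \<open>Y'\<close> is homotopy equivalent to
  \<open>Y\<close> and is concentrated in the degrees of \<open>T\<close>.\<close>

lemma two_term_summand:
  assumes T: "two_term T" and Y: "is_complex Y" "is_complex Z" and iso: "ks.iso T (Y \<oplus>\<^sub>K Z)"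
  shows "ttc (ks.cls Y)"
proof -
  have oT: "is_complex T" using T two_term_def by blast
  obtain i1 i2 p1 p2 where b: "ks.bip T Y Z i1 i2 p1 p2" using ks.iso_imp_bip[OF iso Y] .
  note bD = ks.bipD[OF b]
  have fH: "i1 * p1 \<in> Zc 0 (ac T) (ac T)" using ks.H_mult[OF bD(4,6)] .
  have "i1 * p1 * (i1 * p1) - i1 * p1 = i1 * (p1 * i1 - fst (ac Y)) * p1"
    using ks.un_left[OF bD(6)] by (simp add: algebra_simps)
  then have idem: "i1 * p1 * (i1 * p1) - i1 * p1 \<in> Bc 0 (ac T) (ac T)" using ks.N_mid[OF bD(8,4,6)] by simp
  obtain g where g: "g \<in> Zc 0 (ac T) (ac T)" "g * g = g" "fst (ac T) * g = g" "g * fst (ac T) = g"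
    "g - i1 * p1 \<in> Bc 0 (ac T) (ac T)" using strict_idempotent[OF acx_ac[OF oT] fH idem] .
  obtain Y' Z' j1 j2 q1 q2 where s: "is_complex Y'" "is_complex Z'" "fst (ac Y') = g" "fst (ac Z') = fst (ac T) - g"
      "j1 \<in> Zc 0 (ac Y') (ac T)" "j2 \<in> Zc 0 (ac Z') (ac T)" "q1 \<in> Zc 0 (ac T) (ac Y')" "q2 \<in> Zc 0 (ac T) (ac Z')"
      "q1 * j1 = fst (ac Y')" "q2 * j2 = fst (ac Z')" "q1 * j2 = 0" "q2 * j1 = 0" "j1 * q1 + j2 * q2 = fst (ac T)" "j1 * q1 = g"
    using split_idempotent[OF oT g(1-4)] .
  have tY': "two_term Y'"
    unfolding two_term_iff_tt tt_def
  proof (intro conjI s(1) allI impI)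
    fix i a j b assume i: "i \<noteq> - 1" "(i::int) \<noteq> 0"
    show "ent (fst (ac Y')) (Ix i a) (Ix j b) = 0"
    proof (rule ccontr)
      assume "ent (fst (ac Y')) (Ix i a) (Ix j b) \<noteq> 0"
      then have "ent (fst (ac T) * g) (Ix i a) (Ix j b) \<noteq> 0" using s(3) g(3) by simp
      from ent_mult_nonzero[OF this] obtain w where w: "ent (fst (ac T)) (Ix i a) w \<noteq> 0" by blast
      obtain k c where "w = Ix k c" by (cases w)
      then show False using w i T unfolding two_term_iff_tt tt_def by blast
    qed
  qed
  have f: "p1 * j1 \<in> Zc 0 (ac Y') (ac Y)" "q1 * i1 \<in> Zc 0 (ac Y) (ac Y')"
    using ks.H_mult[OF bD(6) s(5)] ks.H_mult[OF s(7) bD(4)] .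
  have "p1 * j1 * (q1 * i1) - fst (ac Y) = p1 * (g - i1 * p1) * i1 + (p1 * i1) * (p1 * i1 - fst (ac Y)) + (p1 * i1 - fst (ac Y))"
    unfolding s(14)[symmetric] using ks.un_right[OF bD(4)] by (simp add: algebra_simps)
  also have "\<dots> \<in> Bc 0 (ac Y) (ac Y)"
    by (intro Bc_add ks.N_mid[OF g(5) bD(6,4)] ks.N_left[OF ks.H_mult[OF bD(6,4)] bD(8)] bD(8))
  finally have 1: "p1 * j1 * (q1 * i1) - fst (ac Y) \<in> Bc 0 (ac Y) (ac Y)" .
  have jg: "q1 * g * j1 = fst (ac Y')"
    unfolding s(14)[symmetric] using s(9) ks.un_left[OF ks.un_H[OF s(1)]] by (simp add: mult.assoc[symmetric]) (simp add: mult.assoc)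
  have "q1 * i1 * (p1 * j1) - fst (ac Y') = - (q1 * (g - i1 * p1) * j1)"
    using jg by (simp add: algebra_simps)
  also have "\<dots> \<in> Bc 0 (ac Y') (ac Y')" by (intro Bc_uminus ks.N_mid[OF g(5) s(7,5)])
  finally have 2: "q1 * i1 * (p1 * j1) - fst (ac Y') \<in> Bc 0 (ac Y') (ac Y')" .
  have "ks.iso Y' Y" unfolding ks.iso_def using s(1) Y(1) f 1 2 by blast
  then show ?thesis unfolding ttc_def ks.cls_def using tY' by blast
qed

lemma ttc_kms:
  assumes X: "is_complex X" shows "ttc (ks.cls X) \<longleftrightarrow> (\<forall>c\<in>#ks.kms X. ttc c)"
proof
  assume "ttc (ks.cls X)"
  then obtain T where T: "ks.iso T X" "two_term T" unfolding ttc_def ks.cls_def by blast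
  show "\<forall>c\<in>#ks.kms X. ttc c"
  proof
    fix c assume c: "c \<in># ks.kms X"
    obtain Y where Y: "ks.indec Y" "c = ks.cls Y" using ks.kms_mem[OF X c] by blast
    obtain Z where Z: "is_complex Z" "ks.iso X (Y \<oplus>\<^sub>K Z)"
      using ks.kms_mem_summand[OF X Y(1)] c Y(2) by blast
    show "ttc c" unfolding Y(2)
      by (rule two_term_summand[OF T(2) ks.indec_ob[OF Y(1)] Z(1) ks.iso_trans[OF T(1) Z(2)]])
  qed
next
  assume *: "\<forall>c\<in>#ks.kms X. ttc c"
  obtain Xs where Xs: "\<forall>Y\<in>set Xs. ks.indec Y" "ks.iso X (ks.slist Xs)" "ks.kms X = mset (map ks.cls Xs)"
    using ks.kms_decompose[OF X] .
  have "\<forall>Y\<in>set Xs. ttc (ks.cls Y)" using * Xs(3) by simp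
  then have "\<exists>T. two_term T \<and> ks.iso T (ks.slist Xs)"
  proof (induction Xs)
    case Nil
    then show ?case using two_term_zero ks.iso_refl[OF ks.ob_zr] by (intro exI[of _ zero_cplx]) simp
  next
    case (Cons Y Ys)
    then obtain T T' where "two_term T" "ks.iso T (ks.slist Ys)" "two_term T'" "ks.iso T' Y"
      unfolding ttc_def ks.cls_def by auto
    then show ?case using two_term_dsum[of T' T] ks.sm_cong[of T' Y T "ks.slist Ys"]
      by (intro exI[of _ "T' \<oplus>\<^sub>K T"]) simp
  qed
  then obtain T where "two_term T" "ks.iso T (ks.slist Xs)" by blast
  then show "ttc (ks.cls X)" unfolding ttc_def ks.cls_def using ks.iso_trans[OF _ ks.iso_sym[OF Xs(2)]] by blast
qed

text \<open>One copy of \<open>T\<close> is reserved for each \<open>G\<close> in the list, and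
  \<open>F\<close> is the row made of these maps; \<open>G\<close> is recovered along the inclusion
  of its copy.\<close>

lemma universal_class:
  assumes T: "is_complex T" and A: "is_complex A"
  shows "set L \<subseteq> Zc 1 (ac T) (ac A) \<Longrightarrow>
    \<exists>F\<in>Zc 1 (ac (ks.slist (replicate (length L) T))) (ac A). \<forall>G\<in>set L.
      \<exists>c\<in>Zc 0 (ac T) (ac (ks.slist (replicate (length L) T))). G = F * c"
proof (induction L)
  case Nil
  show ?case by (rule bexI[of _ 0]) simp_all
next
  case (Cons G L)
  let ?S = "ks.slist (replicate (length L) T)"
  have S: "is_complex ?S" using T by (intro ks.ob_slist) simp
  from Cons obtain F where F: "F \<in> Zc 1 (ac ?S) (ac A)" "\<And>G. G \<in> set L \<Longrightarrow> \<exists>c\<in>Zc 0 (ac T) (ac ?S). G = F * c" by auto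
  obtain i1 i2 p1 p2 where g: "glued 0 (ac (T \<oplus>\<^sub>K ?S)) (ac T) (ac ?S) (snd (ac T)) 0 i1 i2 p1 p2"
    using dsum_glued(2)[OF T S] by blast
  note gb = glued_biproduct[OF g acx_ac[OF T] acx_ac[OF S]] and gD = gluedD[OF g]
  have G: "G \<in> Zc 1 (ac T) (ac A)" using Cons.prems by simp
  define F' where "F' = G * p1 + F * p2"
  have F': "F' \<in> Zc 1 (ac (T \<oplus>\<^sub>K ?S)) (ac A)"
    unfolding F'_def using Zc_add[OF Zc_mult[OF G gb(3)] Zc_mult[OF F(1) gb(4)]] by simp
  have "G = F' * i1"
    unfolding F'_def using gD hmD(3)[OF ZcD(1)[OF G]] by (simp add: distrib_right mult.assoc)
  moreover have "\<exists>c\<in>Zc 0 (ac T) (ac (T \<oplus>\<^sub>K ?S)). G' = F' * c" if "G' \<in> set L" for G'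
  proof -
    obtain c where c: "c \<in> Zc 0 (ac T) (ac ?S)" "G' = F * c" using F(2)[OF \<open>G' \<in> set L\<close>] by blast
    have "F' * (i2 * c) = F * fst (ac ?S) * c"
      unfolding F'_def using glued_simps[OF g] gD by (simp add: distrib_right mult.assoc)
    also have "\<dots> = G'" using hmD(3)[OF ZcD(1)[OF F(1)]] c(2) by simp
    finally show ?thesis using Zc_mult[OF gb(2) c(1)] by (intro bexI[of _ "i2 * c"]) simp_all
  qed
  ultimately show ?case using F' gb(1) by (intro bexI[of _ F']) auto
qed

text \<open>For a basis \<open>L\<close> of the cocycles from \<open>T\<close> to the first shift of
  \<open>A\<close>, the universal map \<open>F\<close> on as many copies of \<open>T\<close> defines
  \<open>U\<close> as an extension of these copies by \<open>A\<close>. The gluing data are returned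
  as well, since they are needed to recover \<open>A\<close> from \<open>T\<close> and
  \<open>U\<close>.\<close>

lemma bongartz:
  assumes T: "two_term T" "presilting T"
  obtains U r F I1 I2 P1 P2 where "two_term U" "presilting (T \<oplus>\<^sub>K U)"
    "glued 0 (ac U) (ac (ks.slist (replicate r T))) (ac alg_cplx) (snd (ac (ks.slist (replicate r T)))) F I1 I2 P1 P2"
    "F \<in> Zc 1 (ac (ks.slist (replicate r T))) (ac alg_cplx)"
proof -
  have oT: "is_complex T" "acx (ac T)" "tt (ac T)"
    using T(1)[unfolded two_term_iff_tt] acx_ac[of T] by simp_all
  note oA = alg_cplx_ac(1) acx_ac[OF alg_cplx_ac(1)] tt_alg
  let ?V = "Zc 1 (ac T) (ac alg_cplx)"
  obtain B where B: "finite B" "{x. fst (ac alg_cplx) * x = x \<and> x * fst (ac T) = x} \<subseteq> vs.span B"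
    using finite_span_corner by blast
  have V: "?V \<subseteq> vs.span B" using B(2) hmD[OF ZcD(1)] by blast
  obtain C where C: "C \<subseteq> ?V" "vs.independent C" "?V \<subseteq> vs.span C" by (rule vs.basis_exists[of ?V])
  have "finite C" using vs.independent_span_bound[OF B(1) C(2)] C(1) V by blast
  then obtain L where L: "set L = C" using finite_list by blast
  define T' where "T' = ks.slist (replicate (length L) T)"
  obtain F where F: "F \<in> Zc 1 (ac T') (ac alg_cplx)" "\<And>G. G \<in> set L \<Longrightarrow> \<exists>c\<in>Zc 0 (ac T) (ac T'). G = F * c"
    using universal_class[OF oT(1) oA(1), of L] C(1) L unfolding T'_def by blast
  have univ: "\<exists>c\<in>Zc 0 (ac T) (ac T'). G = F * c" if "G \<in> hm 1 (ac T) (ac alg_cplx)" for G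
  proof -
    have "G \<in> vs.span C" using that C(3) tt_Zc1[OF oT(2) oA(2) oT(3) oA(3)] by blast
    then show ?thesis
    proof (induction rule: vs.span_induct_alt)
      case base
      then show ?case by (intro bexI[of _ 0]) auto
    next
      case (step c x y)
      then obtain a b where "a \<in> Zc 0 (ac T) (ac T')" "x = F * a" "b \<in> Zc 0 (ac T) (ac T')" "y = F * b"
        using F(2) L by blast
      then show ?case using vs.subspace_add[OF subspace_Zc vs.subspace_scale[OF subspace_Zc]]
        by (intro bexI[of _ "fs c a + b"]) (auto simp: distrib_left fs_mult_right)
    qed
  qed
  have oT': "is_complex T'" unfolding T'_def using oT by (intro ks.ob_slist) simp
  have "two_term (ks.slist (replicate n T))" for n
    by (induction n) (auto simp: two_term_zero two_term_dsum T(1))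
  then have tT': "two_term T'" unfolding T'_def .
  have tA: "two_term (alg_cplx :: 'a cplx)" by (simp add: two_term_iff_tt oA)
  obtain U I1 I2 P1 P2 where U: "is_complex U" "glued 0 (ac U) (ac T') (ac alg_cplx) (snd (ac T')) F I1 I2 P1 P2"
    and U': "two_term T' \<longrightarrow> two_term (alg_cplx :: 'a cplx) \<longrightarrow> two_term U"
    using extension_exists[OF oT' oA(1) F(1)] .
  have tU: "two_term U" using U' tT' tA by simp
  have aU: "acx (ac U)" "tt (ac U)" using acx_ac[OF U(1)] tU[unfolded two_term_iff_tt] by simp_all
  have aT': "acx (ac T')" "tt (ac T')" using acx_ac[OF oT'] tT'[unfolded two_term_iff_tt] by simp_all
  have ev: "aev (ac T) (ac T)" using T(2)[unfolded presilting_iff_aev] by simp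
  have evT: "aev (ac T) (ac T')" "aev (ac T') (ac T)"
    unfolding T'_def using aev_slist[OF oT(2), of "replicate (length L) T"] ev oT(1) by auto
  note Fh = ZcD(1)[OF F(1)]
  have TU: "e1 (ac T) (ac U)"
    by (rule e1_bongartz[OF U(2) oT(2) aT'(1) oA(2) aU(1) alg_cplx_ac(2) Fh univ])
       (use aev_iff_e1[OF oT(2) aT'(1) oT(3) aT'(2)] evT in auto)
  then have evTU: "aev (ac T) (ac U)" using aev_iff_e1[OF oT(2) aU(1) oT(3) aU(2)] by blast
  have "aev (ac T') (ac U)" unfolding T'_def
    using aev_slist(1)[OF aU(1), of "replicate (length L) T"] evTU oT(1) by auto
  then have T'U: "e1 (ac T') (ac U)" using aev_iff_e1[OF aT'(1) aU(1) aT'(2) aU(2)] by blast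
  have T'T: "e1 (ac T') (ac T)" using aev_iff_e1[OF aT'(1) oT(2) aT'(2) oT(3)] evT(2) by blast
  have "e1 (ac U) (ac U)"
    by (rule e1_extension[OF U(2) aT'(1) oA(2) aU(1) aU(1) alg_cplx_ac(2) hm_alg_zero[OF aU] hmD(3)[OF Fh] hmD(2)[OF Fh] T'U])
  moreover have "e1 (ac U) (ac T)"
    by (rule e1_extension[OF U(2) aT'(1) oA(2) aU(1) oT(2) alg_cplx_ac(2) hm_alg_zero[OF oT(2,3)] hmD(3)[OF Fh] hmD(2)[OF Fh] T'T])
  ultimately have evU: "aev (ac U) (ac U)" "aev (ac U) (ac T)"
    using aev_iff_e1[OF aU(1) aU(1) aU(2) aU(2)] aev_iff_e1[OF aU(1) oT(2) aU(2) oT(3)] by blast+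
  have oTU: "is_complex (T \<oplus>\<^sub>K U)" by (rule dsum_glued(1)[OF oT(1) U(1)])
  have "presilting (T \<oplus>\<^sub>K U)" unfolding presilting_iff_aev
    using oTU aev_dsum[OF oT(1) U(1) acx_ac[OF oTU]] aev_dsum[OF oT(1) U(1) oT(2)] aev_dsum[OF oT(1) U(1) aU(1)] ev evTU evU by blast
  then show thesis using that[OF tU _ U(2)[unfolded T'_def] F(1)[unfolded T'_def]] by blast
qed

end

section \<open>Thick subcategories\<close>

text \<open>The gluing data determine the complex: matching inclusions with projections gives
  strictly inverse chain maps.\<close>

lemma glued_unique:
  assumes g: "glued c B X Y a f i1 i2 p1 p2" and g': "glued c B' X Y a f j1 j2 q1 q2"
    and a: "fst X * a = a" "a * fst X = a" and f: "fst Y * f = f" "f * fst X = f" and Y: "acx Y"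
  shows "hiso B B'"
proof -
  note gD = gluedD[OF g] gluedD[OF g'] and gs = glued_simps[OF g] glued_simps[OF g']
  have as: "fst X * (a * y) = a * y" "a * (fst X * y) = a * y" "fst Y * (f * y) = f * y" "f * (fst X * y) = f * y"
    "fst Y * (snd Y * y) = snd Y * y" "snd Y * (fst Y * y) = snd Y * y" for y
    using a f Y unfolding acx_def by (simp_all add: mult.assoc[symmetric])
  have u: "j1 * p1 + j2 * p2 \<in> Zc 0 B B'"
    unfolding Zc_def hm_def using dg_mult[OF gD(15) gD(2)] dg_mult[OF gD(17) gD(4)] gD gs as
    by (simp add: dg_add distrib_left distrib_right mult.assoc)
  have v: "i1 * q1 + i2 * q2 \<in> Zc 0 B' B"
    unfolding Zc_def hm_def using dg_mult[OF gD(1) gD(16)] dg_mult[OF gD(3) gD(18)] gD gs as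
    by (simp add: dg_add distrib_left distrib_right mult.assoc)
  have "(i1 * q1 + i2 * q2) * (j1 * p1 + j2 * p2) = fst B" "(j1 * p1 + j2 * p2) * (i1 * q1 + i2 * q2) = fst B'"
    using gD gs by (simp_all add: distrib_left distrib_right mult.assoc)
  then show ?thesis unfolding hiso_def
    by (intro bexI[OF _ u] bexI[OF _ v]) simp
qed

text \<open>An extension of \<open>X\<close> by \<open>Y\<close> is the cone of the connecting map
  on the shift of \<open>X\<close> by -1; the two signs of the differential cancel.\<close>

lemma glued_shift_cone:
  assumes g: "glued 1 C sX Y (- snd sX) (F * p) i1 i2 p1 p2" and s: "shifted (-1) sX X i p"
  shows "glued 0 C X Y (snd X) F (i1 * i) i2 (p * p1) p2"
proof -
  note gD = gluedD[OF g] and gs = glued_simps[OF g] and sD = s[unfolded shifted_def]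
  have r: "p * (i * y) = fst X * y" "fst X * (p * y) = p * y" "i * (fst X * y) = i * y" for y
    using sD by (simp_all add: mult.assoc[symmetric])
  have m: "- snd sX = i * snd X * p" using sD by (simp add: sg_def)
  have e: "fst sX = i * p" using sD by simp
  have 1: "p * (i * p) = p" "i * (p * i) = i" using sD r by (simp_all add: mult.assoc)
  have xs: "i * (p * (p1 * y)) = p1 * y" "i1 * (i * (p * y)) = i1 * y" for y
    using gs(1,2) unfolding e by (simp_all add: mult.assoc)
  have xs': "i * (p * p1) = p1" "i1 * (i * p) = i1"
    using gD(5,6) unfolding e by (simp_all add: mult.assoc)
  have dgs: "dg 0 (i1 * i)" "dg 0 (p * p1)"
    using dg_mult[OF gD(1), of 1 i] dg_mult[of "-1" p 1 p1] gD(2) sD by simp_all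
  have p1i1: "p1 * (i1 * y) = i * (p * y)" for y using gs(5) unfolding e by (simp add: mult.assoc)
  have pi: "p1 * i1 = i * p" using gD(9) e by simp
  show ?thesis unfolding glued_def
    using dgs gD(3,4,7,8,10,11,12,13,14) sD r 1 xs xs' p1i1 gs(7,8) unfolding m
    by (simp add: mult.assoc)
qed

text \<open>Rotation of the triangle: the cone of the projection from the extension \<open>U\<close>
  to \<open>X\<close> is the shift of \<open>Y\<close>.\<close>

lemma cone_of_quotient:
  assumes g: "glued 0 U X Y (snd X) F I1 I2 P1 P2" and c: "glued 1 C U X (- snd U) P1 j1 j2 q1 q2"
    and s: "shifted 1 sY Y s t" and aX: "acx X" and aY: "acx Y" and aU: "acx U"
    and F: "dg 1 F" "fst Y * F = F" "F * fst X = F" "snd Y * F + F * snd X = 0"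
  shows "hiso C sY"
proof -
  note gD = gluedD[OF g] and gs = glued_simps[OF g] and cD = gluedD[OF c] and cs = glued_simps[OF c]
    and sD = s[unfolded shifted_def]
  have ax: "fst X * snd X = snd X" "snd X * fst X = snd X" "fst Y * snd Y = snd Y" "snd Y * fst Y = snd Y"
    "fst U * snd U = snd U" "snd U * fst U = snd U" "fst Y * fst Y = fst Y" "fst X * fst X = fst X" "fst U * fst U = fst U"
    using aX aY aU unfolding acx_def by auto
  have ax': "fst X * (snd X * y) = snd X * y" "snd X * (fst X * y) = snd X * y"
    "fst Y * (snd Y * y) = snd Y * y" "snd Y * (fst Y * y) = snd Y * y" "fst U * (snd U * y) = snd U * y" "snd U * (fst U * y) = snd U * y"
    "fst Y * (F * y) = F * y" "F * (fst X * y) = F * y" for y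
    using ax F by (simp_all add: mult.assoc[symmetric])
  have st: "t * (s * y) = fst Y * y" "fst Y * (t * y) = t * y" "s * (fst Y * y) = s * y" for y
    using sD by (simp_all add: mult.assoc[symmetric])
  have mF: "F * snd X = - (snd Y * F)" using F(4) by (simp add: eq_neg_iff_add_eq_0 add.commute)
  have mF': "F * (snd X * y) = - (snd Y * (F * y))" for y
    using arg_cong[OF mF, of "\<lambda>z. z * y"] by (simp add: mult.assoc)
  have PD: "P2 * snd U = F * P1 + snd Y * P2" unfolding gD(14) using gD gs ax' by (simp add: distrib_left mult.assoc)
  have PD': "P2 * (snd U * y) = F * (P1 * y) + snd Y * (P2 * y)" for y
    using arg_cong[OF PD, of "\<lambda>z. z * y"] by (simp add: mult.assoc distrib_right)
  have DI2: "snd U * I2 = I2 * snd Y" unfolding gD(14) using gD gs ax by (simp add: distrib_right mult.assoc)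
  have DI2': "snd U * (I2 * y) = I2 * (snd Y * y)" for y
    using arg_cong[OF DI2, of "\<lambda>z. z * y"] by (simp add: mult.assoc)
  have DI1: "snd U * I1 = I1 * snd X + I2 * F" unfolding gD(14) using gD gs ax F(3) by (simp add: distrib_right mult.assoc)
  have DI1': "snd U * (I1 * y) = I1 * (snd X * y) + I2 * (F * y)" for y
    using arg_cong[OF DI1, of "\<lambda>z. z * y"] by (simp add: mult.assoc distrib_right)
  have UI: "fst U * I1 = I1" "fst U * I2 = I2" "P1 * fst U = P1" "P2 * fst U = P2"
    unfolding gD(13) using gD gs by (simp_all add: distrib_left distrib_right mult.assoc)
  have UI': "fst U * (I1 * y) = I1 * y" "fst U * (I2 * y) = I2 * y" "P1 * (fst U * y) = P1 * y" "P2 * (fst U * y) = P2 * y" for y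
    using UI by (simp_all add: mult.assoc[symmetric])
  have sY: "fst sY = s * t" "snd sY = - (s * (snd Y * t))" using sD by (simp_all add: mult.assoc)
  \<comment> \<open>The projection from \<open>U\<close> to \<open>Y\<close> is not a chain map; the
    term \<open>F * q2\<close> corrects this on the summand \<open>X\<close> of the cone.
    \<open>be\<close> includes \<open>Y\<close> through \<open>U\<close>, and \<open>hh\<close>
    contracts the two copies of \<open>X\<close>.\<close>
  define al where "al = s * (P2 * q1 + F * q2)"
  define be where "be = j1 * (I2 * t)"
  define hh where "hh = - (j1 * (I1 * q2))"
  note ws = gs cs ax' st UI' DI2' mF' PD' DI1' and es = gD(5-12) cD(5-12) ax UI
  have al: "al \<in> Zc 0 C sY"
  proof -
    have 1: "dg 0 al"
      unfolding al_def using dg_mult[of "-1" s 1] dg_mult[OF gD(4) cD(2)] dg_mult[OF F(1) cD(4)] sD by (simp add: dg_add)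
    have 2: "fst sY * al = al" unfolding al_def sY by (simp add: distrib_left mult.assoc left_diff_distrib right_diff_distrib ws sD F(2))
    have 3: "al * fst C = al" unfolding al_def cD(13) by (simp add: distrib_left distrib_right mult.assoc left_diff_distrib right_diff_distrib ws es F(3))
    have 4: "snd sY * al = al * snd C"
      unfolding al_def cD(14) sY by (simp add: distrib_left distrib_right mult.assoc left_diff_distrib right_diff_distrib ws es F)
    show ?thesis unfolding Zc_def hm_def using 1 2 3 4 by simp
  qed
  have be: "be \<in> Zc 0 sY C"
  proof -
    have 1: "dg 0 be" unfolding be_def using dg_mult[OF cD(1) dg_mult[OF gD(3), of 1 t]] sD by simp
    have 2: "fst C * be = be" unfolding be_def cD(13) by (simp add: distrib_right mult.assoc left_diff_distrib right_diff_distrib ws es)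
    have 3: "be * fst sY = be" unfolding be_def sY by (simp add: mult.assoc left_diff_distrib right_diff_distrib ws es sD)
    have 4: "snd C * be = be * snd sY" unfolding be_def cD(14) sY by (simp add: distrib_right mult.assoc left_diff_distrib right_diff_distrib ws es)
    show ?thesis unfolding Zc_def hm_def using 1 2 3 4 by simp
  qed
  have ab: "al * be = fst sY" unfolding al_def be_def sY by (simp add: distrib_left distrib_right mult.assoc left_diff_distrib right_diff_distrib ws es sD)
  have hh: "hh \<in> hm (0 - 1) C C"
  proof -
    have 1: "dg (0 - 1) (j1 * (I1 * q2))" using dg_mult[OF cD(1) dg_mult[OF gD(1) cD(4)]] by simp
    have 2: "fst C * (j1 * (I1 * q2)) = j1 * (I1 * q2)" unfolding cD(13) by (simp add: distrib_right mult.assoc left_diff_distrib right_diff_distrib ws es)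
    have 3: "j1 * (I1 * q2) * fst C = j1 * (I1 * q2)" unfolding cD(13) by (simp add: distrib_left mult.assoc left_diff_distrib right_diff_distrib ws es)
    show ?thesis unfolding hh_def hm_def using 1 2 3 by (simp add: dg_uminus)
  qed
  have "fst U = I1 * P1 + I2 * P2" by (rule gD(13))
  then have q: "j1 * q1 = j1 * (I1 * (P1 * q1)) + j1 * (I2 * (P2 * q1))"
    using cs(1)[of q1] by (simp add: distrib_left distrib_right mult.assoc)
  have "be * al - fst C = snd C * hh + hh * snd C"
    unfolding al_def be_def hh_def cD(13,14) by (simp add: distrib_left distrib_right mult.assoc left_diff_distrib right_diff_distrib ws es q)
  then have "be * al - fst C \<in> Bc 0 C C" unfolding Bc_def using hh by auto
  then show ?thesis unfolding hiso_def using al be ab by (intro bexI[OF _ al] bexI[OF _ be]) simp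
qed

lemma shift_shift: "shift (- t) (shift t X) = X"
proof -
  have "- (- A) = A" for A :: "'b::ring_1 mat" by (rule eq_matI) auto
  then show ?thesis unfolding shift_def cobj_def cdif_def by (cases X) (auto simp: fun_eq_iff)
qed

lemma thick_complex: "X \<in> thick S \<Longrightarrow> is_complex X"
proof (induction rule: thick.induct)
  case (iso X Y)
  then show ?case unfolding htpy_equiv_def by blast
qed (auto intro: zero_cplx_ac(1) shift_shifted(1) cone_glued(1))

lemma thick_hiso: "X \<in> thick S \<Longrightarrow> is_complex Y \<Longrightarrow> hiso (ac X) (ac Y) \<Longrightarrow> Y \<in> thick S"
  using thick.iso[of X S Y] thick_complex[of X S] htpy_equiv_iff by blast

text \<open>Thick subcategories are closed under cones by definition; the extension is rewritten as
  the cone of a map out of the shift of \<open>X\<close> by -1.\<close>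

lemma thick_extension:
  assumes X: "X \<in> thick S" and Y: "Y \<in> thick S" and U: "is_complex U"
    and F: "F \<in> Zc 1 (ac X) (ac Y)" and g: "glued 0 (ac U) (ac X) (ac Y) (snd (ac X)) F i1 i2 p1 p2"
  shows "U \<in> thick S"
proof -
  note oX = thick_complex[OF X] and oY = thick_complex[OF Y]
  note aX = acx_ac[OF oX, unfolded acx_def] and Fh = hmD[OF ZcD(1)[OF F]]
  let ?sX = "shift (-1) X"
  note osX = shift_shifted(1)[OF oX, of "-1"]
  obtain i p where s: "shifted (-1) (ac ?sX) (ac X) i p" using shift_shifted(2)[OF oX] by blast
  note sD = s[unfolded shifted_def]
  have pp: "p * (i * y) = fst (ac X) * y" for y using sD by (simp add: mult.assoc[symmetric])
  have "F * p \<in> Zc 0 (ac ?sX) (ac Y)"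
  proof -
    have 1: "dg 0 (F * p)" using dg_mult[OF Fh(1), of "-1" p] sD by simp
    have 2: "fst (ac Y) * (F * p) = F * p" using Fh(2) by (simp add: mult.assoc[symmetric])
    have 3: "F * p * fst (ac ?sX) = F * p" using sD pp Fh(3) by (simp add: mult.assoc)
    have "F * p * snd (ac ?sX) = - (F * (p * (i * (snd (ac X) * p))))"
      using sD by (simp add: sg_def mult.assoc)
    also have "\<dots> = - (F * snd (ac X) * p)" using pp aX by (simp add: mult.assoc[symmetric])
    also have "\<dots> = snd (ac Y) * (F * p)" using ZcD(2)[OF F] by (simp add: mult.assoc[symmetric]) (metis mult_minus_left minus_minus)
    finally show ?thesis unfolding Zc_def hm_def using 1 2 3 by simp
  qed
  then obtain f where f: "f \<in> homs 0 ?sX Y" "enc 0 ?sX Y f = F * p" "enc 0 ?sX Y f \<in> Zc 0 (ac ?sX) (ac Y)"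
    using enc_surj[OF osX oY ZcD(1)] by metis
  have cm: "chain_map ?sX Y f" using chain_map_iff[OF osX oY, of 0 f] f by simp
  have C: "cone ?sX Y f \<in> thick S" by (rule thick.cne[OF thick.shft[OF X] Y cm])
  obtain k1 k2 r1 r2 where k: "glued 1 (ac (cone ?sX Y f)) (ac ?sX) (ac Y) (- snd (ac ?sX)) (F * p) k1 k2 r1 r2"
    using cone_glued(2)[OF osX oY cm] f(2) by auto
  have "hiso (ac (cone ?sX Y f)) (ac U)"
    by (rule glued_unique[OF glued_shift_cone[OF k s] g]) (use aX Fh acx_ac[OF oY] in auto)
  then show ?thesis by (rule thick_hiso[OF C U])
qed

text \<open>The cone of the projection from \<open>U\<close> to \<open>X\<close> is the shift of
  \<open>Y\<close>, which is then shifted back. Applied to the Bongartz extension this produces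
  \<open>A\<close>.\<close>

lemma thick_kernel:
  assumes U: "U \<in> thick S" and X: "X \<in> thick S" and Y: "is_complex Y"
    and F: "F \<in> Zc 1 (ac X) (ac Y)" and g: "glued 0 (ac U) (ac X) (ac Y) (snd (ac X)) F i1 i2 p1 p2"
  shows "Y \<in> thick S"
proof -
  note oX = thick_complex[OF X] and oU = thick_complex[OF U] and Fh = hmD[OF ZcD(1)[OF F]]
  note gD = gluedD[OF g] and gs = glued_simps[OF g]
  have ax: "fst (ac X) * (snd (ac X) * y) = snd (ac X) * y" for y
    using acx_ac[OF oX] unfolding acx_def by (simp add: mult.assoc[symmetric])
  have p1: "p1 \<in> Zc 0 (ac U) (ac X)"
    unfolding Zc_def hm_def using gD gs ax by (simp add: distrib_left mult.assoc)
  then obtain f where f: "f \<in> homs 0 U X" "enc 0 U X f = p1" using enc_surj[OF oU oX ZcD(1)] by metis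
  have cm: "chain_map U X f" using chain_map_iff[OF oU oX, of 0 f] f p1 by simp
  have C: "cone U X f \<in> thick S" by (rule thick.cne[OF U X cm])
  obtain k1 k2 r1 r2 where k: "glued 1 (ac (cone U X f)) (ac U) (ac X) (- snd (ac U)) p1 k1 k2 r1 r2"
    using cone_glued(2)[OF oU oX cm] f(2) by auto
  obtain s t where st: "shifted 1 (ac (shift 1 Y)) (ac Y) s t" using shift_shifted(2)[OF Y] by blast
  have F2: "snd (ac Y) * F + F * snd (ac X) = 0" using ZcD(2)[OF F] by (simp add: add_eq_0_iff)
  have "hiso (ac (cone U X f)) (ac (shift 1 Y))"
    by (rule cone_of_quotient[OF g k st acx_ac[OF oX] acx_ac[OF Y] acx_ac[OF oU] Fh F2])
  then have "shift 1 Y \<in> thick S" by (rule thick_hiso[OF C shift_shifted(1)[OF Y]])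
  from thick.shft[OF this, of "-1"] show ?thesis by (simp add: shift_shift)
qed

section \<open>Generation of all complexes by \<open>A\<close>\<close>

definition munit :: "idx \<Rightarrow> idx \<Rightarrow> 'a::ring_1 fm" where
  "munit u v = Abs_fm (\<lambda>x y. if x = u \<and> y = v then 1 else 0)"

lemma ent_munit: "ent (munit u v :: 'a::ring_1 fm) x y = (if x = u \<and> y = v then 1 else 0)"
proof -
  have "fin_ent (\<lambda>x y. if x = u \<and> y = v then (1::'a) else 0)"
    by (rule fin_entI[of "{u, v}"]) auto
  then show ?thesis unfolding munit_def by (simp add: ent_Abs_fm)
qed

lemma munit_mult: "munit u v * munit v w = (munit u w :: 'a::ring_1 fm)"
  and munit_mult_zero: "v \<noteq> v' \<Longrightarrow> munit u v * munit v' w = (0 :: 'a::ring_1 fm)"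
proof -
  have m: "ent (munit u v * munit v' w :: 'a fm) x y = (\<Sum>z\<in>{v}. ent (munit u v) x z * ent (munit v' w) z y)" for v' x y
    by (rule ent_mult) (auto simp: ent_munit)
  show "munit u v * munit v w = (munit u w :: 'a fm)" by (rule fm_eqI) (auto simp: m ent_munit)
  show "v \<noteq> v' \<Longrightarrow> munit u v * munit v' w = (0 :: 'a fm)" by (rule fm_eqI) (auto simp: m ent_munit)
qed

lemma ent_sum: "ent (sum F A :: 'a::ring fm) u v = (\<Sum>i\<in>A. ent (F i) u v)"
  by (induction A rule: infinite_finite_induct) auto

text \<open>The identity of the free module of rank \<open>n\<close> placed in degree
  \<open>t\<close>.\<close>

definition idn :: "int \<Rightarrow> nat \<Rightarrow> 'a::ring_1 fm" where
  "idn t n = (\<Sum>a<n. munit (Ix t a) (Ix t a))"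

lemma ent_idn: "ent (idn t n :: 'a::ring_1 fm) (Ix i a) (Ix j b) = (if i = t \<and> j = t \<and> a = b \<and> a < n then 1 else 0)"
proof -
  have "ent (idn t n :: 'a fm) (Ix i a) (Ix j b) = (\<Sum>c<n. if c = a then (if i = t \<and> j = t \<and> a = b then 1 else 0) else 0)"
    unfolding idn_def ent_sum ent_munit by (intro sum.cong) auto
  then show ?thesis by auto
qed

lemma ent_idn_mult: "ent (idn t n * x :: 'a::ring_1 fm) (Ix i a) y = (if i = t \<and> a < n then ent x (Ix i a) y else 0)"
proof -
  have "ent (idn t n * x) (Ix i a) y = (\<Sum>w\<in>{Ix i a}. ent (idn t n) (Ix i a) w * ent x w y)"
  proof (rule ent_mult)
    fix w assume "w \<notin> {Ix i a}"
    then show "ent (idn t n :: 'a fm) (Ix i a) w = 0 \<or> ent x w y = 0" by (cases w) (auto simp: ent_idn)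
  qed simp
  then show ?thesis by (auto simp: ent_idn)
qed

lemma ent_mult_idn: "ent (x * idn t n :: 'a::ring_1 fm) y (Ix j b) = (if j = t \<and> b < n then ent x y (Ix j b) else 0)"
proof -
  have "ent (x * idn t n) y (Ix j b) = (\<Sum>w\<in>{Ix j b}. ent x y w * ent (idn t n) w (Ix j b))"
  proof (rule ent_mult)
    fix w assume "w \<notin> {Ix j b}"
    then show "ent x y w = 0 \<or> ent (idn t n :: 'a fm) w (Ix j b) = 0" by (cases w) (auto simp: ent_idn)
  qed simp
  then show ?thesis by (auto simp: ent_idn)
qed

lemma dg_idn: "dg 0 (idn t n)" and idn_idem: "idn t n * idn t n = (idn t n :: 'a::ring_1 fm)"
  subgoal unfolding dg_def ent_idn by (auto split: if_splits)
  subgoal by (rule fm_eqI') (auto simp: ent_idn_mult ent_idn)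
  done

lemma position_bound: "\<exists>n. \<forall>i a j b. n \<le> a \<or> n \<le> b \<longrightarrow> ent x (Ix i a) (Ix j b) = 0"
proof -
  obtain I where I: "finite I" "fm_in I x" using ex_fm_in by blast
  define ps where "ps = (\<lambda>x. case x of Ix i a \<Rightarrow> a)"
  define n where "n = Suc (Max (insert 0 (ps ` I)))"
  have "Ix i a \<notin> I" if "a \<ge> n" for i a
  proof
    assume "Ix i a \<in> I"
    then have "ps (Ix i a) \<in> insert 0 (ps ` I)" by blast
    then have "ps (Ix i a) \<le> Max (insert 0 (ps ` I))" using I(1) by (intro Max_ge) auto
    then show False using that unfolding n_def ps_def by simp
  qed
  then show ?thesis using fm_inD[OF I(2)] by blast
qed

lemma degree_bound: "\<exists>N. \<forall>i a j b. \<bar>i\<bar> > N \<longrightarrow> ent x (Ix i a) (Ix j b) = 0"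
proof -
  obtain I where I: "finite I" "fm_in I x" using ex_fm_in by blast
  define dgr where "dgr = (\<lambda>x. case x of Ix i a \<Rightarrow> \<bar>i\<bar>)"
  define N where "N = Max (insert 0 (dgr ` I))"
  have "Ix i a \<notin> I" if "\<bar>i\<bar> > N" for i a
  proof
    assume "Ix i a \<in> I"
    then have "dgr (Ix i a) \<in> insert 0 (dgr ` I)" by blast
    then have "dgr (Ix i a) \<le> N" unfolding N_def using I(1) by (intro Max_ge) auto
    then show False using that unfolding dgr_def by simp
  qed
  then show ?thesis using fm_inD[OF I(2)] by blast
qed

lemma ent_alg: "fst (ac (alg_cplx :: 'a::ring_1 cplx)) = munit (Ix 0 0) (Ix 0 0)"
  by (rule fm_eqI') (auto simp: alg_cplx_ac(3) ent_munit)

lemma acx_zero_diff: "dg 0 e \<Longrightarrow> e * e = e \<Longrightarrow> acx (e, 0)"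
  unfolding acx_def by simp

lemma thick_idn:
  assumes A: "(alg_cplx :: 'a::ring_1 cplx) \<in> thick S"
  shows "is_complex X \<Longrightarrow> ac X = (idn 0 n, 0) \<Longrightarrow> X \<in> thick S"
proof (induction n arbitrary: X)
  case 0
  have "hiso (ac (zero_cplx :: 'a cplx)) (ac X)"
    unfolding hiso_def using 0 by (intro bexI[of _ 0]) (simp_all add: zero_cplx_ac idn_def)
  then show ?case by (rule thick_hiso[OF thick.zero 0(1)])
next
  case (Suc n)
  let ?u = "munit (Ix 0 n) (Ix 0 n) :: 'a fm"
  have du: "dg 0 (munit (Ix 0 a) (Ix 0 b) :: 'a fm)" for a b unfolding dg_def ent_munit by (auto split: if_splits)
  have uu: "?u * ?u = ?u" by (rule munit_mult)
  obtain D where D: "is_complex D" "ac D = (?u, 0)" using realize[OF acx_zero_diff[OF du uu]] by blast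
  obtain Y where Y: "is_complex Y" "ac Y = (idn 0 n, 0 :: 'a fm)" using realize[OF acx_zero_diff[OF dg_idn idn_idem]] by blast
  have "hiso (ac (alg_cplx :: 'a cplx)) (ac D)"
    unfolding hiso_def
    by (intro bexI[of _ "munit (Ix 0 n) (Ix 0 0)"] bexI[of _ "munit (Ix 0 0) (Ix 0 n)"])
       (simp_all add: munit_mult ent_alg D(2) Zc_def hm_def du alg_cplx_ac(2))
  then have DS: "D \<in> thick S" by (rule thick_hiso[OF A D(1)])
  have YS: "Y \<in> thick S" by (rule Suc.IH[OF Y])
  have un: "?u * idn 0 n = 0" "idn 0 n * ?u = 0"
    unfolding idn_def sum_distrib_left sum_distrib_right by (auto intro!: sum.neutral munit_mult_zero)
  have "glued 0 (ac X) (ac D) (ac Y) (snd (ac D)) 0 ?u (idn 0 n) ?u (idn 0 n)"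
    unfolding glued_def Suc.prems(2) D(2) Y(2) using un uu by (simp add: du dg_idn idn_idem) (simp add: idn_def add.commute)
  then show ?case by (rule thick_extension[OF DS YS Suc.prems(1) Zc_zero])
qed

context fdalg
begin

text \<open>Homotopy retracts are direct summands, because idempotents split in the homotopy
  category.\<close>

lemma thick_retract:
  fixes B X :: "'a cplx"
  assumes B: "B \<in> thick S" and X: "is_complex X"
    and f: "f \<in> Zc 0 (ac X) (ac B)" "g \<in> Zc 0 (ac B) (ac X)" "g * f - fst (ac X) \<in> Bc 0 (ac X) (ac X)"
  shows "X \<in> thick S"
proof -
  note oB = thick_complex[OF B]
  obtain W i p where b: "ks.bip B X W f i g p" using ks.split_retract[OF f X oB] .
  have "B \<simeq>\<^sub>K X \<oplus>\<^sub>K W" using ks.bip_imp_iso[OF b] iso_iff by simp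
  from thick.iso[OF B this] show ?thesis by (rule thick.summand[OF _ X ks.bipD(3)[OF b]])
qed

text \<open>An idempotent matrix in degree 0 exhibits its image as a retract of the free module of
  rank \<open>n\<close>, for \<open>n\<close> beyond all positions that it uses.\<close>

lemma thick_stalk0:
  assumes A: "(alg_cplx :: 'a cplx) \<in> thick S" and X: "is_complex X" "snd (ac X) = 0"
    and s: "\<And>i a j b. ent (fst (ac X)) (Ix i a) (Ix j b) \<noteq> 0 \<Longrightarrow> i = 0"
  shows "X \<in> thick S"
proof -
  let ?e = "fst (ac X)"
  note aX = acx_ac[OF X(1), unfolded acx_def]
  obtain n where n: "\<And>i a j b. n \<le> a \<or> n \<le> b \<Longrightarrow> ent ?e (Ix i a) (Ix j b) = 0" using position_bound by metis
  have s': "j = 0" if "ent ?e (Ix i a) (Ix j b) \<noteq> 0" for i a j b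
    using s[OF that] aX that unfolding dg_def by force
  have l: "idn 0 n * ?e = ?e"
  proof (rule fm_eqI')
    fix i a j b show "ent (idn 0 n * ?e) (Ix i a) (Ix j b) = ent ?e (Ix i a) (Ix j b)"
      unfolding ent_idn_mult using s[of i a j b] n[of a b i j] by (cases "ent ?e (Ix i a) (Ix j b) = 0") (auto simp: not_less)
  qed
  have r: "?e * idn 0 n = ?e"
  proof (rule fm_eqI')
    fix i a j b show "ent (?e * idn 0 n) (Ix i a) (Ix j b) = ent ?e (Ix i a) (Ix j b)"
      unfolding ent_mult_idn using s'[of i a j b] n[of a b i j] by (cases "ent ?e (Ix i a) (Ix j b) = 0") (auto simp: not_less)
  qed
  obtain B where B: "is_complex B" "ac B = (idn 0 n, 0 :: 'a fm)"
    using realize[OF acx_zero_diff[OF dg_idn idn_idem]] by blast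
  have BS: "B \<in> thick S" by (rule thick_idn[OF A B])
  show ?thesis
    by (rule thick_retract[OF BS X(1), of ?e ?e]) (use l r aX B(2) X(2) in \<open>auto simp: Zc_def hm_def\<close>)
qed

lemma thick_stalk:
  assumes A: "(alg_cplx :: 'a cplx) \<in> thick S" and X: "is_complex X" "snd (ac X) = 0"
    and s: "\<And>i a j b. ent (fst (ac X)) (Ix i a) (Ix j b) \<noteq> 0 \<Longrightarrow> i = t"
  shows "X \<in> thick S"
proof -
  obtain k p where sh: "shifted t (ac (shift t X)) (ac X) k p" using shift_shifted(2)[OF X(1)] by blast
  note sD = sh[unfolded shifted_def]
  have "shift t X \<in> thick S"
  proof (rule thick_stalk0[OF A shift_shifted(1)[OF X(1)]])
    show "snd (ac (shift t X)) = 0" using sD X(2) by simp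
    fix i a j b assume "ent (fst (ac (shift t X))) (Ix i a) (Ix j b) \<noteq> 0"
    then have "ent (k * (fst (ac X) * p)) (Ix i a) (Ix j b) \<noteq> 0" using sD by simp
    then obtain w where w: "ent k (Ix i a) w \<noteq> 0" "ent (fst (ac X) * p) w (Ix j b) \<noteq> 0" using ent_mult_nonzero by blast
    obtain i' a' where w': "w = Ix i' a'" by (cases w)
    obtain z where z: "ent (fst (ac X)) (Ix i' a') z \<noteq> 0" using ent_mult_nonzero[OF w(2)] w' by blast
    obtain j' b' where "z = Ix j' b'" by (cases z)
    then have "i' = t" using s z by blast
    moreover have "i = i' + - t" using sD w(1) w' unfolding dg_def by blast
    ultimately show "i = 0" by simp
  qed
  from thick.shft[OF this, of "- t"] show ?thesis by (simp add: shift_shift)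
qed

text \<open>Induction on the number of degrees: the term \<open>X2\<close> of top degree is a
  subcomplex concentrated in one degree, and \<open>X\<close> is an extension of the remaining part
  \<open>X1\<close> by it.\<close>

lemma thick_all_bounded:
  assumes A: "(alg_cplx :: 'a cplx) \<in> thick S"
  shows "is_complex X \<Longrightarrow> (\<And>i a j c. ent (fst (ac X)) (Ix i a) (Ix j c) \<noteq> 0 \<Longrightarrow> b \<le> i \<and> i < b + int k) \<Longrightarrow> X \<in> thick S"
proof (induction k arbitrary: X)
  case 0
  have "fst (ac X) = 0"
  proof (rule fm_eqI')
    fix i a j c
    show "ent (fst (ac X)) (Ix i a) (Ix j c) = ent 0 (Ix i a) (Ix j c)" using 0(2)[of i a j c] by fastforce
  qed
  then have "ks.iso X zero_cplx" unfolding ks.iso_zr_iff[OF 0(1)] by simp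
  then have "zero_cplx \<simeq>\<^sub>K X" using iso_iff ks.iso_sym by simp
  then show ?case by (rule thick.iso[OF thick.zero])
next
  case (Suc k)
  define e where "e = fst (ac X)"
  define d where "d = snd (ac X)"
  define t where "t = b + int k"
  note aX = acx_ac[OF Suc.prems(1), unfolded acx_def, folded e_def d_def]
  have supp: "b \<le> i \<and> i \<le> t" if "ent e (Ix i a) (Ix j c) \<noteq> 0" for i a j c
    using Suc.prems(2)[of i a j c] that unfolding e_def t_def by simp
  obtain n where n: "\<And>i a j b. n \<le> a \<or> n \<le> b \<Longrightarrow> ent e (Ix i a) (Ix j b) = 0" using position_bound by metis
  \<comment> \<open>The part of \<open>e\<close> in the top degree \<open>t\<close>. It commutes
    with \<open>e\<close> since \<open>e\<close> has degree 0, and the differential kills it since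
    nothing lies above \<open>t\<close>.\<close>
  define e2 where "e2 = idn t n * e"
  have ent2: "ent e2 (Ix i a) (Ix j c) = (if i = t then ent e (Ix i a) (Ix j c) else 0)" for i a j c
    unfolding e2_def ent_idn_mult using n[of a c i j] by (auto simp: not_less)
  have comm: "idn t n * e = e * idn t n"
  proof (rule fm_eqI')
    fix i a j c
    have "ent e (Ix i a) (Ix j c) = 0" if "i \<noteq> j" using aX that unfolding dg_def by force
    then show "ent (idn t n * e) (Ix i a) (Ix j c) = ent (e * idn t n) (Ix i a) (Ix j c)"
      unfolding ent_idn_mult ent_mult_idn using n[of a c i j] by (cases "i = j") (auto simp: not_less)
  qed
  have e22: "e2 * e2 = e2"
  proof -
    have "e2 * e2 = idn t n * (e * idn t n) * e" unfolding e2_def by (simp add: mult.assoc)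
    also have "\<dots> = (idn t n * idn t n) * (e * e)" unfolding comm[symmetric] by (simp add: mult.assoc)
    finally show ?thesis unfolding e2_def using aX by (simp add: idn_idem)
  qed
  have ee: "e * e = e" using aX by simp
  have ee2: "e * e2 = e2" "e2 * e = e2"
    unfolding e2_def using comm ee by (metis mult.assoc)+
  have dge2: "dg 0 e2" unfolding e2_def using dg_mult[OF dg_idn, of 0 e] aX by simp
  have de2: "d * e2 = 0"
  proof (rule fm_eqI')
    fix i a j c
    show "ent (d * e2) (Ix i a) (Ix j c) = ent 0 (Ix i a) (Ix j c)"
    proof (rule ccontr)
      assume "ent (d * e2) (Ix i a) (Ix j c) \<noteq> ent 0 (Ix i a) (Ix j c)"
      then have nz: "ent (d * e2) (Ix i a) (Ix j c) \<noteq> 0" by simp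
      then obtain w where w: "ent d (Ix i a) w \<noteq> 0" "ent e2 w (Ix j c) \<noteq> 0" using ent_mult_nonzero by blast
      obtain i' a' where w': "w = Ix i' a'" by (cases w)
      have "i' = t" using w(2) unfolding w' ent2 by (auto split: if_splits)
      then have "i = t + 1" using w(1) aX unfolding w' dg_def by blast
      have "ent (e * d) (Ix i a) w \<noteq> 0" using w(1) aX by simp
      then obtain z where z: "ent e (Ix i a) z \<noteq> 0" using ent_mult_nonzero by blast
      obtain j' b' where z': "z = Ix j' b'" by (cases z)
      show False using supp[of i a j' b'] z \<open>i = t + 1\<close> unfolding z' by simp
    qed
  qed
  define e1 where "e1 = e - e2"
  have e11: "e1 * e1 = e1" "e1 * e2 = 0" "e2 * e1 = 0" "e * e1 = e1" "e1 * e = e1" "dg 0 e1" "d * e1 = d"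
    unfolding e1_def using aX ee2 e22 dge2 de2
    by (simp_all add: left_diff_distrib right_diff_distrib dg_diff)
  have r: "e1 * (e1 * y) = e1 * y" "e1 * (e2 * y) = 0" "e2 * (e1 * y) = 0" "d * (e1 * y) = d * y" "d * (e2 * y) = 0"
    "d * (d * y) = 0" "e2 * (e2 * y) = e2 * y" for y
    using e11 de2 aX e22 by (simp_all add: mult.assoc[symmetric])
  have dd: "d * d = 0" "e1 * d + e2 * d = d" using aX by (simp_all add: e1_def distrib_right[symmetric])
  have "acx (e1, e1 * d)"
    unfolding acx_def using e11 r dd dg_mult[OF e11(6), of 1 d] aX by (simp add: mult.assoc)
  then obtain X1 where X1: "is_complex X1" "ac X1 = (e1, e1 * d)" using realize by blast
  obtain X2 where X2: "is_complex X2" "ac X2 = (e2, 0 :: 'a fm)" using realize[OF acx_zero_diff[OF dge2 e22]] by blast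
  have S1: "X1 \<in> thick S"
  proof (rule Suc.IH[OF X1(1)])
    fix i a j c assume nz: "ent (fst (ac X1)) (Ix i a) (Ix j c) \<noteq> 0"
    then have "ent e (Ix i a) (Ix j c) \<noteq> 0" "i \<noteq> t" unfolding X1(2) e1_def by (auto simp: ent2 split: if_splits)
    then show "b \<le> i \<and> i < b + int k" using supp unfolding t_def by fastforce
  qed
  have S2: "X2 \<in> thick S"
    by (rule thick_stalk[OF A X2(1), of t]) (auto simp: X2(2) ent2 split: if_splits)
  have "e2 * d \<in> Zc 1 (ac X1) (ac X2)"
    unfolding Zc_def hm_def X1(2) X2(2) using r e11 e22 dd dg_mult[OF dge2, of 1 d] aX by (simp add: mult.assoc)
  moreover have "glued 0 (ac X) (ac X1) (ac X2) (snd (ac X1)) (e2 * d) e1 e2 e1 e2"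
    unfolding glued_def X1(2) X2(2) using e11 e22 r dd dge2 unfolding e_def[symmetric] d_def[symmetric]
    by (simp add: mult.assoc) (simp add: e1_def)
  ultimately show ?case by (rule thick_extension[OF S1 S2 Suc.prems(1)])
qed

lemma thick_all:
  assumes A: "(alg_cplx :: 'a cplx) \<in> thick S" and X: "is_complex X" shows "X \<in> thick S"
proof -
  obtain N where N: "\<And>i a j b. \<bar>i\<bar> > N \<Longrightarrow> ent (fst (ac X)) (Ix i a) (Ix j b) = 0" using degree_bound by metis
  show ?thesis
  proof (rule thick_all_bounded[OF A X, of "- \<bar>N\<bar>" "nat (2 * \<bar>N\<bar> + 1)"])
    fix i a j c assume "ent (fst (ac X)) (Ix i a) (Ix j c) \<noteq> 0"
    then have "\<bar>i\<bar> \<le> N" using N by (meson not_less)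
    then show "- \<bar>N\<bar> \<le> i \<and> i < - \<bar>N\<bar> + int (nat (2 * \<bar>N\<bar> + 1))" by (auto simp: abs_le_iff)
  qed
qed

lemma thick_kms:
  assumes S: "is_complex S" and X: "is_complex X" "set_mset (ks.kms X) \<subseteq> set_mset (ks.kms S)"
  shows "X \<in> thick {S}"
proof -
  obtain Xs where Xs: "\<forall>Y\<in>set Xs. ks.indec Y" "ks.iso X (ks.slist Xs)" "ks.kms X = mset (map ks.cls Xs)"
    using ks.kms_decompose[OF X(1)] .
  have SS: "S \<in> thick {S}" by (rule thick.base) (use S in auto)
  have mem: "Y \<in> thick {S}" if "Y \<in> set Xs" for Y
  proof -
    have i: "ks.indec Y" and "ks.cls Y \<in># ks.kms S" using that Xs X(2) by auto
    then obtain Z where Z: "is_complex Z" "ks.iso S (Y \<oplus>\<^sub>K Z)" using ks.kms_mem_summand[OF S i] by blast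
    have "S \<simeq>\<^sub>K Y \<oplus>\<^sub>K Z" using Z(2) iso_iff by simp
    from thick.iso[OF SS this] show ?thesis by (rule thick.summand[OF _ ks.indec_ob[OF i] Z(1)])
  qed
  have "ks.slist Ys \<in> thick {S}" if "set Ys \<subseteq> set Xs" for Ys
    using that
  proof (induction Ys)
    case Nil
    then show ?case by (simp add: thick.zero)
  next
    case (Cons Y Ys)
    then have Y: "Y \<in> thick {S}" "ks.slist Ys \<in> thick {S}" using mem by auto
    obtain i1 i2 p1 p2 where g: "glued 0 (ac (Y \<oplus>\<^sub>K ks.slist Ys)) (ac Y) (ac (ks.slist Ys)) (snd (ac Y)) 0 i1 i2 p1 p2"
      using dsum_glued(2)[OF thick_complex[OF Y(1)] thick_complex[OF Y(2)]] by blast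
    have "Y \<oplus>\<^sub>K ks.slist Ys \<in> thick {S}"
      by (rule thick_extension[OF Y dsum_glued(1)[OF thick_complex[OF Y(1)] thick_complex[OF Y(2)]] Zc_zero g])
    then show ?case by simp
  qed
  then have L: "ks.slist Xs \<in> thick {S}" by simp
  have "ks.slist Xs \<simeq>\<^sub>K X" using ks.iso_sym[OF Xs(2)] iso_iff by simp
  then show ?thesis by (rule thick.iso[OF L])
qed

end

section \<open>Faces\<close>

context fdalg
begin

definition icls :: "'a cplx set \<Rightarrow> bool" where "icls c \<longleftrightarrow> (\<exists>Y. ks.indec Y \<and> c = ks.cls Y)"

text \<open>The finite good sets are the faces of \<open>\<Delta>(A)\<close>.\<close>

definition good :: "'a cplx set set \<Rightarrow> bool" where
  "good C \<longleftrightarrow> (\<forall>c\<in>C. icls c \<and> ttc c \<and> (\<forall>d\<in>C. pev c d))"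

lemma two_term_presilting_good:
  assumes "two_term T" "presilting T" shows "good (set_mset (ks.kms T))"
proof -
  have T: "is_complex T" using assms(1) two_term_def by blast
  have "ttc (ks.cls T)" unfolding ttc_def ks.cls_def using assms(1) ks.iso_refl[OF T] by blast
  then have 1: "\<forall>c\<in>#ks.kms T. ttc c" using ttc_kms[OF T] by simp
  have 2: "\<forall>c\<in>#ks.kms T. \<forall>d\<in>#ks.kms T. pev c d"
    using assms(2)[unfolded presilting_iff_aev] aev_kms[OF T T] by simp
  show ?thesis unfolding good_def icls_def using 1 2 ks.kms_mem[OF T] by simp
qed

lemma good_two_term_presilting:
  assumes "good (set_mset M)" obtains T where "two_term T" "presilting T" "ks.kms T = M"
proof -
  obtain X where X: "is_complex X" "ks.kms X = M"
    using ks.kms_ex[of M] assms unfolding good_def icls_def by blast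
  have "ttc (ks.cls X)" using ttc_kms[OF X(1)] X(2) assms unfolding good_def by simp
  then obtain T where T: "ks.iso T X" "two_term T" unfolding ttc_def ks.cls_def by blast
  have oT: "is_complex T" by (rule ks.iso_ob(1)[OF T(1)])
  have kT: "ks.kms T = M" using ks.kms_iso[OF T(1)] X(2) by simp
  have "presilting T"
    unfolding presilting_iff_aev using oT aev_kms[OF oT oT] kT assms unfolding good_def by simp
  then show thesis using that T(2) kT by blast
qed

lemma good_subset: "good C \<Longrightarrow> D \<subseteq> C \<Longrightarrow> good D"
  unfolding good_def by (meson subset_iff)

text \<open>\<open>S\<close> is the multiplicity-free version of \<open>T\<close> plus its Bongartz
  complement \<open>U\<close>. Its thick closure contains \<open>U\<close> and the powers of
  \<open>T\<close>, hence \<open>A\<close>, and thereby every complex.\<close>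

lemma good_silting:
  assumes "two_term T" "presilting T"
  obtains S where "two_term S" "silting S" "basic S" "set_mset (ks.kms T) \<subseteq> set_mset (ks.kms S)"
proof -
  obtain U r F I1 I2 P1 P2 where U: "two_term U" "presilting (T \<oplus>\<^sub>K U)"
    "glued 0 (ac U) (ac (ks.slist (replicate r T))) (ac alg_cplx) (snd (ac (ks.slist (replicate r T)))) F I1 I2 P1 P2"
    "F \<in> Zc 1 (ac (ks.slist (replicate r T))) (ac alg_cplx)"
    using bongartz[OF assms] .
  have oT: "is_complex T" "is_complex U" using assms(1) U(1) two_term_def by blast+
  let ?K = "set_mset (ks.kms (T \<oplus>\<^sub>K U))"
  have K: "?K = set_mset (ks.kms T) \<union> set_mset (ks.kms U)" using ks.kms_sm[OF oT] by simp
  have "good ?K" by (rule two_term_presilting_good[OF two_term_dsum[OF assms(1) U(1)] U(2)])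
  then have "good (set_mset (mset_set ?K))" by simp
  then obtain S where S: "two_term S" "presilting S" "ks.kms S = mset_set ?K" using good_two_term_presilting by blast
  have oS: "is_complex S" using S(1) two_term_def by blast
  have kS: "set_mset (ks.kms S) = ?K" using S(3) by simp
  have bS: "basic S" unfolding basic_iff using oS S(3) by (auto simp: count_mset_set')
  let ?T' = "ks.slist (replicate r T)"
  have oT': "is_complex ?T'" using oT(1) by (intro ks.ob_slist) simp
  have "set_mset (ks.kms ?T') \<subseteq> set_mset (ks.kms T)"
  proof (induction r)
    case 0
    then show ?case by (simp add: ks.kms_zr)
  next
    case (Suc r)
    have "is_complex (ks.slist (replicate r T))" using oT(1) by (intro ks.ob_slist) simp
    then show ?case using Suc ks.kms_sm[OF oT(1), of "ks.slist (replicate r T)"] by simp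
  qed
  then have T'S: "?T' \<in> thick {S}" by (intro thick_kms[OF oS oT']) (use kS K in blast)
  have US: "U \<in> thick {S}" by (rule thick_kms[OF oS oT(2)]) (use kS K in blast)
  have "(alg_cplx :: 'a cplx) \<in> thick {S}" by (rule thick_kernel[OF US T'S alg_cplx_ac(1) U(4,3)])
  then have "silting S" unfolding silting_def using S(2) thick_all by blast
  then show thesis using that[OF S(1) _ bS] kS K by simp
qed

text \<open>The vertices of the simplicial complex: indecomposable two-term presilting
  classes.\<close>

definition Tset :: "'a cplx set set" where "Tset = {c. good {c}}"

lemma finite_Tset:
  assumes "g_finite TYPE('a)" shows "finite Tset"
proof -
  let ?Q = "{T :: 'a cplx. two_term T \<and> silting T \<and> basic T}"
  have fin: "finite (iso_class ` ?Q)" using assms unfolding g_finite_def .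
  \<comment> \<open>The support is an invariant of the isomorphism class, so any representative may
    be chosen; each of the finitely many silting classes thus contributes finitely many
    vertices.\<close>
  define f where "f = (\<lambda>C. set_mset (ks.kms (SOME X :: 'a cplx. X \<in> C)))"
  have f: "f (iso_class S) = set_mset (ks.kms S)" if "is_complex S" for S
  proof -
    have "S \<in> iso_class S" unfolding iso_class_eq ks.cls_def using ks.iso_refl[OF that] by simp
    then have "(SOME X. X \<in> iso_class S) \<in> iso_class S" by (rule someI)
    then have "ks.iso (SOME X. X \<in> iso_class S) S" unfolding iso_class_eq ks.cls_def by simp
    then show ?thesis unfolding f_def using ks.kms_iso by simp
  qed
  have "Tset \<subseteq> \<Union> (f ` (iso_class ` ?Q))"
  proof
    fix c assume "c \<in> Tset"
    then have "good (set_mset {#c#})" unfolding Tset_def by simp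
    then obtain T where T: "two_term T" "presilting T" "ks.kms T = {#c#}" using good_two_term_presilting by blast
    obtain S where S: "two_term S" "silting S" "basic S" "set_mset (ks.kms T) \<subseteq> set_mset (ks.kms S)"
      using good_silting[OF T(1,2)] .
    have oS: "is_complex S" using S(1)[unfolded two_term_def] by simp
    have "c \<in> f (iso_class S)" using f[OF oS] S(4) T(3) by simp
    then show "c \<in> \<Union> (f ` (iso_class ` ?Q))" using S by (intro UN_I[of "iso_class S"] image_eqI[of _ _ S]) simp_all
  qed
  moreover have "finite (\<Union> (f ` (iso_class ` ?Q)))"
    by (rule finite_UN_I[OF fin]) (simp add: f_def)
  ultimately show ?thesis by (rule finite_subset)
qed

end

section \<open>Bounding the number of summands\<close>

text \<open>Morphisms between the projectives cut out by \<open>P\<close> and \<open>Q\<close>, with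
  no condition on degrees.\<close>

definition hq :: "'a::ring fm \<Rightarrow> 'a fm \<Rightarrow> 'a fm set" where
  "hq P Q = {x. Q * x = x \<and> x * P = x}"

lemma hqD: "x \<in> hq P Q \<Longrightarrow> Q * x = x" "x \<in> hq P Q \<Longrightarrow> x * P = x"
  unfolding hq_def by auto

lemma hqI: "Q * x = x \<Longrightarrow> x * P = x \<Longrightarrow> x \<in> hq P Q"
  unfolding hq_def by auto

lemma hq_mult: "y \<in> hq Q R \<Longrightarrow> x \<in> hq P Q \<Longrightarrow> y * x \<in> hq P R"
  unfolding hq_def by (auto simp: mult.assoc) (simp add: mult.assoc[symmetric])

lemma hq_add: "x \<in> hq P Q \<Longrightarrow> y \<in> hq P Q \<Longrightarrow> x + y \<in> hq P Q"
  and hq_diff: "x \<in> hq P Q \<Longrightarrow> y \<in> hq P Q \<Longrightarrow> x - y \<in> hq P Q"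
  and hq_zero: "0 \<in> hq P Q"
  and hq_uminus: "x \<in> hq P Q \<Longrightarrow> - x \<in> hq P Q"
  unfolding hq_def by (auto simp: algebra_simps)

context fdalg
begin

lemma subspace_hq: "vs.subspace (hq P Q)"
  unfolding hq_def
  by (rule vs.subspaceI) (auto simp: distrib_left distrib_right fs_mult_left fs_mult_right)

text \<open>The vanishing of maps from \<open>d1\<close> to the shift of \<open>d2\<close>, for two
  complexes with the same terms \<open>P\<close> and \<open>Q\<close>: \<open>h\<close> and
  \<open>h'\<close> are the two components of the homotopy.\<close>

definition e1d :: "'a fm \<Rightarrow> 'a fm \<Rightarrow> 'a fm \<Rightarrow> 'a fm \<Rightarrow> bool" where
  "e1d P Q d1 d2 \<longleftrightarrow> (\<forall>b\<in>hq P Q. \<exists>h\<in>hq P P. \<exists>h'\<in>hq Q Q. b = h' * d1 + d2 * h)"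

text \<open>Degree zero components of chain maps from \<open>d1 : P \<rightarrow> Q\<close> to \<open>d2 : P \<rightarrow> Q\<close>.\<close>

definition cmaps :: "'a fm \<Rightarrow> 'a fm \<Rightarrow> 'a fm \<Rightarrow> 'a fm \<Rightarrow> 'a fm set" where
  "cmaps P Q d1 d2 = {\<phi>\<in>hq Q Q. \<exists>\<rho>\<in>hq P P. \<phi> * d1 = d2 * \<rho>}"

lemma cmapsD: "\<phi> \<in> cmaps P Q d1 d2 \<Longrightarrow> \<phi> \<in> hq Q Q" "\<phi> \<in> cmaps P Q d1 d2 \<Longrightarrow> \<exists>\<rho>\<in>hq P P. \<phi> * d1 = d2 * \<rho>"
  unfolding cmaps_def by auto

lemma cmaps_mult:
  assumes "\<psi> \<in> cmaps P Q d2 d3" "\<phi> \<in> cmaps P Q d1 d2" shows "\<psi> * \<phi> \<in> cmaps P Q d1 d3"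
proof -
  obtain r where r: "r \<in> hq P P" "\<phi> * d1 = d2 * r" using cmapsD(2)[OF assms(2)] by blast
  obtain s where s: "s \<in> hq P P" "\<psi> * d2 = d3 * s" using cmapsD(2)[OF assms(1)] by blast
  have "\<psi> * \<phi> * d1 = d3 * (s * r)" using r s by (metis mult.assoc)
  then show ?thesis unfolding cmaps_def using hq_mult[OF cmapsD(1)[OF assms(1)] cmapsD(1)[OF assms(2)]] hq_mult[OF s(1) r(1)] by blast
qed

lemma subspace_cmaps: "vs.subspace (cmaps P Q d1 d2)"
proof (rule vs.subspaceI)
  show "0 \<in> cmaps P Q d1 d2" unfolding cmaps_def using hq_zero by (auto intro!: bexI[of _ 0])
next
  fix x y assume "x \<in> cmaps P Q d1 d2" "y \<in> cmaps P Q d1 d2"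
  then obtain r s where "x \<in> hq Q Q" "y \<in> hq Q Q" "r \<in> hq P P" "s \<in> hq P P" "x * d1 = d2 * r" "y * d1 = d2 * s"
    unfolding cmaps_def by blast
  then show "x + y \<in> cmaps P Q d1 d2" unfolding cmaps_def
    by (auto simp: hq_add distrib_right distrib_left intro!: bexI[of _ "r + s"])
next
  fix c x assume "x \<in> cmaps P Q d1 d2"
  then obtain r where r: "x \<in> hq Q Q" "r \<in> hq P P" "x * d1 = d2 * r" unfolding cmaps_def by blast
  have "fs c x \<in> hq Q Q" "fs c r \<in> hq P P" using r vs.subspace_scale[OF subspace_hq] by auto
  then show "fs c x \<in> cmaps P Q d1 d2" unfolding cmaps_def using r
    by (auto simp: fs_mult_left fs_mult_right intro!: bexI[of _ "fs c r"])
qed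

definition prods :: "'a fm set \<Rightarrow> 'a fm set \<Rightarrow> 'a fm set" where
  "prods A B = vs.span {a * b | a b. a \<in> A \<and> b \<in> B}"

text \<open>Scalars are absorbed into the second factor because \<open>B\<close> is a subspace, so
  the induction runs over sums of plain products.\<close>

lemma prods_induct [consumes 1, case_names zero add]:
  assumes "x \<in> prods A B" "R 0" "\<And>a b y. a \<in> A \<Longrightarrow> b \<in> B \<Longrightarrow> R y \<Longrightarrow> R (a * b + y)"
    and B: "vs.subspace B"
  shows "R x"
  using assms(1) unfolding prods_def
proof (induction rule: vs.span_induct_alt)
  case base
  then show ?case by (rule assms(2))
next
  case (step c x y)
  then obtain a b where ab: "x = a * b" "a \<in> A" "b \<in> B" by blast
  have "fs c x = a * fs c b" using ab(1) by (simp add: fs_mult_right)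
  then show ?case using assms(3)[OF ab(2) vs.subspace_scale[OF B ab(3)] step(2)] by simp
qed

lemma prodsI: "a \<in> A \<Longrightarrow> b \<in> B \<Longrightarrow> a * b \<in> prods A B"
  unfolding prods_def by (rule vs.span_base) blast

lemma prods_zero: "0 \<in> prods A B" and prods_add: "x \<in> prods A B \<Longrightarrow> y \<in> prods A B \<Longrightarrow> x + y \<in> prods A B"
  unfolding prods_def by (auto simp: vs.span_zero vs.span_add)

lemma prods_sub:
  assumes "x \<in> prods A B" "vs.subspace B" "vs.subspace V" "\<And>a b. a \<in> A \<Longrightarrow> b \<in> B \<Longrightarrow> a * b \<in> V"
  shows "x \<in> V"
  using assms(1)
  by (induction rule: prods_induct) (auto intro: assms vs.subspace_0 vs.subspace_add)

text \<open>Right multiplication by \<open>d\<close> and by \<open>d'\<close> induces maps from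
  End(\<open>Q\<close>) modulo \<open>W1\<close> to Hom(\<open>P\<close>, \<open>Q\<close>) modulo
  \<open>W2\<close>. The first is onto by the vanishing for \<open>d\<close> with itself. The second
  is injective: by the vanishing for \<open>d'\<close> with itself, an \<open>x\<close> with
  \<open>x * d'\<close> in \<open>W2\<close> differs from an element of \<open>W1\<close> by a chain
  map from \<open>d'\<close> to \<open>d\<close>. By dimensions the first is injective too, and
  \<open>Q * d = d * P\<close> lies in \<open>W2\<close>.\<close>

lemma unit_in_trace:
  assumes P: "P * P = P" and Q: "Q * Q = Q" and d: "d \<in> hq P Q" "d' \<in> hq P Q"
    and e: "e1d P Q d d" "e1d P Q d' d'" "e1d P Q d' d"
  shows "\<exists>c\<in>hq Q P. \<exists>x\<in>prods (cmaps P Q d' d) (hq Q Q). Q = d * c + x"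
proof -
  let ?J = "cmaps P Q d' d"
  \<comment> \<open>Morphisms into \<open>Q\<close> whose class in the cokernel of \<open>d\<close>
    lies in the part generated by chain maps from \<open>d'\<close> to \<open>d\<close>;
    \<open>W2\<close> is the same with source \<open>P\<close>.\<close>
  define W1 where "W1 = {d * c + x | c x. c \<in> hq Q P \<and> x \<in> prods ?J (hq Q Q)}"
  define W2 where "W2 = {d * r + x | r x. r \<in> hq P P \<and> x \<in> prods ?J (hq P Q)}"
  have QQ: "Q \<in> hq Q Q" and PP: "P \<in> hq P P" using P Q unfolding hq_def by auto
  have sub: "vs.subspace {d * c + x | c x. c \<in> hq U P \<and> x \<in> prods ?J (hq U Q)}" for U
  proof (rule vs.subspaceI)
    show "0 \<in> {d * c + x | c x. c \<in> hq U P \<and> x \<in> prods ?J (hq U Q)}"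
      using hq_zero prods_zero by force
  next
    fix a b assume "a \<in> {d * c + x | c x. c \<in> hq U P \<and> x \<in> prods ?J (hq U Q)}" "b \<in> {d * c + x | c x. c \<in> hq U P \<and> x \<in> prods ?J (hq U Q)}"
    then obtain c x c' x' where "a = d * c + x" "c \<in> hq U P" "x \<in> prods ?J (hq U Q)" "b = d * c' + x'" "c' \<in> hq U P" "x' \<in> prods ?J (hq U Q)" by blast
    then have "a + b = d * (c + c') + (x + x')" "c + c' \<in> hq U P" "x + x' \<in> prods ?J (hq U Q)"
      by (auto simp: distrib_left hq_add prods_add)
    then show "a + b \<in> {d * c + x | c x. c \<in> hq U P \<and> x \<in> prods ?J (hq U Q)}" by blast
  next
    fix k a assume "a \<in> {d * c + x | c x. c \<in> hq U P \<and> x \<in> prods ?J (hq U Q)}"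
    then obtain c x where "a = d * c + x" "c \<in> hq U P" "x \<in> prods ?J (hq U Q)" by blast
    then have "fs k a = d * fs k c + fs k x" "fs k c \<in> hq U P" "fs k x \<in> prods ?J (hq U Q)"
      using vs.subspace_scale[OF subspace_hq] unfolding prods_def by (auto simp: vs.scale_right_distrib fs_mult_right vs.span_scale)
    then show "fs k a \<in> {d * c + x | c x. c \<in> hq U P \<and> x \<in> prods ?J (hq U Q)}" by blast
  qed
  obtain B where B: "finite B" "{x. Q * x = x \<and> x * Q = x} \<subseteq> vs.span B" using finite_span_corner by blast
  have jm: "x * y \<in> prods ?J (hq P Q)" if "x \<in> prods ?J (hq Q Q)" "y \<in> hq P Q" for x y
    using that(1)
  proof (induction rule: prods_induct)
    case zero
    then show ?case by (simp add: prods_zero)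
  next
    case (add a b z)
    have "(a * b + z) * y = a * (b * y) + z * y" by (simp add: distrib_right mult.assoc)
    then show ?case using prods_add[OF prodsI[OF add(1) hq_mult[OF add(2) that(2)]] add(3)] by simp
  qed (rule subspace_hq)
  have W12: "x * y \<in> W2" if xy: "x \<in> W1" "y \<in> hq P Q" for x y
  proof -
    obtain c z where cz: "x = d * c + z" "c \<in> hq Q P" "z \<in> prods ?J (hq Q Q)" using xy(1) unfolding W1_def by blast
    have "x * y = d * (c * y) + z * y" using cz(1) by (simp add: distrib_right mult.assoc)
    then show ?thesis unfolding W2_def using hq_mult[OF cz(2) xy(2)] jm[OF cz(3) xy(2)] by blast
  qed
  have jb: "\<exists>r\<in>hq P P. \<exists>w\<in>prods ?J (hq Q Q). z = d * r + w * d'" if "z \<in> prods ?J (hq P Q)" for z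
    using that
  proof (induction rule: prods_induct)
    case zero
    then show ?case using hq_zero prods_zero by (intro bexI[of _ 0]) auto
  next
    case (add a b z)
    then obtain r w where rw: "r \<in> hq P P" "w \<in> prods ?J (hq Q Q)" "z = d * r + w * d'" by blast
    obtain h h' where h: "h \<in> hq P P" "h' \<in> hq Q Q" "b = h' * d' + d' * h" using e(2) add(2) unfolding e1d_def by blast
    obtain s where s: "s \<in> hq P P" "a * d' = d * s" using cmapsD(2)[OF add(1)] by blast
    have "a * b = a * h' * d' + a * d' * h" by (simp add: h(3) distrib_left mult.assoc)
    then have "a * b + z = d * (s * h + r) + (a * h' + w) * d'"
      using rw(3) s(2) by (simp add: distrib_left distrib_right mult.assoc add.assoc add.left_commute)
    then show ?case using hq_add[OF hq_mult[OF s(1) h(1)] rw(1)] prods_add[OF prodsI[OF add(1) h(2)] rw(2)] by blast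
  qed (rule subspace_hq)
  have "Q \<in> W1"
  proof (rule vs.quotient_surj_inj[of "hq Q Q" W1 W2 B "\<lambda>x. x * d" "\<lambda>x. x * d'" "hq P Q"])
    show "vs.subspace (hq Q Q)" by (rule subspace_hq)
    show "vs.subspace W1" "vs.subspace W2" unfolding W1_def W2_def by (rule sub)+
    show "W1 \<subseteq> hq Q Q"
    proof
      fix x assume "x \<in> W1"
      then obtain c z where cz: "x = d * c + z" "c \<in> hq Q P" "z \<in> prods ?J (hq Q Q)" unfolding W1_def by blast
      have "z \<in> hq Q Q" by (rule prods_sub[OF cz(3) subspace_hq subspace_hq]) (auto intro: hq_mult cmapsD)
      then show "x \<in> hq Q Q" unfolding cz(1) using hq_add[OF hq_mult[OF d(1) cz(2)]] by blast
    qed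
    show "hq Q Q \<subseteq> vs.span B" "finite B" using B unfolding hq_def by auto
    show "x * d \<in> W2" "x * d' \<in> W2" if "x \<in> W1" for x using W12[OF that] d by auto
    show "x * d \<in> hq P Q" "x * d' \<in> hq P Q" if "x \<in> hq Q Q" for x using hq_mult[OF that] d by auto
    show "\<exists>x\<in>hq Q Q. y - x * d \<in> W2" if y: "y \<in> hq P Q" for y
    proof -
      obtain h h' where h: "h \<in> hq P P" "h' \<in> hq Q Q" "y = h' * d + d * h" using e(1) y unfolding e1d_def by blast
      have "y - h' * d = d * h + 0" using h(3) by simp
      then show ?thesis using h unfolding W2_def using prods_zero by blast
    qed
    show "x \<in> W1" if x: "x \<in> hq Q Q" "x * d' \<in> W2" for x
    proof -
      obtain r z where rz: "x * d' = d * r + z" "r \<in> hq P P" "z \<in> prods ?J (hq P Q)" using x(2) unfolding W2_def by blast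
      obtain s w where sw: "s \<in> hq P P" "w \<in> prods ?J (hq Q Q)" "z = d * s + w * d'" using jb[OF rz(3)] by blast
      have wQ: "w \<in> hq Q Q" by (rule prods_sub[OF sw(2) subspace_hq subspace_hq]) (auto intro: hq_mult cmapsD)
      have "(x - w) * d' = d * (r + s)" using rz(1) sw(3) by (simp add: left_diff_distrib distrib_left)
      then have xw: "x - w \<in> ?J" unfolding cmaps_def using hq_diff[OF x(1) wQ] hq_add[OF rz(2) sw(1)] by blast
      have "(x - w) * Q = x - w" using hqD(2)[OF cmapsD(1)[OF xw]] .
      then have "x = d * 0 + ((x - w) * Q + w)" by simp
      moreover have "(x - w) * Q + w \<in> prods ?J (hq Q Q)" by (rule prods_add[OF prodsI[OF xw QQ] sw(2)])
      ultimately show ?thesis unfolding W1_def using hq_zero by blast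
    qed
    show "Q \<in> hq Q Q" by (rule QQ)
    have "Q * d = d * P + 0" using hqD[OF d(1)] by simp
    then show "Q * d \<in> W2" unfolding W2_def using PP prods_zero by blast
  qed (simp_all add: distrib_right fs_mult_left)
  then show ?thesis unfolding W1_def by blast
qed

text \<open>Nakayama's lemma: the cokernel of \<open>d\<close> is generated by its image under the ideal of
  endomorphisms factoring through the other complex, which lies in the radical.\<close>

lemma nakayama_split:
  assumes P: "P * P = P" and Q: "Q * Q = Q" and d: "d \<in> hq P Q" "d' \<in> hq P Q"
    and e: "e1d P Q d d" "e1d P Q d' d'" "e1d P Q d' d" "e1d P Q d d'"
    and inv: "\<And>a. a \<in> prods (cmaps P Q d' d) (cmaps P Q d d') \<Longrightarrow> \<exists>v\<in>cmaps P Q d d. \<exists>c\<in>hq Q P. v * (Q - a) - Q = d * c"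
  shows "\<exists>c\<in>hq Q P. Q = d * c"
proof -
  let ?J = "cmaps P Q d' d" and ?J' = "cmaps P Q d d'" and ?Z = "cmaps P Q d d"
  have QQ: "Q \<in> hq Q Q" using Q unfolding hq_def by auto
  \<comment> \<open>The trace decomposition is used twice, for \<open>d\<close> and then, inside the
    trace part, for \<open>d'\<close>. A chain map from \<open>d'\<close> to \<open>d\<close>
    carries multiples of \<open>d'\<close> to multiples of \<open>d\<close>, so only products of
    maps to and from \<open>d'\<close> remain.\<close>
  have dec: "\<exists>c\<in>hq Q P. \<exists>x\<in>prods (prods ?J ?J') (hq Q Q). s = d * c + x" if s: "s \<in> hq Q Q" for s
  proof -
    obtain c x where cx: "c \<in> hq Q P" "x \<in> prods ?J (hq Q Q)" "Q = d * c + x"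
      using unit_in_trace[OF P Q d e(1,2,3)] by blast
    obtain c' x' where cx': "c' \<in> hq Q P" "x' \<in> prods ?J' (hq Q Q)" "Q = d' * c' + x'"
      using unit_in_trace[OF P Q d(2,1) e(2,1,4)] by blast
    have a: "a * b \<in> prods (prods ?J ?J') (hq Q Q)" if "a \<in> ?J" "b \<in> prods ?J' (hq Q Q)" for a b
      using that(2)
    proof (induction rule: prods_induct)
      case zero
      then show ?case by (simp add: prods_zero)
    next
      case (add p q y)
      have "a * (p * q + y) = (a * p) * q + a * y" by (simp add: distrib_left mult.assoc)
      then show ?case using prods_add[OF prodsI[OF prodsI[OF that(1) add(1)] add(2)] add(3)] by simp
    qed (rule subspace_hq)
    have r: "x * t \<in> prods ?J' (hq Q Q)" if "x \<in> prods ?J' (hq Q Q)" "t \<in> hq Q Q" for x t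
      using that(1)
    proof (induction rule: prods_induct)
      case zero
      then show ?case by (simp add: prods_zero)
    next
      case (add p q y)
      have "(p * q + y) * t = p * (q * t) + y * t" by (simp add: distrib_right mult.assoc)
      then show ?case using prods_add[OF prodsI[OF add(1) hq_mult[OF add(2) that(2)]] add(3)] by simp
    qed (rule subspace_hq)
    have j: "\<exists>c\<in>hq Q P. \<exists>y\<in>prods (prods ?J ?J') (hq Q Q). x * t = d * c + y" if "x \<in> prods ?J (hq Q Q)" "t \<in> hq Q Q" for x t
      using that(1)
    proof (induction rule: prods_induct)
      case zero
      then show ?case using hq_zero prods_zero by (intro bexI[of _ 0]) auto
    next
      case (add p q y)
      then obtain c0 y0 where 0: "c0 \<in> hq Q P" "y0 \<in> prods (prods ?J ?J') (hq Q Q)" "y * t = d * c0 + y0" by blast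
      obtain \<rho> where rho: "\<rho> \<in> hq P P" "p * d' = d * \<rho>" using cmapsD(2)[OF add(1)] by blast
      have qt: "q * t \<in> hq Q Q" using hq_mult[OF add(2) that(2)] .
      have "p * (q * t) = p * (Q * (q * t))" using hqD(1)[OF qt] by simp
      also have "\<dots> = p * ((d' * c' + x') * (q * t))" using cx'(3) by simp
      also have "\<dots> = d * (\<rho> * (c' * (q * t))) + p * (x' * (q * t))"
        using rho(2) by (simp add: distrib_left distrib_right mult.assoc[symmetric])
      finally have "(p * q + y) * t = d * (\<rho> * (c' * (q * t)) + c0) + (p * (x' * (q * t)) + y0)"
        using 0(3) by (simp add: distrib_left distrib_right mult.assoc add.assoc add.left_commute)
      moreover have "\<rho> * (c' * (q * t)) + c0 \<in> hq Q P" using hq_add[OF hq_mult[OF rho(1) hq_mult[OF cx'(1) qt]] 0(1)] .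
      moreover have "p * (x' * (q * t)) + y0 \<in> prods (prods ?J ?J') (hq Q Q)"
        using prods_add[OF a[OF add(1) r[OF cx'(2) qt]] 0(2)] .
      ultimately show ?case by blast
    qed (rule subspace_hq)
    obtain c1 y1 where 1: "c1 \<in> hq Q P" "y1 \<in> prods (prods ?J ?J') (hq Q Q)" "x * s = d * c1 + y1" using j[OF cx(2) s] by blast
    have "s = (d * c + x) * s" using cx(3) hqD(1)[OF s] by simp
    also have "\<dots> = d * (c * s + c1) + y1" using 1(3) by (simp add: distrib_left distrib_right mult.assoc add.assoc)
    finally have "s = d * (c * s + c1) + y1" .
    then show ?thesis using hq_add[OF hq_mult[OF cx(1) s] 1(1)] 1(2) by blast
  qed
  have IZ: "a \<in> ?Z" if "a \<in> prods ?J ?J'" for a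
    by (rule prods_sub[OF that subspace_cmaps subspace_cmaps]) (rule cmaps_mult)
  have IZZ: "a * z \<in> prods ?J ?J'" if "a \<in> prods ?J ?J'" "z \<in> ?Z" for a z
    using that(1)
  proof (induction rule: prods_induct)
    case zero
    then show ?case by (simp add: prods_zero)
  next
    case (add p q y)
    have "(p * q + y) * z = p * (q * z) + y * z" by (simp add: distrib_right mult.assoc)
    then show ?case using prods_add[OF prodsI[OF add(1) cmaps_mult[OF add(2) that(2)]] add(3)] by simp
  qed (rule subspace_cmaps)
  \<comment> \<open>\<open>M L\<close> is the submodule of End(\<open>Q\<close>) generated by the
    elements of \<open>L\<close> over the ring \<open>?Z\<close> of chain endomorphisms, together
    with the multiples of \<open>d\<close>. \<open>M []\<close> being everything is the
    claim.\<close>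
  define M where "M = (\<lambda>L. rec_list {d * c | c. c \<in> hq Q P} (\<lambda>s L M. {m + z * s | m z. m \<in> M \<and> z \<in> ?Z}) L)"
  have M0: "M [] = {d * c | c. c \<in> hq Q P}" and MS: "M (s # L) = {m + z * s | m z. m \<in> M L \<and> z \<in> ?Z}" for s L
    by (simp_all add: M_def)
  have Madd: "x + y \<in> M L" if "x \<in> M L" "y \<in> M L" for x y L
    using that
  proof (induction L arbitrary: x y)
    case Nil
    then obtain a b where "x = d * a" "y = d * b" "a \<in> hq Q P" "b \<in> hq Q P" unfolding M0 by blast
    then have "x + y = d * (a + b)" "a + b \<in> hq Q P" by (auto simp: distrib_left hq_add)
    then show ?case unfolding M0 by blast
  next
    case (Cons s L)
    then obtain m z m' z' where "x = m + z * s" "y = m' + z' * s" "m \<in> M L" "m' \<in> M L" "z \<in> ?Z" "z' \<in> ?Z" unfolding MS by blast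
    then have "x + y = (m + m') + (z + z') * s" "m + m' \<in> M L" "z + z' \<in> ?Z"
      using Cons.IH vs.subspace_add[OF subspace_cmaps] by (auto simp: distrib_right algebra_simps)
    then show ?case unfolding MS by blast
  qed
  have MZ: "z * x \<in> M L" if zx: "z \<in> ?Z" "x \<in> M L" for z x L
    using zx(2)
  proof (induction L arbitrary: x)
    case Nil
    then obtain a where a: "x = d * a" "a \<in> hq Q P" unfolding M0 by blast
    obtain r where r: "r \<in> hq P P" "z * d = d * r" using cmapsD(2)[OF zx(1)] by blast
    have "z * x = d * (r * a)" using a(1) r(2) by (simp add: mult.assoc[symmetric])
    then show ?case unfolding M0 using hq_mult[OF r(1) a(2)] by blast
  next
    case (Cons s L)
    then obtain m y where m: "x = m + y * s" "m \<in> M L" "y \<in> ?Z" unfolding MS by blast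
    have "z * x = z * m + (z * y) * s" using m(1) by (simp add: distrib_left mult.assoc)
    then show ?case unfolding MS using Cons.IH[OF m(2)] cmaps_mult[OF zx(1) m(3)] by blast
  qed
  have Z0: "0 \<in> ?Z" by (rule vs.subspace_0[OF subspace_cmaps])
  have Md: "d * c \<in> M L" if "c \<in> hq Q P" for c L
  proof (induction L)
    case Nil
    then show ?case unfolding M0 using that by blast
  next
    case (Cons s L)
    have "d * c = d * c + 0 * s" by simp
    then show ?case unfolding MS using Cons Z0 by blast
  qed
  have M00: "0 \<in> M L" for L using Md[OF hq_zero, of L] by simp
  have step: "hq Q Q \<subseteq> M L" if V: "hq Q Q \<subseteq> M (s # L)" and s: "s \<in> hq Q Q" for s L
  proof -
    have I: "\<exists>m\<in>M L. \<exists>a\<in>prods ?J ?J'. y = m + a * s" if "y \<in> prods (prods ?J ?J') (hq Q Q)" for y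
      using that
    proof (induction rule: prods_induct)
      case zero
      then show ?case using M00[of L] prods_zero[of ?J ?J'] by (intro bexI[of _ 0]) auto
    next
      case (add p q y)
      then obtain m a where ma: "m \<in> M L" "a \<in> prods ?J ?J'" "y = m + a * s" by blast
      obtain m' z where mz: "m' \<in> M L" "z \<in> ?Z" "q = m' + z * s" using V add(2) unfolding MS by blast
      have "p * q + y = (p * m' + m) + (p * z + a) * s"
        unfolding ma(3) mz(3) by (simp add: distrib_left distrib_right mult.assoc add.assoc add.left_commute)
      then show ?case using Madd[OF MZ[OF IZ[OF add(1)] mz(1)] ma(1)] prods_add[OF IZZ[OF add(1) mz(2)] ma(2)] by blast
    qed (rule subspace_hq)
    obtain c y where cy: "c \<in> hq Q P" "y \<in> prods (prods ?J ?J') (hq Q Q)" "s = d * c + y" using dec[OF s] by blast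
    obtain m a where ma: "m \<in> M L" "a \<in> prods ?J ?J'" "y = m + a * s" using I[OF cy(2)] by blast
    define m1 where "m1 = d * c + m"
    have m1: "m1 \<in> M L" unfolding m1_def by (rule Madd[OF Md[OF cy(1)] ma(1)])
    have sm: "s = m1 + a * s" using cy(3) ma(3) unfolding m1_def by (simp add: add.assoc)
    obtain v k where vk: "v \<in> ?Z" "k \<in> hq Q P" "v * (Q - a) - Q = d * k" using inv[OF ma(2)] by blast
    have "(Q - a) * s = m1" using sm hqD(1)[OF s] by (metis add_diff_cancel_right' left_diff_distrib)
    then have "v * m1 = (v * (Q - a)) * s" by (simp add: mult.assoc)
    also have "v * (Q - a) = d * k + Q" using vk(3) by (metis diff_add_cancel)
    finally have "s = v * m1 + d * (- (k * s))" using hqD(1)[OF s] by (simp add: distrib_right mult.assoc)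
    then have sM: "s \<in> M L" using Madd[OF MZ[OF vk(1) m1] Md[OF hq_uminus[OF hq_mult[OF vk(2) s]]]] by metis
    show ?thesis
    proof
      fix x assume "x \<in> hq Q Q"
      then obtain m z where "m \<in> M L" "z \<in> ?Z" "x = m + z * s" using V unfolding MS by blast
      then show "x \<in> M L" using Madd[OF _ MZ[OF _ sM]] by metis
    qed
  qed
  have down: "set L \<subseteq> hq Q Q \<Longrightarrow> hq Q Q \<subseteq> M L \<Longrightarrow> hq Q Q \<subseteq> M []" for L
  proof (induction L)
    case (Cons s L)
    then show ?case using step[of s L] by auto
  qed simp
  obtain B where B: "finite B" "{x. Q * x = x \<and> x * Q = x} \<subseteq> vs.span B" using finite_span_corner by blast
  have "hq Q Q \<subseteq> vs.span B" using B(2) unfolding hq_def by blast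
  obtain C where C: "C \<subseteq> hq Q Q" "vs.independent C" "hq Q Q \<subseteq> vs.span C" by (rule vs.basis_exists[of "hq Q Q"])
  have "finite C" using vs.independent_span_bound[OF B(1) C(2)] C(1) \<open>hq Q Q \<subseteq> vs.span B\<close> by blast
  then obtain L where L: "set L = C" using finite_list by blast
  \<comment> \<open>The unit lies in \<open>?Z\<close>, so scalars do too, and a vector space basis
    of End(\<open>Q\<close>) serves as the initial finite list of generators.\<close>
  have QZ: "Q \<in> ?Z" unfolding cmaps_def using hqD[OF d(1)] QQ P by (auto intro!: bexI[of _ P] hqI)
  have single: "fs k x \<in> M L'" if "x \<in> set L'" "x \<in> hq Q Q" for x k L'
    using that(1)
  proof (induction L')
    case (Cons s L')
    show ?case
    proof (cases "x = s")
      case True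
      have "fs k s = 0 + fs k Q * s" using hqD(1)[OF that(2)] True by (simp add: fs_mult_left)
      then show ?thesis unfolding MS using True M00[of L'] vs.subspace_scale[OF subspace_cmaps QZ, of k] by blast
    next
      case False
      then have "fs k x \<in> M L'" using Cons by simp
      moreover have "fs k x = fs k x + 0 * s" by simp
      ultimately show ?thesis unfolding MS using Z0 by blast
    qed
  qed simp
  have "x \<in> M L" if "x \<in> vs.span C" for x
    using that
  proof (induction rule: vs.span_induct_alt)
    case base
    then show ?case by (rule M00)
  next
    case (step c x y)
    have "x \<in> set L" "x \<in> hq Q Q" using step(1) L C(1) by auto
    from Madd[OF single[OF this] step(2)] show ?case .
  qed
  then have "hq Q Q \<subseteq> M L" using C(3) by blast
  then have "hq Q Q \<subseteq> M []" using down[of L] C(1) L by simp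
  then have "Q \<in> M []" using QQ by (rule subsetD)
  then show ?thesis unfolding M0 by blast
qed

end

section \<open>Endomorphisms factoring through an object without common summands\<close>

context ks_cat
begin

lemma bip_kms: "bip B Y Z i1 i2 p1 p2 \<Longrightarrow> kms B = kms Y + kms Z"
  using kms_iso[OF bip_imp_iso] kms_sm[OF bipD(2,3)] by metis

lemma retract_kms:
  assumes "f \<in> H Y W" "g \<in> H W Y" "g * f - un Y \<in> N Y Y" "ob Y" "ob W"
  shows "kms Y \<subseteq># kms W"
proof -
  obtain W' i p where "bip W Y W' f i g p" by (rule split_retract[OF assms])
  then show ?thesis using bip_kms by simp
qed

text \<open>The idempotent that \<open>exchange\<close> attaches to \<open>F * G\<close> splits off
  an object \<open>Y\<close> which is a retract of both \<open>X\<close> and \<open>W\<close>.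
  Having no common summands forces \<open>Y\<close> to be zero, so \<open>un X - F * G\<close> is
  invertible.\<close>

lemma disjoint_inverse:
  assumes X: "ob X" and W: "ob W" and dis: "set_mset (kms X) \<inter> set_mset (kms W) = {}"
    and F: "F \<in> H W X" and G: "G \<in> H X W"
  shows "\<exists>v\<in>H X X. v * (un X - F * G) - un X \<in> N X X"
proof -
  have a: "F * G \<in> H X X" using H_mult[OF F G] .
  obtain e u v where e: "e \<in> H X X" "u \<in> H X X" "v \<in> H X X" "e * e - e \<in> N X X"
    "F * G * u - e \<in> N X X" "v * (un X - F * G) - (un X - e) \<in> N X X"
    using exchange[OF X a] by blast
  obtain Y Z i1 i2 p1 p2 where s: "ob Y" "ob Z" "i1 \<in> H Y X" "p1 \<in> H X Y" "p1 * i1 = un Y"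
    "i1 * p1 - e \<in> N X X"
    using splitting[OF X e(1,4)] by blast
  have 1: "kms Y \<subseteq># kms X" using retract_kms[OF s(3,4) _ s(1) X] s(5) N_zero by simp
  have "p1 * (F * G * u - e) * i1 - p1 * (i1 * p1 - e) * i1 \<in> N Y Y"
    by (intro N_diff N_mid[OF e(5) s(4,3)] N_mid[OF s(6) s(4,3)])
  moreover have "p1 * (F * G * u - e) * i1 - p1 * (i1 * p1 - e) * i1 = (p1 * F) * (G * u * i1) - (p1 * i1) * (p1 * i1)"
    by (simp add: algebra_simps)
  moreover have "(p1 * i1) * (p1 * i1) = un Y" using s(5) un_left[OF un_H[OF s(1)]] by simp
  ultimately have "(p1 * F) * (G * u * i1) - un Y \<in> N Y Y" by simp
  then have 2: "kms Y \<subseteq># kms W"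
    using retract_kms[OF H_mult[OF H_mult[OF G e(2)] s(3)] H_mult[OF s(4) F] _ s(1) W] by simp
  have "kms Y = {#}"
  proof (rule ccontr)
    assume "kms Y \<noteq> {#}"
    then obtain c where "c \<in># kms Y" by auto
    then show False using mset_subset_eqD[OF 1] mset_subset_eqD[OF 2] dis by blast
  qed
  then have "un Y \<in> N Y Y" using kms_empty_iff[OF s(1)] iso_zr_iff[OF s(1)] by simp
  from zero_factor[OF this s(3,4)] have "e \<in> N X X" using N_cong[OF N_sym[OF s(6)]] by simp
  then have "v * (un X - F * G) - (un X - e) - e \<in> N X X" by (rule N_diff[OF e(6)])
  then show ?thesis using e(3) by (intro bexI[of _ v]) (simp_all add: algebra_simps)
qed

end

section \<open>Two-term complexes as maps between projectives\<close>

definition blk :: "int \<Rightarrow> int \<Rightarrow> 'a::zero fm \<Rightarrow> bool" where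
  "blk s t x \<longleftrightarrow> (\<forall>i a j b. ent x (Ix i a) (Ix j b) \<noteq> 0 \<longrightarrow> i = s \<and> j = t)"

lemma blk_dg: "blk s t x \<Longrightarrow> dg (s - t) x"
  unfolding blk_def dg_def by force

lemma blk_mult: "blk s t x \<Longrightarrow> blk t' r y \<Longrightarrow> blk s r (x * y :: 'a::ring fm)"
  unfolding blk_def using ent_mult_nonzero by (metis idx.exhaust)

lemma blk_mult_zero: "blk s t x \<Longrightarrow> blk t' r y \<Longrightarrow> t \<noteq> t' \<Longrightarrow> x * y = (0 :: 'a::ring fm)"
  by (rule fm_eqI) (metis blk_def ent_mult_nonzero ent_zero idx.exhaust)

lemma blk_corner: "blk s s p \<Longrightarrow> blk t t q \<Longrightarrow> p * x = x \<Longrightarrow> x * q = x \<Longrightarrow> blk s t (x :: 'a::ring fm)"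
  unfolding blk_def by (metis ent_mult_nonzero idx.exhaust)

lemma blk_dg_zero:
  assumes "blk s s p" "blk t t q" "dg k f" "s \<noteq> t + k"
  shows "p * f * q = (0 :: 'a::ring fm)"
proof (rule fm_eqI, rule ccontr)
  fix u v assume "ent (p * f * q) u v \<noteq> ent 0 u v"
  then obtain w where w: "ent (p * f) u w \<noteq> 0" "ent q w v \<noteq> 0" using ent_mult_nonzero[of "p * f" q u v] by auto
  then obtain w' where w': "ent p u w' \<noteq> 0" "ent f w' w \<noteq> 0" using ent_mult_nonzero[of p f u w] by auto
  obtain i a j b i' a' j' b' where "w = Ix i a" "w' = Ix j b" "u = Ix i' a'" "v = Ix j' b'" by (metis idx.exhaust)
  then have "i = t" "j = s" "j = i + k" using w w' assms(1-3) unfolding blk_def dg_def by blast+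
  then show False using assms(4) by simp
qed

text \<open>\<open>P\<close> is a projective in degree -1 and \<open>Q\<close> one in degree 0; each
  \<open>d\<close> in \<open>hq P Q\<close> then makes \<open>(P + Q, d)\<close> a two-term
  complex.\<close>

definition tb :: "'a::ring fm \<Rightarrow> 'a fm \<Rightarrow> bool" where
  "tb P Q \<longleftrightarrow> blk (-1) (-1) P \<and> blk 0 0 Q \<and> P * P = P \<and> Q * Q = Q"

lemma tbD:
  assumes "tb P Q"
  shows "blk (-1) (-1) P" "blk 0 0 Q" "P * P = P" "Q * Q = Q" "P * Q = 0" "Q * P = 0"
proof -
  show 1: "blk (-1) (-1) P" "blk 0 0 Q" "P * P = P" "Q * Q = Q" using assms unfolding tb_def by auto
  show "P * Q = 0" "Q * P = 0" using blk_mult_zero[OF 1(1,2)] blk_mult_zero[OF 1(2,1)] by auto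
qed

lemma hq_orth:
  assumes "x \<in> hq Q R" "y \<in> hq A B" "Q * B = 0" shows "x * y = (0 :: 'a::ring fm)"
proof -
  have "x * y = (x * Q) * (B * y)" using hqD(2)[OF assms(1)] hqD(1)[OF assms(2)] by simp
  also have "\<dots> = x * (Q * B) * y" by (simp add: mult.assoc)
  finally show ?thesis using assms(3) by simp
qed

lemma tb_zero:
  assumes "tb P Q" "x \<in> hq P Q"
  shows "P * x = 0" "x * Q = 0"
proof -
  have "P * x = (P * Q) * x" "x * Q = x * (P * Q)" using hqD[OF assms(2)] by (simp_all add: mult.assoc) (simp add: mult.assoc[symmetric])
  then show "P * x = 0" "x * Q = 0" using tbD(5)[OF assms(1)] by simp_all
qed

lemma tb_acx:
  assumes t: "tb P Q" and d: "d \<in> hq P Q" shows "acx (P + Q, d :: 'a::ring fm)"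
proof -
  note tD = tbD[OF t] and z = tb_zero[OF t d] and h = hqD[OF d]
  have "dg 0 (P + Q)" using blk_dg[OF tD(1)] blk_dg[OF tD(2)] by (simp add: dg_add)
  moreover have "dg 1 d" using blk_dg[OF blk_corner[OF tD(2,1) h]] by simp
  moreover have "d * d = (d * P) * (Q * d)" using h by simp
  moreover have "(d * P) * (Q * d) = d * (P * Q) * d" by (simp add: mult.assoc)
  ultimately show ?thesis unfolding acx_def using tD z h by (simp add: distrib_left distrib_right)
qed

text \<open>For reasons of degree a map of degree 0 is block diagonal: its components are a map on
  \<open>P\<close> and a map on \<open>Q\<close>.\<close>

lemma tb_hm0:
  assumes t: "tb P Q" and f: "f \<in> hm 0 (P + Q, d) (P + Q, d' :: 'a::ring fm)"
  shows "P * f * Q = 0" "Q * f * P = 0" "f = P * f * P + Q * f * Q"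
    "P * f = P * f * P" "Q * f = Q * f * Q" "f * P = P * f * P" "f * Q = Q * f * Q"
proof -
  note tD = tbD[OF t] and h = hmD[OF f, simplified]
  show z: "P * f * Q = 0" "Q * f * P = 0" using blk_dg_zero[OF tD(1,2) h(1)] blk_dg_zero[OF tD(2,1) h(1)] by simp_all
  have 1: "f = (P + Q) * f * (P + Q)" using h(2,3) by simp
  show 2: "f = P * f * P + Q * f * Q" by (subst 1) (simp add: distrib_left distrib_right z del: h(2,3))
  show "P * f = P * f * P" "Q * f = Q * f * Q"
    by (subst 2, simp add: distrib_left mult.assoc[symmetric] tD)+
  show "f * P = P * f * P" "f * Q = Q * f * Q"
    by (subst 2, simp add: distrib_right mult.assoc tD)+
qed

lemma tb_hm1:
  assumes t: "tb P Q" and f: "f \<in> hm (-1) (P + Q, d) (P + Q, d' :: 'a::ring fm)"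
  shows "f \<in> hq Q P"
proof -
  note tD = tbD[OF t] and h = hmD[OF f, simplified]
  have z: "P * f * P = 0" "Q * f * P = 0" "Q * f * Q = 0"
    using blk_dg_zero[OF tD(1,1) h(1)] blk_dg_zero[OF tD(2,1) h(1)] blk_dg_zero[OF tD(2,2) h(1)] by simp_all
  have 1: "f = (P + Q) * f * (P + Q)" using h(2,3) by simp
  have 2: "f = P * f * Q" by (subst 1) (simp add: distrib_left distrib_right z del: h(2,3))
  have "P * (P * f * Q) = P * f * Q" "P * f * Q * Q = P * f * Q"
    by (simp_all add: mult.assoc tD(4)) (simp add: mult.assoc[symmetric] tD(3))
  then show ?thesis using 2 by (intro hqI) simp_all
qed

context fdalg
begin

lemma cmaps_Zc:
  assumes t: "tb P Q" and d: "d \<in> hq P Q" "d' \<in> hq P Q" and p: "\<phi> \<in> hq Q Q" "\<rho> \<in> hq P P" "\<phi> * d = d' * \<rho>"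
  shows "\<phi> + \<rho> \<in> Zc 0 (P + Q, d) (P + Q, d')"
proof -
  note tD = tbD[OF t]
  have "blk 0 0 \<phi>" "blk (-1) (-1) \<rho>" using blk_corner[OF tD(2,2) hqD[OF p(1)]] blk_corner[OF tD(1,1) hqD[OF p(2)]] .
  then have g: "dg 0 (\<phi> + \<rho>)" using blk_dg[of 0 0 \<phi>] blk_dg[of "-1" "-1" \<rho>] by (simp add: dg_add)
  have z: "P * \<phi> = 0" "\<phi> * P = 0" "Q * \<rho> = 0" "\<rho> * Q = 0" "d' * \<phi> = 0" "\<rho> * d = 0"
    using hqD[OF p(1)] hqD[OF p(2)] hqD[OF d(1)] hqD[OF d(2)] tD(5,6) mult.assoc[of P Q \<phi>] mult.assoc[of \<phi> Q P]
      mult.assoc[of Q P \<rho>] mult.assoc[of \<rho> P Q] mult.assoc[of d' Q \<phi>] mult.assoc[of \<rho> Q d] tb_zero[OF t d(1)] tb_zero[OF t d(2)]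
    by (metis mult_zero_left mult_zero_right)+
  show ?thesis unfolding Zc_def hm_def sg_def
    using g z hqD[OF p(1)] hqD[OF p(2)] p(3) by (simp add: distrib_left distrib_right)
qed

lemma Zc_cmaps:
  assumes t: "tb P Q" and d: "d \<in> hq P Q" "d' \<in> hq P Q" and f: "f \<in> Zc 0 (P + Q, d) (P + Q, d')"
  shows "Q * f * Q \<in> cmaps P Q d d'"
proof -
  note tD = tbD[OF t] and h = tb_hm0[OF t ZcD(1)[OF f]]
  have c: "d' * f = f * d" using ZcD(2)[OF f] by (simp add: sg_def)
  have "Q * f * Q * d = Q * (f * d)" using h(5) by (simp add: mult.assoc[symmetric])
  also have "\<dots> = d' * (P * f)" using c hqD(1)[OF d(2)] hqD(2)[OF d(2)] by (metis mult.assoc)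
  finally have "Q * f * Q * d = d' * (P * f * P)" using h(4) by simp
  moreover have "Q * f * Q \<in> hq Q Q" "P * f * P \<in> hq P P"
    by (rule hqI; simp add: mult.assoc tD; simp add: mult.assoc[symmetric] tD)+
  ultimately show ?thesis unfolding cmaps_def by blast
qed

text \<open>A sum of composites through \<open>Y\<close> is a single composite through a direct sum
  of copies of \<open>Y\<close>, assembled as a row and a column. \<open>\<rho>\<close> is the
  component in degree -1, about which the sum of products says nothing.\<close>

lemma cmaps_prods_lift:
  assumes t: "tb P Q" and d: "d \<in> hq P Q" "d' \<in> hq P Q"
    and X: "is_complex X" "ac X = (P + Q, d)" and Y: "is_complex Y" "ac Y = (P + Q, d')"
    and a: "a \<in> prods (cmaps P Q d' d) (cmaps P Q d d')"
  shows "\<exists>\<rho>\<in>hq P P. \<exists>W. is_complex W \<and> set_mset (ks.kms W) \<subseteq> set_mset (ks.kms Y) \<and>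
    (\<exists>F\<in>Zc 0 (ac W) (ac X). \<exists>G\<in>Zc 0 (ac X) (ac W). F * G = a + \<rho>)"
  using a
proof (induction rule: prods_induct)
  case zero
  have "0 \<in> Zc 0 (ac (zero_cplx :: 'a cplx)) (ac X)" "0 \<in> Zc 0 (ac X) (ac (zero_cplx :: 'a cplx))" "0 * 0 = 0 + (0 :: 'a fm)" by simp_all
  moreover have "set_mset (ks.kms zero_cplx) \<subseteq> set_mset (ks.kms Y)" unfolding ks.kms_zr by simp
  ultimately show ?case using ks.ob_zr hq_zero[of P P] by blast
next
  case (add p q y)
  obtain \<rho> W F G where IH: "\<rho> \<in> hq P P" "is_complex W" "set_mset (ks.kms W) \<subseteq> set_mset (ks.kms Y)"
    "F \<in> Zc 0 (ac W) (ac X)" "G \<in> Zc 0 (ac X) (ac W)" "F * G = y + \<rho>" using add(3) by blast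
  obtain r where r: "r \<in> hq P P" "p * d' = d * r" using cmapsD(2)[OF add(1)] by blast
  obtain r' where r': "r' \<in> hq P P" "q * d = d' * r'" using cmapsD(2)[OF add(2)] by blast
  have p: "p \<in> hq Q Q" "q \<in> hq Q Q" using cmapsD(1)[OF add(1)] cmapsD(1)[OF add(2)] .
  have f: "p + r \<in> Zc 0 (ac Y) (ac X)" unfolding X Y by (rule cmaps_Zc[OF t d(2,1) p(1) r])
  have g: "q + r' \<in> Zc 0 (ac X) (ac Y)" unfolding X Y by (rule cmaps_Zc[OF t d p(2) r'])
  have z: "p * r' = 0" "r * q = 0"
    using hq_orth[OF p(1) r'(1) tbD(6)[OF t]] hq_orth[OF r(1) p(2) tbD(5)[OF t]] .
  have fg: "(p + r) * (q + r') = p * q + r * r'" by (simp add: distrib_left distrib_right z)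
  obtain i1 i2 p1 p2 where b: "i1 \<in> Zc 0 (ac Y) (ac (Y \<oplus>\<^sub>K W))" "i2 \<in> Zc 0 (ac W) (ac (Y \<oplus>\<^sub>K W))"
    "p1 \<in> Zc 0 (ac (Y \<oplus>\<^sub>K W)) (ac Y)" "p2 \<in> Zc 0 (ac (Y \<oplus>\<^sub>K W)) (ac W)" "p1 * i1 = fst (ac Y)" "p2 * i2 = fst (ac W)"
    "p1 * i2 = 0" "p2 * i1 = 0" using ks.biproduct[OF Y(1) IH(2)] by blast
  let ?F = "(p + r) * p1 + F * p2" and ?G = "i1 * (q + r') + i2 * G"
  have "?F * ?G = (p + r) * (p1 * i1 * (q + r')) + F * (p2 * i2 * G) + (p + r) * (p1 * i2) * G + F * (p2 * i1) * (q + r')"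
    by (simp add: algebra_simps)
  also have "\<dots> = (p + r) * (q + r') + F * G" unfolding b(5-8) ks.un_left[OF g] ks.un_left[OF IH(5)] by simp
  finally have "?F * ?G = (p * q + y) + (r * r' + \<rho>)" unfolding fg IH(6) by (simp add: algebra_simps)
  moreover have "?F \<in> Zc 0 (ac (Y \<oplus>\<^sub>K W)) (ac X)"
    using ks.H_add[OF ks.H_mult[OF f b(3)] ks.H_mult[OF IH(4) b(4)]] .
  moreover have "?G \<in> Zc 0 (ac X) (ac (Y \<oplus>\<^sub>K W))"
    using ks.H_add[OF ks.H_mult[OF b(1) g] ks.H_mult[OF b(2) IH(5)]] .
  moreover have "set_mset (ks.kms (Y \<oplus>\<^sub>K W)) \<subseteq> set_mset (ks.kms Y)" using ks.kms_sm[OF Y(1) IH(2)] IH(3) by simp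
  moreover have "r * r' + \<rho> \<in> hq P P" using hq_add[OF hq_mult[OF r(1) r'(1)] IH(1)] .
  moreover have "is_complex (Y \<oplus>\<^sub>K W)" by (rule ks.ob_sm[OF Y(1) IH(2)])
  ultimately show ?case by blast
qed (rule subspace_cmaps)

text \<open>Supplies the inverses required for Nakayama's lemma. The inverse in the homotopy
  category is projected to its component on \<open>Q\<close>; the homotopy leaves an error
  \<open>d * c\<close> there.\<close>

lemma cmaps_prods_inverse:
  assumes t: "tb P Q" and d: "d \<in> hq P Q" "d' \<in> hq P Q"
    and X: "is_complex X" "ac X = (P + Q, d)" and Y: "is_complex Y" "ac Y = (P + Q, d')"
    and dis: "set_mset (ks.kms X) \<inter> set_mset (ks.kms Y) = {}"
    and a: "a \<in> prods (cmaps P Q d' d) (cmaps P Q d d')"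
  shows "\<exists>v\<in>cmaps P Q d d. \<exists>c\<in>hq Q P. v * (Q - a) - Q = d * c"
proof -
  note tD = tbD[OF t]
  obtain \<rho> W F G where 0: "\<rho> \<in> hq P P" "is_complex W" "set_mset (ks.kms W) \<subseteq> set_mset (ks.kms Y)"
    "F \<in> Zc 0 (ac W) (ac X)" "G \<in> Zc 0 (ac X) (ac W)" "F * G = a + \<rho>"
    using cmaps_prods_lift[OF t d X Y a] by blast
  have "set_mset (ks.kms X) \<inter> set_mset (ks.kms W) = {}" using dis 0(3) by blast
  from ks.disjoint_inverse[OF X(1) 0(2) this 0(4,5)]
  obtain v where v: "v \<in> Zc 0 (P + Q, d) (P + Q, d)"
    "v * (P + Q - (a + \<rho>)) - (P + Q) \<in> Bc 0 (P + Q, d) (P + Q, d)"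
    unfolding 0(6) X(2) by auto
  obtain c where c: "c \<in> hm (-1) (P + Q, d) (P + Q, d)" "v * (P + Q - (a + \<rho>)) - (P + Q) = d * c + c * d"
    using v(2) unfolding Bc_def sg_def by auto
  have cq: "c \<in> hq Q P" by (rule tb_hm1[OF t c(1)])
  have "a \<in> cmaps P Q d d" by (rule prods_sub[OF a subspace_cmaps subspace_cmaps]) (rule cmaps_mult)
  then have aQ: "a \<in> hq Q Q" by (rule cmapsD(1))
  have QQ: "Q \<in> hq Q Q" using tD(4) by (intro hqI)
  have z: "\<rho> * Q = 0" "P * Q = 0" "d * Q = 0" "a * Q = a" "Q * a = a" "c * Q = c" "Q * d = d" "Q * Q = Q"
    using hq_orth[OF 0(1) QQ tD(5)] tD(4,5) tb_zero[OF t d(1)] hqD[OF aQ] hqD[OF cq] hqD[OF d(1)] by simp_all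
  have "Q * (v * (P + Q - (a + \<rho>)) - (P + Q)) * Q = Q * v * (Q * (Q - a)) - Q"
    by (simp add: algebra_simps z tD)
  moreover have "Q * (d * c + c * d) * Q = d * c"
    by (simp add: distrib_left distrib_right mult.assoc z) (simp add: mult.assoc[symmetric] z)
  ultimately have "(Q * v * Q) * (Q - a) - Q = d * c" unfolding c(2) by (simp add: mult.assoc)
  then show ?thesis using Zc_cmaps[OF t d(1) d(1) v(1)] cq by blast
qed

end

section \<open>Isomorphisms and direct sums of projectives\<close>

definition eqv :: "'a::ring fm \<Rightarrow> 'a fm \<Rightarrow> 'a fm \<Rightarrow> 'a fm \<Rightarrow> bool" where
  "eqv P Q u u' \<longleftrightarrow> u \<in> hq P Q \<and> u' \<in> hq Q P \<and> u' * u = P \<and> u * u' = Q"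

lemma eqvD:
  assumes "eqv P Q u u'" shows "u \<in> hq P Q" "u' \<in> hq Q P" "u' * u = P" "u * u' = Q"
  using assms unfolding eqv_def by auto

lemma eqv_sym: "eqv P Q u u' \<Longrightarrow> eqv Q P u' u"
  unfolding eqv_def by auto

lemma eqv_trans:
  assumes "eqv P Q u u'" "eqv Q R v v'" shows "eqv P R (v * u) (u' * v')"
proof -
  note a = eqvD[OF assms(1)] and b = eqvD[OF assms(2)]
  have "(u' * v') * (v * u) = u' * ((v' * v) * u)" "(v * u) * (u' * v') = v * ((u * u') * v')" by (simp_all add: mult.assoc)
  then show ?thesis unfolding eqv_def using a b hq_mult[OF b(1) a(1)] hq_mult[OF a(2) b(2)]
      hqD(1)[OF a(1)] hqD(1)[OF b(2)] by simp
qed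

text \<open>A strict biproduct of idempotents in possibly different degrees. Strictness allows
  replacing a summand or the whole along a strict isomorphism.\<close>

definition bs :: "'a::ring fm \<Rightarrow> 'a fm \<Rightarrow> 'a fm \<Rightarrow> 'a fm \<Rightarrow> 'a fm \<Rightarrow> 'a fm \<Rightarrow> 'a fm \<Rightarrow> bool" where
  "bs B Y Z i1 i2 p1 p2 \<longleftrightarrow> i1 \<in> hq Y B \<and> i2 \<in> hq Z B \<and> p1 \<in> hq B Y \<and> p2 \<in> hq B Z \<and>
     p1 * i1 = Y \<and> p2 * i2 = Z \<and> p1 * i2 = 0 \<and> p2 * i1 = 0 \<and> i1 * p1 + i2 * p2 = B"

lemma bsD:
  assumes "bs B Y Z i1 i2 p1 p2"
  shows "i1 \<in> hq Y B" "i2 \<in> hq Z B" "p1 \<in> hq B Y" "p2 \<in> hq B Z"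
    "p1 * i1 = Y" "p2 * i2 = Z" "p1 * i2 = 0" "p2 * i1 = 0" "i1 * p1 + i2 * p2 = B"
  using assms unfolding bs_def by auto

lemma bs_swap: "bs B Y Z i1 i2 p1 p2 \<Longrightarrow> bs B Z Y i2 i1 p2 p1"
  unfolding bs_def by (auto simp: add.commute)

lemma bs_unique_half:
  assumes "bs P Y Z i1 i2 p1 p2" "bs B Y Z j1 j2 q1 q2"
  shows "(i1 * q1 + i2 * q2) * (j1 * p1 + j2 * p2) = P"
proof -
  note a = bsD[OF assms(1)] and b = bsD[OF assms(2)]
  have "(i1 * q1 + i2 * q2) * (j1 * p1 + j2 * p2) =
    i1 * ((q1 * j1) * p1) + i1 * (q1 * j2) * p2 + i2 * (q2 * j1) * p1 + i2 * ((q2 * j2) * p2)"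
    by (simp add: algebra_simps)
  then show ?thesis using hqD(1)[OF a(3)] hqD(1)[OF a(4)] by (simp add: a b)
qed

lemma bs_unique:
  assumes "bs P Y Z i1 i2 p1 p2" "bs B Y Z j1 j2 q1 q2"
  shows "eqv P B (j1 * p1 + j2 * p2) (i1 * q1 + i2 * q2)"
  unfolding eqv_def using bs_unique_half[OF assms] bs_unique_half[OF assms(2,1)]
    bsD(1-4)[OF assms(1)] bsD(1-4)[OF assms(2)] by (intro conjI hq_add hq_mult)

lemma bs_eqv_left:
  assumes b: "bs B Y Z i1 i2 p1 p2" and e: "eqv W Y u u'"
  shows "bs B W Z (i1 * u) i2 (u' * p1) p2"
proof -
  note bD = bsD[OF b] and eD = eqvD[OF e]
  have "(u' * p1) * (i1 * u) = u' * ((p1 * i1) * u)" "(u' * p1) * i2 = u' * (p1 * i2)"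
    "p2 * (i1 * u) = (p2 * i1) * u" "(i1 * u) * (u' * p1) = i1 * ((u * u') * p1)" by (simp_all add: mult.assoc)
  then show ?thesis unfolding bs_def using bD eD hqD(1)[OF eD(1)] hqD(1)[OF bD(3)]
      hq_mult[OF bD(1) eD(1)] hq_mult[OF eD(2) bD(3)] by simp
qed

lemma bs_eqv_whole:
  assumes b: "bs B Y Z i1 i2 p1 p2" and e: "eqv B C t t'"
  shows "bs C Y Z (t * i1) (t * i2) (p1 * t') (p2 * t')"
proof -
  note bD = bsD[OF b] and eD = eqvD[OF e]
  have 1: "(p * t') * (t * i) = p * i" if "i \<in> hq Y B \<or> i \<in> hq Z B" for p i
  proof -
    have "(p * t') * (t * i) = p * ((t' * t) * i)" by (simp add: mult.assoc)
    then show ?thesis using that hqD(1) eD(3) by metis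
  qed
  have "(t * i1) * (p1 * t') + (t * i2) * (p2 * t') = t * ((i1 * p1 + i2 * p2) * t')" by (simp add: algebra_simps)
  then have 2: "(t * i1) * (p1 * t') + (t * i2) * (p2 * t') = C" using bD(9) eD(4) hqD(1)[OF eD(2)] by simp
  show ?thesis unfolding bs_def using 1 2 bD hq_mult[OF eD(1)] hq_mult[OF _ eD(2)] by simp
qed

text \<open>Restricts a biproduct to parts of its summands; it is used to isolate a single degree in
  the direct sum of two complexes.\<close>

lemma bs_cut:
  assumes b: "bs B Y Z i1 i2 p1 p2" and y: "y \<in> hq Y Y" "y * y = y" and z: "z \<in> hq Z Z" "z * z = z"
  shows "bs (i1 * y * p1 + i2 * z * p2) y z (i1 * y) (i2 * z) (y * p1) (z * p2)"
proof -
  note bD = bsD[OF b]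
  have r: "p1 * (i1 * w) = Y * w" "p2 * (i2 * w) = Z * w" "p1 * (i2 * w) = 0" "p2 * (i1 * w) = 0"
    "Y * (y * w) = y * w" "Z * (z * w) = z * w" "y * (y * w) = y * w" "z * (z * w) = z * w" "Y * y = y" "Z * z = z" for w
    using bD hqD[OF y(1)] hqD[OF z(1)] y(2) z(2) by (simp_all add: mult.assoc[symmetric])
  show ?thesis unfolding bs_def hq_def by (simp add: r y(2) z(2) distrib_left distrib_right mult.assoc)
qed

lemma blk_zero: "blk s t (0 :: 'a::ring fm)"
  unfolding blk_def by simp

lemma blk_add: "blk s t x \<Longrightarrow> blk s t y \<Longrightarrow> blk s t (x + y :: 'a::ring fm)"
  unfolding blk_def by (metis add.right_neutral ent_add)

lemma blk_dg_left:
  assumes "dg k x" "blk s t y" shows "blk (s + k) t (x * y :: 'a::ring fm)"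
  unfolding blk_def
proof (intro allI impI)
  fix i a j b assume "ent (x * y) (Ix i a) (Ix j b) \<noteq> 0"
  then obtain w where "ent x (Ix i a) w \<noteq> 0" "ent y w (Ix j b) \<noteq> 0" using ent_mult_nonzero by blast
  moreover obtain i' a' where "w = Ix i' a'" by (cases w)
  ultimately show "i = s + k \<and> j = t" using assms unfolding dg_def blk_def by blast
qed

lemma blk_dg_right:
  assumes "blk s t y" "dg k x" shows "blk s (t - k) (y * x :: 'a::ring fm)"
  unfolding blk_def
proof (intro allI impI)
  fix i a j b assume "ent (y * x) (Ix i a) (Ix j b) \<noteq> 0"
  then obtain w where w: "ent y (Ix i a) w \<noteq> 0" "ent x w (Ix j b) \<noteq> 0" using ent_mult_nonzero by blast
  obtain i' a' where "w = Ix i' a'" by (cases w)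
  then have "i = s \<and> i' = t" "i' = j + k" using w assms unfolding dg_def blk_def by blast+
  then show "i = s \<and> j = t - k" by simp
qed

lemma blk_hq: "blk s s P \<Longrightarrow> blk t t Q \<Longrightarrow> x \<in> hq P Q \<Longrightarrow> blk t s (x :: 'a::ring fm)"
  using blk_corner hqD by metis

lemma stalk_Zc:
  assumes "blk s s P" "blk s s Q" "x \<in> hq P Q" shows "x \<in> Zc 0 (P, 0) (Q, 0 :: 'a::ring fm)"
  unfolding Zc_def hm_def using blk_dg[OF blk_hq[OF assms]] hqD[OF assms(3)] by (simp add: sg_def)

text \<open>With zero differentials nothing nonzero is null-homotopic, so equivalence in the
  homotopy category is isomorphism of projectives and Krull-Schmidt applies to the latter.\<close>

lemma stalk_Bc: "x \<in> Bc 0 (P, 0) (Q, 0 :: 'a::ring fm) \<longleftrightarrow> x = 0"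
  unfolding Bc_def by (auto simp: sg_def intro!: exI[of _ 0])

lemma stalk_acx: "blk s s P \<Longrightarrow> P * P = P \<Longrightarrow> acx (P, 0 :: 'a::ring fm)"
  using acx_zero_diff blk_dg by fastforce

context fdalg
begin

lemma stalk_kms_sum:
  assumes "is_complex R" "ac R = (b, 0)" "is_complex V" "ac V = (v, 0)" "is_complex W" "ac W = (w, 0)"
    and k: "blk s s b" "blk s s v" "blk s s w" and b: "bs b v w i1 i2 p1 p2"
  shows "ks.kms R = ks.kms V + ks.kms W"
proof -
  note bD = bsD[OF b]
  have "ks.bip R V W i1 i2 p1 p2" unfolding ks.bip_def
    using assms(1-6) bD(5-9) stalk_Zc[OF k(2,1) bD(1)] stalk_Zc[OF k(3,1) bD(2)] stalk_Zc[OF k(1,2) bD(3)] stalk_Zc[OF k(1,3) bD(4)]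
    by (simp add: stalk_Bc)
  then show ?thesis by (rule ks.bip_kms)
qed

lemma stalk_kms_eq:
  assumes V: "is_complex V" "ac V = (v, 0)" and W: "is_complex W" "ac W = (w, 0)"
    and k: "blk s s v" "blk s s w" and e: "eqv v w u u'"
  shows "ks.kms V = ks.kms W"
proof -
  note eD = eqvD[OF e]
  have "ks.iso V W" unfolding ks.iso_def V(2) W(2)
    using V(1) W(1) stalk_Zc[OF k eD(1)] stalk_Zc[OF k(2,1) eD(2)] eD(3,4) by (auto simp: stalk_Bc)
  then show ?thesis by (rule ks.kms_iso)
qed

lemma stalk_eqv:
  assumes V: "is_complex V" "ac V = (v, 0)" and W: "is_complex W" "ac W = (w, 0)" and k: "ks.kms V = ks.kms W"
  shows "\<exists>u u'. eqv v w u u'"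
proof -
  have "ks.iso V W" using ks.iso_iff_kms[OF V(1) W(1)] k by simp
  then obtain f g where f: "f \<in> Zc 0 (v, 0) (w, 0)" "g \<in> Zc 0 (w, 0) (v, 0)" "g * f - v = 0" "f * g - w = 0"
    unfolding ks.iso_def V(2) W(2) stalk_Bc fst_conv by blast
  have "f \<in> hq v w" "g \<in> hq w v" using hmD(2,3)[OF ZcD(1)[OF f(1)]] hmD(2,3)[OF ZcD(1)[OF f(2)]] by (auto intro: hqI)
  then have "eqv v w f g" unfolding eqv_def using f(3,4) by simp
  then show ?thesis by blast
qed

lemma stalk_sum:
  fixes V W :: "'a cplx"
  assumes V: "is_complex V" "ac V = (v, 0)" and W: "is_complex W" "ac W = (w, 0)" and k: "blk s s v" "blk s s w"
  shows "\<exists>b i1 i2 p1 p2. ac (V \<oplus>\<^sub>K W) = (b, 0) \<and> blk s s b \<and> bs b v w i1 i2 p1 p2"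
proof -
  let ?B = "V \<oplus>\<^sub>K W"
  note oB = ks.ob_sm[OF V(1) W(1)]
  obtain i1 i2 p1 p2 where b: "i1 \<in> Zc 0 (ac V) (ac ?B)" "i2 \<in> Zc 0 (ac W) (ac ?B)"
    "p1 \<in> Zc 0 (ac ?B) (ac V)" "p2 \<in> Zc 0 (ac ?B) (ac W)" "p1 * i1 = fst (ac V)" "p2 * i2 = fst (ac W)"
    "p1 * i2 = 0" "p2 * i1 = 0" "i1 * p1 + i2 * p2 = fst (ac ?B)" using ks.biproduct[OF V(1) W(1)] by blast
  note h = hmD[OF ZcD(1)[OF b(1)]] hmD[OF ZcD(1)[OF b(2)]] hmD[OF ZcD(1)[OF b(3)]] hmD[OF ZcD(1)[OF b(4)]]
  have bs: "bs (fst (ac ?B)) v w i1 i2 p1 p2" unfolding bs_def hq_def using b(5-9) h V(2) W(2) by simp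
  have "snd (ac ?B) * i1 = 0" "snd (ac ?B) * i2 = 0" using ZcD(2)[OF b(1)] ZcD(2)[OF b(2)] V(2) W(2) by (simp_all add: sg_def)
  moreover have "snd (ac ?B) = snd (ac ?B) * fst (ac ?B)" using acx_ac[OF oB] unfolding acx_def by simp
  ultimately have "snd (ac ?B) = 0" unfolding b(9)[symmetric] by (simp add: distrib_left mult.assoc[symmetric])
  then have 1: "ac ?B = (fst (ac ?B), 0)" by (simp add: prod_eq_iff)
  have "i1 * v = i1" "i2 * w = i2" using h V(2) W(2) by simp_all
  then have "blk s s i1" "blk s s i2" using blk_dg_left[OF h(1) k(1)] blk_dg_left[OF h(4) k(2)] by simp_all
  moreover have "blk s s p1" "blk s s p2" using blk_dg_right[OF k(1) h(7)] blk_dg_right[OF k(2) h(10)] h(8,11) V(2) W(2) by simp_all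
  ultimately have "blk s s (fst (ac ?B))" unfolding b(9)[symmetric] by (intro blk_add blk_mult)
  with 1 bs show ?thesis by blast
qed

text \<open>The projective \<open>P\<close>, placed in an arbitrary degree, becomes a complex with summands \<open>A\<close> when moved to
  degree 0.\<close>

definition stk :: "'a fm \<Rightarrow> 'a cplx set multiset \<Rightarrow> bool" where
  "stk P A \<longleftrightarrow> (\<exists>R b u u'. is_complex R \<and> ac R = (b, 0) \<and> blk 0 0 b \<and> ks.kms R = A \<and> eqv P b u u')"

lemma stk_bs:
  assumes "stk P A" "stk Q B"
  shows "\<exists>R b i1 i2 p1 p2. is_complex R \<and> ac R = (b, 0) \<and> blk 0 0 b \<and> ks.kms R = A + B \<and> bs b P Q i1 i2 p1 p2"
proof -
  obtain R b u u' where R: "is_complex R" "ac R = (b, 0)" "blk 0 0 b" "ks.kms R = A" "eqv P b u u'"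
    using assms(1) unfolding stk_def by blast
  obtain S c v v' where S: "is_complex S" "ac S = (c, 0)" "blk 0 0 c" "ks.kms S = B" "eqv Q c v v'"
    using assms(2) unfolding stk_def by blast
  obtain a i1 i2 p1 p2 where a: "ac (R \<oplus>\<^sub>K S) = (a, 0)" "blk 0 0 a" "bs a b c i1 i2 p1 p2"
    using stalk_sum[OF R(1,2) S(1,2) R(3) S(3)] by blast
  have "bs a P Q (i1 * u) (i2 * v) (u' * p1) (v' * p2)"
    using bs_swap[OF bs_eqv_left[OF bs_swap[OF bs_eqv_left[OF a(3) R(5)]] S(5)]] .
  moreover have "ks.kms (R \<oplus>\<^sub>K S) = A + B" using ks.kms_sm[OF R(1) S(1)] R(4) S(4) by simp
  ultimately show ?thesis using a(1,2) ks.ob_sm[OF R(1) S(1)] by blast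
qed

lemma stk_sum:
  assumes "bs B P Q i1 i2 p1 p2" "stk P M" "stk Q N" shows "stk B (M + N)"
proof -
  obtain R b j1 j2 q1 q2 where "is_complex R" "ac R = (b, 0)" "blk 0 0 b" "ks.kms R = M + N" "bs b P Q j1 j2 q1 q2"
    using stk_bs[OF assms(2,3)] by blast
  then show ?thesis unfolding stk_def using bs_unique[OF assms(1)] by blast
qed

lemma idn_kms:
  "is_complex X \<Longrightarrow> ac X = (idn 0 n, 0) \<Longrightarrow> set_mset (ks.kms X) \<subseteq> set_mset (ks.kms alg_cplx)"
proof (induction n arbitrary: X)
  case 0
  then have "ks.iso X zero_cplx" unfolding ks.iso_zr_iff[OF 0(1)] by (simp add: idn_def)
  then have "ks.kms X = {#}" using ks.kms_empty_iff[OF 0(1)] by simp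
  then show ?case by simp
next
  case (Suc n)
  let ?u = "munit (Ix 0 n) (Ix 0 n) :: 'a fm"
  have bu: "blk 0 0 (munit (Ix 0 a) (Ix 0 b) :: 'a fm)" for a b unfolding blk_def ent_munit by (auto split: if_splits)
  have bi: "blk 0 0 (idn 0 m :: 'a fm)" for m unfolding blk_def ent_idn by (auto split: if_splits)
  have uu: "?u * ?u = ?u" by (rule munit_mult)
  obtain D where D: "is_complex D" "ac D = (?u, 0)" using realize[OF stalk_acx[OF bu uu]] by blast
  obtain Y where Y: "is_complex Y" "ac Y = (idn 0 n, 0 :: 'a fm)" using realize[OF acx_zero_diff[OF dg_idn idn_idem]] by blast
  have A: "ac (alg_cplx :: 'a cplx) = (munit (Ix 0 0) (Ix 0 0), 0)" by (simp add: prod_eq_iff ent_alg alg_cplx_ac(2))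
  have "eqv ?u (munit (Ix 0 0) (Ix 0 0)) (munit (Ix 0 0) (Ix 0 n)) (munit (Ix 0 n) (Ix 0 0))"
    unfolding eqv_def hq_def by (simp add: munit_mult)
  then have kD: "ks.kms D = ks.kms alg_cplx" by (rule stalk_kms_eq[OF D alg_cplx_ac(1) A bu bu])
  have un: "?u * idn 0 n = 0" "idn 0 n * ?u = 0"
    unfolding idn_def sum_distrib_left sum_distrib_right by (auto intro!: sum.neutral munit_mult_zero)
  have "idn 0 (Suc n) = ?u + idn 0 n" by (simp add: idn_def add.commute)
  then have "bs (idn 0 (Suc n)) ?u (idn 0 n) ?u (idn 0 n) ?u (idn 0 n)"
    unfolding bs_def hq_def using un uu idn_idem[of 0 n] by (simp add: distrib_left distrib_right)
  from stalk_kms_sum[OF Suc.prems D Y bi bu bi this] have "ks.kms X = ks.kms D + ks.kms Y" .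
  then show ?case using Suc.IH[OF Y] kD by simp
qed

text \<open>\<open>X\<close> is a retract of a free module, whose indecomposable summands are those
  of \<open>A\<close>.\<close>

lemma stalk_kms_alg:
  assumes X: "is_complex X" "ac X = (e, 0)" and k: "blk 0 0 e"
  shows "set_mset (ks.kms X) \<subseteq> set_mset (ks.kms alg_cplx)"
proof -
  obtain n where n: "\<And>i a j b. n \<le> a \<or> n \<le> b \<Longrightarrow> ent e (Ix i a) (Ix j b) = 0" using position_bound by metis
  have s: "i = 0 \<and> j = 0" if "ent e (Ix i a) (Ix j b) \<noteq> 0" for i a j b using k that unfolding blk_def by blast
  have l: "idn 0 n * e = e" "e * idn 0 n = e"
  proof -
    show "idn 0 n * e = e"
    proof (rule fm_eqI')
      fix i a j b show "ent (idn 0 n * e) (Ix i a) (Ix j b) = ent e (Ix i a) (Ix j b)"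
        unfolding ent_idn_mult using s[of i a j b] n[of a b i j] by (cases "ent e (Ix i a) (Ix j b) = 0") (auto simp: not_less)
    qed
    show "e * idn 0 n = e"
    proof (rule fm_eqI')
      fix i a j b show "ent (e * idn 0 n) (Ix i a) (Ix j b) = ent e (Ix i a) (Ix j b)"
        unfolding ent_mult_idn using s[of i a j b] n[of a b i j] by (cases "ent e (Ix i a) (Ix j b) = 0") (auto simp: not_less)
    qed
  qed
  have ee: "e * e = e" using acx_ac[OF X(1)] unfolding X(2) acx_def by simp
  have bi: "blk 0 0 (idn 0 n :: 'a fm)" unfolding blk_def ent_idn by (auto split: if_splits)
  obtain B where B: "is_complex B" "ac B = (idn 0 n, 0 :: 'a fm)"
    using realize[OF acx_zero_diff[OF dg_idn idn_idem]] by blast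
  have "e \<in> hq e (idn 0 n)" "e \<in> hq (idn 0 n) e" unfolding hq_def using l ee by simp_all
  then have "ks.kms X \<subseteq># ks.kms B"
    using ks.retract_kms[of e X B e, unfolded X(2) B(2) stalk_Bc fst_conv, OF stalk_Zc[OF k bi] stalk_Zc[OF bi k] _ X(1) B(1)] ee by simp
  then show ?thesis using idn_kms[OF B] set_mset_mono by blast
qed

text \<open>Shifting by \<open>t\<close> moves \<open>P\<close> to degree 0, and the structure maps
  of the shift are the strict isomorphism asked for.\<close>

lemma stk_exists:
  assumes k: "blk t t P" and P: "P * P = P"
  shows "\<exists>A. stk P A \<and> set_mset A \<subseteq> set_mset (ks.kms alg_cplx)"
proof -
  obtain S where S: "is_complex S" "ac S = (P, 0)" using realize[OF stalk_acx[OF k P]] by blast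
  obtain i p where sh: "shifted t (ac (shift t S)) (ac S) i p" using shift_shifted(2)[OF S(1)] by blast
  note sD = sh[unfolded shifted_def S(2) fst_conv snd_conv]
  have c: "is_complex (shift t S)" by (rule shift_shifted(1)[OF S(1)])
  have a: "ac (shift t S) = (i * p, 0)" using sD by (simp add: prod_eq_iff sg_def)
  have "blk 0 t (i * P)" using blk_dg_left[OF conjunct1[OF sD] k] by simp
  moreover have "blk t 0 (P * p)" using blk_dg_right[OF k, of t p] sD by simp
  ultimately have b: "blk 0 0 (i * p)" using blk_mult[of 0 t i t 0 p] sD by simp
  have "(i * p) * i = i * (p * i)" "p * (i * p) = (p * i) * p" by (simp_all add: mult.assoc)
  then have "eqv P (i * p) i p" unfolding eqv_def hq_def using sD by simp
  then have "stk P (ks.kms (shift t S))" unfolding stk_def using c a b by blast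
  then show ?thesis using stalk_kms_alg[OF c a b] by blast
qed

end

text \<open>More vectors than coordinates are linearly dependent. Gaussian elimination is done
  without division: the pivot \<open>c0\<close> clears the coordinate \<open>s\<close> after the
  other vectors have been multiplied by \<open>v c0 s\<close>.\<close>

lemma integer_relation:
  fixes v :: "'c \<Rightarrow> 's \<Rightarrow> int"
  assumes "finite S" "finite C" "card S < card C"
  shows "\<exists>a. (\<exists>c\<in>C. a c \<noteq> 0) \<and> (\<forall>s\<in>S. (\<Sum>c\<in>C. a c * v c s) = 0)"
  using assms
proof (induction S arbitrary: C v rule: finite_induct)
  case empty
  then have "C \<noteq> {}" by auto
  then show ?case by (intro exI[of _ "\<lambda>_. 1"]) auto
next
  case (insert s S)
  show ?case
  proof (cases "\<forall>c\<in>C. v c s = 0")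
    case True
    have "card S < card C" using insert by simp
    from insert.IH[OF insert.prems(1) this, of v] obtain a where
      "\<exists>c\<in>C. a c \<noteq> 0" "\<forall>s\<in>S. (\<Sum>c\<in>C. a c * v c s) = 0" by blast
    then show ?thesis using True by (intro exI[of _ a]) simp
  next
    case False
    then obtain c0 where c0: "c0 \<in> C" "v c0 s \<noteq> 0" by blast
    define D where "D = C - {c0}"
    have C: "C = insert c0 D" "finite D" "c0 \<notin> D" unfolding D_def using c0 insert.prems(1) by auto
    have "card S < card D" using insert C by simp
    from insert.IH[OF C(2) this, of "\<lambda>c t. v c0 s * v c t - v c s * v c0 t"] obtain a where
      a: "\<exists>c\<in>D. a c \<noteq> 0" "\<forall>t\<in>S. (\<Sum>c\<in>D. a c * (v c0 s * v c t - v c s * v c0 t)) = 0" by blast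
    \<comment> \<open>The relation among the reduced vectors, rewritten for the original ones; the
      coefficient of the pivot collects what was subtracted.\<close>
    define b where "b = (\<lambda>c. if c = c0 then - (\<Sum>c\<in>D. a c * v c s) else v c0 s * a c)"
    have "(\<Sum>c\<in>C. b c * v c t) = (\<Sum>c\<in>D. a c * (v c0 s * v c t - v c s * v c0 t))" for t
    proof -
      have "(\<Sum>c\<in>C. b c * v c t) = - (\<Sum>c\<in>D. a c * v c s) * v c0 t + (\<Sum>c\<in>D. b c * v c t)"
        using C by (simp add: b_def)
      also have "(\<Sum>c\<in>D. b c * v c t) = (\<Sum>c\<in>D. v c0 s * a c * v c t)"
        using C(3) by (intro sum.cong) (auto simp: b_def)
      finally show ?thesis by (simp add: sum_distrib_left sum_subtractf algebra_simps)
    qed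
    moreover have "\<exists>c\<in>C. b c \<noteq> 0"
    proof -
      obtain c where "c \<in> D" "a c \<noteq> 0" using a(1) by blast
      then have "c \<in> C" "b c \<noteq> 0" using C c0(2) unfolding b_def by auto
      then show ?thesis by blast
    qed
    ultimately show ?thesis using a(2) by (intro exI[of _ b]) (auto simp: mult.commute)
  qed
qed

section \<open>Adding contractible summands and splitting off kernels\<close>

lemma tb_degrees:
  assumes t: "tb P Q" shows "tt (P + Q, d :: 'a::ring fm)"
  unfolding tt_def
proof (intro allI impI)
  fix i a j b assume i: "i \<noteq> - 1" "i \<noteq> (0::int)"
  have "ent P (Ix i a) (Ix j b) = 0" "ent Q (Ix i a) (Ix j b) = 0"
    using tbD(1,2)[OF t] i unfolding blk_def by blast+
  then show "ent (fst (P + Q, d)) (Ix i a) (Ix j b) = 0" by simp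
qed

lemma tb_hq_hm:
  assumes t: "tb P Q" and b: "b \<in> hq P Q" shows "b \<in> hm 1 (P + Q, d) (P + Q, d' :: 'a::ring fm)"
proof -
  have "dg 1 b" using blk_dg[OF blk_hq[OF tbD(1,2)[OF t] b]] by simp
  then show ?thesis unfolding hm_def using tb_zero[OF t b] hqD[OF b] by (simp add: distrib_left distrib_right)
qed

text \<open>The summand added to \<open>d\<close> is the identity of \<open>R\<close>, which appears
  as \<open>i2 * r2\<close> because the copies of \<open>R\<close> in \<open>P'\<close> and in
  \<open>Q'\<close> are only identified up to isomorphism.\<close>

lemma add_contractible:
  assumes t: "tb P Q" "tb P' Q'" and d: "d \<in> hq P Q"
    and P: "bs P' P R k1 k2 r1 r2" and Q: "bs Q' Q R i1 i2 p1 p2"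
  shows "i1 * d * r1 + i2 * r2 \<in> hq P' Q'" "hiso (P + Q, d) (P' + Q', i1 * d * r1 + i2 * r2 :: 'a::ring fm)"
proof -
  define D where "D = i1 * d * r1 + i2 * r2"
  note PD = bsD[OF P] and QD = bsD[OF Q] and tD = tbD[OF t(1)] tbD[OF t(2)]
  show "i1 * d * r1 + i2 * r2 \<in> hq P' Q'" by (intro hq_add hq_mult[OF QD(2) PD(4)] hq_mult[OF hq_mult[OF QD(1) d] PD(3)])
  then have D: "D \<in> hq P' Q'" unfolding D_def .
  have b: "blk 0 0 i1" "blk (-1) (-1) k1" "blk 0 0 p1" "blk (-1) (-1) r1" "blk (-1) (-1) (k2 * r2)"
    using blk_hq[OF tD(2,8) QD(1)] blk_hq[OF tD(1,7) PD(1)] blk_hq[OF tD(8,2) QD(3)] blk_hq[OF tD(7,1) PD(3)]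
      blk_hq[OF tD(7,7) hq_mult[OF PD(2,4)]] .
  have z: "i1 * P = 0" "k1 * Q = 0" "P' * i1 = 0" "Q' * k1 = 0" "p1 * P' = 0" "r1 * Q' = 0" "P * p1 = 0" "Q * r1 = 0"
    using blk_mult_zero[OF b(1) tD(1)] blk_mult_zero[OF b(2) tD(2)] blk_mult_zero[OF tD(7) b(1)] blk_mult_zero[OF tD(8) b(2)]
      blk_mult_zero[OF b(3) tD(7)] blk_mult_zero[OF b(4) tD(8)] blk_mult_zero[OF tD(1) b(3)] blk_mult_zero[OF tD(2) b(4)] by simp_all
  have o: "p1 * k1 = 0" "r1 * i1 = 0" "i1 * r1 = 0" "k1 * p1 = 0"
    using blk_mult_zero[OF b(3,2)] blk_mult_zero[OF b(4,1)] blk_mult_zero[OF b(1,4)] blk_mult_zero[OF b(2,3)] by simp_all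
  note h = hqD[OF PD(1)] hqD[OF PD(2)] hqD[OF PD(3)] hqD[OF PD(4)] hqD[OF QD(1)] hqD[OF QD(2)] hqD[OF QD(3)] hqD[OF QD(4)] hqD[OF d]
  have g: "dg 0 i1" "dg 0 k1" "dg 0 p1" "dg 0 r1" using blk_dg[OF b(1)] blk_dg[OF b(2)] blk_dg[OF b(3)] blk_dg[OF b(4)] by simp_all
  have D1: "D * i1 = 0" "k1 * d = 0" "D * k1 = i1 * d" "p1 * D = d * r1" "r1 * D = 0" "d * p1 = 0"
  proof -
    have "k1 * d = k1 * Q * d" "d * p1 = d * (P * p1)" using h by (simp_all add: mult.assoc) (simp add: mult.assoc[symmetric])
    then show "k1 * d = 0" "d * p1 = 0" using z by simp_all
    have "D * i1 = D * (P' * i1)" using hqD(2)[OF D] by (simp add: mult.assoc[symmetric])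
    then show "D * i1 = 0" using z by simp
    have "r1 * D = (r1 * Q') * D" using hqD(1)[OF D] by (simp add: mult.assoc)
    then show "r1 * D = 0" using z by simp
    have "D * k1 = i1 * (d * (r1 * k1)) + i2 * (r2 * k1)" unfolding D_def by (simp add: distrib_right mult.assoc)
    then show "D * k1 = i1 * d" using PD h by simp
    have "p1 * D = (p1 * i1) * d * r1 + (p1 * i2) * r2" unfolding D_def by (simp add: distrib_left mult.assoc)
    then show "p1 * D = d * r1" using QD h by simp
  qed
  have f: "i1 + k1 \<in> Zc 0 (P + Q, d) (P' + Q', D)"
    unfolding Zc_def hm_def using g z h D1(1-3) by (simp add: sg_def dg_add distrib_left distrib_right)
  have f': "p1 + r1 \<in> Zc 0 (P' + Q', D) (P + Q, d)"
    unfolding Zc_def hm_def using g z h D1(4-6) by (simp add: sg_def dg_add distrib_left distrib_right)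
  have gf: "(p1 + r1) * (i1 + k1) - (P + Q) = 0" using PD QD o by (simp add: distrib_left distrib_right)
  \<comment> \<open>The contraction: the identity of \<open>R\<close> taken back from
    \<open>Q'\<close> to \<open>P'\<close>, with the sign that cancels the complement of the
    original complex.\<close>
  let ?h = "- (k2 * p2)"
  have kp: "k2 * p2 \<in> hq Q' P'" using hq_mult[OF PD(2) QD(4)] .
  have hm: "?h \<in> hm (0 - 1) (P' + Q', D) (P' + Q', D)"
  proof -
    have "dg (0 - 1) (k2 * p2)" using blk_dg[OF blk_hq[OF tD(8,7) kp]] by simp
    moreover have "Q' * (k2 * p2) = 0" "k2 * p2 * P' = 0"
      using hq_orth[OF _ kp tD(12), of Q'] hq_orth[OF kp _ tD(12), of P'] tD(9,10) by (simp_all add: hq_def)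
    ultimately show ?thesis unfolding hm_def using hqD[OF kp] by (simp add: dg_uminus distrib_left distrib_right)
  qed
  have "(i1 + k1) * (p1 + r1) - (P' + Q') = i1 * p1 + k1 * r1 - (k1 * r1 + k2 * r2) - (i1 * p1 + i2 * p2)"
    using PD(9) QD(9) o by (simp add: distrib_left distrib_right)
  also have "\<dots> = - (k2 * r2) - i2 * p2" by simp
  finally have 1: "(i1 + k1) * (p1 + r1) - (P' + Q') = - (k2 * r2) - i2 * p2" .
  have "D * ?h + ?h * D = - (i1 * d * (r1 * k2) * p2 + i2 * ((r2 * k2) * p2)) - (k2 * (p2 * i1) * d * r1 + k2 * ((p2 * i2) * r2))"
    unfolding D_def by (simp add: algebra_simps)
  then have "- (k2 * r2) - i2 * p2 = sg 0 (D * ?h) + ?h * D" using PD QD h by (simp add: sg_def)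
  then have fg: "(i1 + k1) * (p1 + r1) - (P' + Q') \<in> Bc 0 (P' + Q', D) (P' + Q', D)"
    unfolding 1 Bc_def snd_conv using hm by blast
  show "hiso (P + Q, d) (P' + Q', i1 * d * r1 + i2 * r2)"
    unfolding hiso_def D_def[symmetric] using f f' gf fg by (intro bexI[of _ "i1 + k1"] bexI[of _ "p1 + r1"]) simp_all
qed

context fdalg
begin

lemma e1_e1d:
  assumes t: "tb P Q" and e: "e1 (P + Q, d) (P + Q, d')" and d: "d \<in> hq P Q" "d' \<in> hq P Q"
  shows "e1d P Q d d'"
  unfolding e1d_def
proof
  fix b assume b: "b \<in> hq P Q"
  note tD = tbD[OF t]
  obtain h where h: "h \<in> hm 0 (P + Q, d) (P + Q, d')" "b = h * d - d' * h"
    using e[unfolded e1_def] tb_hq_hm[OF t b, of d d'] by auto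
  note s = tb_hm0[OF t h(1)]
  have "h * d = h * Q * d" "d' * h = d' * (P * h)" using hqD(1)[OF d(1)] hqD(2)[OF d(2)] by (simp_all add: mult.assoc) (simp add: mult.assoc[symmetric])
  then have "h * d = Q * h * Q * d" "d' * h = d' * (P * h * P)" using s(4,7) by simp_all
  then have "b = (Q * h * Q) * d + d' * (- (P * h * P))" using h(2) by simp
  moreover have "Q * h * Q \<in> hq Q Q" "P * h * P \<in> hq P P"
    by (rule hqI; simp add: mult.assoc tD; simp add: mult.assoc[symmetric] tD)+
  ultimately show "\<exists>h\<in>hq P P. \<exists>h'\<in>hq Q Q. b = h' * d + d' * h" using hq_uminus by blast
qed

text \<open>If \<open>d\<close> is a split surjection, \<open>v = c * d\<close> is an idempotent on
  \<open>P\<close> whose image is isomorphic to \<open>Q\<close>, and the complex retracts onto the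
  kernel \<open>w = P - v\<close> in degree -1. So the summands of \<open>P\<close> are those of the
  complex together with those of \<open>V\<close>.\<close>

lemma split_stalk:
  assumes t: "tb P Q" and d: "d \<in> hq P Q" and c: "c \<in> hq Q P" "Q = d * c"
    and X: "is_complex X" "ac X = (P + Q, d)" and S: "is_complex S" "ac S = (P, 0)"
  shows "\<exists>V v. is_complex V \<and> ac V = (v, 0) \<and> blk (-1) (-1) v \<and> eqv v Q d c \<and> ks.kms S = ks.kms X + ks.kms V"
proof -
  note tD = tbD[OF t] and h = hqD[OF d] hqD[OF c(1)]
  define v where "v = c * d"
  define w where "w = P - v"
  have dv: "d * v = d" "v * c = c" unfolding v_def using h c(2) by (metis mult.assoc)+
  have Pv: "P * v = v" "v * P = v" unfolding v_def using h by (metis mult.assoc)+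
  have vv: "v * v = v" using dv(1) unfolding v_def by (simp add: mult.assoc)
  have ww: "w * w = w" "w * v = 0" "v * w = 0" "P * w = w" "w * P = w" "d * w = 0"
    unfolding w_def using vv Pv tD(3) dv h by (simp_all add: left_diff_distrib right_diff_distrib)
  have bv: "blk (-1) (-1) v" "blk (-1) (-1) w" using blk_corner[OF tD(1,1)] Pv ww(4,5) by blast+
  obtain V where V: "is_complex V" "ac V = (v, 0)" using realize[OF stalk_acx[OF bv(1) vv]] by blast
  obtain W where W: "is_complex W" "ac W = (w, 0)" using realize[OF stalk_acx[OF bv(2) ww(1)]] by blast
  have ev: "eqv v Q d c" unfolding eqv_def hq_def using dv h c(2) v_def by simp
  have "bs P w v w v w v" unfolding bs_def hq_def using ww vv Pv by (simp add: w_def)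
  from stalk_kms_sum[OF S W V tD(1) bv(2,1) this] have k: "ks.kms S = ks.kms W + ks.kms V" .
  have zw: "w * Q = 0" "Q * w = 0" "w * d = 0"
  proof -
    show "w * Q = 0" "Q * w = 0" using blk_mult_zero[OF bv(2) tD(2)] blk_mult_zero[OF tD(2) bv(2)] by simp_all
    then show "w * d = 0" using h(1) by (metis mult.assoc mult_zero_left)
  qed
  have gw: "dg 0 w" using blk_dg[OF bv(2)] by simp
  have Z: "w \<in> Zc 0 (ac X) (ac W)" "w \<in> Zc 0 (ac W) (ac X)"
    unfolding X(2) W(2) Zc_def hm_def using gw ww zw by (simp_all add: sg_def distrib_left distrib_right)
  have "- c \<in> hm (0 - 1) (P + Q, d) (P + Q, d)"
  proof -
    have "dg (0 - 1) c" using blk_dg[OF blk_hq[OF tD(2,1) c(1)]] by simp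
    moreover have "Q * c = 0" "c * P = 0"
      using hq_orth[OF _ c(1) tD(6), of Q] hq_orth[OF c(1) _ tD(6), of P] tD(3,4) by (simp_all add: hq_def)
    ultimately show ?thesis unfolding hm_def using h by (simp add: dg_uminus distrib_left distrib_right)
  qed
  moreover have "w * w - (P + Q) = sg 0 (d * - c) + - c * d"
    unfolding ww(1) unfolding w_def v_def by (simp add: sg_def c(2))
  ultimately have "w * w - fst (ac X) \<in> Bc 0 (ac X) (ac X)" unfolding X(2) Bc_def fst_conv snd_conv by blast
  moreover have "w * w - fst (ac W) \<in> Bc 0 (ac W) (ac W)" unfolding W(2) stalk_Bc using ww(1) by simp
  ultimately have i: "ks.iso X W" unfolding ks.iso_def using X(1) W(1) Z by blast
  have "ks.kms S = ks.kms X + ks.kms V" unfolding ks.kms_iso[OF i] k ..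
  then show ?thesis using V bv(1) ev by blast
qed

text \<open>\<open>A\<close> and \<open>B\<close> record the summands of the terms in degrees 0 and
  -1; the \<open>g\<close>-vector of \<open>X\<close> is the difference of \<open>A\<close> and
  \<open>B\<close>.\<close>

definition pres :: "'a cplx \<Rightarrow> 'a cplx set multiset \<Rightarrow> 'a cplx set multiset \<Rightarrow> bool" where
  "pres X A B \<longleftrightarrow> is_complex X \<and>
     (\<exists>P Q d. tb P Q \<and> d \<in> hq P Q \<and> ac X = (P + Q, d) \<and> stk Q A \<and> stk P B)"

lemma pres_zero: "pres zero_cplx {#} {#}"
proof -
  let ?O = "zero_cplx :: 'a cplx"
  have "acx (ac ?O)" by (rule acx_ac[OF zero_cplx_ac(1)])
  then have "0 * snd (ac ?O) = snd (ac ?O)" unfolding acx_def zero_cplx_ac(2) by blast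
  then have a: "ac ?O = (0, 0)" using zero_cplx_ac(2) by (simp add: prod_eq_iff)
  have "eqv 0 0 0 (0 :: 'a fm)" unfolding eqv_def hq_def by simp
  then have "stk 0 {#}" unfolding stk_def using ks.ob_zr a blk_zero[of 0 0] ks.kms_zr by blast
  then show ?thesis unfolding pres_def tb_def hq_def using ks.ob_zr a
    by (intro conjI exI[of _ 0]) (simp_all add: blk_zero)
qed

lemma pres_sum:
  assumes "pres X A B" "pres Y A' B'" shows "pres (X \<oplus>\<^sub>K Y) (A + A') (B + B')"
proof -
  obtain P Q d where X: "is_complex X" "tb P Q" "d \<in> hq P Q" "ac X = (P + Q, d)" "stk Q A" "stk P B"
    using assms(1) unfolding pres_def by blast
  obtain P' Q' d' where Y: "is_complex Y" "tb P' Q'" "d' \<in> hq P' Q'" "ac Y = (P' + Q', d')" "stk Q' A'" "stk P' B'"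
    using assms(2) unfolding pres_def by blast
  let ?B = "X \<oplus>\<^sub>K Y"
  note oB = ks.ob_sm[OF X(1) Y(1)] and tD = tbD[OF X(2)] and tD' = tbD[OF Y(2)]
  obtain i1 i2 p1 p2 where b: "i1 \<in> Zc 0 (ac X) (ac ?B)" "i2 \<in> Zc 0 (ac Y) (ac ?B)"
    "p1 \<in> Zc 0 (ac ?B) (ac X)" "p2 \<in> Zc 0 (ac ?B) (ac Y)" "p1 * i1 = fst (ac X)" "p2 * i2 = fst (ac Y)"
    "p1 * i2 = 0" "p2 * i1 = 0" "i1 * p1 + i2 * p2 = fst (ac ?B)" using ks.biproduct[OF X(1) Y(1)] by blast
  note h = hmD[OF ZcD(1)[OF b(1)]] hmD[OF ZcD(1)[OF b(2)]] hmD[OF ZcD(1)[OF b(3)]] hmD[OF ZcD(1)[OF b(4)]]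
  have bs: "bs (fst (ac ?B)) (P + Q) (P' + Q') i1 i2 p1 p2" unfolding bs_def hq_def using b(5-9) h X(4) Y(4) by simp
  define P2 where "P2 = i1 * P * p1 + i2 * P' * p2"
  define Q2 where "Q2 = i1 * Q * p1 + i2 * Q' * p2"
  define D where "D = i1 * d * p1 + i2 * d' * p2"
  have hP: "P \<in> hq (P + Q) (P + Q)" "Q \<in> hq (P + Q) (P + Q)" "P' \<in> hq (P' + Q') (P' + Q')" "Q' \<in> hq (P' + Q') (P' + Q')"
    unfolding hq_def using tD tD' by (simp_all add: distrib_left distrib_right)
  have bP: "bs P2 P P' (i1 * P) (i2 * P') (P * p1) (P' * p2)" unfolding P2_def by (rule bs_cut[OF bs hP(1) tD(3) hP(3) tD'(3)])
  have bQ: "bs Q2 Q Q' (i1 * Q) (i2 * Q') (Q * p1) (Q' * p2)" unfolding Q2_def by (rule bs_cut[OF bs hP(2) tD(4) hP(4) tD'(4)])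
  have k: "blk s s (i * y * p)" if "dg 0 i" "dg 0 p" "blk s s y" for s i y p
    using blk_dg_right[OF blk_dg_left[OF that(1,3)] that(2)] by simp
  have tb: "tb P2 Q2"
    unfolding tb_def
  proof (intro conjI)
    show "blk (- 1) (- 1) P2" unfolding P2_def by (intro blk_add k h(1,4,7,10) tD(1) tD'(1))
    show "blk 0 0 Q2" unfolding Q2_def by (intro blk_add k h(1,4,7,10) tD(2) tD'(2))
    note pD = bsD[OF bP] and qD = bsD[OF bQ]
    have "P2 * ((i1 * P) * (P * p1) + (i2 * P') * (P' * p2)) = (i1 * P) * (P * p1) + (i2 * P') * (P' * p2)"
      using hqD(1)[OF pD(1)] hqD(1)[OF pD(2)] by (simp add: distrib_left mult.assoc[symmetric])
    then show "P2 * P2 = P2" unfolding pD(9) .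
    have "Q2 * ((i1 * Q) * (Q * p1) + (i2 * Q') * (Q' * p2)) = (i1 * Q) * (Q * p1) + (i2 * Q') * (Q' * p2)"
      using hqD(1)[OF qD(1)] hqD(1)[OF qD(2)] by (simp add: distrib_left mult.assoc[symmetric])
    then show "Q2 * Q2 = Q2" unfolding qD(9) .
  qed
  have r: "p1 * (i1 * w) = (P + Q) * w" "p2 * (i2 * w) = (P' + Q') * w" "p1 * (i2 * w) = 0" "p2 * (i1 * w) = 0"
    "Q * (d * w) = d * w" "Q' * (d' * w) = d' * w" "P * (d * w) = 0" "P' * (d' * w) = 0"
    "d * (P * w) = d * w" "d' * (P' * w) = d' * w" "P * (P * w) = P * w" "P' * (P' * w) = P' * w"
    "Q * (P * w) = 0" "Q' * (P' * w) = 0" for w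
    using b(5-8) X(4) Y(4) hqD[OF X(3)] hqD[OF Y(3)] tb_zero[OF X(2,3)] tb_zero[OF Y(2,3)] tD tD'
    by (simp_all add: mult.assoc[symmetric])
  have D: "D \<in> hq P2 Q2"
    unfolding hq_def D_def P2_def Q2_def by (simp add: distrib_left distrib_right mult.assoc r)
  have "snd (ac ?B) * i1 = i1 * d" "snd (ac ?B) * i2 = i2 * d'" using ZcD(2)[OF b(1)] ZcD(2)[OF b(2)] X(4) Y(4) by (simp_all add: sg_def)
  moreover have "snd (ac ?B) = snd (ac ?B) * fst (ac ?B)" using acx_ac[OF oB] unfolding acx_def by simp
  ultimately have "snd (ac ?B) = D" unfolding b(9)[symmetric] D_def by (simp add: distrib_left mult.assoc[symmetric])
  moreover have "fst (ac ?B) = P2 + Q2"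
  proof -
    have "i1 * (P + Q) = i1" "i2 * (P' + Q') = i2" using h X(4) Y(4) by simp_all
    then have "i1 * (P + Q) * p1 + i2 * (P' + Q') * p2 = fst (ac ?B)" using b(9) by simp
    then show ?thesis unfolding P2_def Q2_def by (simp add: distrib_left distrib_right algebra_simps)
  qed
  ultimately have "ac ?B = (P2 + Q2, D)" by (simp add: prod_eq_iff)
  then show ?thesis unfolding pres_def using oB tb D stk_sum[OF bQ X(5) Y(5)] stk_sum[OF bP X(6) Y(6)] by blast
qed

end

text \<open>An idempotent of degree 0 commutes with the truncation \<open>idn t n\<close>, where
  \<open>n\<close> exceeds all positions in use, so the truncated matrix is idempotent
  again.\<close>

lemma degree_part:
  assumes "dg 0 e" "e * e = (e :: 'a::ring_1 fm)"
  shows "\<exists>x. blk t t x \<and> x * x = x \<and>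
    (\<forall>i a j b. ent x (Ix i a) (Ix j b) = (if i = t then ent e (Ix i a) (Ix j b) else 0))"
proof -
  obtain n where n: "\<And>i a j b. n \<le> a \<or> n \<le> b \<Longrightarrow> ent e (Ix i a) (Ix j b) = 0" using position_bound by metis
  have ent2: "ent (idn t n * e) (Ix i a) (Ix j c) = (if i = t then ent e (Ix i a) (Ix j c) else 0)" for i a j c
    unfolding ent_idn_mult using n[of a c i j] by (auto simp: not_less)
  have comm: "idn t n * e = e * idn t n"
  proof (rule fm_eqI')
    fix i a j c
    have "ent e (Ix i a) (Ix j c) = 0" if "i \<noteq> j" using assms(1) that unfolding dg_def by force
    then show "ent (idn t n * e) (Ix i a) (Ix j c) = ent (e * idn t n) (Ix i a) (Ix j c)"
      unfolding ent_idn_mult ent_mult_idn using n[of a c i j] by (cases "i = j") (auto simp: not_less)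
  qed
  have "(idn t n * e) * (idn t n * e) = idn t n * (e * idn t n) * e" by (simp add: mult.assoc)
  also have "\<dots> = (idn t n * idn t n) * (e * e)" unfolding comm[symmetric] by (simp add: mult.assoc)
  finally have "(idn t n * e) * (idn t n * e) = idn t n * e" using assms(2) by (simp add: idn_idem)
  moreover have "blk t t (idn t n * e)" unfolding blk_def ent2 using assms(1)[unfolded dg_def] by (auto split: if_splits)
  ultimately show ?thesis using ent2 by blast
qed

context fdalg
begin

lemma pres_exists:
  assumes "two_term X"
  shows "\<exists>A B. pres X A B \<and> set_mset A \<subseteq> set_mset (ks.kms alg_cplx) \<and> set_mset B \<subseteq> set_mset (ks.kms alg_cplx)"
proof -
  obtain E D where XE: "ac X = (E, D)" by (cases "ac X")
  have X: "is_complex X" "tt (E, D)" using assms[unfolded two_term_iff_tt] XE by simp_all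
  note aX = acx_ac[OF X(1), unfolded XE acx_def fst_conv snd_conv]
  obtain P where P: "blk (-1) (-1) P" "P * P = P"
    "\<And>i a j b. ent P (Ix i a) (Ix j b) = (if i = -1 then ent E (Ix i a) (Ix j b) else 0)"
    using degree_part[of E "-1"] aX by blast
  obtain Q where Q: "blk 0 0 Q" "Q * Q = Q"
    "\<And>i a j b. ent Q (Ix i a) (Ix j b) = (if i = 0 then ent E (Ix i a) (Ix j b) else 0)"
    using degree_part[of E 0] aX by blast
  have E: "E = P + Q"
  proof (rule fm_eqI')
    fix i a j b
    show "ent E (Ix i a) (Ix j b) = ent (P + Q) (Ix i a) (Ix j b)"
      using X(2)[unfolded tt_def fst_conv, rule_format, of i a j b] by (simp add: P(3) Q(3))
  qed
  have z: "P * D * P = 0" "P * D * Q = 0" "Q * D * Q = 0"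
    using blk_dg_zero[OF P(1) P(1), of 1 D] blk_dg_zero[OF P(1) Q(1), of 1 D] blk_dg_zero[OF Q(1) Q(1), of 1 D] aX by simp_all
  have ED: "E * D = D" "D * E = D" using aX by simp_all
  have "P * (D * E) = P * D * P + P * D * Q" "(E * D) * Q = P * D * Q + Q * D * Q"
    unfolding E by (simp_all add: distrib_left distrib_right mult.assoc)
  then have "P * D = 0" "D * Q = 0" using z ED by simp_all
  then have D: "D \<in> hq P Q" using ED unfolding E by (intro hqI) (simp_all add: distrib_left distrib_right)
  have t: "tb P Q" unfolding tb_def using P(1,2) Q(1,2) by simp
  obtain A where A: "stk Q A" "set_mset A \<subseteq> set_mset (ks.kms alg_cplx)" using stk_exists[OF Q(1,2)] by blast
  obtain B where B: "stk P B" "set_mset B \<subseteq> set_mset (ks.kms alg_cplx)" using stk_exists[OF P(1,2)] by blast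
  have "pres X A B" unfolding pres_def using X(1) t D XE E A(1) B(1) by blast
  then show ?thesis using A(2) B(2) by blast
qed

text \<open>If the terms of \<open>X\<close> and \<open>Y\<close> agree in the Grothendieck group, contractible summands can be added so
  that both complexes become maps between the same two projectives; the vanishing of extensions then
  makes both maps split surjections, and cancellation identifies the two kernels.\<close>

lemma pres_cancel:
  assumes X: "pres X A B" and Y: "pres Y A' B'" and eq: "A + B' = A' + B"
    and e: "aev (ac X) (ac X)" "aev (ac X) (ac Y)" "aev (ac Y) (ac X)" "aev (ac Y) (ac Y)"
    and dis: "set_mset (ks.kms X) \<inter> set_mset (ks.kms Y) = {}"
  shows "ks.kms X = {#} \<and> ks.kms Y = {#}"
proof -
  obtain P Q d where x: "is_complex X" "tb P Q" "d \<in> hq P Q" "ac X = (P + Q, d)" "stk Q A" "stk P B"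
    using X unfolding pres_def by blast
  obtain P' Q' d' where y: "is_complex Y" "tb P' Q'" "d' \<in> hq P' Q'" "ac Y = (P' + Q', d')" "stk Q' A'" "stk P' B'"
    using Y unfolding pres_def by blast
  note tD = tbD[OF x(2)] and tD' = tbD[OF y(2)]
  \<comment> \<open>\<open>q\<close> is the sum of \<open>Q\<close> and \<open>P'\<close>,
    \<open>q'\<close> that of \<open>Q'\<close> and \<open>P\<close>, both moved to degree 0. By
    \<open>eq\<close> they have the same summands, whence the isomorphism \<open>u\<close>.\<close>
  obtain R q i1 i2 p1 p2 where R: "is_complex R" "ac R = (q, 0)" "blk 0 0 q" "ks.kms R = A + B'" "bs q Q P' i1 i2 p1 p2"
    using stk_bs[OF x(5) y(6)] by blast
  obtain R' q' j1 j2 s1 s2 where R': "is_complex R'" "ac R' = (q', 0)" "blk 0 0 q'" "ks.kms R' = A' + B" "bs q' Q' P j1 j2 s1 s2"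
    using stk_bs[OF y(5) x(6)] by blast
  have "ks.kms R' = ks.kms R" using R(4) R'(4) eq by simp
  from stalk_eqv[OF R'(1,2) R(1,2) this] obtain u u' where u: "eqv q' q u u'" by blast
  obtain S where S: "is_complex S" "ac S = (P, 0)" using realize[OF stalk_acx[OF tD(1,3)]] by blast
  obtain S' where S': "is_complex S'" "ac S' = (P', 0)" using realize[OF stalk_acx[OF tD'(1,3)]] by blast
  obtain p k1 k2 r1 r2 where p: "ac (S \<oplus>\<^sub>K S') = (p, 0)" "blk (-1) (-1) p" "bs p P P' k1 k2 r1 r2"
    using stalk_sum[OF S S' tD(1) tD'(1)] by blast
  note oS = ks.ob_sm[OF S(1) S'(1)]
  have "p * p = p" "q * q = q" using acx_ac[OF oS] acx_ac[OF R(1)] unfolding p(1) R(2) acx_def by simp_all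
  then have t: "tb p q" unfolding tb_def using p(2) R(3) by simp
  \<comment> \<open>The identity of \<open>P'\<close> is added to \<open>d\<close>, and that of
    \<open>P\<close> to \<open>d'\<close>; after transport along \<open>u\<close> both are maps from
    \<open>p\<close> to \<open>q\<close>.\<close>
  define a where "a = i1 * d * r1 + i2 * r2"
  define b where "b = (u * j1) * d' * r2 + (u * j2) * r1"
  have a: "a \<in> hq p q" "hiso (P + Q, d) (p + q, a)"
    unfolding a_def by (rule add_contractible[OF x(2) t x(3) p(3) R(5)])+
  have b: "b \<in> hq p q" "hiso (P' + Q', d') (p + q, b)"
    unfolding b_def by (rule add_contractible[OF y(2) t y(3) bs_swap[OF p(3)] bs_eqv_whole[OF R'(5) u]])+
  obtain V where V: "is_complex V" "ac V = (p + q, a)" using realize[OF tb_acx[OF t a(1)]] by blast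
  obtain W where W: "is_complex W" "ac W = (p + q, b)" using realize[OF tb_acx[OF t b(1)]] by blast
  have iV: "ks.iso X V" using a(2) x(1,4) V unfolding iso_iff[symmetric] htpy_equiv_iff by simp
  have iW: "ks.iso Y W" using b(2) y(1,4) W unfolding iso_iff[symmetric] htpy_equiv_iff by simp
  have kV: "ks.kms V = ks.kms X" "ks.kms W = ks.kms Y" using ks.kms_iso[OF iV] ks.kms_iso[OF iW] by simp_all
  have e1: "e1d p q c1 c2" if c: "aev (p + q, c1) (p + q, c2)" "c1 \<in> hq p q" "c2 \<in> hq p q" for c1 c2
    by (rule e1_e1d[OF t _ c(2,3)])
       (use c(1) aev_iff_e1[OF tb_acx[OF t c(2)] tb_acx[OF t c(3)] tb_degrees[OF t] tb_degrees[OF t]] in simp)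
  note e1s = e1[OF aev_iso[OF iV iV e(1), unfolded V(2)] a(1) a(1)]
    e1[OF aev_iso[OF iW iW e(4), unfolded W(2)] b(1) b(1)]
    e1[OF aev_iso[OF iW iV e(3), unfolded V(2) W(2)] b(1) a(1)]
    e1[OF aev_iso[OF iV iW e(2), unfolded V(2) W(2)] a(1) b(1)]
  have dV: "set_mset (ks.kms V) \<inter> set_mset (ks.kms W) = {}" "set_mset (ks.kms W) \<inter> set_mset (ks.kms V) = {}"
    unfolding kV using dis by blast+
  note tt = tbD[OF t]
  obtain c where c: "c \<in> hq q p" "q = a * c"
    using nakayama_split[OF tt(3,4) a(1) b(1) e1s cmaps_prods_inverse[OF t a(1) b(1) V W dV(1)]] by blast
  obtain c' where c': "c' \<in> hq q p" "q = b * c'"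
    using nakayama_split[OF tt(3,4) b(1) a(1) e1s(2,1,4,3) cmaps_prods_inverse[OF t b(1) a(1) W V dV(2)]] by blast
  \<comment> \<open>\<open>G\<close> and \<open>G'\<close> are both isomorphic to \<open>q\<close>,
    so cancelling them from the summands of \<open>p\<close> identifies the two kernels, and these
    are \<open>X\<close> and \<open>Y\<close>.\<close>
  obtain G g where G: "is_complex G" "ac G = (g, 0)" "blk (-1) (-1) g" "eqv g q a c" "ks.kms (S \<oplus>\<^sub>K S') = ks.kms V + ks.kms G"
    using split_stalk[OF t a(1) c V oS p(1)] by blast
  obtain G' g' where G': "is_complex G'" "ac G' = (g', 0)" "blk (-1) (-1) g'" "eqv g' q b c'" "ks.kms (S \<oplus>\<^sub>K S') = ks.kms W + ks.kms G'"
    using split_stalk[OF t b(1) c' W oS p(1)] by blast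
  have "ks.kms G = ks.kms G'"
    by (rule stalk_kms_eq[OF G(1,2) G'(1,2) G(3) G'(3) eqv_trans[OF G(4) eqv_sym[OF G'(4)]]])
  then have "ks.kms X = ks.kms Y" using G(5) G'(5) kV by simp
  then show ?thesis using dis by simp
qed

lemma pres_multiset:
  assumes "\<And>c. c \<in> C \<Longrightarrow> ks.kms (T c) = {#c#} \<and> pres (T c) (A c) (B c)"
  shows "set_mset M \<subseteq> C \<Longrightarrow> \<exists>X. ks.kms X = M \<and> pres X (\<Sum>c\<in>#M. A c) (\<Sum>c\<in>#M. B c)"
proof (induction M)
  case empty
  show ?case using ks.kms_zr pres_zero by (intro exI[of _ zero_cplx]) simp
next
  case (add c M)
  then obtain X where X: "ks.kms X = M" "pres X (\<Sum>c\<in>#M. A c) (\<Sum>c\<in>#M. B c)" by auto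
  have c: "ks.kms (T c) = {#c#}" "pres (T c) (A c) (B c)" using assms[of c] add.prems by auto
  have "ks.kms (T c \<oplus>\<^sub>K X) = {#c#} + M" using ks.kms_sm[of "T c" X] c X unfolding pres_def by simp
  then show ?case using pres_sum[OF c(2) X(2)] by (intro exI[of _ "T c \<oplus>\<^sub>K X"]) simp
qed

lemma good_card:
  assumes g: "good C" and C: "finite C" shows "card C \<le> num_summands (alg_cplx :: 'a cplx)"
proof (rule ccontr)
  let ?S = "set_mset (ks.kms alg_cplx)"
  assume "\<not> card C \<le> num_summands (alg_cplx :: 'a cplx)"
  then have less: "card ?S < card C" using num_summands_eq[OF alg_cplx_ac(1)] by simp
  have "\<forall>c\<in>C. \<exists>T A B. ks.kms T = {#c#} \<and> pres T A B \<and> set_mset A \<subseteq> ?S \<and> set_mset B \<subseteq> ?S"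
  proof
    fix c assume "c \<in> C"
    then have c: "icls c" "ttc c" using g unfolding good_def by blast+
    obtain Y where Y: "ks.indec Y" "c = ks.cls Y" using c(1) unfolding icls_def by blast
    obtain T where T: "T \<in> c" "two_term T" using c(2) unfolding ttc_def by blast
    have "ks.iso T Y" using T(1) unfolding Y(2) ks.cls_def by simp
    then have "ks.kms T = {#c#}" using ks.kms_iso ks.kms_indec[OF Y(1)] Y(2) by metis
    then show "\<exists>T A B. ks.kms T = {#c#} \<and> pres T A B \<and> set_mset A \<subseteq> ?S \<and> set_mset B \<subseteq> ?S"
      using pres_exists[OF T(2)] by blast
  qed
  from bchoice[OF this] obtain T where
    "\<forall>c\<in>C. \<exists>A B. ks.kms (T c) = {#c#} \<and> pres (T c) A B \<and> set_mset A \<subseteq> ?S \<and> set_mset B \<subseteq> ?S" ..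
  from bchoice[OF this] obtain A where
    "\<forall>c\<in>C. \<exists>B. ks.kms (T c) = {#c#} \<and> pres (T c) (A c) B \<and> set_mset (A c) \<subseteq> ?S \<and> set_mset B \<subseteq> ?S" ..
  from bchoice[OF this] obtain B where
    "\<forall>c\<in>C. ks.kms (T c) = {#c#} \<and> pres (T c) (A c) (B c) \<and> set_mset (A c) \<subseteq> ?S \<and> set_mset (B c) \<subseteq> ?S" ..
  note TAB0 = this
  have TAB: "ks.kms (T c) = {#c#} \<and> pres (T c) (A c) (B c) \<and> set_mset (A c) \<subseteq> ?S \<and> set_mset (B c) \<subseteq> ?S"
    if "c \<in> C" for c by (rule bspec[OF TAB0 that])
  \<comment> \<open>The \<open>g\<close>-vectors have one coordinate for each indecomposable summand
    of \<open>A\<close>, so more than that many of them are linearly dependent.\<close>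
  obtain a :: "'a cplx set \<Rightarrow> int" where a: "\<exists>c\<in>C. a c \<noteq> 0"
    "\<forall>s\<in>?S. (\<Sum>c\<in>C. a c * (int (count (A c) s) - int (count (B c) s))) = 0"
    using integer_relation[OF finite_set_mset C less, of "\<lambda>c s. int (count (A c) s) - int (count (B c) s)"] by blast
  \<comment> \<open>\<open>M\<close> and \<open>N\<close> collect the positive and the negative
    coefficients. Their supports are disjoint by construction, and complexes with these summands
    have the same \<open>g\<close>-vector.\<close>
  define M where "M = (\<Sum>c\<in>C. replicate_mset (nat (a c)) c)"
  define N where "N = (\<Sum>c\<in>C. replicate_mset (nat (- a c)) c)"
  have cM: "count M c = (if c \<in> C then nat (a c) else 0)" "count N c = (if c \<in> C then nat (- a c) else 0)" for c
    unfolding M_def N_def count_sum using C by auto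
  have MC: "set_mset M \<subseteq> C" "set_mset N \<subseteq> C" using cM by (auto simp: set_mset_def split: if_splits)
  have dis: "set_mset M \<inter> set_mset N = {}" using cM by (auto simp: set_mset_def split: if_splits)
  have TAB': "ks.kms (T c) = {#c#} \<and> pres (T c) (A c) (B c)" if "c \<in> C" for c using TAB[OF that] by blast
  obtain X where X: "ks.kms X = M" "pres X (\<Sum>c\<in>#M. A c) (\<Sum>c\<in>#M. B c)" using pres_multiset[OF TAB' MC(1)] by blast
  obtain Y where Y: "ks.kms Y = N" "pres Y (\<Sum>c\<in>#N. A c) (\<Sum>c\<in>#N. B c)" using pres_multiset[OF TAB' MC(2)] by blast
  have cnt: "count (\<Sum>c\<in>#K. f c) s = (\<Sum>c\<in>C. count K c * count (f c) s)" if "set_mset K \<subseteq> C" for K and f :: "'a cplx set \<Rightarrow> 'a cplx set multiset" and s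
    using that
  proof (induction K)
    case (add x K)
    have "(\<Sum>c\<in>C. count (add_mset x K) c * count (f c) s) = (\<Sum>c\<in>C. (if c = x then count (f x) s else 0) + count K c * count (f c) s)"
      by (intro sum.cong) auto
    also have "\<dots> = count (f x) s + (\<Sum>c\<in>C. count K c * count (f c) s)" using add.prems C by (simp add: sum.distrib)
    finally show ?case using add by simp
  qed simp
  have "count ((\<Sum>c\<in>#M. A c) + (\<Sum>c\<in>#N. B c)) s = count ((\<Sum>c\<in>#N. A c) + (\<Sum>c\<in>#M. B c)) s" for s
  proof (cases "s \<in> ?S")
    case True
    have "int (count ((\<Sum>c\<in>#M. A c) + (\<Sum>c\<in>#N. B c)) s) - int (count ((\<Sum>c\<in>#N. A c) + (\<Sum>c\<in>#M. B c)) s)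
      = (\<Sum>c\<in>C. (int (count M c) - int (count N c)) * (int (count (A c) s) - int (count (B c) s)))"
      by (simp add: cnt MC sum.distrib[symmetric] sum_subtractf[symmetric] algebra_simps)
    also have "\<dots> = (\<Sum>c\<in>C. a c * (int (count (A c) s) - int (count (B c) s)))"
      by (intro sum.cong) (auto simp: cM)
    finally show ?thesis using a(2) True by simp
  next
    case False
    then have "count (A c) s = 0" "count (B c) s = 0" if "c \<in> C" for c
      using TAB[OF that] by (meson count_inI subset_iff)+
    then show ?thesis by (simp add: cnt MC)
  qed
  \<comment> \<open>Equality of the two \<open>g\<close>-vectors, written without
    subtraction.\<close>
  then have eq: "(\<Sum>c\<in>#M. A c) + (\<Sum>c\<in>#N. B c) = (\<Sum>c\<in>#N. A c) + (\<Sum>c\<in>#M. B c)" by (rule multiset_eqI)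
  have oX: "is_complex X" "is_complex Y" using X(2) Y(2) unfolding pres_def by blast+
  have pev: "pev c c'" if "c \<in> C" "c' \<in> C" for c c' using g that unfolding good_def by blast
  have "aev (ac X) (ac X)" "aev (ac X) (ac Y)" "aev (ac Y) (ac X)" "aev (ac Y) (ac Y)"
    unfolding aev_kms[OF oX(1) oX(1)] aev_kms[OF oX] aev_kms[OF oX(2) oX(1)] aev_kms[OF oX(2) oX(2)] X(1) Y(1)
    using pev MC by blast+
  from pres_cancel[OF X(2) Y(2) eq this] have "M = {#}" "N = {#}" using dis X(1) Y(1) by simp_all
  then have "count M c = 0" "count N c = 0" for c by simp_all
  then have "a c = 0" if "c \<in> C" for c using cM[of c] that by simp
  then show False using a(1) by blast
qed

end

section \<open>Counting\<close>

text \<open>Both maps have the same fibres on \<open>S\<close>, so their images are in bijection. It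
  allows isomorphism classes to be counted by their multisets of summands.\<close>

lemma card_image_cong:
  assumes "\<And>x y. x \<in> S \<Longrightarrow> y \<in> S \<Longrightarrow> f x = f y \<longleftrightarrow> g x = g y"
  shows "card (f ` S) = card (g ` S)"
proof -
  define h where "h c = g (SOME x. x \<in> S \<and> f x = c)" for c
  have h: "h (f x) = g x" if "x \<in> S" for x
  proof -
    have "\<exists>y. y \<in> S \<and> f y = f x" using that by blast
    from someI_ex[OF this] show ?thesis unfolding h_def using assms that by blast
  qed
  have "inj_on h (f ` S)" using assms h by (auto intro!: inj_onI)
  moreover have "h ` f ` S = g ` S" using h by (auto simp: image_image)
  ultimately show ?thesis using card_image by metis
qed

text \<open>Removing one copy of a fixed \<open>s\<close> leaves a multiset with support
  \<open>S\<close> or \<open>S - {s}\<close> and size at most \<open>l\<close>: Pascal's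
  recursion.\<close>

lemma multisets_of_support:
  "finite S \<Longrightarrow> finite {M. set_mset M = S \<and> size M \<le> l} \<and> card {M. set_mset M = S \<and> size M \<le> l} = l choose card S"
proof (induction l arbitrary: S)
  case 0
  have "{M. set_mset M = S \<and> size M \<le> 0} = (if S = {} then {{#}} else {})" by auto
  then show ?case using 0 by (auto simp: card_gt_0_iff)
next
  case (Suc l)
  show ?case
  proof (cases "S = {}")
    case True
    then have "{M. set_mset M = S \<and> size M \<le> Suc l} = {{#}}" by auto
    then show ?thesis using True by simp
  next
    case False
    then obtain s where s: "s \<in> S" by blast
    define R where "R = S - {s}"
    have S: "S = insert s R" "s \<notin> R" "finite R" unfolding R_def using s Suc.prems by auto
    define U where "U = {M. set_mset M = S \<and> size M \<le> l}"
    define V where "V = {M. set_mset M = R \<and> size M \<le> l}"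
    have "{M. set_mset M = S \<and> size M \<le> Suc l} = add_mset s ` (U \<union> V)"
    proof (rule equalityI; rule subsetI)
      fix M assume M: "M \<in> {M. set_mset M = S \<and> size M \<le> Suc l}"
      then have "s \<in># M" using s by simp
      then obtain K where K: "M = add_mset s K" by (rule mset_add)
      have i: "insert s (set_mset K) = S" "size K \<le> l" using M K by simp_all
      have "set_mset K = S \<or> set_mset K = R" unfolding R_def using i(1) by blast
      then have "K \<in> U \<union> V" unfolding U_def V_def using i(2) by simp
      then show "M \<in> add_mset s ` (U \<union> V)" using K by simp
    next
      fix M assume "M \<in> add_mset s ` (U \<union> V)"
      then obtain K where K: "M = add_mset s K" "set_mset K = S \<or> set_mset K = R" "size K \<le> l"
        unfolding U_def V_def by blast
      have "insert s (set_mset K) = S" using K(2) s unfolding R_def by blast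
      then show "M \<in> {M. set_mset M = S \<and> size M \<le> Suc l}" using K(1,3) by simp
    qed
    moreover have "inj_on (add_mset s) (U \<union> V)" by (auto intro: inj_onI)
    moreover have "U \<inter> V = {}" unfolding U_def V_def R_def using s by blast
    moreover have "finite U" "card U = l choose card S" using Suc.IH[OF Suc.prems] unfolding U_def by auto
    moreover have "finite V" "card V = l choose card R" using Suc.IH[OF S(3)] unfolding V_def by auto
    moreover have "card S = Suc (card R)" using S by simp
    ultimately show ?thesis by (simp add: card_image card_Un_disjoint)
  qed
qed

section \<open>From the \<open>f\<close>-vector to the \<open>h\<close>-vector\<close>

text \<open>Pascal's rule and a shift of the index: a difference of order \<open>m + 1\<close> is a
  difference of order \<open>m\<close> applied to first differences.\<close>

lemma alternating_binomial_Suc: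
  fixes g :: "nat \<Rightarrow> int"
  shows "(\<Sum>k\<le>Suc m. (-1) ^ k * int (Suc m choose k) * g k) =
    (\<Sum>k\<le>m. (-1) ^ k * int (m choose k) * (g k - g (Suc k)))"
proof -
  have "(\<Sum>k\<le>m. (-1) ^ k * int (m choose k) * g k) = (\<Sum>k\<le>Suc m. (-1) ^ k * int (m choose k) * g k)" by simp
  also have "\<dots> = g 0 + (\<Sum>k\<le>m. (-1) ^ Suc k * int (m choose Suc k) * g (Suc k))"
    by (subst sum.atMost_Suc_shift) simp
  finally have 1: "(\<Sum>k\<le>m. (-1) ^ k * int (m choose k) * g k) = g 0 + (\<Sum>k\<le>m. (-1) ^ Suc k * int (m choose Suc k) * g (Suc k))" .
  have "(\<Sum>k\<le>Suc m. (-1) ^ k * int (Suc m choose k) * g k) =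
    g 0 + (\<Sum>k\<le>m. (-1) ^ Suc k * int (Suc m choose Suc k) * g (Suc k))"
    by (subst sum.atMost_Suc_shift) simp
  also have "(\<Sum>k\<le>m. (-1) ^ Suc k * int (Suc m choose Suc k) * g (Suc k)) =
    (\<Sum>k\<le>m. (-1) ^ Suc k * int (m choose Suc k) * g (Suc k) - (-1) ^ k * int (m choose k) * g (Suc k))"
    by (intro sum.cong) (auto simp: algebra_simps)
  also have "g 0 + \<dots> = (\<Sum>k\<le>m. (-1) ^ k * int (m choose k) * g k) - (\<Sum>k\<le>m. (-1) ^ k * int (m choose k) * g (Suc k))"
    unfolding 1 sum_subtractf by simp
  also have "\<dots> = (\<Sum>k\<le>m. (-1) ^ k * int (m choose k) * (g k - g (Suc k)))"
    by (simp add: sum_subtractf[symmetric] right_diff_distrib)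
  finally show ?thesis .
qed

text \<open>By Pascal's rule each first difference of binomial coefficients lowers the bottom entry
  by one; \<open>m\<close> of them lead from \<open>r + m\<close> to \<open>r\<close>.\<close>

lemma alternating_binomial_sum:
  "(\<Sum>k\<le>m. (-1) ^ k * int (m choose k) * int ((N + m - k) choose (r + m))) = int (N choose r)"
proof (induction m)
  case (Suc m)
  have "(\<Sum>k\<le>Suc m. (-1) ^ k * int (Suc m choose k) * int ((N + Suc m - k) choose (r + Suc m))) =
    (\<Sum>k\<le>m. (-1) ^ k * int (m choose k) *
      (int ((N + Suc m - k) choose (r + Suc m)) - int ((N + Suc m - Suc k) choose (r + Suc m))))"
    by (rule alternating_binomial_Suc)
  also have "\<dots> = (\<Sum>k\<le>m. (-1) ^ k * int (m choose k) * int ((N + m - k) choose (r + m)))"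
    by (intro sum.cong) (auto simp: Suc_diff_le)
  finally show ?case using Suc by simp
qed simp

text \<open>After exchanging the sums, the coefficient of \<open>f i\<close> is an alternating sum
  over \<open>k = j - i\<close>. It is the preceding identity with \<open>m = n - i\<close>,
  \<open>N = l\<close> and \<open>r = i\<close>.\<close>

lemma h_vector_transform:
  fixes f :: "nat \<Rightarrow> int"
  shows "(\<Sum>j = 0..n. int ((n + l - j) choose n) * (\<Sum>i = 0..j. (-1) ^ (j - i) * int ((n - i) choose (j - i)) * f i)) =
    (\<Sum>i = 0..n. int (l choose i) * f i)"
proof -
  let ?t = "\<lambda>i j. int ((n + l - j) choose n) * ((-1) ^ (j - i) * int ((n - i) choose (j - i)) * f i)"
  have "(\<Sum>j = 0..n. int ((n + l - j) choose n) * (\<Sum>i = 0..j. (-1) ^ (j - i) * int ((n - i) choose (j - i)) * f i)) =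
    (\<Sum>j = 0..n. \<Sum>i = 0..n. if i \<le> j then ?t i j else 0)"
  proof (intro sum.cong refl)
    fix j assume "j \<in> {0..n}"
    then have "{0..j} = {0..n} \<inter> {i. i \<le> j}" by auto
    then have "int ((n + l - j) choose n) * (\<Sum>i = 0..j. (-1) ^ (j - i) * int ((n - i) choose (j - i)) * f i) =
      (\<Sum>i\<in>{0..n} \<inter> {i. i \<le> j}. ?t i j)" by (simp only: sum_distrib_left)
    then show "int ((n + l - j) choose n) * (\<Sum>i = 0..j. (-1) ^ (j - i) * int ((n - i) choose (j - i)) * f i) =
      (\<Sum>i = 0..n. if i \<le> j then ?t i j else 0)" by (simp add: sum.inter_restrict)
  qed
  also have "\<dots> = (\<Sum>i = 0..n. \<Sum>j = 0..n. if i \<le> j then ?t i j else 0)" by (rule sum.swap)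
  also have "\<dots> = (\<Sum>i = 0..n. int (l choose i) * f i)"
  proof (intro sum.cong refl)
    fix i assume "i \<in> {0..n}"
    then obtain m where m: "n = i + m" using le_Suc_ex by auto
    have "(\<Sum>j = 0..n. if i \<le> j then ?t i j else 0) = (\<Sum>j\<in>{0..n} \<inter> {j. i \<le> j}. ?t i j)" by (simp add: sum.inter_restrict)
    also have "{0..n} \<inter> {j. i \<le> j} = {0 + i..m + i}" using m by auto
    also have "(\<Sum>j = 0 + i..m + i. ?t i j) = (\<Sum>k = 0..m. ?t i (k + i))" by (rule sum.shift_bounds_cl_nat_ivl)
    also have "\<dots> = (\<Sum>k\<le>m. (-1) ^ k * int (m choose k) * int ((l + m - k) choose (i + m))) * f i"
      unfolding sum_distrib_right atMost_atLeast0 by (intro sum.cong) (auto simp: m algebra_simps)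
    also have "\<dots> = int (l choose i) * f i" by (simp only: alternating_binomial_sum)
    finally show "(\<Sum>j = 0..n. if i \<le> j then ?t i j else 0) = int (l choose i) * f i" .
  qed
  finally show ?thesis .
qed

context fdalg
begin

lemma card_iso_classes:
  assumes "\<And>X. X \<in> S \<Longrightarrow> is_complex X" shows "card (iso_class ` S) = card (ks.kms ` S)"
  by (rule card_image_cong) (use assms in \<open>simp add: iso_class_eq ks.cls_eq_iff ks.iso_iff_kms\<close>)

lemma two_term_complex: "two_term X \<Longrightarrow> is_complex X"
  unfolding two_term_def by blast

text \<open>A basic complex has a multiplicity-free multiset of summands, which amounts to its
  support; so basic presilting complexes correspond to faces.\<close>

lemma psilt_count_eq: "psilt_count TYPE('a) j = card {C. good C \<and> finite C \<and> card C = j}"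
proof -
  let ?S = "{T :: 'a cplx. two_term T \<and> presilting T \<and> basic T \<and> num_summands T = j}"
  let ?G = "{C. good C \<and> finite C \<and> card C = j}"
  have "ks.kms ` ?S = mset_set ` ?G"
  proof (rule equalityI; rule subsetI)
    fix M assume "M \<in> ks.kms ` ?S"
    then obtain T where "M = ks.kms T" "T \<in> ?S" by (rule imageE)
    then have T: "M = ks.kms T" "two_term T" "presilting T" "basic T" "num_summands T = j" by simp_all
    have "M = mset_set (set_mset M)"
    proof (rule multiset_eqI)
      fix c
      have le: "count M c \<le> 1" using conjunct2[OF T(4)[unfolded basic_iff]] unfolding T(1) by (rule spec)
      have "count M c = 1" if "c \<in># M" by (rule antisym[OF le]) (use that in simp)
      then show "count M c = count (mset_set (set_mset M)) c" by (simp add: count_mset_set' not_in_iff)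
    qed
    moreover have "set_mset M \<in> ?G"
      using two_term_presilting_good[OF T(2,3)] num_summands_eq[OF two_term_complex[OF T(2)]] T(1,5) by simp
    ultimately show "M \<in> mset_set ` ?G" by (rule image_eqI)
  next
    fix M assume "M \<in> mset_set ` ?G"
    then obtain C where "M = mset_set C" "C \<in> ?G" by (rule imageE)
    then have C: "M = mset_set C" "good C" "finite C" "card C = j" by simp_all
    have "good (set_mset M)" using C by simp
    then obtain T where T: "two_term T" "presilting T" "ks.kms T = M" by (rule good_two_term_presilting)
    have "basic T" unfolding basic_iff T(3) C(1) using two_term_complex[OF T(1)] C(3) by (simp add: count_mset_set')
    moreover have "num_summands T = j" using num_summands_eq[OF two_term_complex[OF T(1)]] T(3) C by simp
    ultimately have "T \<in> ?S" using T(1,2) by simp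
    then show "M \<in> ks.kms ` ?S" unfolding T(3)[symmetric] by (rule imageI)
  qed
  moreover have "inj_on mset_set ?G" by (rule inj_on_inverseI[of _ set_mset]) simp
  ultimately have "card (ks.kms ` ?S) = card ?G" by (simp add: card_image)
  then show ?thesis unfolding psilt_count_def by (subst card_iso_classes) (simp_all add: two_term_complex)
qed

lemma psilt_oplus_le_count_eq: "psilt_oplus_le_count TYPE('a) l = card {M. good (set_mset M) \<and> size M \<le> l}"
proof -
  let ?S = "{T :: 'a cplx. two_term T \<and> presilting T \<and>
    (\<exists>Ts. length Ts \<le> l \<and> (\<forall>Y\<in>set Ts. indec Y) \<and> T \<simeq>\<^sub>K dsum_list Ts)}"
  have "ks.kms ` ?S = {M. good (set_mset M) \<and> size M \<le> l}"
  proof (rule equalityI; rule subsetI)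
    fix M assume "M \<in> ks.kms ` ?S"
    then obtain T where TS: "M = ks.kms T" "T \<in> ?S" by (rule imageE)
    then obtain Ts where T: "M = ks.kms T" "two_term T" "presilting T" "length Ts \<le> l"
      "\<forall>Y\<in>set Ts. indec Y" "T \<simeq>\<^sub>K dsum_list Ts" unfolding mem_Collect_eq by (elim conjE exE)
    have "M = mset (map ks.cls Ts)" unfolding T(1)
      by (rule ks.kms_eqI) (use T(5,6) in \<open>simp_all add: indec_iff iso_iff dsum_list_eq\<close>)
    then have "size M \<le> l" using T(4) by simp
    then show "M \<in> {M. good (set_mset M) \<and> size M \<le> l}" using two_term_presilting_good[OF T(2,3)] T(1) by simp
  next
    fix M assume "M \<in> {M. good (set_mset M) \<and> size M \<le> l}"
    then have M: "good (set_mset M)" "size M \<le> l" by simp_all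
    obtain T where T: "two_term T" "presilting T" "ks.kms T = M" by (rule good_two_term_presilting[OF M(1)])
    obtain Ts where Ts: "\<forall>Y\<in>set Ts. ks.indec Y" "ks.iso T (ks.slist Ts)" "ks.kms T = mset (map ks.cls Ts)"
      using ks.kms_decompose[OF two_term_complex[OF T(1)]] .
    have "length Ts = size M" using Ts(3) T(3) by (metis length_map size_mset)
    then have "length Ts \<le> l \<and> (\<forall>Y\<in>set Ts. indec Y) \<and> T \<simeq>\<^sub>K dsum_list Ts"
      using Ts(1,2) M(2) by (simp add: indec_iff iso_iff dsum_list_eq)
    then have "\<exists>Ts. length Ts \<le> l \<and> (\<forall>Y\<in>set Ts. indec Y) \<and> T \<simeq>\<^sub>K dsum_list Ts" by (rule exI)
    then have "T \<in> ?S" unfolding mem_Collect_eq using T(1,2) by (intro conjI)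
    then show "M \<in> ks.kms ` ?S" unfolding T(3)[symmetric] by (rule imageI)
  qed
  then show ?thesis unfolding psilt_oplus_le_count_def by (subst card_iso_classes) (simp_all add: two_term_complex)
qed

lemma psilt_oplus_le_count_binomial:
  assumes "g_finite TYPE('a)"
  shows "int (psilt_oplus_le_count TYPE('a) l) =
    (\<Sum>i = 0..num_summands (alg_cplx :: 'a cplx). int (l choose i) * fvec TYPE('a) i)"
proof -
  let ?n = "num_summands (alg_cplx :: 'a cplx)"
  let ?G = "{C. good C \<and> finite C}" and ?F = "\<lambda>C :: 'a cplx set set. {M. set_mset M = C \<and> size M \<le> l}"
  have "C \<subseteq> Tset" if "good C" for C unfolding Tset_def using good_subset[OF that] by blast
  then have fG: "finite ?G" using finite_subset[of ?G "Pow Tset"] finite_Tset[OF assms] by blast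
  have "{M. good (set_mset M) \<and> size M \<le> l} = (\<Union>C\<in>?G. ?F C)" by auto
  then have "psilt_oplus_le_count TYPE('a) l = (\<Sum>C\<in>?G. card (?F C))"
    unfolding psilt_oplus_le_count_eq
    by (simp add: fG card_UN_disjoint multisets_of_support disjoint_iff)
  also have "\<dots> = (\<Sum>C\<in>?G. l choose card C)"
    by (intro sum.cong) (auto simp: multisets_of_support)
  \<comment> \<open>Grouping by the number of vertices is exhaustive because a face has at most
    \<open>?n\<close> of them.\<close>
  also have "\<dots> = (\<Sum>i = 0..?n. \<Sum>C\<in>{C \<in> ?G. card C = i}. l choose card C)"
    using good_card by (intro sum.group[symmetric] fG) auto
  also have "\<dots> = (\<Sum>i = 0..?n. (l choose i) * psilt_count TYPE('a) i)"
    unfolding psilt_count_eq by (intro sum.cong) (auto simp: conj_assoc)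
  finally have 1: "psilt_oplus_le_count TYPE('a) l = (\<Sum>i = 0..?n. (l choose i) * psilt_count TYPE('a) i)" .
  \<comment> \<open>The convention that the entry of index 0 is 1 agrees with counting the empty
    face, that is, the zero complex.\<close>
  have "{C. good C \<and> finite C \<and> card C = 0} = {{}}" unfolding good_def by (auto simp: card_eq_0_iff)
  then have "fvec TYPE('a) i = int (psilt_count TYPE('a) i)" for i
    unfolding fvec_def using psilt_count_eq[of 0] by simp
  then show ?thesis unfolding 1 by simp
qed

end

theorem theorem5p5:
  fixes scale :: "'k::field \<Rightarrow> 'a::ring_1 \<Rightarrow> 'a"
  assumes "fd_algebra scale"
    and "g_finite TYPE('a)"
  shows "\<forall>l::nat. int (psilt_oplus_le_count TYPE('a) l) =
           (\<Sum>j = 0..num_summands (alg_cplx :: 'a cplx).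
              int ((num_summands (alg_cplx :: 'a cplx) + l - j) choose
                   (num_summands (alg_cplx :: 'a cplx)))
              * hvec TYPE('a) (num_summands (alg_cplx :: 'a cplx)) j)"
proof -
  interpret fdalg scale by unfold_locales (rule assms(1))
  show ?thesis unfolding hvec_def h_vector_transform using psilt_oplus_le_count_binomial[OF assms(2)] by blast
qed

end
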